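(* Let $Q,V,U\in L^\infty_{\rm loc}(\mathbb R)$ and $W\in L^\infty(\mathbb R)$ be such that there is $\theta\in[0,\pi/2)$ with $$\operatorname{essran}(Q)\subseteq\{\lambda\in\mathbb C:|\arg\lambda|\le\theta\},\qquad\lim_{|x|\to\infty}|Q(x)|=\infty,$$ and there is $b\ge0$ with $|V(x)|^2\le b|Q(x)|$ for a.e. $x\in\mathbb R$. In $L^2(\mathbb R)\oplus L^2(\mathbb R)$ define $$\mathcal T=\begin{pmatrix} -\frac{d^2}{dx^2}+Q & W \\ {} V & U \end{pmatrix},\quad\operatorname{dom}(\mathcal T)=\{f\in W^{2,2}(\mathbb R):Qf\in L^2(\mathbb R)\}\oplus\{f\in L^2(\mathbb R):Uf\in L^2(\mathbb R)\}.$$ (i) Let $a_0,b_0>0$ be constants such that $\|Vf\|^2\le a_0\|f\|^2+b_0\operatorname{Re}\langle -f''+Qf,f\rangle$ for all $f\in W^{2,2}(\mathbb R)$ with $Qf\in L^2(\mathbb R)$, and for $\lambda\notin\operatorname{essran}(U)$ define the bounded operator $$\mathcal B_\lambda=\begin{pmatrix} I & 0 \\ 0 & \varepsilon(U-\lambda)^{-1} \end{pmatrix},\qquad\varepsilon=\frac1{b_0\|(U-\lambda)^{-1}\|^2}.$$ Then $$\sigma_e(\mathcal T)=\bigcap_{\lambda\notin\operatorname{essran}(U)}W_e(\mathcal B_\lambda\mathcal T,\mathcal B_\lambda)=\operatorname{essran}(U).$$ (ii) If $\mathcal T$ is truncated to the operators $\mathcal T_n$, $n\in\mathbb N$, in $L^2(-n,n)\oplus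 L^2(-n,n)$ (acting by the same matrix expression) with $$\operatorname{dom}(\mathcal T_n)=\{f\in W^{2,2}(-n,n):f(\pm n)=0\}\oplus L^2(-n,n),\qquad n\in\mathbb N,$$ then no spectral pollution occurs and all discrete eigenvalues of $\mathcal T$ are approximated.
   Context: All functions are complex-valued and identified with the corresponding multiplication operators; $\operatorname{essran}$ denotes the essential range. For a linear operator $S$ in a Hilbert space: $W_e(S)$ is the set of all $\mu\in\mathbb C$ for which there are $x_n\in\operatorname{dom}(S)$ with $\|x_n\|=1$, $x_n\to0$ weakly and $\langle Sx_n,x_n\rangle\to\mu$; $\sigma_e(S)$ is the set of all $\lambda\in\mathbb C$ for which there are $x_n\in\operatorname{dom}(S)$ with $\|x_n\|=1$, $x_n\to0$ weakly and $\|(S-\lambda)x_n\|\to0$. For linear operators $A,B$ with $\operatorname{dom}(A)\subseteq\operatorname{dom}(B)$, $W_e(A,B)=\{\lambda\in\mathbb C:0\in W_e(A-\lambda B)\}$. No spectral pollution occurs means: there is no $\lambda\notin\sigma(\mathcal T)$ for which there exist an infinite set $I\subseteq\mathbb N$ and $\lambda_n\in\sigma(\mathcal T_n)$, $n\in I$, with $\lambda_n\to\lambda$. Discrete eigenvalues are the isolated points $\lambda$ of $\sigma(\mathcal T)$ outside $\sigma_e(\mathcal T)$; such a $\lambda$ is approximated if there are $\lambda_n\in\sigma(\mathcal T_n)$, $n\in\mathbb N$, with $\lambda_n\to\lambda$. *)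

theory Defs
  imports "HOL-Analysis.Analysis"
begin

section \<open>Hilbert spaces on representatives\<close>

text \<open>
  Elements of \<open>L\<^sup>2\<close> are represented by functions, not by equivalence classes modulo null sets.
  Hence the inner product of the structures below is only positive semidefinite, and two
  vectors are the same element of the Hilbert space iff their difference has norm 0.
\<close>

record 'v hilbert =
  carrier :: "'v set"
  add :: "'v \<Rightarrow> 'v \<Rightarrow> 'v"
  scale :: "complex \<Rightarrow> 'v \<Rightarrow> 'v"
  inn :: "'v \<Rightarrow> 'v \<Rightarrow> complex"

definition hnorm :: "'v hilbert \<Rightarrow> 'v \<Rightarrow> real" where
  "hnorm H x = sqrt (Re (inn H x x))"

definition weakly_null :: "'v hilbert \<Rightarrow> (nat \<Rightarrow> 'v) \<Rightarrow> bool" where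
  "weakly_null H x \<longleftrightarrow> (\<forall>y\<in>carrier H. (\<lambda>n. inn H (x n) y) \<longlonglongrightarrow> 0)"

definition L2 :: "'a measure \<Rightarrow> ('a \<Rightarrow> complex) hilbert" where
  "L2 M = \<lparr> carrier = {f \<in> borel_measurable M. integrable M (\<lambda>x. (norm (f x))\<^sup>2)},
            add = (\<lambda>f g x. f x + g x),
            scale = (\<lambda>c f x. c * f x),
            inn = (\<lambda>f g. LINT x|M. f x * cnj (g x)) \<rparr>"

definition hilbert_sum :: "'v hilbert \<Rightarrow> 'w hilbert \<Rightarrow> ('v \<times> 'w) hilbert" where
  "hilbert_sum H K =
     \<lparr> carrier = carrier H \<times> carrier K,
       add = (\<lambda>x y. (add H (fst x) (fst y), add K (snd x) (snd y))),
       scale = (\<lambda>c x. (scale H c (fst x), scale K c (snd x))),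
       inn = (\<lambda>x y. inn H (fst x) (fst y) + inn K (snd x) (snd y)) \<rparr>"


section \<open>Linear operators\<close>

text \<open>
  An operator is given by its graph: \<open>(x, y) \<in> S\<close> means that \<open>x\<close> lies in the domain and that
  \<open>y\<close> is a representative of \<open>S x\<close>. All concrete graphs below contain, with \<open>(x, y)\<close>, every
  \<open>(x, y')\<close> with \<open>y'\<close> another representative of the same vector; composition is \<open>T O B\<close>
  (first \<open>T\<close>, then \<open>B\<close>).
\<close>

definition op_diff :: "'v hilbert \<Rightarrow> ('v \<times> 'v) set \<Rightarrow> complex \<Rightarrow> ('v \<times> 'v) set \<Rightarrow> ('v \<times> 'v) set" where
  \<comment> \<open>\<open>A - \<zeta>B\<close>\<close>
  "op_diff H A \<zeta> B = {(x, add H y (scale H (- \<zeta>) z)) | x y z. (x, y) \<in> A \<and> (x, z) \<in> B}"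

definition op_shift :: "'v hilbert \<Rightarrow> ('v \<times> 'v) set \<Rightarrow> complex \<Rightarrow> ('v \<times> 'v) set" where
  "op_shift H S \<zeta> = op_diff H S \<zeta> (Id_on (carrier H))"

definition op_norm :: "'v hilbert \<Rightarrow> ('v \<times> 'v) set \<Rightarrow> real" where
  "op_norm H S = Sup {hnorm H y | x y. (x, y) \<in> S \<and> hnorm H x \<le> 1}"

definition resolvent_set :: "'v hilbert \<Rightarrow> ('v \<times> 'v) set \<Rightarrow> complex set" where
  \<comment> \<open>\<open>S - \<zeta>\<close> is surjective and injective with bounded inverse\<close>
  "resolvent_set H S =
     {\<zeta>. (\<forall>y\<in>carrier H. \<exists>x. (x, y) \<in> op_shift H S \<zeta>) \<and>
         (\<forall>(x, y)\<in>op_shift H S \<zeta>. hnorm H y = 0 \<longrightarrow> hnorm H x = 0) \<and>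
         (\<exists>C. \<forall>(x, y)\<in>op_shift H S \<zeta>. hnorm H x \<le> C * hnorm H y)}"

definition spectrum :: "'v hilbert \<Rightarrow> ('v \<times> 'v) set \<Rightarrow> complex set" where
  "spectrum H S = - resolvent_set H S"

definition ess_spectrum :: "'v hilbert \<Rightarrow> ('v \<times> 'v) set \<Rightarrow> complex set" where
  "ess_spectrum H S =
     {\<zeta>. \<exists>x y. (\<forall>n. (x n, y n) \<in> op_shift H S \<zeta>) \<and> (\<forall>n. hnorm H (x n) = 1) \<and>
              weakly_null H x \<and> (\<lambda>n. hnorm H (y n)) \<longlonglongrightarrow> 0}"

definition ess_num_range :: "'v hilbert \<Rightarrow> ('v \<times> 'v) set \<Rightarrow> complex set" where
  "ess_num_range H S =
     {\<mu>. \<exists>x y. (\<forall>n. (x n, y n) \<in> S) \<and> (\<forall>n. hnorm H (x n) = 1) \<and>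
              weakly_null H x \<and> (\<lambda>n. inn H (y n) (x n)) \<longlonglongrightarrow> \<mu>}"

definition ess_num_range_pencil ::
    "'v hilbert \<Rightarrow> ('v \<times> 'v) set \<Rightarrow> ('v \<times> 'v) set \<Rightarrow> complex set" where
  "ess_num_range_pencil H A B = {\<zeta>. 0 \<in> ess_num_range H (op_diff H A \<zeta> B)}"

definition no_spectral_pollution ::
    "complex set \<Rightarrow> (nat \<Rightarrow> complex set) \<Rightarrow> bool" where
  \<comment> \<open>arguments: the spectra of \<open>T\<close> and of \<open>T\<^sub>n\<close>, \<open>n \<ge> 1\<close>; the filter expresses
      convergence along the index set \<open>I\<close>\<close>
  "no_spectral_pollution \<sigma> \<sigma>n \<longleftrightarrow>
     \<not> (\<exists>\<zeta>. \<zeta> \<notin> \<sigma> \<and>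
          (\<exists>I l. infinite I \<and> I \<subseteq> {1..} \<and> (\<forall>n\<in>I. l n \<in> \<sigma>n n) \<and>
                 (l \<longlongrightarrow> \<zeta>) (inf sequentially (principal I))))"

definition discrete_eigenvalues :: "'v hilbert \<Rightarrow> ('v \<times> 'v) set \<Rightarrow> complex set" where
  "discrete_eigenvalues H S = {\<zeta>. \<zeta> isolated_in spectrum H S \<and> \<zeta> \<notin> ess_spectrum H S}"

definition approximated :: "(nat \<Rightarrow> complex set) \<Rightarrow> complex \<Rightarrow> bool" where
  "approximated \<sigma>n \<zeta> \<longleftrightarrow> (\<exists>l. (\<forall>n\<ge>1. l n \<in> \<sigma>n n) \<and> l \<longlonglongrightarrow> \<zeta>)"


section \<open>Functions, Sobolev spaces and multiplication operators\<close>

definition Linf :: "(real \<Rightarrow> complex) set" where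
  "Linf = {f \<in> borel_measurable lebesgue. \<exists>C. AE x in lebesgue. norm (f x) \<le> C}"

definition Linf_loc :: "(real \<Rightarrow> complex) set" where
  "Linf_loc = {f \<in> borel_measurable lebesgue.
                 \<forall>K. compact K \<longrightarrow> (\<exists>C. AE x in lebesgue. x \<in> K \<longrightarrow> norm (f x) \<le> C)}"

definition essran :: "(real \<Rightarrow> complex) \<Rightarrow> complex set" where
  "essran f = {z. \<forall>e>0. emeasure lebesgue {x. dist (f x) z < e} > 0}"

definition test_fun :: "real set \<Rightarrow> (real \<Rightarrow> real) \<Rightarrow> bool" where
  "test_fun \<Omega> \<phi> \<longleftrightarrow>
     (\<forall>j x. ((deriv ^^ j) \<phi>) field_differentiable (at x)) \<and>
     compact (closure {x. \<phi> x \<noteq> 0}) \<and> closure {x. \<phi> x \<noteq> 0} \<subseteq> \<Omega>"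

definition loc_integrable :: "real set \<Rightarrow> (real \<Rightarrow> complex) \<Rightarrow> bool" where
  "loc_integrable \<Omega> f \<longleftrightarrow> (\<forall>K. compact K \<and> K \<subseteq> \<Omega> \<longrightarrow> set_integrable lebesgue K f)"

definition weak_deriv :: "real set \<Rightarrow> nat \<Rightarrow> (real \<Rightarrow> complex) \<Rightarrow> (real \<Rightarrow> complex) \<Rightarrow> bool" where
  \<comment> \<open>\<open>g\<close> is a representative of the \<open>j\<close>-th weak derivative of \<open>f\<close> on the open set \<open>\<Omega>\<close>\<close>
  "weak_deriv \<Omega> j f g \<longleftrightarrow>
     loc_integrable \<Omega> f \<and> loc_integrable \<Omega> g \<and>
     (\<forall>\<phi>. test_fun \<Omega> \<phi> \<longrightarrow>
        (LINT x|lebesgue_on \<Omega>. complex_of_real ((deriv ^^ j) \<phi> x) * f x) =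
        (-1) ^ j * (LINT x|lebesgue_on \<Omega>. complex_of_real (\<phi> x) * g x))"

definition sobolev :: "nat \<Rightarrow> real set \<Rightarrow> (real \<Rightarrow> complex) set" where
  \<comment> \<open>\<open>W\<^sup>k\<^sup>,\<^sup>2(\<Omega>)\<close>\<close>
  "sobolev k \<Omega> = {f \<in> carrier (L2 (lebesgue_on \<Omega>)).
                    \<forall>j\<le>k. \<exists>g\<in>carrier (L2 (lebesgue_on \<Omega>)). weak_deriv \<Omega> j f g}"

definition vanishes_at_ends :: "real \<Rightarrow> real \<Rightarrow> (real \<Rightarrow> complex) \<Rightarrow> bool" where
  \<comment> \<open>boundary values are those of the representative that is continuous up to the boundary\<close>
  "vanishes_at_ends a b f \<longleftrightarrow>
     (\<exists>F. continuous_on {a..b} F \<and> (AE x in lebesgue_on {a<..<b}. f x = F x) \<and> F a = 0 \<and> F b = 0)"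

definition mult_op :: "'a measure \<Rightarrow> ('a \<Rightarrow> complex) \<Rightarrow> (('a \<Rightarrow> complex) \<times> ('a \<Rightarrow> complex)) set" where
  "mult_op M m = {(f, g). f \<in> carrier (L2 M) \<and> g \<in> carrier (L2 M) \<and> (AE x in M. g x = m x * f x)}"

definition diag_op :: "('v \<times> 'v) set \<Rightarrow> ('w \<times> 'w) set \<Rightarrow> (('v \<times> 'w) \<times> ('v \<times> 'w)) set" where
  "diag_op A B = {((f, g), (u, v)). (f, u) \<in> A \<and> (g, v) \<in> B}"


section \<open>The operator matrix and its truncations\<close>

type_synonym fun2 = "(real \<Rightarrow> complex) \<times> (real \<Rightarrow> complex)"

abbreviation Hsp :: "real set \<Rightarrow> fun2 hilbert" where
  "Hsp \<Omega> \<equiv> hilbert_sum (L2 (lebesgue_on \<Omega>)) (L2 (lebesgue_on \<Omega>))"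

definition matrix_op :: "real set \<Rightarrow> (real \<Rightarrow> complex) set \<Rightarrow> (real \<Rightarrow> complex) set \<Rightarrow>
    (real \<Rightarrow> complex) \<Rightarrow> (real \<Rightarrow> complex) \<Rightarrow> (real \<Rightarrow> complex) \<Rightarrow> (real \<Rightarrow> complex) \<Rightarrow> (fun2 \<times> fun2) set" where
  \<comment> \<open>matrix with rows \<open>(-d\<^sup>2/dx\<^sup>2 + Q, W)\<close> and \<open>(V, U)\<close> in \<open>L\<^sup>2(\<Omega>) \<oplus> L\<^sup>2(\<Omega>)\<close> on the domain \<open>D1 \<oplus> D2\<close>;
      here \<open>h\<close> stands for the second weak derivative of \<open>f\<close>\<close>
  "matrix_op \<Omega> D1 D2 Q W V U =
     {((f, g), (u, v)). f \<in> D1 \<and> g \<in> D2 \<and> (u, v) \<in> carrier (Hsp \<Omega>) \<and>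
        (\<exists>h. weak_deriv \<Omega> 2 f h \<and>
             (AE x in lebesgue_on \<Omega>. u x = - h x + Q x * f x + W x * g x)) \<and>
        (AE x in lebesgue_on \<Omega>. v x = V x * f x + U x * g x)}"

definition domA :: "(real \<Rightarrow> complex) \<Rightarrow> (real \<Rightarrow> complex) set" where
  "domA Q = {f \<in> sobolev 2 UNIV. (\<lambda>x. Q x * f x) \<in> carrier (L2 (lebesgue_on UNIV))}"

definition domU :: "(real \<Rightarrow> complex) \<Rightarrow> (real \<Rightarrow> complex) set" where
  "domU U = {f \<in> carrier (L2 (lebesgue_on UNIV)).
               (\<lambda>x. U x * f x) \<in> carrier (L2 (lebesgue_on UNIV))}"

definition op_T :: "(real \<Rightarrow> complex) \<Rightarrow> (real \<Rightarrow> complex) \<Rightarrow> (real \<Rightarrow> complex) \<Rightarrow> (real \<Rightarrow> complex) \<Rightarrow>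
    (fun2 \<times> fun2) set" where
  "op_T Q W V U = matrix_op UNIV (domA Q) (domU U) Q W V U"

definition interval :: "nat \<Rightarrow> real set" where
  "interval n = {- real n <..< real n}"

definition op_Tn :: "(real \<Rightarrow> complex) \<Rightarrow> (real \<Rightarrow> complex) \<Rightarrow> (real \<Rightarrow> complex) \<Rightarrow> (real \<Rightarrow> complex) \<Rightarrow>
    nat \<Rightarrow> (fun2 \<times> fun2) set" where
  "op_Tn Q W V U n =
     matrix_op (interval n)
       {f \<in> sobolev 2 (interval n). vanishes_at_ends (- real n) (real n) f}
       (carrier (L2 (lebesgue_on (interval n)))) Q W V U"

definition resolvent_norm :: "(real \<Rightarrow> complex) \<Rightarrow> complex \<Rightarrow> real" where
  \<comment> \<open>the operator norm of \<open>(U - \<zeta>)\<^sup>-\<^sup>1\<close> in \<open>L\<^sup>2\<close>\<close>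
  "resolvent_norm U \<zeta> =
     op_norm (L2 (lebesgue_on UNIV)) (mult_op (lebesgue_on UNIV) (\<lambda>x. inverse (U x - \<zeta>)))"

definition op_B :: "real \<Rightarrow> (real \<Rightarrow> complex) \<Rightarrow> complex \<Rightarrow> (fun2 \<times> fun2) set" where
  "op_B b0 U \<zeta> =
     (let \<epsilon> = 1 / (b0 * (resolvent_norm U \<zeta>)\<^sup>2) in
      diag_op (mult_op (lebesgue_on UNIV) (\<lambda>x. 1))
              (mult_op (lebesgue_on UNIV) (\<lambda>x. complex_of_real \<epsilon> * inverse (U x - \<zeta>))))"

end

theory Submission
  imports Defs "HOL-Complex_Analysis.Complex_Analysis"
begin

text \<open>
  Part (i). If \<open>\<lambda>\<close> lies in the essential range of \<open>U\<close>, functions concentrated on short intervals where \<open>U\<close> is close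
  to \<open>\<lambda>\<close> give a singular sequence of \<open>T\<close>: they are placed in the second component, and the first component is
  chosen so that its second derivative cancels \<open>W g\<close>. A singular sequence of \<open>T - \<lambda>\<close> yields \<open>\<lambda>\<close> in the
  essential numerical range of each pencil. Finally, for \<open>\<lambda>\<close> outside the essential range of \<open>U\<close>, the factor
  \<open>\<epsilon>\<close> makes the pencil at \<open>\<lambda>\<close> coercive modulo the norm of the first component, which tends to 0 along weakly null
  sequences of bounded energy because \<open>Q\<close> tends to infinity.

  Part (ii). If \<open>T - \<lambda>\<close> is bounded below, then so is \<open>T\<^sub>n - \<mu>\<close>, uniformly for large \<open>n\<close> and \<open>\<mu>\<close> near \<open>\<lambda>\<close>: multiplying by the
  cut-off \<open>(1 - x\<^sup>2/n\<^sup>2)\<^sup>2\<close> carries vectors from the interval to the line with an error of order \<open>1/n\<close>, and the energy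
  controls what happens near the end points. Hence there is no pollution. If the spectra of infinitely many \<open>T\<^sub>n\<close> avoided a
  neighbourhood of an isolated point \<open>\<lambda>\<close> of the spectrum of \<open>T\<close>, the maximum principle would carry the uniform bounds
  of the resolvents from a small circle to its centre \<open>\<lambda>\<close>; cutting off functions on the line then shows that
  \<open>T - \<lambda>\<close> is bounded below, so \<open>\<lambda>\<close> would be a regular point.
\<close>

text \<open>Resolvents on different intervals are never compared in norm. All transfers between the
  line and the intervals concern lower bounds \<open>hnorm H x \<le> C * hnorm H y\<close> on
  graphs, which cut-offs carry in both directions. Such a bound says nothing about surjectivity,
  which has two sources of its own. On an interval, \<open>U - \<mu>\<close> stays away from 0 when
  \<open>T\<close> is bounded below at a point close to \<mu>, so the second component can be
  eliminated; what remains is a scalar two-point boundary value problem, where uniqueness gives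
  existence. On the line, surjectivity at regular points close to \<lambda> passes to \<lambda> by a
  contraction in the complete space \<open>Hsp UNIV\<close>. The entry \<open>V\<close> is
  unbounded; in part (ii) it is controlled through the form of \<open>Q\<close>, by |V|^2 \<le> b
  |Q| \<le> (b / cos \<theta>) Re Q. Hence the energy of the first component is bounded before its
  image under \<open>V\<close>. The definition of \<open>approximated\<close> asks for a spectral
  point of \<open>Tn n\<close> for each n \<ge> 1, so the truncated spectra must also be shown to be
  nonempty; the essential values of \<open>U\<close> on the interval supply such points.\<close>

locale semihilbert =
  fixes H :: "'v hilbert"
  assumes add_closed: "x \<in> carrier H \<Longrightarrow> y \<in> carrier H \<Longrightarrow> add H x y \<in> carrier H"
    and scale_closed: "x \<in> carrier H \<Longrightarrow> scale H c x \<in> carrier H"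
    and inn_add_left: "x \<in> carrier H \<Longrightarrow> y \<in> carrier H \<Longrightarrow> z \<in> carrier H \<Longrightarrow>
      inn H (add H x y) z = inn H x z + inn H y z"
    and inn_scale_left: "x \<in> carrier H \<Longrightarrow> y \<in> carrier H \<Longrightarrow> inn H (scale H c x) y = c * inn H x y"
    and inn_cnj: "x \<in> carrier H \<Longrightarrow> y \<in> carrier H \<Longrightarrow> cnj (inn H x y) = inn H y x"
    and inn_nonneg: "x \<in> carrier H \<Longrightarrow> 0 \<le> Re (inn H x x)"
    and add_assoc: "add H (add H x y) z = add H x (add H y z)"
    and add_commute: "add H x y = add H y x"
    and scale_add: "scale H c (add H x y) = add H (scale H c x) (scale H c y)"
    and add_scale: "add H (scale H c x) (scale H d x) = scale H (c + d) x"
    and scale_scale: "scale H c (scale H d x) = scale H (c * d) x"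
    and scale_one: "scale H 1 x = x"
    and add_cancel: "add H (add H u (scale H c x)) (scale H (- c) x) = u"
begin

text \<open>The record has neither a zero vector nor negatives. The axiom \<open>add_cancel\<close>
  stands in for both, and multiples by 0 act as the zero vector.\<close>

lemma add_scale_zero: "add H u (scale H 0 x) = u"
  using add_cancel[of u 1 x] by (simp add: add_assoc add_scale)

lemma add_diff_self: "add H (add H y p) (scale H (-1) y) = p"
  using add_cancel[of p 1 y] by (simp add: scale_one add_commute)

lemma diff_add_left: "add H (add H y p) (scale H (-1) (add H y q)) = add H p (scale H (-1) q)"
proof -
  have "add H (add H y p) (scale H (-1) (add H y q)) =
      add H (add H (add H y p) (scale H (-1) y)) (scale H (-1) q)"
    by (simp add: scale_add add_assoc)
  then show ?thesis by (simp add: add_diff_self)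
qed

lemma add_left_commute: "add H x (add H y z) = add H y (add H x z)"
  by (metis add_assoc add_commute)

lemmas vec_ac = scale_add scale_scale add_assoc add_commute add_left_commute

lemma diff_scale: "add H (scale H d a) (scale H (-1) (scale H d b)) = scale H d (add H a (scale H (-1) b))"
  by (simp add: scale_add scale_scale)

lemma inn_add_right: "x \<in> carrier H \<Longrightarrow> y \<in> carrier H \<Longrightarrow> z \<in> carrier H \<Longrightarrow>
    inn H z (add H x y) = inn H z x + inn H z y"
  by (subst (1 2 3) inn_cnj[symmetric]) (simp_all add: add_closed inn_add_left)

lemma inn_scale_right: "x \<in> carrier H \<Longrightarrow> y \<in> carrier H \<Longrightarrow> inn H y (scale H c x) = cnj c * inn H y x"
  by (subst (1 2) inn_cnj[symmetric]) (simp_all add: scale_closed inn_scale_left)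

lemmas inn_simps = inn_add_left inn_add_right inn_scale_left inn_scale_right add_closed scale_closed

lemma inn_self: "x \<in> carrier H \<Longrightarrow> inn H x x = complex_of_real ((hnorm H x)\<^sup>2)"
  using inn_cnj[of x x] inn_nonneg[of x] by (simp add: hnorm_def complex_eq_iff)

lemma hnorm_nonneg [simp]: "x \<in> carrier H \<Longrightarrow> 0 \<le> hnorm H x"
  using inn_nonneg by (simp add: hnorm_def)

lemma hnorm_sq: "x \<in> carrier H \<Longrightarrow> (hnorm H x)\<^sup>2 = Re (inn H x x)"
  using inn_nonneg by (simp add: hnorm_def)

lemma hnorm_add_sq:
  assumes "x \<in> carrier H" "y \<in> carrier H"
  shows "(hnorm H (add H x (scale H c y)))\<^sup>2 =
    (hnorm H x)\<^sup>2 + (cmod c)\<^sup>2 * (hnorm H y)\<^sup>2 + 2 * Re (cnj c * inn H x y)"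
proof -
  have *: "inn H y x = cnj (inn H x y)" using assms by (simp add: inn_cnj)
  have "inn H (add H x (scale H c y)) (add H x (scale H c y)) =
      inn H x x + c * cnj c * inn H y y + (cnj c * inn H x y + cnj (cnj c * inn H x y))"
    using assms by (simp add: inn_simps * algebra_simps)
  also have "\<dots> = complex_of_real ((hnorm H x)\<^sup>2 + (cmod c)\<^sup>2 * (hnorm H y)\<^sup>2 + 2 * Re (cnj c * inn H x y))"
    using assms unfolding complex_add_cnj by (simp add: inn_self flip: complex_norm_square)
  finally show ?thesis
    using assms by (subst hnorm_sq) (simp_all add: inn_simps)
qed

lemma hnorm_scale: "x \<in> carrier H \<Longrightarrow> hnorm H (scale H c x) = cmod c * hnorm H x"
proof (rule power2_eq_imp_eq)
  assume x: "x \<in> carrier H"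
  have "inn H (scale H c x) (scale H c x) = complex_of_real ((cmod c * hnorm H x)\<^sup>2)"
    using x by (simp add: inn_simps inn_self[OF x] power_mult_distrib)
      (metis complex_norm_square mult.commute mult.left_commute of_real_power)
  then show "(hnorm H (scale H c x))\<^sup>2 = (cmod c * hnorm H x)\<^sup>2"
    using x by (simp add: hnorm_sq scale_closed)
qed (simp_all add: scale_closed)

text \<open>The form is only semidefinite, so a vector of norm 0 cannot be replaced by 0. Both
  degenerate cases have to be read off from the nonnegativity of the quadratic polynomial in
  t.\<close>

lemma Cauchy_Schwarz:
  assumes x: "x \<in> carrier H" and y: "y \<in> carrier H"
  shows "cmod (inn H x y) \<le> hnorm H x * hnorm H y"
proof (cases "inn H x y = 0")
  case True
  then show ?thesis using assms by simp
next
  case False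
  \<comment> \<open>\<open>s\<close> is the phase of the inner product. It makes
    \<open>cnj s * inn H x y\<close> real and nonnegative, so that a real parameter t is
    enough.\<close>
  define s where "s = inn H x y / cmod (inn H x y)"
  have s: "cmod s = 1" using False by (simp add: s_def norm_divide)
  have cs: "cnj s * inn H x y = cmod (inn H x y)"
    using False by (simp add: s_def complex_norm_square[symmetric] power2_eq_square mult.commute)
  have q: "0 \<le> (hnorm H x)\<^sup>2 + t\<^sup>2 * (hnorm H y)\<^sup>2 + 2 * t * cmod (inn H x y)" for t :: real
  proof -
    have "cnj (t * s) * inn H x y = complex_of_real (t * cmod (inn H x y))"
      using cs by (simp add: mult.assoc)
    then have "Re (cnj (t * s) * inn H x y) = t * cmod (inn H x y)" by (metis Re_complex_of_real)
    moreover have "(cmod (t * s))\<^sup>2 = t\<^sup>2" using s by (simp add: norm_mult)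
    ultimately show ?thesis
      using hnorm_add_sq[OF x y, of "t * s"] by (metis mult.assoc zero_le_power2)
  qed
  show ?thesis
  proof (cases "hnorm H y = 0")
    case True
    \<comment> \<open>For \<open>hnorm H y = 0\<close> the polynomial is affine in t with slope
      twice the modulus of the inner product; at this t its value would be -1.\<close>
    have "0 \<le> (hnorm H x)\<^sup>2 - ((hnorm H x)\<^sup>2 + 1)"
      using q[of "- ((hnorm H x)\<^sup>2 + 1) / (2 * cmod (inn H x y))"] True False by (simp add: field_simps)
    then show ?thesis by linarith
  next
    case nz: False
    have "0 \<le> (hnorm H x)\<^sup>2 + (hnorm H x)\<^sup>2 - 2 * (hnorm H x / hnorm H y) * cmod (inn H x y)"
      using q[of "- hnorm H x / hnorm H y"] nz by (simp add: power_divide)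
    then have *: "hnorm H x * cmod (inn H x y) \<le> hnorm H x * (hnorm H x * hnorm H y)"
      using nz hnorm_nonneg[OF y] by (simp add: field_simps power2_eq_square)
    show ?thesis
    proof (cases "hnorm H x = 0")
      case True
      have "0 \<le> (t\<^sup>2 * (hnorm H y)\<^sup>2 + 2 * t * cmod (inn H x y))" for t using q[of t] True by simp
      from this[of "- cmod (inn H x y) / (hnorm H y)\<^sup>2"] nz
      have "(cmod (inn H x y))\<^sup>2 / (hnorm H y)\<^sup>2 \<le> 0"
        by (simp add: power_divide power2_eq_square field_simps)
      then show ?thesis using nz False by (simp add: divide_le_0_iff)
    next
      case False
      then have "0 < hnorm H x" using hnorm_nonneg[OF x] by simp
      with * show ?thesis by simp
    qed
  qed
qed

lemma triangle:
  assumes x: "x \<in> carrier H" and y: "y \<in> carrier H"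
  shows "hnorm H (add H x (scale H c y)) \<le> hnorm H x + cmod c * hnorm H y"
proof (rule power2_le_imp_le)
  have "Re (cnj c * inn H x y) \<le> cmod (cnj c * inn H x y)" by (rule complex_Re_le_cmod)
  also have "\<dots> \<le> cmod c * (hnorm H x * hnorm H y)"
    using Cauchy_Schwarz[OF x y] by (simp add: norm_mult mult_left_mono)
  finally show "(hnorm H (add H x (scale H c y)))\<^sup>2 \<le> (hnorm H x + cmod c * hnorm H y)\<^sup>2"
    unfolding hnorm_add_sq[OF x y] by (simp add: power2_sum power_mult_distrib algebra_simps)
qed (use assms in simp)

end

section \<open>Linear operators given by graphs, and their resolvents\<close>

locale graph_op = semihilbert H for H :: "'v hilbert" +
  fixes S :: "('v \<times> 'v) set"
  assumes graph_closed: "(x, y) \<in> S \<Longrightarrow> x \<in> carrier H \<and> y \<in> carrier H"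
    and graph_add: "(x, y) \<in> S \<Longrightarrow> (x', y') \<in> S \<Longrightarrow> (add H x (scale H c x'), add H y (scale H c y')) \<in> S"
    and graph_scale: "(x, y) \<in> S \<Longrightarrow> (scale H c x, scale H c y) \<in> S"
    and graph_cong: "(x, y) \<in> S \<Longrightarrow> y' \<in> carrier H \<Longrightarrow> hnorm H (add H y' (scale H (-1) y)) = 0 \<Longrightarrow> (x, y') \<in> S"
begin

abbreviation "Sh \<equiv> op_shift H S"

lemma shift_iff: "(x, y) \<in> Sh \<zeta> \<longleftrightarrow> (\<exists>w. (x, w) \<in> S \<and> y = add H w (scale H (- \<zeta>) x))"
  using graph_closed unfolding op_shift_def op_diff_def Id_on_def by blast

lemma shift_closed: "(x, y) \<in> Sh \<zeta> \<Longrightarrow> x \<in> carrier H \<and> y \<in> carrier H"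
  using graph_closed by (auto simp: shift_iff add_closed scale_closed)

text \<open>This plays the part of the resolvent identity: perturbation bounds, the
  differentiability of the resolvent and the fixed point equation in \<open>surjective_near\<close>
  all start from it.\<close>

lemma shift_change:
  assumes "(x, y) \<in> Sh \<zeta>"
  shows "(x, add H y (scale H (\<zeta> - \<zeta>') x)) \<in> Sh \<zeta>'"
  using assms unfolding shift_iff by (auto simp: add_assoc add_scale)

lemma shift_add:
  assumes "(x, y) \<in> Sh \<zeta>" "(x', y') \<in> Sh \<zeta>"
  shows "(add H x (scale H c x'), add H y (scale H c y')) \<in> Sh \<zeta>"
proof -
  obtain w w' where w: "(x, w) \<in> S" "y = add H w (scale H (- \<zeta>) x)"
      "(x', w') \<in> S" "y' = add H w' (scale H (- \<zeta>) x')"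
    using assms by (auto simp: shift_iff)
  have "add H y (scale H c y') = add H (add H w (scale H c w')) (scale H (- \<zeta>) (add H x (scale H c x')))"
    unfolding w(2,4) by (simp add: vec_ac mult.commute)
  then show ?thesis using graph_add[OF w(1,3), of c] by (auto simp: shift_iff)
qed

lemma shift_scale:
  assumes "(x, y) \<in> Sh \<zeta>"
  shows "(scale H c x, scale H c y) \<in> Sh \<zeta>"
proof -
  obtain w where w: "(x, w) \<in> S" "y = add H w (scale H (- \<zeta>) x)"
    using assms by (auto simp: shift_iff)
  have "scale H c y = add H (scale H c w) (scale H (- \<zeta>) (scale H c x))"
    unfolding w(2) by (simp add: vec_ac mult.commute)
  then show ?thesis using graph_scale[OF w(1), of c] by (auto simp: shift_iff)
qed

lemma shift_cong:
  assumes "(x, y) \<in> Sh \<zeta>" "y' \<in> carrier H" "hnorm H (add H y' (scale H (-1) y)) = 0"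
  shows "(x, y') \<in> Sh \<zeta>"
proof -
  obtain w where w: "(x, w) \<in> S" "y = add H w (scale H (- \<zeta>) x)"
    using assms by (auto simp: shift_iff)
  have cl: "x \<in> carrier H" "w \<in> carrier H" using w graph_closed by auto
  let ?w = "add H y' (scale H \<zeta> x)"
  have "hnorm H (add H ?w (scale H (-1) w)) = 0"
  proof -
    have "add H ?w (scale H (-1) w) = add H y' (scale H (-1) y)"
      unfolding w(2) by (simp add: vec_ac mult.commute)
    then show ?thesis using assms(3) by simp
  qed
  then have "(x, ?w) \<in> S"
    using graph_cong w(1) assms(2) cl by (auto simp: add_closed scale_closed)
  then show ?thesis unfolding shift_iff
    using add_cancel[of y' \<zeta> x] by (intro exI[of _ ?w]) simp
qed

lemma resolvent_setI:
  assumes "\<And>y. y \<in> carrier H \<Longrightarrow> \<exists>x. (x, y) \<in> Sh \<zeta>"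
    and "\<And>x y. (x, y) \<in> Sh \<zeta> \<Longrightarrow> hnorm H x \<le> C * hnorm H y"
  shows "\<zeta> \<in> resolvent_set H S"
proof -
  have "hnorm H x = 0" if "(x, y) \<in> Sh \<zeta>" "hnorm H y = 0" for x y
    using assms(2)[OF that(1)] that(2) shift_closed[OF that(1)] hnorm_nonneg[of x] by (simp add: order_antisym)
  then show ?thesis
    unfolding resolvent_set_def using assms by blast
qed

text \<open>The change of parameter costs at most half of \<open>hnorm H x\<close>, which is
  absorbed on the left-hand side and doubles the constant.\<close>

lemma shift_bound_perturb:
  assumes "\<And>x y. (x, y) \<in> Sh \<zeta> \<Longrightarrow> hnorm H x \<le> C * hnorm H y" and "0 \<le> C"
    and "C * cmod (\<zeta>' - \<zeta>) \<le> 1/2" and xy: "(x, y) \<in> Sh \<zeta>'"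
  shows "hnorm H x \<le> 2 * C * hnorm H y"
proof -
  have cl: "x \<in> carrier H" "y \<in> carrier H" using shift_closed[OF xy] by auto
  have "hnorm H x \<le> C * hnorm H (add H y (scale H (\<zeta>' - \<zeta>) x))"
    using assms(1)[OF shift_change[OF xy]] .
  also have "\<dots> \<le> C * (hnorm H y + cmod (\<zeta>' - \<zeta>) * hnorm H x)"
    using triangle[OF cl(2,1)] assms(2) by (intro mult_left_mono) auto
  also have "\<dots> = C * hnorm H y + C * cmod (\<zeta>' - \<zeta>) * hnorm H x" by (simp add: algebra_simps)
  also have "\<dots> \<le> C * hnorm H y + 1/2 * hnorm H x"
    using assms(3) cl by (intro add_left_mono mult_right_mono) auto
  finally show ?thesis by simp
qed

text \<open>The maximum modulus principle is applied to matrix elements of the resolvent.\<close>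

lemma resolvent_bound_center:
  assumes r: "0 < r"
    and res: "\<And>\<zeta>. cmod (\<zeta> - \<zeta>0) \<le> r \<Longrightarrow> \<zeta> \<in> resolvent_set H S"
    and bd: "\<And>\<zeta> x y. cmod (\<zeta> - \<zeta>0) = r \<Longrightarrow> (x, y) \<in> Sh \<zeta> \<Longrightarrow> hnorm H x \<le> C * hnorm H y"
    and xy: "(x, y) \<in> Sh \<zeta>0"
  shows "hnorm H x \<le> C * hnorm H y"
proof -
  have cl: "x \<in> carrier H" "y \<in> carrier H" using shift_closed[OF xy] by auto
  let ?D = "cball \<zeta>0 r"
  have surj: "\<exists>x. (x, z) \<in> Sh \<zeta>" if "\<zeta> \<in> ?D" "z \<in> carrier H" for \<zeta> z
    using res[of \<zeta>] that by (auto simp: resolvent_set_def dist_norm norm_minus_commute)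
  \<comment> \<open>\<open>R\<close> is a choice of representatives, linear only up to vectors of
    norm 0. Identities for it are therefore obtained by applying the lower bound to differences of
    graph elements.\<close>
  define R where "R \<zeta> z = (SOME x. (x, z) \<in> Sh \<zeta>)" for \<zeta> z
  have R: "(R \<zeta> z, z) \<in> Sh \<zeta>" if "\<zeta> \<in> ?D" "z \<in> carrier H" for \<zeta> z
    unfolding R_def using surj[OF that] by (rule someI_ex)
  have Rc: "R \<zeta> z \<in> carrier H" if "\<zeta> \<in> ?D" "z \<in> carrier H" for \<zeta> z
    using shift_closed[OF R[OF that]] by simp
  \<comment> \<open>The resolvent applied to \<open>y\<close> is paired with the given solution
    \<open>x\<close> itself. At the centre this is the square of the norm of \<open>x\<close>, on
    the circle at most \<open>C * hnorm H y * hnorm H x\<close>; cancelling one factor gives the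
    claim.\<close>
  define \<phi> where "\<phi> \<zeta> = inn H (R \<zeta> y) x" for \<zeta>
  have bounded: "\<exists>K\<ge>0. \<forall>x y. (x, y) \<in> Sh \<zeta> \<longrightarrow> hnorm H x \<le> K * hnorm H y" if \<zeta>: "\<zeta> \<in> ?D" for \<zeta>
  proof -
    obtain K where K: "\<forall>(x, y)\<in>Sh \<zeta>. hnorm H x \<le> K * hnorm H y"
      using res[of \<zeta>] \<zeta> by (auto simp: resolvent_set_def dist_norm norm_minus_commute)
    show ?thesis
    proof (intro exI conjI allI impI)
      show "0 \<le> max K 0" by simp
      fix x y assume "(x, y) \<in> Sh \<zeta>"
      then have "hnorm H x \<le> K * hnorm H y" "0 \<le> hnorm H y" using K shift_closed by auto
      then show "hnorm H x \<le> max K 0 * hnorm H y"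
        by (meson max.cobounded1 mult_right_mono order_trans)
    qed
  qed
  have deriv: "(\<phi> has_field_derivative inn H (R \<zeta> (R \<zeta> y)) x) (at \<zeta> within ?D)" if \<zeta>: "\<zeta> \<in> ?D" for \<zeta>
  proof -
    obtain K where K: "K \<ge> 0" "\<And>x y. (x, y) \<in> Sh \<zeta> \<Longrightarrow> hnorm H x \<le> K * hnorm H y"
      using bounded[OF \<zeta>] by blast
    let ?L = "inn H (R \<zeta> (R \<zeta> y)) x"
    have Ry: "R \<zeta> y \<in> carrier H" and RRy: "R \<zeta> (R \<zeta> y) \<in> carrier H" using Rc \<zeta> cl by auto
    define B where "B = K * (K * (2 * K * hnorm H y)) * hnorm H x"
    have main: "cmod ((\<phi> \<zeta>' - \<phi> \<zeta>) / (\<zeta>' - \<zeta>) - ?L) \<le> B * cmod (\<zeta>' - \<zeta>)"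
      if \<zeta>': "\<zeta>' \<in> ?D" "\<zeta>' \<noteq> \<zeta>" and near: "K * cmod (\<zeta>' - \<zeta>) \<le> 1/2" for \<zeta>'
    proof -
      let ?d = "\<zeta>' - \<zeta>"
      have Ry': "R \<zeta>' y \<in> carrier H" using Rc \<zeta>' cl by auto
      have 1: "(R \<zeta>' y, add H y (scale H ?d (R \<zeta>' y))) \<in> Sh \<zeta>"
        using shift_change[OF R[OF \<zeta>'(1) cl(2)]] .
      define z where "z = add H (R \<zeta>' y) (scale H (-1) (R \<zeta> y))"
      define wz where "wz = add H (add H y (scale H ?d (R \<zeta>' y))) (scale H (-1) y)"
      have z: "(z, wz) \<in> Sh \<zeta>"
        unfolding z_def wz_def using shift_add[OF 1 R[OF \<zeta> cl(2)]] .
      \<comment> \<open>\<open>v\<close> is the remainder of the first-order expansion of the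
        resolvent at \<zeta>. Its image under the shifted operator is
        \<open>\<zeta>' - \<zeta>\<close> times \<open>z\<close>, and \<open>z\<close> is itself of
        first order, so \<open>v\<close> is of second order.\<close>
      define v where "v = add H z (scale H (- ?d) (R \<zeta> (R \<zeta> y)))"
      define wv where "wv = add H wz (scale H (- ?d) (R \<zeta> y))"
      have v: "(v, wv) \<in> Sh \<zeta>"
        unfolding v_def wv_def using shift_add[OF z R[OF \<zeta> Ry]] .
      have zc: "z \<in> carrier H" "wz \<in> carrier H" "v \<in> carrier H" "wv \<in> carrier H"
        using shift_closed[OF z] shift_closed[OF v] by auto
      have wz: "wz = scale H ?d (R \<zeta>' y)"
        unfolding wz_def by (rule add_diff_self)
      have wv: "wv = scale H ?d z"
        unfolding wv_def wz z_def using diff_scale[of ?d] by (simp add: scale_scale)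
      have nwz: "hnorm H wz = cmod ?d * hnorm H (R \<zeta>' y)" "hnorm H wv = cmod ?d * hnorm H z"
        unfolding wz wv using zc(1) Ry' by (simp_all add: hnorm_scale)
      have "hnorm H (R \<zeta>' y) \<le> 2 * K * hnorm H y"
        by (rule shift_bound_perturb[OF K(2) K(1) near R[OF \<zeta>'(1) cl(2)]])
      moreover have "hnorm H z \<le> K * (cmod ?d * hnorm H (R \<zeta>' y))" using K(2)[OF z] nwz by simp
      moreover have "hnorm H v \<le> K * (cmod ?d * hnorm H z)" using K(2)[OF v] nwz by simp
      ultimately have "hnorm H v \<le> K * (cmod ?d * (K * (cmod ?d * (2 * K * hnorm H y))))"
        using K(1) by (meson mult_left_mono norm_ge_zero order_trans)
      from mult_right_mono[OF this, of "hnorm H x"]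
      have "hnorm H v * hnorm H x \<le> (cmod ?d)\<^sup>2 * B"
        unfolding B_def using cl by (simp add: power2_eq_square algebra_simps)
      moreover have "inn H v x = \<phi> \<zeta>' - \<phi> \<zeta> - ?d * ?L"
        unfolding v_def z_def \<phi>_def using cl Ry Ry' RRy by (simp add: inn_simps algebra_simps)
      ultimately have "cmod (\<phi> \<zeta>' - \<phi> \<zeta> - ?d * ?L) \<le> (cmod ?d)\<^sup>2 * B"
        using Cauchy_Schwarz[OF zc(3) cl(1)] by simp
      moreover have "(\<phi> \<zeta>' - \<phi> \<zeta>) / ?d - ?L = (\<phi> \<zeta>' - \<phi> \<zeta> - ?d * ?L) / ?d"
        using \<zeta>'(2) by (simp add: field_simps)
      ultimately show ?thesis
        using \<zeta>'(2) by (simp add: norm_divide divide_le_eq power2_eq_square mult_ac)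
    qed
    have "((\<lambda>\<zeta>'. (\<phi> \<zeta>' - \<phi> \<zeta>) / (\<zeta>' - \<zeta>) - ?L) \<longlongrightarrow> 0) (at \<zeta> within ?D)"
    proof (rule Lim_null_comparison)
      have "((\<lambda>\<zeta>'. K * cmod (\<zeta>' - \<zeta>)) \<longlongrightarrow> K * cmod (\<zeta> - \<zeta>)) (at \<zeta> within ?D)"
        by (intro tendsto_intros)
      then have "eventually (\<lambda>\<zeta>'. K * cmod (\<zeta>' - \<zeta>) < 1/2) (at \<zeta> within ?D)"
        by (rule order_tendstoD) simp
      moreover have "eventually (\<lambda>\<zeta>'. \<zeta>' \<in> ?D \<and> \<zeta>' \<noteq> \<zeta>) (at \<zeta> within ?D)"
        by (auto simp: eventually_at_filter)
      ultimately show "eventually (\<lambda>\<zeta>'. cmod ((\<phi> \<zeta>' - \<phi> \<zeta>) / (\<zeta>' - \<zeta>) - ?L) \<le> B * cmod (\<zeta>' - \<zeta>)) (at \<zeta> within ?D)"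
        by eventually_elim (use main in auto)
      have "((\<lambda>\<zeta>'. B * cmod (\<zeta>' - \<zeta>)) \<longlongrightarrow> B * cmod (\<zeta> - \<zeta>)) (at \<zeta> within ?D)"
        by (intro tendsto_intros)
      then show "((\<lambda>\<zeta>'. B * cmod (\<zeta>' - \<zeta>)) \<longlongrightarrow> 0) (at \<zeta> within ?D)" by simp
    qed
    then show ?thesis
      unfolding has_field_derivative_iff by (simp add: LIM_zero_iff)
  qed
  have hol: "\<phi> holomorphic_on ?D" using deriv unfolding holomorphic_on_def field_differentiable_def by blast
  have "cmod (\<phi> \<zeta>0) \<le> C * hnorm H y * hnorm H x"
  proof (rule maximum_modulus_frontier[of \<phi> ?D])
    show "\<phi> holomorphic_on interior ?D" by (rule holomorphic_on_subset[OF hol interior_subset])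
    show "continuous_on (closure ?D) \<phi>" using hol by (simp add: holomorphic_on_imp_continuous_on)
    fix z assume "z \<in> frontier ?D"
    then have z: "cmod (z - \<zeta>0) = r" "z \<in> ?D" using r by (auto simp: dist_norm norm_minus_commute)
    have "cmod (\<phi> z) \<le> hnorm H (R z y) * hnorm H x"
      unfolding \<phi>_def by (rule Cauchy_Schwarz) (use Rc z cl in auto)
    also have "\<dots> \<le> C * hnorm H y * hnorm H x"
      using bd[OF z(1) R[OF z(2) cl(2)]] cl by (intro mult_right_mono) auto
    finally show "cmod (\<phi> z) \<le> C * hnorm H y * hnorm H x" .
  qed (use r in auto)
  moreover have "\<phi> \<zeta>0 = (hnorm H x)\<^sup>2"
  proof -
    have m: "\<zeta>0 \<in> ?D" using r by simp
    let ?R = "R \<zeta>0 y"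
    obtain K where K: "K \<ge> 0" "\<And>x y. (x, y) \<in> Sh \<zeta>0 \<Longrightarrow> hnorm H x \<le> K * hnorm H y"
      using bounded[OF m] by blast
    have Rc0: "?R \<in> carrier H" using Rc m cl by auto
    have "hnorm H (add H y (scale H (-1) y)) = 0"
      using cl by (simp add: hnorm_def inn_simps)
    then have "hnorm H (add H ?R (scale H (-1) x)) \<le> 0"
      using K(2)[OF shift_add[OF R[OF m cl(2)] xy, of "-1"]] by simp
    moreover have dc: "add H ?R (scale H (-1) x) \<in> carrier H" using Rc0 cl by (simp add: inn_simps)
    ultimately have "cmod (inn H (add H ?R (scale H (-1) x)) x) \<le> 0"
      using Cauchy_Schwarz[OF dc cl(1)] hnorm_nonneg[OF dc] by simp
    then have "inn H ?R x = inn H x x" using Rc0 cl by (simp add: inn_simps)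
    then show ?thesis unfolding \<phi>_def using inn_self[OF cl(1)] by simp
  qed
  ultimately have "hnorm H x * hnorm H x \<le> hnorm H x * (C * hnorm H y)"
    by (simp add: power2_eq_square mult_ac norm_mult)
  \<comment> \<open>No sign of \<open>C\<close> is assumed. At a point of the circle the bound has a
    nonnegative left-hand side, which settles the case \<open>hnorm H x = 0\<close>.\<close>
  moreover have "0 \<le> C * hnorm H y"
  proof -
    define \<zeta>1 where "\<zeta>1 = \<zeta>0 + r"
    have z: "cmod (\<zeta>1 - \<zeta>0) = r" "\<zeta>1 \<in> ?D" using r by (auto simp: \<zeta>1_def dist_norm)
    have "0 \<le> hnorm H (R \<zeta>1 y)" using Rc[OF z(2) cl(2)] by simp
    then show ?thesis using bd[OF z(1) R[OF z(2) cl(2)]] by linarith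
  qed
  ultimately show ?thesis
    using hnorm_nonneg[OF cl(1)] by (cases "hnorm H x = 0") auto
qed

text \<open>With R the resolvent at \<zeta>, the vector R v solves the equation at \<zeta>0 as soon
  as v = y + (\<zeta>0 - \<zeta>) R v, and the right-hand side is a contraction. The factor 4 in
  \<open>near\<close> arises since the bound C at \<zeta>0 becomes 2 C at \<zeta>, and 2 C |\<zeta>
  - \<zeta>0| \<le> 1/2 is the contraction constant; the iterates then have the geometric increments
  for which completeness is stated.\<close>

lemma surjective_near:
  assumes complete: "\<And>u. (\<And>k. u k \<in> carrier H) \<Longrightarrow>
      (\<exists>K. \<forall>k. hnorm H (add H (u (Suc k)) (scale H (-1) (u k))) \<le> K * (1/2) ^ k) \<Longrightarrow>
      \<exists>v\<in>carrier H. (\<lambda>k. hnorm H (add H v (scale H (-1) (u k)))) \<longlonglongrightarrow> 0"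
    and bd: "\<And>x y. (x, y) \<in> Sh \<zeta>0 \<Longrightarrow> hnorm H x \<le> C * hnorm H y" and C: "0 \<le> C"
    and near: "4 * C * cmod (\<zeta> - \<zeta>0) \<le> 1"
    and surj: "\<And>y. y \<in> carrier H \<Longrightarrow> \<exists>x. (x, y) \<in> Sh \<zeta>"
    and y: "y \<in> carrier H"
  shows "\<exists>x. (x, y) \<in> Sh \<zeta>0"
proof -
  let ?d = "\<zeta>0 - \<zeta>"
  have near': "C * cmod (\<zeta> - \<zeta>0) \<le> 1/2" "2 * C * cmod ?d \<le> 1/2"
  proof -
    have "C * cmod (\<zeta> - \<zeta>0) \<le> 1/4" using near by simp
    then show "C * cmod (\<zeta> - \<zeta>0) \<le> 1/2" "2 * C * cmod ?d \<le> 1/2"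
      by (simp_all add: norm_minus_commute)
  qed
  have bd': "hnorm H x \<le> 2 * C * hnorm H y" if "(x, y) \<in> Sh \<zeta>" for x y
    by (rule shift_bound_perturb[OF bd C near'(1) that])
  define R where "R z = (SOME x. (x, z) \<in> Sh \<zeta>)" for z
  have R: "(R z, z) \<in> Sh \<zeta>" if "z \<in> carrier H" for z
    unfolding R_def using surj[OF that] by (rule someI_ex)
  have Rc: "R z \<in> carrier H" if "z \<in> carrier H" for z using shift_closed[OF R[OF that]] by simp
  have Rdiff: "hnorm H (add H (R a) (scale H (-1) (R b))) \<le> 2 * C * hnorm H (add H a (scale H (-1) b))"
    if "a \<in> carrier H" "b \<in> carrier H" for a b
    by (rule bd'[OF shift_add[OF R[OF that(1)] R[OF that(2)]]])
  define u where "u = rec_nat y (\<lambda>k a. add H y (scale H ?d (R a)))"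
  have u0: "u 0 = y" and us: "u (Suc k) = add H y (scale H ?d (R (u k)))" for k by (simp_all add: u_def)
  have uc: "u k \<in> carrier H" for k by (induction k) (use y Rc in \<open>simp_all add: u0 us inn_simps\<close>)
  have diff: "hnorm H (add H (add H y (scale H ?d a)) (scale H (-1) (add H y (scale H ?d b)))) =
      cmod ?d * hnorm H (add H a (scale H (-1) b))" if "a \<in> carrier H" "b \<in> carrier H" for a b
    using that by (simp add: diff_add_left diff_scale hnorm_scale add_closed scale_closed)
  have diff': "hnorm H (add H (add H y (scale H ?d (R a))) (scale H (-1) (add H y (scale H ?d (R b)))))
      \<le> 1/2 * hnorm H (add H a (scale H (-1) b))" if "a \<in> carrier H" "b \<in> carrier H" for a b
  proof -
    have "hnorm H (add H (add H y (scale H ?d (R a))) (scale H (-1) (add H y (scale H ?d (R b)))))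
       \<le> cmod ?d * (2 * C * hnorm H (add H a (scale H (-1) b)))"
      unfolding diff[OF Rc[OF that(1)] Rc[OF that(2)]] by (intro mult_left_mono Rdiff that) simp
    also have "\<dots> = 2 * C * cmod ?d * hnorm H (add H a (scale H (-1) b))" by simp
    also have "\<dots> \<le> 1/2 * hnorm H (add H a (scale H (-1) b))"
      using near' that by (intro mult_right_mono) (auto simp: inn_simps)
    finally show ?thesis .
  qed
  have geo: "hnorm H (add H (u (Suc k)) (scale H (-1) (u k))) \<le> hnorm H (add H (u 1) (scale H (-1) (u 0))) * (1/2) ^ k" for k
  proof (induction k)
    case (Suc k)
    have "hnorm H (add H (u (Suc (Suc k))) (scale H (-1) (u (Suc k)))) \<le> 1/2 * hnorm H (add H (u (Suc k)) (scale H (-1) (u k)))"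
      using diff'[OF uc uc, of "Suc k" k] unfolding us[symmetric] .
    with Suc show ?case by simp
  qed simp
  obtain v where v: "v \<in> carrier H" "(\<lambda>k. hnorm H (add H v (scale H (-1) (u k)))) \<longlonglongrightarrow> 0"
    using complete[of u] uc geo by blast
  let ?w = "add H v (scale H (- ?d) (R v))"
  have wS: "(R v, ?w) \<in> Sh \<zeta>0"
    using shift_change[OF R[OF v(1)], of \<zeta>0] by simp
  have wc: "?w \<in> carrier H" using v(1) Rc by (simp add: inn_simps)
  let ?e = "\<lambda>k. hnorm H (add H v (scale H (-1) (u k)))"
  have est: "hnorm H (add H y (scale H (-1) ?w)) \<le> ?e (Suc k) + 1/2 * ?e k" for k
  proof -
    let ?a = "add H v (scale H (-1) (u (Suc k)))"
    let ?b = "add H (add H y (scale H ?d (R v))) (scale H (-1) (u (Suc k)))"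
    have c: "?a \<in> carrier H" "?b \<in> carrier H" using v(1) y Rc uc by (auto simp: inn_simps)
    have "add H y (scale H (-1) ?w) = add H ?b (scale H (-1) ?a)"
      unfolding add_commute[of _ "scale H (-1) (u (Suc k))"] diff_add_left
      by (simp add: vec_ac mult.commute)
    then have "hnorm H (add H y (scale H (-1) ?w)) = hnorm H (add H ?b (scale H (-1) ?a))" by simp
    also have "\<dots> \<le> hnorm H ?b + ?e (Suc k)" using triangle[OF c(2,1), of "-1"] by simp
    also have "hnorm H ?b \<le> 1/2 * ?e k" using diff'[OF v(1) uc, of k] unfolding us[symmetric] .
    finally show ?thesis by simp
  qed
  have "(\<lambda>k. ?e (Suc k) + 1/2 * ?e k) \<longlonglongrightarrow> 0 + 1/2 * 0"
    by (intro tendsto_intros v(2) filterlim_compose[OF v(2) filterlim_Suc])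
  then have "hnorm H (add H y (scale H (-1) ?w)) \<le> 0"
    using est by (intro LIMSEQ_le_const[of _ 0]) auto
  moreover have "0 \<le> hnorm H (add H y (scale H (-1) ?w))" using y wc by (intro hnorm_nonneg) (simp add: inn_simps)
  ultimately have "(R v, y) \<in> Sh \<zeta>0"
    using shift_cong[OF wS y] by simp
  then show ?thesis by blast
qed

end

section \<open>The spaces L^2, their direct sums and their completeness\<close>

lemma carrier_L2: "f \<in> carrier (L2 M) \<longleftrightarrow> f \<in> borel_measurable M \<and> integrable M (\<lambda>x. (cmod (f x))\<^sup>2)"
  by (simp add: L2_def)

lemma L2_simps: "add (L2 M) = (\<lambda>f g x. f x + g x)" "scale (L2 M) = (\<lambda>c f x. c * f x)"
    "inn (L2 M) = (\<lambda>f g. LINT x|M. f x * cnj (g x))"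
  by (simp_all add: L2_def)

lemma L2_measurable: "f \<in> carrier (L2 M) \<Longrightarrow> f \<in> borel_measurable M"
  and L2_integrable: "f \<in> carrier (L2 M) \<Longrightarrow> integrable M (\<lambda>x. (cmod (f x))\<^sup>2)"
  by (simp_all add: carrier_L2)

lemma norm_mult_le_squares: "cmod a * cmod b \<le> (cmod a)\<^sup>2 + (cmod b)\<^sup>2"
proof -
  have "2 * (cmod a * cmod b) \<le> (cmod a)\<^sup>2 + (cmod b)\<^sup>2" using sum_squares_bound[of "cmod a" "cmod b"] by simp
  then show ?thesis by (smt (verit) mult_nonneg_nonneg norm_ge_zero)
qed

lemma norm_add_sq_le: "(cmod (a + b))\<^sup>2 \<le> 2 * (cmod a)\<^sup>2 + 2 * (cmod b)\<^sup>2"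
proof -
  have "(cmod (a + b))\<^sup>2 \<le> (cmod a + cmod b)\<^sup>2" by (intro power_mono norm_triangle_ineq) simp
  also have "\<dots> \<le> 2 * (cmod a)\<^sup>2 + 2 * (cmod b)\<^sup>2"
    using sum_squares_bound[of "cmod a" "cmod b"] by (simp add: power2_sum)
  finally show ?thesis .
qed

lemma L2_mult_integrable:
  assumes "f \<in> carrier (L2 M)" "g \<in> carrier (L2 M)"
  shows "integrable M (\<lambda>x. f x * g x)"
proof (rule Bochner_Integration.integrable_bound)
  show "integrable M (\<lambda>x. (cmod (f x))\<^sup>2 + (cmod (g x))\<^sup>2)"
    using assms by (intro Bochner_Integration.integrable_add L2_integrable)
  show "(\<lambda>x. f x * g x) \<in> borel_measurable M" using assms by (intro borel_measurable_times L2_measurable)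
  have "cmod (f x * g x) \<le> norm ((cmod (f x))\<^sup>2 + (cmod (g x))\<^sup>2)" for x
    using norm_mult_le_squares[of "f x" "g x"] by (simp add: norm_mult)
  then show "AE x in M. cmod (f x * g x) \<le> norm ((cmod (f x))\<^sup>2 + (cmod (g x))\<^sup>2)" by blast
qed

lemma L2_dominated:
  assumes "g \<in> carrier (L2 M)" "f \<in> borel_measurable M" "AE x in M. cmod (f x) \<le> C * cmod (g x)"
  shows "f \<in> carrier (L2 M)"
  unfolding carrier_L2
proof
  show "integrable M (\<lambda>x. (cmod (f x))\<^sup>2)"
  proof (rule Bochner_Integration.integrable_bound)
    show "integrable M (\<lambda>x. C\<^sup>2 * (cmod (g x))\<^sup>2)"
      using assms(1) by (intro integrable_mult_right L2_integrable)
    show "(\<lambda>x. (cmod (f x))\<^sup>2) \<in> borel_measurable M" using assms(2) by measurable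
    show "AE x in M. norm ((cmod (f x))\<^sup>2) \<le> norm (C\<^sup>2 * (cmod (g x))\<^sup>2)"
      using assms(3)
    proof eventually_elim
      case (elim x)
      then have "(cmod (f x))\<^sup>2 \<le> (C * cmod (g x))\<^sup>2" by (intro power_mono) auto
      then show ?case by (simp add: power_mult_distrib)
    qed
  qed
qed fact

lemma borel_measurable_cnj: "f \<in> borel_measurable M \<Longrightarrow> (\<lambda>x. cnj (f x)) \<in> borel_measurable M"
  by (rule measurable_compose[where g=cnj and N=borel]) (auto intro: borel_measurable_continuous_onI continuous_intros)

lemma L2_cnj [simp]: "f \<in> carrier (L2 M) \<Longrightarrow> (\<lambda>x. cnj (f x)) \<in> carrier (L2 M)"
  by (rule L2_dominated[where g=f and C=1]) (simp_all add: carrier_L2 borel_measurable_cnj)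

lemma L2_scale [intro]: "f \<in> carrier (L2 M) \<Longrightarrow> (\<lambda>x. c * f x) \<in> carrier (L2 M)"
  by (rule L2_dominated[where g=f and C="cmod c"]) (auto simp: carrier_L2 norm_mult)

lemma L2_zero [simp]: "(\<lambda>x. 0) \<in> carrier (L2 M)"
  by (simp add: carrier_L2)

lemma L2_add [intro]:
  assumes "f \<in> carrier (L2 M)" "g \<in> carrier (L2 M)"
  shows "(\<lambda>x. f x + g x) \<in> carrier (L2 M)"
  unfolding carrier_L2
proof
  show m: "(\<lambda>x. f x + g x) \<in> borel_measurable M" using assms by (intro borel_measurable_add L2_measurable)
  show "integrable M (\<lambda>x. (cmod (f x + g x))\<^sup>2)"
  proof (rule Bochner_Integration.integrable_bound)
    show "integrable M (\<lambda>x. 2 * (cmod (f x))\<^sup>2 + 2 * (cmod (g x))\<^sup>2)"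
      using assms by (intro Bochner_Integration.integrable_add integrable_mult_right L2_integrable)
    show "(\<lambda>x. (cmod (f x + g x))\<^sup>2) \<in> borel_measurable M" using m by measurable
    show "AE x in M. norm ((cmod (f x + g x))\<^sup>2) \<le> norm (2 * (cmod (f x))\<^sup>2 + 2 * (cmod (g x))\<^sup>2)"
      using norm_add_sq_le[of "f _" "g _"] by simp
  qed
qed

lemma L2_uminus [intro]: "f \<in> carrier (L2 M) \<Longrightarrow> (\<lambda>x. - f x) \<in> carrier (L2 M)"
  using L2_scale[of f M "-1"] by simp

lemma L2_diff [intro]: "f \<in> carrier (L2 M) \<Longrightarrow> g \<in> carrier (L2 M) \<Longrightarrow> (\<lambda>x. f x - g x) \<in> carrier (L2 M)"
  using L2_add[of f M "\<lambda>x. - g x"] L2_uminus[of g M] by simp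

lemma inn_L2_self: "inn (L2 M) f f = complex_of_real (LINT x|M. (cmod (f x))\<^sup>2)"
  unfolding L2_simps complex_norm_square[symmetric] by (rule integral_complex_of_real)

lemma semihilbert_L2: "semihilbert (L2 M)"
proof
  fix f g h :: "'a \<Rightarrow> complex" and c :: complex
  show "inn (L2 M) (add (L2 M) f g) h = inn (L2 M) f h + inn (L2 M) g h"
    if "f \<in> carrier (L2 M)" "g \<in> carrier (L2 M)" "h \<in> carrier (L2 M)"
    using that unfolding L2_simps
    by (simp add: algebra_simps L2_mult_integrable)
  show "inn (L2 M) (scale (L2 M) c f) g = c * inn (L2 M) f g"
    unfolding L2_simps by (simp add: mult.assoc)
  show "cnj (inn (L2 M) f g) = inn (L2 M) g f"
    unfolding L2_simps by (subst Bochner_Integration.integral_cnj[symmetric]) (simp add: mult.commute)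
  show "0 \<le> Re (inn (L2 M) f f)"
    unfolding inn_L2_self by simp
qed (auto simp: L2_simps algebra_simps L2_add L2_scale)

lemma hilbert_sum_simps:
  "carrier (hilbert_sum H K) = carrier H \<times> carrier K"
  "add (hilbert_sum H K) = (\<lambda>x y. (add H (fst x) (fst y), add K (snd x) (snd y)))"
  "scale (hilbert_sum H K) = (\<lambda>c x. (scale H c (fst x), scale K c (snd x)))"
  "inn (hilbert_sum H K) = (\<lambda>x y. inn H (fst x) (fst y) + inn K (snd x) (snd y))"
  by (simp_all add: hilbert_sum_def)

lemma semihilbert_sum:
  assumes "semihilbert H" "semihilbert K"
  shows "semihilbert (hilbert_sum H K)"
proof -
  interpret H: semihilbert H by fact
  interpret K: semihilbert K by fact
  show ?thesis
    by unfold_locales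
      (auto simp: hilbert_sum_simps H.inn_simps K.inn_simps H.inn_cnj K.inn_cnj H.inn_nonneg K.inn_nonneg
         H.add_scale_zero K.add_scale_zero H.scale_one K.scale_one H.vec_ac K.vec_ac H.add_scale K.add_scale algebra_simps)
qed

lemma semihilbert_Hsp: "semihilbert (Hsp \<Omega>)"
  by (intro semihilbert_sum semihilbert_L2)

lemma hnorm_L2_sq: "(hnorm (L2 M) f)\<^sup>2 = (LINT x|M. (cmod (f x))\<^sup>2)"
  by (simp add: hnorm_def inn_L2_self)

lemma hnorm_L2_nonneg [simp]: "0 \<le> hnorm (L2 M) f"
  by (simp add: hnorm_def inn_L2_self)

lemma hnorm_L2: "hnorm (L2 M) f = sqrt (LINT x|M. (cmod (f x))\<^sup>2)"
  by (metis hnorm_L2_sq hnorm_L2_nonneg real_sqrt_unique)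

lemma hnorm_sum_sq:
  assumes "semihilbert H" "semihilbert K" "x \<in> carrier H" "y \<in> carrier K"
  shows "(hnorm (hilbert_sum H K) (x, y))\<^sup>2 = (hnorm H x)\<^sup>2 + (hnorm K y)\<^sup>2"
  using assms semihilbert.inn_nonneg[OF assms(1,3)] semihilbert.inn_nonneg[OF assms(2,4)]
  by (simp add: hnorm_def hilbert_sum_simps)

lemma hnorm_Hsp_sq:
  assumes "f \<in> carrier (L2 (lebesgue_on \<Omega>))" "g \<in> carrier (L2 (lebesgue_on \<Omega>))"
  shows "(hnorm (Hsp \<Omega>) (f, g))\<^sup>2 = (hnorm (L2 (lebesgue_on \<Omega>)) f)\<^sup>2 + (hnorm (L2 (lebesgue_on \<Omega>)) g)\<^sup>2"
  by (intro hnorm_sum_sq semihilbert_L2 assms)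

lemma hnorm_Hsp_nonneg [simp]: "0 \<le> hnorm (Hsp \<Omega>) x"
  by (simp add: hnorm_def hilbert_sum_simps inn_L2_self)

lemma hnorm_Hsp_ge:
  assumes "f \<in> carrier (L2 (lebesgue_on \<Omega>))" "g \<in> carrier (L2 (lebesgue_on \<Omega>))"
  shows "hnorm (L2 (lebesgue_on \<Omega>)) f \<le> hnorm (Hsp \<Omega>) (f, g)"
    and "hnorm (L2 (lebesgue_on \<Omega>)) g \<le> hnorm (Hsp \<Omega>) (f, g)"
  by (rule power2_le_imp_le; simp add: hnorm_Hsp_sq[OF assms])+

lemma L2_Cauchy_Schwarz:
  "f \<in> carrier (L2 M) \<Longrightarrow> g \<in> carrier (L2 M) \<Longrightarrow> cmod (LINT x|M. f x * cnj (g x)) \<le> hnorm (L2 M) f * hnorm (L2 M) g"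
  using semihilbert.Cauchy_Schwarz[OF semihilbert_L2, of f M g] by (simp add: L2_simps)

lemma L2_triangle:
  "f \<in> carrier (L2 M) \<Longrightarrow> g \<in> carrier (L2 M) \<Longrightarrow> hnorm (L2 M) (\<lambda>x. f x + g x) \<le> hnorm (L2 M) f + hnorm (L2 M) g"
  using semihilbert.triangle[OF semihilbert_L2, of f M g 1] by (simp add: L2_simps)

lemma hnorm_L2_mono:
  assumes "g \<in> carrier (L2 M)" "f \<in> borel_measurable M" "AE x in M. cmod (f x) \<le> C * cmod (g x)" "0 \<le> C"
  shows "hnorm (L2 M) f \<le> C * hnorm (L2 M) g"
proof (rule power2_le_imp_le)
  have f: "f \<in> carrier (L2 M)" by (rule L2_dominated[OF assms(1-3)])
  have "(LINT x|M. (cmod (f x))\<^sup>2) \<le> (LINT x|M. C\<^sup>2 * (cmod (g x))\<^sup>2)"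
  proof (rule integral_mono_AE)
    show "AE x in M. (cmod (f x))\<^sup>2 \<le> C\<^sup>2 * (cmod (g x))\<^sup>2"
      using assms(3)
    proof eventually_elim
      case (elim x)
      then have "(cmod (f x))\<^sup>2 \<le> (C * cmod (g x))\<^sup>2" by (intro power_mono) auto
      then show ?case by (simp add: power_mult_distrib)
    qed
  qed (use f assms(1) in \<open>auto intro: L2_integrable\<close>)
  then show "(hnorm (L2 M) f)\<^sup>2 \<le> (C * hnorm (L2 M) g)\<^sup>2"
    by (simp add: power_mult_distrib hnorm_L2_sq)
qed (use assms in auto)

lemma hnorm_L2_cong_AE:
  assumes "f \<in> borel_measurable M" "g \<in> borel_measurable M" "AE x in M. f x = g x"
  shows "hnorm (L2 M) f = hnorm (L2 M) g"
  unfolding hnorm_L2 using assms by (auto intro!: integral_cong_AE)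

lemma hnorm_L2_eq_0:
  assumes "f \<in> carrier (L2 M)"
  shows "hnorm (L2 M) f = 0 \<longleftrightarrow> (AE x in M. f x = 0)"
  using integral_nonneg_eq_0_iff_AE[OF L2_integrable[OF assms]] by (simp add: hnorm_L2)

text \<open>Since \<open>2 |d| \<le> \<rho> + |d|\<^sup>2 / \<rho>\<close>, the differences of a sequence with geometrically decaying
  increments are almost everywhere summable.\<close>

lemma L2_complete:
  fixes u :: "nat \<Rightarrow> 'a \<Rightarrow> complex"
  assumes u: "\<And>k. u k \<in> carrier (L2 M)"
    and geo: "\<And>k. hnorm (L2 M) (\<lambda>x. u (Suc k) x - u k x) \<le> K * (1/2) ^ k"
  shows "\<exists>v\<in>carrier (L2 M). (\<lambda>k. hnorm (L2 M) (\<lambda>x. v x - u k x)) \<longlonglongrightarrow> 0"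
proof -
  define d where "d k x = cmod (u (Suc k) x - u k x)" for k x
  have dL: "(\<lambda>x. u (Suc k) x - u k x) \<in> carrier (L2 M)" for k using u by (intro L2_diff)
  have K: "0 \<le> K" using order_trans[OF hnorm_L2_nonneg geo[of 0]] by simp
  have intd: "integrable M (\<lambda>x. 2 ^ k * (d k x)\<^sup>2)" for k
    unfolding d_def by (intro integrable_mult_right L2_integrable dL)
  have bnd: "(\<integral>x. 2 ^ k * (d k x)\<^sup>2 \<partial>M) \<le> K\<^sup>2 * (1/2) ^ k" for k
  proof -
    have "(\<integral>x. 2 ^ k * (d k x)\<^sup>2 \<partial>M) = 2 ^ k * (hnorm (L2 M) (\<lambda>x. u (Suc k) x - u k x))\<^sup>2"
      unfolding hnorm_L2_sq d_def by simp
    also have "\<dots> \<le> 2 ^ k * (K * (1/2) ^ k)\<^sup>2"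
      by (intro mult_left_mono power_mono geo) auto
    also have "\<dots> = K\<^sup>2 * (1/2) ^ k"
      by (simp add: power_mult_distrib power2_eq_square field_simps)
    finally show ?thesis .
  qed
  \<comment> \<open>The weights 2^k are beaten by the squared norms of the increments, which are of
    order 4^(-k); so the weighted series has a finite integral and converges almost
    everywhere.\<close>
  have sm: "AE x in M. summable (\<lambda>k. norm (2 ^ k * (d k x)\<^sup>2))"
  proof -
    have "(\<integral>\<^sup>+x. (\<Sum>k. ennreal (2 ^ k * (d k x)\<^sup>2)) \<partial>M) = (\<Sum>k. \<integral>\<^sup>+x. ennreal (2 ^ k * (d k x)\<^sup>2) \<partial>M)"
      using intd by (intro nn_integral_suminf) auto
    also have "\<dots> \<le> (\<Sum>k. ennreal (K\<^sup>2 * (1/2) ^ k))"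
      by (intro suminf_le summableI) (use bnd intd in \<open>simp add: nn_integral_eq_integral ennreal_leI\<close>)
    also have "\<dots> = ennreal (\<Sum>k. K\<^sup>2 * (1/2) ^ k)"
      by (intro suminf_ennreal2) (auto intro: summable_mult)
    finally have fin: "(\<integral>\<^sup>+x. (\<Sum>k. ennreal (2 ^ k * (d k x)\<^sup>2)) \<partial>M) \<noteq> \<infinity>"
      by (auto simp: top_unique)
    have "AE x in M. (\<Sum>k. ennreal (2 ^ k * (d k x)\<^sup>2)) \<noteq> \<infinity>"
      using intd by (intro nn_integral_PInf_AE[OF _ fin]) auto
    then show ?thesis
    proof eventually_elim
      case (elim x)
      then have "summable (\<lambda>k. 2 ^ k * (d k x)\<^sup>2)"
        by (intro summable_suminf_not_top) auto
      then show ?case by (simp add: abs_mult)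
    qed
  qed
  have conv: "AE x in M. convergent (\<lambda>k. u k x)"
    using sm
  proof eventually_elim
    case (elim x)
    have "summable (\<lambda>k. (1/2::real) ^ k + 2 ^ k * (d k x)\<^sup>2)"
      using elim by (intro summable_add) (auto simp: abs_mult)
    then have "summable (\<lambda>k. u (Suc k) x - u k x)"
    proof (rule summable_comparison_test')
      fix k
      have "2 * (sqrt ((1/2) ^ k) * (sqrt (2 ^ k) * d k x)) \<le> (sqrt ((1/2) ^ k))\<^sup>2 + (sqrt (2 ^ k) * d k x)\<^sup>2"
        using sum_squares_bound[of "sqrt ((1/2) ^ k)" "sqrt (2 ^ k) * d k x"] by (simp add: mult.assoc)
      moreover have "sqrt ((1/2) ^ k) * sqrt (2 ^ k) = 1"
        by (simp flip: real_sqrt_mult power_mult_distrib)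
      then have "sqrt ((1/2) ^ k) * (sqrt (2 ^ k) * d k x) = d k x" by (metis mult.assoc mult_1)
      ultimately have "2 * d k x \<le> (1/2) ^ k + 2 ^ k * (d k x)\<^sup>2" by (simp add: power_mult_distrib)
      moreover have "0 \<le> d k x" by (simp add: d_def)
      ultimately show "norm (u (Suc k) x - u k x) \<le> (1/2) ^ k + 2 ^ k * (d k x)\<^sup>2"
        unfolding d_def[symmetric] by simp
    qed
    then have "(\<lambda>k. (\<Sum>i<k. u (Suc i) x - u i x) + u 0 x) \<longlonglongrightarrow> (\<Sum>i. u (Suc i) x - u i x) + u 0 x"
      by (intro tendsto_intros summable_LIMSEQ)
    then show ?case
      unfolding sum_lessThan_telescope[of "\<lambda>k. u k x"] by (auto simp: convergent_def)
  qed
  define v where "v x = lim (\<lambda>k. u k x)" for x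
  have vm: "v \<in> borel_measurable M" unfolding v_def using u by (intro borel_measurable_lim_metric L2_measurable)
  have lim: "AE x in M. (\<lambda>k. u k x) \<longlonglongrightarrow> v x"
    using conv by eventually_elim (auto simp: v_def convergent_LIMSEQ_iff)
  have tele: "hnorm (L2 M) (\<lambda>x. u (k + j) x - u k x) \<le> 2 * K * (1/2) ^ k * (1 - (1/2) ^ j)" for k j
  proof (induction j)
    case (Suc j)
    have "hnorm (L2 M) (\<lambda>x. (u (k + j) x - u k x) + (u (Suc (k + j)) x - u (k + j) x))
        \<le> hnorm (L2 M) (\<lambda>x. u (k + j) x - u k x) + hnorm (L2 M) (\<lambda>x. u (Suc (k + j)) x - u (k + j) x)"
      using u by (intro L2_triangle L2_diff)
    also have "\<dots> \<le> 2 * K * (1/2) ^ k * (1 - (1/2) ^ j) + K * (1/2) ^ (k + j)"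
      by (intro add_mono Suc geo)
    also have "\<dots> = 2 * K * (1/2) ^ k * (1 - (1/2) ^ Suc j)"
      by (simp add: power_add field_simps)
    finally show ?case by (simp add: algebra_simps)
  qed (simp add: hnorm_L2)
  \<comment> \<open>Fatou's lemma for j tending to infinity with k fixed. The limit is not yet known
    to be square integrable, hence the integrals of nonnegative functions.\<close>
  have bound: "(\<integral>\<^sup>+x. ennreal ((cmod (v x - u k x))\<^sup>2) \<partial>M) \<le> ennreal ((2 * K * (1/2) ^ k)\<^sup>2)" for k
  proof -
    have "(\<integral>\<^sup>+x. ennreal ((cmod (v x - u k x))\<^sup>2) \<partial>M)
        = (\<integral>\<^sup>+x. liminf (\<lambda>j. ennreal ((cmod (u (k + j) x - u k x))\<^sup>2)) \<partial>M)"
    proof (rule nn_integral_cong_AE)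
      show "AE x in M. ennreal ((cmod (v x - u k x))\<^sup>2) = liminf (\<lambda>j. ennreal ((cmod (u (k + j) x - u k x))\<^sup>2))"
        using lim
      proof eventually_elim
        case (elim x)
        have "(\<lambda>j. u (k + j) x) \<longlonglongrightarrow> v x"
          using LIMSEQ_ignore_initial_segment[OF elim, of k] by (simp add: add.commute)
        then have "(\<lambda>j. ennreal ((cmod (u (k + j) x - u k x))\<^sup>2)) \<longlonglongrightarrow> ennreal ((cmod (v x - u k x))\<^sup>2)"
          by (intro tendsto_intros)
        then show ?case by (intro lim_imp_Liminf[symmetric]) auto
      qed
    qed
    also have "\<dots> \<le> liminf (\<lambda>j. \<integral>\<^sup>+x. ennreal ((cmod (u (k + j) x - u k x))\<^sup>2) \<partial>M)"
      using u[THEN L2_measurable] by (intro nn_integral_liminf) measurable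
    also have "\<dots> \<le> ennreal ((2 * K * (1/2) ^ k)\<^sup>2)"
    proof (rule order_trans[OF Liminf_le_Limsup Limsup_bounded[OF always_eventually[OF allI]]])
      fix j
      have "(\<integral>\<^sup>+x. ennreal ((cmod (u (k + j) x - u k x))\<^sup>2) \<partial>M) = ennreal ((hnorm (L2 M) (\<lambda>x. u (k + j) x - u k x))\<^sup>2)"
        unfolding hnorm_L2_sq using u by (intro nn_integral_eq_integral L2_integrable L2_diff) auto
      also have "\<dots> \<le> ennreal ((2 * K * (1/2) ^ k)\<^sup>2)"
      proof (intro ennreal_leI power_mono)
        have "2 * K * (1/2) ^ k * (1 - (1/2) ^ j) \<le> 2 * K * (1/2) ^ k * 1"
          using K by (intro mult_left_mono) auto
        then show "hnorm (L2 M) (\<lambda>x. u (k + j) x - u k x) \<le> 2 * K * (1/2) ^ k" using tele[of k j] by simp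
      qed simp
      finally show "(\<integral>\<^sup>+x. ennreal ((cmod (u (k + j) x - u k x))\<^sup>2) \<partial>M) \<le> ennreal ((2 * K * (1/2) ^ k)\<^sup>2)" .
    qed simp
    finally show ?thesis .
  qed
  have diffL: "(\<lambda>x. v x - u k x) \<in> carrier (L2 M)" for k
    unfolding carrier_L2
  proof
    show m: "(\<lambda>x. v x - u k x) \<in> borel_measurable M" by (rule borel_measurable_diff[OF vm L2_measurable[OF u]])
    show "integrable M (\<lambda>x. (cmod (v x - u k x))\<^sup>2)"
      using m by (intro integrableI_nonneg le_less_trans[OF bound[of k]]) auto
  qed
  have "v \<in> carrier (L2 M)" using L2_add[OF diffL u, of 0 0] by simp
  moreover have "(\<lambda>k. hnorm (L2 M) (\<lambda>x. v x - u k x)) \<longlonglongrightarrow> 0"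
  proof (rule tendsto_sandwich[OF always_eventually always_eventually, where f="\<lambda>_. 0"])
    show "\<forall>k. hnorm (L2 M) (\<lambda>x. v x - u k x) \<le> 2 * K * (1/2) ^ k"
    proof
      fix k
      have "ennreal ((hnorm (L2 M) (\<lambda>x. v x - u k x))\<^sup>2) \<le> ennreal ((2 * K * (1/2) ^ k)\<^sup>2)"
        using bound[of k] diffL unfolding hnorm_L2_sq
        by (subst nn_integral_eq_integral[symmetric]) (simp_all add: L2_integrable)
      then have "(hnorm (L2 M) (\<lambda>x. v x - u k x))\<^sup>2 \<le> (2 * K * (1/2) ^ k)\<^sup>2"
        by (meson ennreal_le_iff zero_le_power2)
      then show "hnorm (L2 M) (\<lambda>x. v x - u k x) \<le> 2 * K * (1/2) ^ k"
        by (rule power2_le_imp_le) (use K in simp)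
    qed
    have "(\<lambda>k. 2 * K * (1/2::real) ^ k) \<longlonglongrightarrow> 2 * K * 0" by (intro tendsto_intros LIMSEQ_realpow_zero) auto
    then show "(\<lambda>k. 2 * K * (1/2::real) ^ k) \<longlonglongrightarrow> 0" by simp
  qed auto
  ultimately show ?thesis by blast
qed

lemma Hsp_complete:
  fixes u :: "nat \<Rightarrow> fun2"
  assumes u: "\<And>k. u k \<in> carrier (Hsp \<Omega>)"
    and geo: "\<And>k. hnorm (Hsp \<Omega>) (add (Hsp \<Omega>) (u (Suc k)) (scale (Hsp \<Omega>) (-1) (u k))) \<le> K * (1/2) ^ k"
  shows "\<exists>v\<in>carrier (Hsp \<Omega>). (\<lambda>k. hnorm (Hsp \<Omega>) (add (Hsp \<Omega>) v (scale (Hsp \<Omega>) (-1) (u k)))) \<longlonglongrightarrow> 0"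
proof -
  let ?L = "L2 (lebesgue_on \<Omega>)"
  have uc: "fst (u k) \<in> carrier ?L" "snd (u k) \<in> carrier ?L" for k
    using u[of k] unfolding hilbert_sum_simps mem_Times_iff by simp_all
  have e: "add (Hsp \<Omega>) v (scale (Hsp \<Omega>) (-1) (u k)) = (\<lambda>x. fst v x - fst (u k) x, \<lambda>x. snd v x - snd (u k) x)" for v k
    unfolding hilbert_sum_simps L2_simps by simp
  have *: "hnorm ?L (\<lambda>x. fst (u (Suc k)) x - fst (u k) x) \<le> K * (1/2) ^ k"
          "hnorm ?L (\<lambda>x. snd (u (Suc k)) x - snd (u k) x) \<le> K * (1/2) ^ k" for k
  proof -
    let ?n = "hnorm (Hsp \<Omega>) (add (Hsp \<Omega>) (u (Suc k)) (scale (Hsp \<Omega>) (-1) (u k)))"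
    have "hnorm ?L (\<lambda>x. fst (u (Suc k)) x - fst (u k) x) \<le> ?n" "hnorm ?L (\<lambda>x. snd (u (Suc k)) x - snd (u k) x) \<le> ?n"
      unfolding e by (rule hnorm_Hsp_ge[OF L2_diff[OF uc(1) uc(1)] L2_diff[OF uc(2) uc(2)]])+
    with geo[of k] show "hnorm ?L (\<lambda>x. fst (u (Suc k)) x - fst (u k) x) \<le> K * (1/2) ^ k"
          "hnorm ?L (\<lambda>x. snd (u (Suc k)) x - snd (u k) x) \<le> K * (1/2) ^ k" by (meson order_trans)+
  qed
  obtain v where v: "v \<in> carrier ?L" "(\<lambda>k. hnorm ?L (\<lambda>x. v x - fst (u k) x)) \<longlonglongrightarrow> 0"
    using L2_complete[OF uc(1) *(1)] by blast
  obtain w where w: "w \<in> carrier ?L" "(\<lambda>k. hnorm ?L (\<lambda>x. w x - snd (u k) x)) \<longlonglongrightarrow> 0"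
    using L2_complete[OF uc(2) *(2)] by blast
  let ?s = "\<lambda>k. sqrt ((hnorm ?L (\<lambda>x. v x - fst (u k) x))\<^sup>2 + (hnorm ?L (\<lambda>x. w x - snd (u k) x))\<^sup>2)"
  have eq: "hnorm (Hsp \<Omega>) (add (Hsp \<Omega>) (v, w) (scale (Hsp \<Omega>) (-1) (u k))) = ?s k" for k
    unfolding e fst_conv snd_conv
    using hnorm_Hsp_sq[OF L2_diff[OF v(1) uc(1)] L2_diff[OF w(1) uc(2)]]
    by (rule real_sqrt_unique[OF _ hnorm_Hsp_nonneg, symmetric])
  have "?s \<longlonglongrightarrow> sqrt (0\<^sup>2 + 0\<^sup>2)"
    by (intro tendsto_intros v(2) w(2))
  then have "(\<lambda>k. hnorm (Hsp \<Omega>) (add (Hsp \<Omega>) (v, w) (scale (Hsp \<Omega>) (-1) (u k)))) \<longlonglongrightarrow> 0"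
    unfolding eq by (simp only: power_zero_numeral add_0 real_sqrt_zero)
  moreover have "(v, w) \<in> carrier (Hsp \<Omega>)" using v(1) w(1) unfolding hilbert_sum_simps by simp
  ultimately show ?thesis by (rule bexI)
qed

section \<open>Locally absolutely continuous functions\<close>

text \<open>\<open>prim F f\<close>: \<open>F\<close> is locally absolutely continuous on the real line with derivative \<open>f\<close>.\<close>

definition prim :: "(real \<Rightarrow> complex) \<Rightarrow> (real \<Rightarrow> complex) \<Rightarrow> bool" where
  "prim F f \<longleftrightarrow> (\<forall>a b. a \<le> b \<longrightarrow> f absolutely_integrable_on {a..b} \<and> F b - F a = integral {a..b} f)"

lemma primD:
  assumes "prim F f" "a \<le> b"
  shows "f absolutely_integrable_on {a..b}" "integral {a..b} f = F b - F a" "f integrable_on {a..b}"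
  using assms by (auto simp: prim_def set_lebesgue_integral_eq_integral(1))

lemma prim_continuous:
  assumes "prim F f" shows "continuous_on S F"
proof -
  have "isCont F x" for x
  proof -
    have "continuous_on {x-1..x+1} (\<lambda>y. F (x-1) + integral {x-1..y} f)"
      by (intro continuous_intros indefinite_integral_continuous_1 primD(3)[OF assms]) simp
    moreover have "F (x-1) + integral {x-1..y} f = F y" if "y \<in> {x-1..x+1}" for y
      using primD(2)[OF assms, of "x-1" y] that by simp
    ultimately have "continuous_on {x-1..x+1} F" using continuous_on_eq by blast
    then show ?thesis by (rule continuous_on_interior) (simp add: interior_atLeastAtMost_real)
  qed
  then show ?thesis by (auto intro: continuous_at_imp_continuous_on)
qed

lemma prim_of_deriv:
  assumes "\<And>x. (F has_vector_derivative f x) (at x)" "continuous_on UNIV f"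
  shows "prim F f"
  unfolding prim_def
proof (intro allI impI conjI)
  fix a b :: real assume "a \<le> b"
  show "f absolutely_integrable_on {a..b}"
    using assms(2) by (intro absolutely_integrable_continuous_real) (auto intro: continuous_on_subset)
  have "(f has_integral F b - F a) {a..b}"
    using \<open>a \<le> b\<close> assms(1) by (intro fundamental_theorem_of_calculus) (auto intro: has_vector_derivative_at_within)
  then show "F b - F a = integral {a..b} f" by (simp add: integral_unique)
qed

lemma prim_deriv:
  assumes "prim F f" "continuous_on UNIV f"
  shows "(F has_vector_derivative f x) (at x)"
proof -
  have "((\<lambda>u. integral {x-1..u} f) has_vector_derivative f x) (at x within {x-1..x+1})"
    using assms(2) by (intro integral_has_vector_derivative) (auto intro: continuous_on_subset)
  then have "((\<lambda>u. F (x-1) + integral {x-1..u} f) has_vector_derivative 0 + f x) (at x within {x-1..x+1})"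
    by (intro derivative_intros)
  moreover have "F (x-1) + integral {x-1..u} f = F u" if "u \<in> {x-1..x+1}" for u
    using primD(2)[OF assms(1), of "x-1" u] that by simp
  ultimately have "(F has_vector_derivative f x) (at x within {x-1..x+1})"
    by (auto intro: has_vector_derivative_transform[rotated -1])
  moreover have "at x within {x-1..x+1} = at x" by (rule at_within_interior) (simp add: interior_atLeastAtMost_real)
  ultimately show ?thesis by simp
qed

lemma prim_const: "prim (\<lambda>x. c) (\<lambda>x. 0)"
  by (simp add: prim_def)

lemma prim_add:
  assumes "prim F f" "prim G g" shows "prim (\<lambda>x. F x + G x) (\<lambda>x. f x + g x)"
  unfolding prim_def
  using primD[OF assms(1)] primD[OF assms(2)] by (auto simp: integral_add intro: set_integral_add)

lemma prim_cmult:
  assumes "prim F f" shows "prim (\<lambda>x. c * F x) (\<lambda>x. c * f x)"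
  unfolding prim_def
proof (intro allI impI conjI)
  fix a b :: real assume "a \<le> b"
  then show "(\<lambda>x. c * f x) absolutely_integrable_on {a..b}"
    using primD(1)[OF assms] by auto
  show "c * F b - c * F a = integral {a..b} (\<lambda>x. c * f x)"
    using primD(2)[OF assms \<open>a \<le> b\<close>] by (simp add: right_diff_distrib)
qed

lemma prim_cnj:
  assumes "prim F f" shows "prim (\<lambda>x. cnj (F x)) (\<lambda>x. cnj (f x))"
  unfolding prim_def
proof (intro allI impI conjI)
  fix a b :: real assume "a \<le> b"
  then show "(\<lambda>x. cnj (f x)) absolutely_integrable_on {a..b}"
    using absolutely_integrable_linear[OF primD(1)[OF assms] bounded_linear_cnj] by (simp add: o_def)
  show "cnj (F b) - cnj (F a) = integral {a..b} (\<lambda>x. cnj (f x))"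
    using primD(2)[OF assms \<open>a \<le> b\<close>] by (simp flip: integral_cnj)
qed

lemma AE_negligibleE:
  assumes "AE x in lebesgue. P x"
  obtains N where "negligible N" "\<And>x. x \<notin> N \<Longrightarrow> P x"
  using assms unfolding eventually_ae_filter_negligible by blast

lemma prim_exists:
  assumes "\<And>a b. f absolutely_integrable_on {a..b}"
  shows "\<exists>F. prim F f \<and> F c = z"
proof (intro exI conjI)
  let ?F = "\<lambda>x. z + (if c \<le> x then integral {c..x} f else - integral {x..c} f)"
  have int: "f integrable_on {a..b}" for a b using assms by (simp add: set_lebesgue_integral_eq_integral(1))
  have comb: "integral {a..m} f + integral {m..b} f = integral {a..b} f" if "a \<le> m" "m \<le> b" for a m b
    using that int by (intro Henstock_Kurzweil_Integration.integral_combine)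
  show "prim ?F f"
    unfolding prim_def
  proof (intro allI impI conjI)
    fix a b :: real assume ab: "a \<le> b"
    consider "c \<le> a" | "a < c" "c \<le> b" | "b < c" by linarith
    then show "?F b - ?F a = integral {a..b} f"
    proof cases
      case 1 then show ?thesis using comb[of c a b] ab by (simp add: algebra_simps)
    next
      case 2 then show ?thesis using comb[of a c b] by (simp add: algebra_simps)
    next
      case 3 then show ?thesis using comb[of a b c] ab by (simp add: algebra_simps)
    qed
  qed (rule assms)
qed simp

text \<open>Integration by parts without differentiating almost everywhere. The defect of the
  formula is additive over adjacent intervals, and on each of them it is at most the oscillation of
  \<open>F\<close> and \<open>G\<close> times the integral of |f| + |g|; uniform continuity makes
  the oscillation as small as desired.\<close>

lemma prim_mult:
  assumes F: "prim F f" and G: "prim G g"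
  shows "prim (\<lambda>x. F x * G x) (\<lambda>x. f x * G x + F x * g x)"
  unfolding prim_def
proof (intro allI impI)
  fix a b :: real assume ab: "a \<le> b"
  let ?k = "\<lambda>x. f x * G x + F x * g x"
  have prod: "(\<lambda>t. p t * q t) absolutely_integrable_on {x..y}"
    if "continuous_on UNIV p" "q absolutely_integrable_on {x..y}" for p q :: "real \<Rightarrow> complex" and x y
  proof (rule absolutely_integrable_bounded_measurable_product[OF
        bilinear_conv_bounded_bilinear[THEN iffD2, OF bounded_bilinear_mult] _ _ _ that(2)])
    have c: "continuous_on {x..y} p" using that(1) by (rule continuous_on_subset) simp
    then show "p \<in> borel_measurable (lebesgue_on {x..y})"
      by (intro continuous_imp_measurable_on_sets_lebesgue) auto
    show "bounded (p ` {x..y})" using c by (intro compact_imp_bounded compact_continuous_image) auto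
  qed auto
  have cF: "continuous_on UNIV F" and cG: "continuous_on UNIV G" using prim_continuous F G by auto
  have i1: "(\<lambda>t. f t * p t) absolutely_integrable_on {x..y}" if "continuous_on UNIV p" "x \<le> y" for p x y
    using prod[OF that(1) primD(1)[OF F that(2)]] by (simp add: mult.commute)
  have i2: "(\<lambda>t. p t * g t) absolutely_integrable_on {x..y}" if "continuous_on UNIV p" "x \<le> y" for p x y
    using prod[OF that(1) primD(1)[OF G that(2)]] .
  have k: "?k absolutely_integrable_on {x..y}" if "x \<le> y" for x y
    by (intro set_integral_add i1 i2 cF cG that)
  let ?n = "\<lambda>t. cmod (f t) + cmod (g t)"
  have n: "?n absolutely_integrable_on {x..y}" if "x \<le> y" for x y
    by (intro set_integral_add absolutely_integrable_norm[unfolded o_def] primD(1)[OF F that] primD(1)[OF G that])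
  let ?D = "\<lambda>x y. F y * G y - F x * G x - integral {x..y} ?k"
  have D_bound: "cmod (?D x y) \<le> w * integral {x..y} ?n"
    if xy: "x \<le> y" and w: "\<And>s t. s \<in> {x..y} \<Longrightarrow> t \<in> {x..y} \<Longrightarrow> cmod (F s - F t) \<le> w \<and> cmod (G s - G t) \<le> w" for x y w
  proof -
    have c1: "continuous_on UNIV (\<lambda>t. G y - G t)" "continuous_on UNIV (\<lambda>t. F x - F t)"
      by (intro continuous_intros cF cG)+
    \<comment> \<open>Splitting the increment of the product as (F y - F x) G y + F x (G y - G x)
      exhibits the defect as an integral in which f and g are multiplied only by increments of G and
      F.\<close>
    let ?h = "\<lambda>t. f t * (G y - G t) + (F x - F t) * g t"
    have h: "?h absolutely_integrable_on {x..y}" by (intro set_integral_add i1 i2 c1 xy)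
    have "integral {x..y} ?h = integral {x..y} (\<lambda>t. f t * G y + F x * g t - ?k t)"
      by (intro integral_cong) (simp add: algebra_simps)
    also have "\<dots> = integral {x..y} (\<lambda>t. f t * G y + F x * g t) - integral {x..y} ?k"
      by (rule integral_diff[OF integrable_add[OF integrable_on_mult_left integrable_on_mult_right]
            set_lebesgue_integral_eq_integral(1)[OF k[OF xy]]]) (rule primD(3)[OF F xy] primD(3)[OF G xy])+
    also have "integral {x..y} (\<lambda>t. f t * G y + F x * g t) = (F y - F x) * G y + F x * (G y - G x)"
      using primD(2,3)[OF F xy] primD(2,3)[OF G xy]
      by (subst integral_add) (auto intro: integrable_on_mult_left integrable_on_mult_right)
    finally have "?D x y = integral {x..y} ?h" by (simp add: algebra_simps)
    also have "cmod \<dots> \<le> integral {x..y} (\<lambda>t. w * ?n t)"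
    proof (rule integral_norm_bound_integral)
      show "?h integrable_on {x..y}" using h by (simp add: set_lebesgue_integral_eq_integral(1))
      show "(\<lambda>t. w * ?n t) integrable_on {x..y}"
        using n[OF xy] by (intro integrable_on_mult_right) (auto simp: set_lebesgue_integral_eq_integral(1))
      fix t assume t: "t \<in> {x..y}"
      have "cmod (?h t) \<le> cmod (f t) * cmod (G y - G t) + cmod (F x - F t) * cmod (g t)"
        by (metis norm_triangle_ineq norm_mult)
      also have "\<dots> \<le> cmod (f t) * w + w * cmod (g t)"
        using w[of y t] w[of x t] t xy by (intro add_mono mult_left_mono mult_right_mono) auto
      finally show "cmod (?h t) \<le> w * ?n t" by (simp add: algebra_simps)
    qed
    finally show ?thesis by simp
  qed
  have D_split: "?D x z = ?D x y + ?D y z" if "x \<le> y" "y \<le> z" for x y z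
  proof -
    have "integral {x..z} ?k = integral {x..y} ?k + integral {y..z} ?k"
      using that k[of x z]
      by (intro Henstock_Kurzweil_Integration.integral_combine[symmetric])
         (auto intro: set_lebesgue_integral_eq_integral(1))
    then show ?thesis by simp
  qed
  have n_split: "integral {x..z} ?n = integral {x..y} ?n + integral {y..z} ?n" if "x \<le> y" "y \<le> z" for x y z
    using that n[of x z]
    by (intro Henstock_Kurzweil_Integration.integral_combine[symmetric])
       (auto intro: set_lebesgue_integral_eq_integral(1))
  have small: "cmod (?D a b) \<le> w * integral {a..b} ?n" if w: "w > 0" for w
  proof -
    have "uniformly_continuous_on {a..b} F" "uniformly_continuous_on {a..b} G"
      using cF cG by (auto intro!: compact_uniformly_continuous intro: continuous_on_subset)
    then obtain d1 d2 where d: "d1 > 0" "d2 > 0"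
      "\<And>s t. s \<in> {a..b} \<Longrightarrow> t \<in> {a..b} \<Longrightarrow> dist s t < d1 \<Longrightarrow> dist (F s) (F t) < w"
      "\<And>s t. s \<in> {a..b} \<Longrightarrow> t \<in> {a..b} \<Longrightarrow> dist s t < d2 \<Longrightarrow> dist (G s) (G t) < w"
      unfolding uniformly_continuous_on_def using w by metis
    define d where "d = min d1 d2 / 2"
    have d0: "d > 0" using d by (simp add: d_def)
    have osc: "cmod (F s - F t) \<le> w \<and> cmod (G s - G t) \<le> w"
      if "s \<in> {x..y}" "t \<in> {x..y}" "a \<le> x" "y \<le> b" "y - x \<le> d" for x y s t
    proof -
      have "dist s t \<le> d" using that by (auto simp: dist_real_def)
      then have "dist s t < d1" "dist s t < d2" using d(1,2) by (auto simp: d_def)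
      then show ?thesis using d(3,4)[of s t] that by (auto simp: dist_norm less_imp_le)
    qed
    \<comment> \<open>Induction on the number of steps of length \<open>d\<close> from a to y. Since
      \<open>d\<close> is half the modulus of uniform continuity, closed intervals of this length
      still satisfy the strict estimates.\<close>
    have "cmod (?D a y) \<le> w * integral {a..y} ?n" if "a \<le> y" "y \<le> b" "y - a \<le> real m * d" for m y
      using that
    proof (induction m arbitrary: y)
      case 0
      then have "y = a" by simp
      then show ?case by simp
    next
      case (Suc m)
      show ?case
      proof (cases "y - a \<le> d")
        case True
        then show ?thesis using Suc.prems by (intro D_bound osc[of _ a y]) auto
      next
        case False
        let ?x = "y - d"
        have x: "a \<le> ?x" "?x \<le> y" "?x \<le> b" "?x - a \<le> real m * d"
          using False d0 Suc.prems by (auto simp: algebra_simps)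
        have "cmod (?D ?x y) \<le> w * integral {?x..y} ?n"
          using x Suc.prems by (intro D_bound osc[of _ ?x y]) auto
        moreover have "cmod (?D a ?x) \<le> w * integral {a..?x} ?n" using x by (intro Suc.IH) auto
        ultimately have "cmod (?D a ?x + ?D ?x y) \<le> w * integral {a..?x} ?n + w * integral {?x..y} ?n"
          by (intro norm_triangle_mono)
        then show ?thesis unfolding D_split[OF x(1,2)] n_split[OF x(1,2)] by (simp add: algebra_simps)
      qed
    qed
    moreover obtain m where "(b - a) / d \<le> real m" using real_arch_simple by blast
    then have "b - a \<le> real m * d" using d0 by (simp add: field_simps)
    ultimately show ?thesis using ab by blast
  qed
  have "cmod (?D a b) \<le> 0"
  proof (rule field_le_epsilon)
    fix e :: real assume e: "0 < e"
    let ?I = "integral {a..b} ?n"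
    have I: "0 \<le> ?I" by (rule integral_nonneg) (use n[OF ab] in \<open>auto simp: set_lebesgue_integral_eq_integral(1)\<close>)
    have "cmod (?D a b) \<le> e / (?I + 1) * ?I" using e I by (intro small) simp
    also have "\<dots> \<le> e" using e I by (simp add: field_simps)
    finally show "cmod (?D a b) \<le> 0 + e" by simp
  qed
  then show "?k absolutely_integrable_on {a..b} \<and> F b * G b - F a * G a = integral {a..b} ?k"
    using k[OF ab] by simp
qed

lemma absolutely_integrable_on_restrict:
  fixes f :: "real \<Rightarrow> complex"
  assumes "S \<in> sets lebesgue" "f absolutely_integrable_on {a..b}"
  shows "(\<lambda>x. if x \<in> S then f x else 0) absolutely_integrable_on {a..b}"
proof -
  have "set_integrable lebesgue (S \<inter> {a..b}) f"
    using assms by (intro set_integrable_subset[OF assms(2)]) auto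
  moreover have "indicat_real {a..b} x *\<^sub>R (if x \<in> S then f x else 0) = indicat_real (S \<inter> {a..b}) x *\<^sub>R f x" for x
    by (auto simp: indicator_def)
  ultimately show ?thesis by (simp add: set_integrable_def)
qed

text \<open>The zeros at both ends prevent jumps. Applied to a function that has been cut off and to
  its derivative, this carries vectors from an interval to the line.\<close>

lemma prim_zero_extension:
  assumes "prim F f" "F a = 0" "F b = 0" "a \<le> b"
  shows "prim (\<lambda>x. if x \<in> {a<..<b} then F x else 0) (\<lambda>x. if x \<in> {a<..<b} then f x else 0)"
  unfolding prim_def
proof (intro allI impI conjI)
  fix x y :: real assume xy: "x \<le> y"
  show "(\<lambda>x. if x \<in> {a<..<b} then f x else 0) absolutely_integrable_on {x..y}"
    by (rule absolutely_integrable_on_restrict[OF _ primD(1)[OF assms(1) xy]]) simp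
  \<comment> \<open>\<open>c\<close> projects the line onto [a, b]. As \<open>F\<close> vanishes at
    both ends, \<open>F (c t)\<close> is the value of the extension at t.\<close>
  define c where "c t = max a (min b t)" for t
  have cc: "c x \<le> c y" using xy by (auto simp: c_def)
  have "integral {x..y} (\<lambda>t. if t \<in> {a<..<b} then f t else 0) = integral ({a<..<b} \<inter> {x..y}) f"
    by (rule integral_restrict_Int)
  also have "\<dots> = integral {c x..c y} f"
  proof (rule integral_spike_set)
    have "{t \<in> {a<..<b} \<inter> {x..y} - {c x..c y}. f t \<noteq> 0} \<subseteq> {a, b}" using xy by (auto simp: c_def)
    then show "negligible {t \<in> {a<..<b} \<inter> {x..y} - {c x..c y}. f t \<noteq> 0}"
      by (rule negligible_subset[rotated]) simp
    have "{t \<in> {c x..c y} - {a<..<b} \<inter> {x..y}. f t \<noteq> 0} \<subseteq> {a, b}" using xy assms(4) by (auto simp: c_def)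
    then show "negligible {t \<in> {c x..c y} - {a<..<b} \<inter> {x..y}. f t \<noteq> 0}"
      by (rule negligible_subset[rotated]) simp
  qed
  also have "\<dots> = F (c y) - F (c x)" using primD(2)[OF assms(1) cc] .
  also have "F (c t) = (if t \<in> {a<..<b} then F t else 0)" for t
    using assms(2-4) by (auto simp: c_def max_def min_def)
  ultimately show "(if y \<in> {a<..<b} then F y else 0) - (if x \<in> {a<..<b} then F x else 0)
      = integral {x..y} (\<lambda>t. if t \<in> {a<..<b} then f t else 0)" by simp
qed

subsection \<open>Test functions\<close>

text \<open>The polynomial in 1/x makes the class closed under differentiation, so that smoothness
  follows by induction. For \<open>p = 1\<close> and s tending to 0 the function tends to the
  indicator of the positive half-line.\<close>

definition expmol :: "real \<Rightarrow> real poly \<Rightarrow> real \<Rightarrow> real" where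
  "expmol s p x = (if x > 0 then poly p (1/x) * exp (- s / x) else 0)"

lemma poly_exp_tendsto_0:
  fixes p :: "real poly"
  assumes "s > 0"
  shows "((\<lambda>y. poly p y * exp (- s * y)) \<longlongrightarrow> 0) at_top"
proof -
  have "((\<lambda>y. y ^ k * exp (- s * y)) \<longlongrightarrow> 0) at_top" for k
  proof -
    have "((\<lambda>y. (s * y) ^ k / exp (s * y)) \<longlongrightarrow> 0) at_top"
      by (rule filterlim_compose[OF tendsto_power_div_exp_0])
         (use assms in \<open>auto intro!: filterlim_tendsto_pos_mult_at_top[OF tendsto_const] filterlim_ident\<close>)
    then have "((\<lambda>y. (1 / s ^ k) * ((s * y) ^ k / exp (s * y))) \<longlongrightarrow> (1 / s ^ k) * 0) at_top"
      by (intro tendsto_intros)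
    then show ?thesis using assms by (simp add: power_mult_distrib exp_minus field_simps)
  qed
  then have "((\<lambda>y. \<Sum>k\<le>degree p. coeff p k * (y ^ k * exp (- s * y))) \<longlongrightarrow> (\<Sum>k\<le>degree p. coeff p k * 0)) at_top"
    by (intro tendsto_intros)
  then show ?thesis by (simp add: poly_altdef sum_distrib_right mult.assoc)
qed

text \<open>With y = 1/x one has dy/dx = -y^2, which explains the factor \<open>[:0, 0, 1:]\<close>
  and the sign. At 0 the right difference quotient is y p(y) exp (-s y) with y tending to
  infinity.\<close>

lemma expmol_deriv:
  assumes s: "s > 0"
  shows "(expmol s p has_field_derivative expmol s ([:0, 0, 1:] * (smult s p - pderiv p)) x) (at x)"
proof -
  let ?q = "[:0, 0, 1:] * (smult s p - pderiv p)"
  consider "x > 0" | "x < 0" | "x = 0" by linarith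
  then show ?thesis
  proof cases
    case 1
    have "((\<lambda>x. poly p (1/x) * exp (- s / x)) has_field_derivative expmol s ?q x) (at x)"
      using 1 by (auto simp: expmol_def power2_eq_square field_simps intro!: derivative_eq_intros)
    moreover have "eventually (\<lambda>y. y > 0) (nhds x)" using 1 by (rule eventually_nhds_in_open[OF open_greaterThan, simplified])
    then have "eventually (\<lambda>y. expmol s p y = poly p (1/y) * exp (- s / y)) (nhds x)"
      by eventually_elim (simp add: expmol_def)
    ultimately show ?thesis by (simp add: DERIV_cong_ev)
  next
    case 2
    have "eventually (\<lambda>y. y < 0) (nhds x)" using 2 by (rule eventually_nhds_in_open[OF open_lessThan, simplified])
    then have "eventually (\<lambda>y. expmol s p y = 0) (nhds x)"
      by eventually_elim (simp add: expmol_def)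
    then have "(expmol s p has_field_derivative 0) (at x)" by (simp add: DERIV_cong_ev)
    then show ?thesis using 2 by (simp add: expmol_def)
  next
    case 3
    have "((\<lambda>h. poly (pCons 0 p) (inverse h) * exp (- s * inverse h)) \<longlongrightarrow> 0) (at_right 0)"
      by (rule filterlim_compose[OF poly_exp_tendsto_0[OF s] filterlim_inverse_at_top_right])
    then have "((\<lambda>h. expmol s p h / h) \<longlongrightarrow> 0) (at_right 0)"
      by (rule Lim_transform_eventually) (auto simp: eventually_at_filter expmol_def field_simps)
    moreover have "((\<lambda>h. expmol s p h / h) \<longlongrightarrow> 0) (at_left 0)"
      by (rule Lim_transform_eventually[OF tendsto_const]) (auto simp: eventually_at_filter expmol_def)
    ultimately have "((\<lambda>h. expmol s p h / h) \<longlongrightarrow> 0) (at 0)" by (intro filterlim_split_at)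
    then show ?thesis using 3 by (simp add: has_field_derivative_iff expmol_def)
  qed
qed

text \<open>The polynomials vary while s, a and b are fixed: every derivative of a bump on (a, b)
  stays in the family, so no formula for higher derivatives has to be found.\<close>

inductive_set bump_family :: "real \<Rightarrow> real \<Rightarrow> real \<Rightarrow> (real \<Rightarrow> real) set" for s a b where
  base: "(\<lambda>x. expmol s p (x - a) * expmol s q (b - x)) \<in> bump_family s a b"
| sum: "f \<in> bump_family s a b \<Longrightarrow> g \<in> bump_family s a b \<Longrightarrow> (\<lambda>x. f x + g x) \<in> bump_family s a b"

lemma bump_family_deriv:
  assumes "f \<in> bump_family s a b" "s > 0"
  shows "\<exists>f'\<in>bump_family s a b. \<forall>x. (f has_field_derivative f' x) (at x)"
  using assms(1)
proof induction
  case (base p q)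
  let ?p = "[:0, 0, 1:] * (smult s p - pderiv p)" and ?q = "[:0, 0, 1:] * (smult s q - pderiv q)"
  \<comment> \<open>The minus sign from the chain rule for b - x moves into the polynomial, so that
    sums suffice in the definition of the family.\<close>
  have neg: "- expmol s ?q y = expmol s (- ?q) y" for y
    by (cases "y > 0") (simp_all only: expmol_def poly_minus if_True if_False mult_minus_left minus_zero)
  show ?case
  proof (intro bexI allI)
    show "(\<lambda>x. expmol s ?p (x - a) * expmol s q (b - x) + expmol s p (x - a) * expmol s (- ?q) (b - x)) \<in> bump_family s a b"
      by (intro bump_family.intros)
    fix x
    have 1: "((\<lambda>x. expmol s p (x - a)) has_field_derivative expmol s ?p (x - a) * 1) (at x)"
      by (rule DERIV_chain2[OF expmol_deriv[OF assms(2)]]) (auto intro!: derivative_eq_intros)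
    have 2: "((\<lambda>x. expmol s q (b - x)) has_field_derivative expmol s ?q (b - x) * (-1)) (at x)"
      by (rule DERIV_chain2[OF expmol_deriv[OF assms(2)]]) (auto intro!: derivative_eq_intros)
    show "((\<lambda>x. expmol s p (x - a) * expmol s q (b - x)) has_field_derivative
        expmol s ?p (x - a) * expmol s q (b - x) + expmol s p (x - a) * expmol s (- ?q) (b - x)) (at x)"
      using DERIV_mult[OF 1 2] unfolding neg[symmetric] by (simp add: algebra_simps)
  qed
next
  case (sum f g)
  then obtain f' g' where "f' \<in> bump_family s a b" "g' \<in> bump_family s a b"
    "\<And>x. (f has_field_derivative f' x) (at x)" "\<And>x. (g has_field_derivative g' x) (at x)" by blast
  then show ?case
    by (intro bexI[of _ "\<lambda>x. f' x + g' x"] allI DERIV_add bump_family.sum) auto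
qed

definition smooth :: "(real \<Rightarrow> real) \<Rightarrow> bool" where
  "smooth \<phi> \<longleftrightarrow> (\<forall>j x. ((deriv ^^ j) \<phi>) field_differentiable (at x))"

lemma bump_family_smooth:
  assumes "f \<in> bump_family s a b" "s > 0" shows "smooth f"
proof -
  have "(deriv ^^ j) f \<in> bump_family s a b" for j
  proof (induction j)
    case (Suc j)
    then obtain f' where f': "f' \<in> bump_family s a b" "\<And>x. ((deriv ^^ j) f has_field_derivative f' x) (at x)"
      using bump_family_deriv[OF _ assms(2)] by blast
    then have "deriv ((deriv ^^ j) f) = f'" by (auto intro!: DERIV_imp_deriv)
    then show ?case using f' by simp
  qed (use assms in simp)
  then show ?thesis
    unfolding smooth_def field_differentiable_def using bump_family_deriv[OF _ assms(2)] by blast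
qed

lemma bump_family_zero: "f \<in> bump_family s a b \<Longrightarrow> x \<notin> {a<..<b} \<Longrightarrow> f x = 0"
  by (induction rule: bump_family.induct) (auto simp: expmol_def)

lemma smooth_DERIV: "smooth \<phi> \<Longrightarrow> (\<phi> has_field_derivative deriv \<phi> x) (at x)"
  unfolding smooth_def DERIV_deriv_iff_field_differentiable by (drule spec[of _ 0]) simp

lemma smooth_deriv: "smooth \<phi> \<Longrightarrow> smooth (deriv \<phi>)"
proof -
  assume "smooth \<phi>"
  then have "((deriv ^^ Suc j) \<phi>) field_differentiable (at x)" for j x unfolding smooth_def by blast
  then show "smooth (deriv \<phi>)" unfolding smooth_def by (simp add: funpow_swap1)
qed

lemma smooth_continuous: "smooth \<phi> \<Longrightarrow> continuous_on S \<phi>"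
  by (meson DERIV_isCont continuous_at_imp_continuous_on smooth_DERIV)

lemma smooth_antideriv:
  assumes "smooth \<phi>" "\<And>x. (\<Phi> has_field_derivative \<phi> x) (at x)"
  shows "smooth \<Phi>"
proof -
  have "deriv \<Phi> = \<phi>" using assms(2) by (auto intro!: DERIV_imp_deriv)
  then have "((deriv ^^ j) \<Phi>) field_differentiable (at x)" for j x
    using assms by (cases j) (auto simp: smooth_def field_differentiable_def funpow_Suc_right simp del: funpow.simps)
  then show ?thesis by (simp add: smooth_def)
qed

lemma smooth_lincomb:
  assumes "smooth f" "smooth g" shows "smooth (\<lambda>x. f x + c * g x)"
proof -
  have fg: "(((deriv ^^ j) f) has_field_derivative (deriv ^^ Suc j) f x) (at x)"
           "(((deriv ^^ j) g) has_field_derivative (deriv ^^ Suc j) g x) (at x)" for j x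
    using assms by (simp_all add: smooth_def DERIV_deriv_iff_field_differentiable)
  have D: "((\<lambda>x. (deriv ^^ j) f x + c * (deriv ^^ j) g x) has_field_derivative
      (deriv ^^ Suc j) f x + c * (deriv ^^ Suc j) g x) (at x)" for j x
    by (intro DERIV_add DERIV_cmult fg)
  have eq: "(deriv ^^ j) (\<lambda>x. f x + c * g x) = (\<lambda>x. (deriv ^^ j) f x + c * (deriv ^^ j) g x)" for j
  proof (induction j)
    case (Suc j)
    then show ?case using DERIV_imp_deriv[OF D[of j]] by auto
  qed simp
  show ?thesis
    unfolding smooth_def field_differentiable_def eq using D by blast
qed

lemma test_fun_iff: "test_fun \<Omega> \<phi> \<longleftrightarrow> smooth \<phi> \<and> compact (closure {x. \<phi> x \<noteq> 0}) \<and> closure {x. \<phi> x \<noteq> 0} \<subseteq> \<Omega>"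
  by (simp add: test_fun_def smooth_def)

lemma test_funI:
  assumes "smooth \<phi>" "\<And>x. x \<notin> {a..b} \<Longrightarrow> \<phi> x = 0" "{a..b} \<subseteq> \<Omega>"
  shows "test_fun \<Omega> \<phi>"
proof -
  have "closure {x. \<phi> x \<noteq> 0} \<subseteq> {a..b}" by (rule closure_minimal) (use assms(2) in \<open>blast, simp\<close>)
  then show ?thesis
    unfolding test_fun_iff using assms(1,3)
    by (metis bounded_closed_interval bounded_subset closed_closure compact_eq_bounded_closed order_trans)
qed

lemma bump_family_test_fun:
  assumes "f \<in> bump_family s a b" "s > 0" "{a..b} \<subseteq> \<Omega>"
  shows "test_fun \<Omega> f"
  using bump_family_zero[OF assms(1)] by (intro test_funI[OF bump_family_smooth[OF assms(1,2)] _ assms(3)]) auto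

lemma test_fun_deriv:
  assumes "test_fun \<Omega> \<phi>"
  shows "test_fun \<Omega> (deriv \<phi>)" and "x \<notin> closure {x. \<phi> x \<noteq> 0} \<Longrightarrow> deriv \<phi> x = 0"
proof -
  let ?K = "closure {x. \<phi> x \<noteq> 0}"
  have z: "deriv \<phi> x = 0" if x: "x \<notin> ?K" for x
  proof -
    have "eventually (\<lambda>y. y \<in> - ?K) (nhds x)" using x by (intro eventually_nhds_in_open) auto
    then have "eventually (\<lambda>y. \<phi> y = 0) (nhds x)"
      by eventually_elim (use closure_subset[of "{x. \<phi> x \<noteq> 0}"] in auto)
    then have "(\<phi> has_field_derivative 0) (at x)" by (subst DERIV_cong_ev[OF refl _ refl]) auto
    then show ?thesis by (rule DERIV_imp_deriv)
  qed
  then have "closure {x. deriv \<phi> x \<noteq> 0} \<subseteq> ?K" by (intro closure_minimal) auto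
  moreover from this have "compact (closure {x. deriv \<phi> x \<noteq> 0})"
    using assms unfolding test_fun_iff by (metis closed_closure compact_Int_closed inf.absorb_iff2)
  ultimately show "test_fun \<Omega> (deriv \<phi>)"
    using assms unfolding test_fun_iff by (blast intro: smooth_deriv)
  show "x \<notin> ?K \<Longrightarrow> deriv \<phi> x = 0" by (rule z)
qed

subsection \<open>The lemma of du Bois-Reymond\<close>

lemma integrable_lebesgue_on_iff:
  fixes f :: "real \<Rightarrow> 'b::euclidean_space"
  assumes "\<Omega> \<in> sets lebesgue"
  shows "integrable (lebesgue_on \<Omega>) f \<longleftrightarrow> integrable lebesgue (\<lambda>x. if x \<in> \<Omega> then f x else 0)"
  using assms by (simp add: integrable_restrict_space indicator_scaleR_eq_if)

lemma integral_lebesgue_on_eq: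
  fixes f :: "real \<Rightarrow> 'b::euclidean_space"
  assumes "\<Omega> \<in> sets lebesgue"
  shows "integral\<^sup>L (lebesgue_on \<Omega>) f = (LINT x|lebesgue. (if x \<in> \<Omega> then f x else 0))"
  using assms by (simp add: integral_restrict_space indicator_scaleR_eq_if)

lemma AE_lebesgue_on_iff:
  assumes "\<Omega> \<in> sets lebesgue"
  shows "(AE x in lebesgue_on \<Omega>. P x) \<longleftrightarrow> (AE x in lebesgue. x \<in> \<Omega> \<longrightarrow> P x)"
  using assms by (simp add: AE_restrict_space_iff)

lemma measurable_lebesgue_on_iff:
  fixes f :: "real \<Rightarrow> 'b::euclidean_space"
  assumes "\<Omega> \<in> sets lebesgue"
  shows "f \<in> borel_measurable (lebesgue_on \<Omega>) \<longleftrightarrow> (\<lambda>x. if x \<in> \<Omega> then f x else 0) \<in> borel_measurable lebesgue"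
  using borel_measurable_if_lebesgue_on[OF assms, of UNIV f] by (simp add: lebesgue_on_UNIV_eq)

lemma measurable_cong_AE_lebesgue_on:
  fixes f :: "real \<Rightarrow> 'b::euclidean_space"
  assumes "\<Omega> \<in> sets lebesgue" "f \<in> borel_measurable (lebesgue_on \<Omega>)" "AE x in lebesgue_on \<Omega>. f x = g x"
  shows "g \<in> borel_measurable (lebesgue_on \<Omega>)"
  using assms unfolding measurable_lebesgue_on_iff[OF assms(1)] AE_lebesgue_on_iff[OF assms(1)]
  by (elim borel_measurable_AE) (auto elim: eventually_mono)

lemma integral_cong_AE_lebesgue_on:
  fixes f :: "real \<Rightarrow> 'b::euclidean_space"
  assumes "\<Omega> \<in> sets lebesgue" "AE x in lebesgue_on \<Omega>. f x = g x"
  shows "integral\<^sup>L (lebesgue_on \<Omega>) f = integral\<^sup>L (lebesgue_on \<Omega>) g"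
proof (cases "f \<in> borel_measurable (lebesgue_on \<Omega>)")
  case True
  then show ?thesis
    using measurable_cong_AE_lebesgue_on[OF assms(1) True assms(2)] assms(2) by (intro integral_cong_AE)
next
  case False
  \<comment> \<open>By completeness of Lebesgue measure the second function is nonmeasurable as
    well; both integrals then have the default value 0.\<close>
  have "AE x in lebesgue_on \<Omega>. g x = f x" using assms(2) by eventually_elim simp
  then have "g \<notin> borel_measurable (lebesgue_on \<Omega>)"
    using False measurable_cong_AE_lebesgue_on[OF assms(1)] by blast
  then have "\<not> integrable (lebesgue_on \<Omega>) f" "\<not> integrable (lebesgue_on \<Omega>) g" using False by auto
  then show ?thesis by (simp add: not_integrable_integral_eq)
qed

lemma L2_cong_AE:
  fixes f g :: "real \<Rightarrow> complex"
  assumes "\<Omega> \<in> sets lebesgue" "g \<in> carrier (L2 (lebesgue_on \<Omega>))" "AE x in lebesgue_on \<Omega>. f x = g x"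
  shows "f \<in> carrier (L2 (lebesgue_on \<Omega>))"
proof (rule L2_dominated[where g=g and C=1])
  have "AE x in lebesgue_on \<Omega>. g x = f x" using assms(3) by eventually_elim simp
  then show "f \<in> borel_measurable (lebesgue_on \<Omega>)"
    using measurable_cong_AE_lebesgue_on[OF assms(1) L2_measurable[OF assms(2)]] by blast
  show "AE x in lebesgue_on \<Omega>. cmod (f x) \<le> 1 * cmod (g x)" using assms(3) by eventually_elim simp
qed (rule assms(2))

lemma continuous_measurable_lebesgue:
  fixes f :: "real \<Rightarrow> 'b::euclidean_space"
  shows "continuous_on UNIV f \<Longrightarrow> f \<in> borel_measurable lebesgue"
  by (intro measurable_completion) (simp add: borel_measurable_continuous_onI)

lemma L2_absolutely_integrable:
  fixes f :: "real \<Rightarrow> complex"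
  assumes \<Omega>: "\<Omega> \<in> sets lebesgue" and f: "f \<in> carrier (L2 (lebesgue_on \<Omega>))"
  shows "(\<lambda>x. if x \<in> \<Omega> then f x else 0) absolutely_integrable_on {a..b}"
proof -
  let ?f = "\<lambda>x. if x \<in> \<Omega> then f x else 0"
  have m: "?f \<in> borel_measurable lebesgue"
    using L2_measurable[OF f] unfolding measurable_lebesgue_on_iff[OF \<Omega>] .
  have "(\<lambda>x. (cmod (?f x))\<^sup>2) = (\<lambda>x. if x \<in> \<Omega> then (cmod (f x))\<^sup>2 else 0)" by auto
  then have i: "integrable lebesgue (\<lambda>x. (cmod (?f x))\<^sup>2)"
    using L2_integrable[OF f] unfolding integrable_lebesgue_on_iff[OF \<Omega>] by simp
  show ?thesis
    unfolding set_integrable_def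
  proof (rule Bochner_Integration.integrable_bound)
    have "integrable lebesgue (indicat_real {a..b})"
      by (rule integrable_real_indicator) (auto simp: emeasure_lborel_Icc_eq)
    then show "integrable lebesgue (\<lambda>x. indicat_real {a..b} x + (cmod (?f x))\<^sup>2)"
      using i by (intro Bochner_Integration.integrable_add)
    show "(\<lambda>x. indicat_real {a..b} x *\<^sub>R ?f x) \<in> borel_measurable lebesgue"
      using m by (intro borel_measurable_scaleR borel_measurable_indicator) auto
    have "cmod (indicat_real {a..b} x *\<^sub>R ?f x) \<le> norm (indicat_real {a..b} x + (cmod (?f x))\<^sup>2)" for x
      using norm_mult_le_squares[of 1 "f x"] by (auto simp: indicator_def)
    then show "AE x in lebesgue. cmod (indicat_real {a..b} x *\<^sub>R ?f x) \<le> norm (indicat_real {a..b} x + (cmod (?f x))\<^sup>2)"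
      by blast
  qed
qed

lemma loc_integrable_restrict:
  assumes "\<Omega> \<in> sets lebesgue" "\<And>a b. (\<lambda>x. if x \<in> \<Omega> then f x else 0) absolutely_integrable_on {a..b}"
  shows "loc_integrable \<Omega> f"
  unfolding loc_integrable_def
proof (intro allI impI)
  fix K assume K: "compact K \<and> K \<subseteq> \<Omega>"
  then obtain r where r: "K \<subseteq> {-r..r}"
    by (metis bounded_subset_cbox_symmetric box_real(2) compact_imp_bounded)
  have "set_integrable lebesgue K (\<lambda>x. if x \<in> \<Omega> then f x else 0)"
    by (rule set_integrable_subset[OF assms(2)]) (use K r in \<open>auto intro: lmeasurable_compact fmeasurableD\<close>)
  moreover have "(\<lambda>x. indicat_real K x *\<^sub>R (if x \<in> \<Omega> then f x else 0)) = (\<lambda>x. indicat_real K x *\<^sub>R f x)"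
    using K by (intro ext) (auto simp: indicator_def)
  ultimately show "set_integrable lebesgue K f" unfolding set_integrable_def by simp
qed

lemma loc_integrable_continuous:
  assumes "continuous_on UNIV f" "\<Omega> \<in> sets lebesgue" shows "loc_integrable \<Omega> f"
  by (intro loc_integrable_restrict absolutely_integrable_on_restrict assms(2)
      absolutely_integrable_continuous_real continuous_on_subset[OF assms(1)]) simp

lemma test_mult_integrable:
  fixes \<psi> :: "real \<Rightarrow> real"
  assumes f: "loc_integrable \<Omega> f" and \<Omega>: "\<Omega> \<in> sets lebesgue" and K: "compact K" "K \<subseteq> \<Omega>"
    and \<psi>: "continuous_on UNIV \<psi>" "\<And>x. x \<notin> K \<Longrightarrow> \<psi> x = 0"
  shows "integrable (lebesgue_on \<Omega>) (\<lambda>x. complex_of_real (\<psi> x) * f x)"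
proof -
  have fi: "integrable lebesgue (\<lambda>x. indicat_real K x *\<^sub>R f x)"
    using f K unfolding loc_integrable_def set_integrable_def by blast
  have "compact (\<psi> ` K)" using \<psi>(1) K(1) by (meson compact_continuous_image continuous_on_subset top_greatest)
  then obtain C where C: "\<And>x. x \<in> K \<Longrightarrow> \<bar>\<psi> x\<bar> \<le> C"
    using compact_imp_bounded bounded_iff by (metis imageI real_norm_def)
  have "integrable lebesgue (\<lambda>x. complex_of_real (\<psi> x) * (indicat_real K x *\<^sub>R f x))"
  proof (rule Bochner_Integration.integrable_bound)
    show "integrable lebesgue (\<lambda>x. C * norm (indicat_real K x *\<^sub>R f x))"
      using fi by (intro integrable_mult_right integrable_norm)
    have "(\<lambda>x. complex_of_real (\<psi> x)) \<in> borel_measurable lebesgue"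
      using \<psi>(1) by (intro continuous_measurable_lebesgue continuous_intros)
    then show "(\<lambda>x. complex_of_real (\<psi> x) * (indicat_real K x *\<^sub>R f x)) \<in> borel_measurable lebesgue"
      using fi by (intro borel_measurable_times) auto
    have "norm (complex_of_real (\<psi> x) * (indicat_real K x *\<^sub>R f x)) \<le> norm (C * norm (indicat_real K x *\<^sub>R f x))" for x
    proof (cases "x \<in> K")
      case True
      then have "\<bar>\<psi> x\<bar> \<le> \<bar>C\<bar>" using C[of x] by simp
      then show ?thesis using True by (simp add: norm_mult abs_mult mult_right_mono)
    qed simp
    then show "AE x in lebesgue. norm (complex_of_real (\<psi> x) * (indicat_real K x *\<^sub>R f x)) \<le> norm (C * norm (indicat_real K x *\<^sub>R f x))"
      by blast
  qed
  moreover have "(if x \<in> \<Omega> then complex_of_real (\<psi> x) * f x else 0) = complex_of_real (\<psi> x) * (indicat_real K x *\<^sub>R f x)" for x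
    using K \<psi>(2)[of x] by (auto simp: indicator_def)
  ultimately show ?thesis unfolding integrable_lebesgue_on_iff[OF \<Omega>] by simp
qed

lemma integral_test_support:
  fixes g :: "real \<Rightarrow> complex"
  assumes \<Omega>: "\<Omega> \<in> sets lebesgue" and g: "g absolutely_integrable_on {a..b}"
    and "\<And>x. x \<notin> \<Omega> \<inter> {a..b} \<Longrightarrow> g x = 0"
  shows "integral\<^sup>L (lebesgue_on \<Omega>) g = integral {a..b} g" "integrable (lebesgue_on \<Omega>) g"
proof -
  have 1: "(if x \<in> \<Omega> then g x else 0) = indicat_real {a..b} x *\<^sub>R g x" for x
    using assms(3)[of x] by (auto simp: indicator_def)
  have "integral\<^sup>L (lebesgue_on \<Omega>) g = set_lebesgue_integral lebesgue {a..b} g"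
    unfolding integral_lebesgue_on_eq[OF \<Omega>] 1 set_lebesgue_integral_def ..
  also have "\<dots> = integral {a..b} g" by (rule set_lebesgue_integral_eq_integral(2)[OF g])
  finally show "integral\<^sup>L (lebesgue_on \<Omega>) g = integral {a..b} g" .
  show "integrable (lebesgue_on \<Omega>) g"
    unfolding integrable_lebesgue_on_iff[OF \<Omega>] 1 using g by (simp add: set_integrable_def)
qed

lemma compact_in_interval:
  fixes K :: "real set"
  assumes "compact K"
  obtains r where "r > 0" "K \<subseteq> {-r<..<r}"
proof -
  obtain a where "K \<subseteq> {-a<..<a}"
    using bounded_subset_box_symmetric[OF compact_imp_bounded[OF assms]] by auto
  then have "K \<subseteq> {-(max a 1)<..<max a 1}" by (force simp: max_def)
  then show thesis using that[of "max a 1"] by simp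
qed

text \<open>The support of the test function is a compact subset of \<Omega> and of some (-r, r).
  Integrals over \<Omega> thus become integrals over [-r, r], where the product rule has no boundary
  terms.\<close>

lemma prim_ibp_test:
  assumes Ff: "prim F f" and \<phi>: "test_fun \<Omega> \<phi>" and \<Omega>: "\<Omega> \<in> sets lebesgue"
  shows "(LINT x|lebesgue_on \<Omega>. complex_of_real (deriv \<phi> x) * F x) = - (LINT x|lebesgue_on \<Omega>. complex_of_real (\<phi> x) * f x)"
proof -
  define K where "K = closure {x. \<phi> x \<noteq> 0}"
  have K: "compact K" "K \<subseteq> \<Omega>" and sm: "smooth \<phi>" using \<phi> by (auto simp: test_fun_iff K_def)
  obtain r where r: "r > 0" "K \<subseteq> {-r<..<r}" using compact_in_interval[OF K(1)] .
  have z: "\<phi> x = 0" "deriv \<phi> x = 0" if "x \<notin> K" for x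
    using that test_fun_deriv(2)[OF \<phi>] closure_subset[of "{x. \<phi> x \<noteq> 0}"] unfolding K_def by auto
  have z0: "x \<notin> K" if "x \<notin> \<Omega> \<inter> {-r..r}" for x
  proof
    assume "x \<in> K"
    then have "x \<in> \<Omega>" "x \<in> {-r<..<r}" using K(2) r(2) by blast+
    with that show False by simp
  qed
  have "prim (\<lambda>x. complex_of_real (\<phi> x)) (\<lambda>x. complex_of_real (deriv \<phi> x))"
  proof (rule prim_of_deriv)
    fix x
    show "((\<lambda>x. complex_of_real (\<phi> x)) has_vector_derivative complex_of_real (deriv \<phi> x)) (at x)"
      using smooth_DERIV[OF sm] by (intro has_vector_derivative_of_real) (simp add: has_real_derivative_iff_has_vector_derivative)
    show "continuous_on UNIV (\<lambda>x. complex_of_real (deriv \<phi> x))"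
      by (intro continuous_intros smooth_continuous smooth_deriv sm)
  qed
  from prim_mult[OF this Ff] have P: "prim (\<lambda>x. complex_of_real (\<phi> x) * F x) (\<lambda>x. complex_of_real (deriv \<phi> x) * F x + complex_of_real (\<phi> x) * f x)" .
  have c: "continuous_on {-r..r} (\<lambda>x. complex_of_real (deriv \<phi> x) * F x)"
    by (intro continuous_intros smooth_continuous smooth_deriv sm prim_continuous[OF Ff])
  have 1: "(\<lambda>x. complex_of_real (deriv \<phi> x) * F x) absolutely_integrable_on {-r..r}"
    by (rule absolutely_integrable_continuous_real[OF c])
  have 12: "(\<lambda>x. complex_of_real (deriv \<phi> x) * F x + complex_of_real (\<phi> x) * f x) absolutely_integrable_on {-r..r}"
    using primD(1)[OF P, of "-r" r] r by simp
  have 2: "(\<lambda>x. complex_of_real (\<phi> x) * f x) absolutely_integrable_on {-r..r}"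
    using set_integral_diff(1)[OF 12 1] by simp
  have "r \<notin> K" "-r \<notin> K" using r by auto
  then have "integral {-r..r} (\<lambda>x. complex_of_real (deriv \<phi> x) * F x + complex_of_real (\<phi> x) * f x) = 0"
    using primD(2)[OF P, of "-r" r] r z by simp
  moreover have "integral {-r..r} (\<lambda>x. complex_of_real (deriv \<phi> x) * F x + complex_of_real (\<phi> x) * f x)
     = integral {-r..r} (\<lambda>x. complex_of_real (deriv \<phi> x) * F x) + integral {-r..r} (\<lambda>x. complex_of_real (\<phi> x) * f x)"
    by (intro integral_add set_lebesgue_integral_eq_integral(1) 1 2)
  moreover have "(LINT x|lebesgue_on \<Omega>. complex_of_real (deriv \<phi> x) * F x) = integral {-r..r} (\<lambda>x. complex_of_real (deriv \<phi> x) * F x)"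
    by (rule integral_test_support(1)[OF \<Omega> 1]) (metis z0 z(2) mult_zero_left of_real_0)
  moreover have "(LINT x|lebesgue_on \<Omega>. complex_of_real (\<phi> x) * f x) = integral {-r..r} (\<lambda>x. complex_of_real (\<phi> x) * f x)"
    by (rule integral_test_support(1)[OF \<Omega> 2]) (metis z0 z(1) mult_zero_left of_real_0)
  ultimately show ?thesis by (simp add: add_eq_0_iff)
qed

lemma prim_loc_integrable:
  assumes "prim F f" "\<Omega> \<in> sets lebesgue" shows "loc_integrable \<Omega> F" "loc_integrable \<Omega> f"
proof -
  show "loc_integrable \<Omega> F" by (intro loc_integrable_continuous prim_continuous[OF assms(1)] assms(2))
  have "f absolutely_integrable_on {a..b}" for a b
    by (cases "a \<le> b") (use primD(1)[OF assms(1)] in auto)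
  then show "loc_integrable \<Omega> f"
    by (intro loc_integrable_restrict absolutely_integrable_on_restrict assms(2))
qed

lemma prim_weak_deriv:
  assumes "prim F f" "\<Omega> \<in> sets lebesgue" shows "weak_deriv \<Omega> 1 F f"
  unfolding weak_deriv_def using prim_loc_integrable[OF assms] prim_ibp_test[OF assms(1) _ assms(2)] by simp

lemma prim_weak_deriv2:
  assumes F: "prim F p" and p: "prim p h" and \<Omega>: "\<Omega> \<in> sets lebesgue" shows "weak_deriv \<Omega> 2 F h"
  unfolding weak_deriv_def
proof (intro conjI allI impI)
  show "loc_integrable \<Omega> F" "loc_integrable \<Omega> h" using prim_loc_integrable F p \<Omega> by auto
  fix \<phi> assume \<phi>: "test_fun \<Omega> \<phi>"
  show "(LINT x|lebesgue_on \<Omega>. complex_of_real ((deriv ^^ 2) \<phi> x) * F x) =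
      (-1) ^ 2 * (LINT x|lebesgue_on \<Omega>. complex_of_real (\<phi> x) * h x)"
    using prim_ibp_test[OF F test_fun_deriv(1)[OF \<phi>] \<Omega>] prim_ibp_test[OF p \<phi> \<Omega>]
    by (simp add: numeral_2_eq_2)
qed

lemma weak_deriv_0: "loc_integrable \<Omega> f \<Longrightarrow> weak_deriv \<Omega> 0 f f"
  by (simp add: weak_deriv_def)

lemma sigma_finite_lebesgue: "sigma_finite_measure (lebesgue :: real measure)"
proof
  have "\<exists>n::nat. - real n \<le> x \<and> x \<le> real n" for x
    using real_arch_simple[of "\<bar>x\<bar>"] by (metis abs_le_iff minus_le_iff)
  then show "\<exists>A. countable A \<and> A \<subseteq> sets (lebesgue :: real measure) \<and> \<Union> A = space lebesgue \<and>
      (\<forall>a\<in>A. emeasure lebesgue a \<noteq> \<infinity>)"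
    by (intro exI[of _ "range (\<lambda>n::nat. {- real n..real n})"]) (auto simp: emeasure_lborel_Icc_eq)
qed

text \<open>Open intervals form an intersection-stable generator of the Borel sets, and the sets
  over which \<open>G\<close> integrates to 0 form a Dynkin system. Lebesgue sets differ from Borel
  sets by null sets.\<close>

lemma AE_eq_0_if_interval_integrals:
  fixes G :: "real \<Rightarrow> complex"
  assumes G: "integrable lebesgue G"
    and 0: "\<And>a b. (LINT x:{a<..<b}|lebesgue. G x) = 0"
  shows "AE x in lebesgue. G x = 0"
proof (rule sigma_finite_measure.density_zero[OF sigma_finite_lebesgue G])
  have si: "set_integrable lebesgue A G" if "A \<in> sets lebesgue" for A
    unfolding set_integrable_def using G that by (intro integrable_mult_indicator)
  \<comment> \<open>Complements require the integral over the whole line, which is the limit of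
    those over (-n, n).\<close>
  have U: "(LINT x|lebesgue. G x) = 0"
  proof -
    have "(\<lambda>n::nat. LINT x|lebesgue. indicat_real {- real n<..<real n} x *\<^sub>R G x) \<longlonglongrightarrow> (LINT x|lebesgue. G x)"
    proof (rule integral_dominated_convergence[where w="\<lambda>x. norm (G x)"])
      have "(\<lambda>n::nat. indicat_real {- real n<..<real n} x *\<^sub>R G x) \<longlonglongrightarrow> G x" for x
      proof (rule tendsto_eventually)
        obtain m :: nat where "\<bar>x\<bar> < real m" using reals_Archimedean2 by blast
        then have "indicat_real {- real n<..<real n} x *\<^sub>R G x = G x" if "n \<ge> m" for n
          using that by (auto simp: indicator_def)
        then show "eventually (\<lambda>n. indicat_real {- real n<..<real n} x *\<^sub>R G x = G x) sequentially"
          by (rule eventually_sequentiallyI)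
      qed
      then show "AE x in lebesgue. (\<lambda>n::nat. indicat_real {- real n<..<real n} x *\<^sub>R G x) \<longlonglongrightarrow> G x" by simp
      show "(\<lambda>x. indicat_real {- real n<..<real n} x *\<^sub>R G x) \<in> borel_measurable lebesgue" for n :: nat
        using G by (intro borel_measurable_scaleR borel_measurable_indicator) auto
    qed (use G in \<open>auto simp: indicator_def\<close>)
    moreover have "(LINT x|lebesgue. indicat_real {- real n<..<real n} x *\<^sub>R G x) = 0" for n
      using 0[of "- real n" "real n"] by (simp add: set_lebesgue_integral_def)
    ultimately show ?thesis by (simp add: LIMSEQ_const_iff)
  qed
  let ?B = "range (\<lambda>(a, b). {a<..<b::real})"
  have B: "sets (borel :: real measure) = sigma_sets UNIV ?B"
    unfolding borel_eq_box by (simp add: box_real cong: image_cong split_cong)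
  have borel: "(LINT x:A|lebesgue. G x) = 0" if "A \<in> sets borel" for A
  proof -
    have "A \<in> sigma_sets UNIV ?B" using that unfolding B .
    then show ?thesis
    proof (induction rule: sigma_sets_induct_disjoint[rotated 2, consumes 1, case_names basic empty compl union stable pow])
      case (basic A)
      then show ?case using 0 by auto
    next
      case (compl A)
      then have A: "A \<in> sets lebesgue"
        unfolding B[symmetric] by simp
      have "(LINT x:UNIV|lebesgue. G x) = (LINT x:A|lebesgue. G x) + (LINT x:UNIV - A|lebesgue. G x)"
      proof -
        have "UNIV - A \<in> sets lebesgue" using A by (metis Compl_in_sets_lebesgue Compl_eq_Diff_UNIV)
        then show ?thesis using A by (subst set_integral_Un[symmetric]) (auto intro: si)
      qed
      then show ?case using compl U by (simp add: set_lebesgue_integral_def)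
    next
      case (union A)
      then have A: "A i \<in> sets lebesgue" for i
        unfolding B[symmetric] by simp
      have "(LINT x:(\<Union>i. A i)|lebesgue. G x) = (\<Sum>i. (LINT x:A i|lebesgue. G x))"
        by (rule lebesgue_integral_countable_add[OF A _ si]) (use union(1) A in \<open>auto simp: disjoint_family_on_def\<close>)
      then show ?case using union by simp
    next
      case stable
      show "Int_stable (range (\<lambda>(a, b). {a<..<b::real}))"
        by (auto simp: Int_stable_def Int_greaterThanLessThan)
    qed (auto simp: set_lebesgue_integral_def)
  qed
  fix A :: "real set" assume A: "A \<in> sets lebesgue"
  then obtain S N N' where N: "A = S \<union> N" "N \<subseteq> N'" "N' \<in> null_sets lborel" "S \<in> sets lborel"
    by (rule sets_completionE)
  then have "S \<in> sets lebesgue" by simp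
  have "(A - S) \<union> (S - A) \<subseteq> N'" using N by auto
  then have "(A - S) \<union> (S - A) \<in> null_sets lebesgue"
    using N(3) null_sets_completion_subset null_sets_completionI by blast
  then have "(LINT x:A|lebesgue. G x) = (LINT x:S|lebesgue. G x)"
    using G A \<open>S \<in> sets lebesgue\<close> by (intro set_integral_null_delta)
  also have "\<dots> = 0" using borel N(4) by simp
  finally show "(LINT x:A|lebesgue. G x) = 0" .
qed

lemma expmol_limit:
  assumes "x > 0"
  shows "(\<lambda>n. expmol (1 / real (Suc n)) 1 x) \<longlonglongrightarrow> 1"
proof -
  have "(\<lambda>n. exp (- (1 / real (Suc n)) / x)) \<longlonglongrightarrow> exp (- 0 / x)"
    by (intro tendsto_intros LIMSEQ_inverse_real_of_nat[unfolded inverse_eq_divide]) (use assms in simp)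
  then show ?thesis using assms by (simp add: expmol_def)
qed

lemma expmol_le_1: "s > 0 \<Longrightarrow> 0 \<le> expmol s 1 x \<and> expmol s 1 x \<le> 1"
  by (simp add: expmol_def)

text \<open>Countably many rational intervals with closure in \<Omega> cover \<Omega>. Read
  contrapositively, this finds a compact interval, on which the coefficients are bounded, where a
  property fails on a nonnull set.\<close>

lemma AE_on_open_if_compact:
  assumes \<Omega>: "open (\<Omega> :: real set)"
    and "\<And>a b. {a..b} \<subseteq> \<Omega> \<Longrightarrow> AE x in lebesgue. x \<in> {a<..<b} \<longrightarrow> P x"
  shows "AE x in lebesgue_on \<Omega>. P x"
proof -
  let ?I = "{(a, b). a \<in> \<rat> \<and> b \<in> \<rat> \<and> {a..b} \<subseteq> \<Omega>}"
  have "countable ?I"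
    by (rule countable_subset[of _ "\<rat> \<times> \<rat>"]) (auto intro: countable_SIGMA countable_rat)
  then have "AE x in lebesgue. \<forall>(a, b)\<in>?I. x \<in> {a<..<b} \<longrightarrow> P x"
    using assms(2) by (subst AE_ball_countable) auto
  then have "AE x in lebesgue. x \<in> \<Omega> \<longrightarrow> P x"
  proof eventually_elim
    case (elim x)
    show ?case
    proof
      assume x: "x \<in> \<Omega>"
      then obtain e where e: "e > 0" "\<And>y. dist y x < e \<Longrightarrow> y \<in> \<Omega>" using \<Omega> unfolding open_dist by blast
      obtain a where a: "a \<in> \<rat>" "x - e < a" "a < x" using Rats_dense_in_real[of "x - e" x] e by auto
      obtain b where b: "b \<in> \<rat>" "x < b" "b < x + e" using Rats_dense_in_real[of x "x + e"] e by auto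
      have "{a..b} \<subseteq> \<Omega>" using a b by (auto intro!: e(2) simp: dist_real_def)
      then show "P x" using elim a b by auto
    qed
  qed
  then show ?thesis using \<Omega> by (subst AE_lebesgue_on_iff) auto
qed

text \<open>The bumps exp (-s/(x-a)) exp (-s/(b-x)) are bounded by 1 and tend to the indicator of
  (a, b) as s tends to 0. Dominated convergence gives vanishing integrals over all intervals with
  closure in \<Omega>, hence the previous criterion applies.\<close>

lemma fundamental_lemma:
  assumes \<Omega>: "open \<Omega>" and F: "loc_integrable \<Omega> F"
    and 0: "\<And>s a b \<phi>. s > 0 \<Longrightarrow> {a..b} \<subseteq> \<Omega> \<Longrightarrow> \<phi> \<in> bump_family s a b \<Longrightarrow>
      (LINT x|lebesgue_on \<Omega>. complex_of_real (\<phi> x) * F x) = 0"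
  shows "AE x in lebesgue_on \<Omega>. F x = 0"
proof (rule AE_on_open_if_compact[OF \<Omega>])
  have \<Omega>m: "\<Omega> \<in> sets lebesgue" using \<Omega> by simp
  have zero: "(LINT x:{a<..<b}|lebesgue. F x) = 0" if ab: "{a..b} \<subseteq> \<Omega>" for a b
  proof -
    define \<phi> where "\<phi> n x = expmol (1 / real (Suc n)) 1 (x - a) * expmol (1 / real (Suc n)) 1 (b - x)" for n x
    have fam: "\<phi> n \<in> bump_family (1 / real (Suc n)) a b" for n
      unfolding \<phi>_def by (rule bump_family.base)
    have z: "\<phi> n x = 0" if "x \<notin> {a<..<b}" for n x using that by (auto simp: \<phi>_def expmol_def)
    have Fi: "integrable lebesgue (\<lambda>x. indicat_real {a..b} x *\<^sub>R F x)"
      using F ab unfolding loc_integrable_def set_integrable_def by simp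
    have "(\<lambda>n. LINT x|lebesgue. complex_of_real (\<phi> n x) * (indicat_real {a..b} x *\<^sub>R F x))
        \<longlonglongrightarrow> (LINT x|lebesgue. indicat_real {a<..<b} x *\<^sub>R F x)"
    proof (rule integral_dominated_convergence[where w="\<lambda>x. norm (indicat_real {a..b} x *\<^sub>R F x)"])
      have "(\<lambda>x. indicat_real {a<..<b} x *\<^sub>R (indicat_real {a..b} x *\<^sub>R F x)) \<in> borel_measurable lebesgue"
        by (intro borel_measurable_scaleR[OF _ borel_measurable_integrable[OF Fi]] borel_measurable_indicator) auto
      also have "(\<lambda>x. indicat_real {a<..<b} x *\<^sub>R (indicat_real {a..b} x *\<^sub>R F x)) = (\<lambda>x. indicat_real {a<..<b} x *\<^sub>R F x)"
        by (intro ext) (auto simp: indicator_def)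
      finally show "(\<lambda>x. indicat_real {a<..<b} x *\<^sub>R F x) \<in> borel_measurable lebesgue" .
      fix n
      have "continuous_on UNIV (\<phi> n)"
        by (rule smooth_continuous[OF bump_family_smooth[OF fam]]) simp
      then have "(\<lambda>x. complex_of_real (\<phi> n x)) \<in> borel_measurable lebesgue"
        by (intro continuous_measurable_lebesgue continuous_intros)
      then show "(\<lambda>x. complex_of_real (\<phi> n x) * (indicat_real {a..b} x *\<^sub>R F x)) \<in> borel_measurable lebesgue"
        by (rule borel_measurable_times[OF _ borel_measurable_integrable[OF Fi]])
      have "\<bar>\<phi> n x\<bar> \<le> 1" for x
        using expmol_le_1[of "1 / real (Suc n)" "x - a"] expmol_le_1[of "1 / real (Suc n)" "b - x"]
        by (auto simp: \<phi>_def abs_mult intro!: mult_le_one)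
      then have "norm (complex_of_real (\<phi> n x) * (indicat_real {a..b} x *\<^sub>R F x)) \<le> norm (indicat_real {a..b} x *\<^sub>R F x)" for x
        using mult_right_mono[of "\<bar>\<phi> n x\<bar>" 1 "norm (indicat_real {a..b} x *\<^sub>R F x)"]
        by (simp only: norm_mult norm_of_real mult_1 norm_ge_zero)
      then show "AE x in lebesgue. norm (complex_of_real (\<phi> n x) * (indicat_real {a..b} x *\<^sub>R F x)) \<le> norm (indicat_real {a..b} x *\<^sub>R F x)"
        by blast
    next
      have "(\<lambda>n. complex_of_real (\<phi> n x) * (indicat_real {a..b} x *\<^sub>R F x)) \<longlonglongrightarrow> indicat_real {a<..<b} x *\<^sub>R F x" for x
      proof (cases "x \<in> {a<..<b}")
        case True
        then have "(\<lambda>n. \<phi> n x) \<longlonglongrightarrow> 1 * 1" unfolding \<phi>_def by (intro tendsto_mult expmol_limit) auto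
        then have "(\<lambda>n. complex_of_real (\<phi> n x) * (indicat_real {a..b} x *\<^sub>R F x)) \<longlonglongrightarrow> complex_of_real (1 * 1) * (indicat_real {a..b} x *\<^sub>R F x)"
          by (intro tendsto_intros)
        then show ?thesis using True by simp
      next
        case False
        then show ?thesis using z[OF False] by (simp only: indicator_simps(2)[OF False] of_real_0 mult_zero_left scaleR_zero_left tendsto_const)
      qed
      then show "AE x in lebesgue. (\<lambda>n. complex_of_real (\<phi> n x) * (indicat_real {a..b} x *\<^sub>R F x)) \<longlonglongrightarrow> indicat_real {a<..<b} x *\<^sub>R F x"
        by simp
    qed (rule integrable_norm[OF Fi])
    moreover have "(LINT x|lebesgue. complex_of_real (\<phi> n x) * (indicat_real {a..b} x *\<^sub>R F x)) = 0" for n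
    proof -
      have "complex_of_real (\<phi> n x) * (indicat_real {a..b} x *\<^sub>R F x) = (if x \<in> \<Omega> then complex_of_real (\<phi> n x) * F x else 0)" for x
        using z[of x n] ab by (auto simp: indicator_def)
      then show ?thesis
        using 0[OF _ ab fam[of n]] unfolding integral_lebesgue_on_eq[OF \<Omega>m] by simp
    qed
    ultimately show ?thesis
      by (simp add: LIMSEQ_const_iff set_lebesgue_integral_def)
  qed
  fix A B assume AB: "{A..B} \<subseteq> \<Omega>"
  let ?G = "\<lambda>x. indicat_real {A<..<B} x *\<^sub>R F x"
  have "set_integrable lebesgue {A..B} F" using F AB unfolding loc_integrable_def by simp
  then have "set_integrable lebesgue {A<..<B} F" by (rule set_integrable_subset) auto
  then have "integrable lebesgue ?G" by (simp add: set_integrable_def)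
  moreover have "(LINT x:{a<..<b}|lebesgue. ?G x) = 0" for a b
  proof -
    have *: "indicat_real {a<..<b} x *\<^sub>R ?G x = indicat_real {max a A<..<min b B} x *\<^sub>R F x" for x
      by (auto simp: indicator_def)
    have "(LINT x:{a<..<b}|lebesgue. ?G x) = (LINT x:{max a A<..<min b B}|lebesgue. F x)"
      unfolding set_lebesgue_integral_def by (intro Bochner_Integration.integral_cong refl *)
    also have "\<dots> = 0" by (rule zero) (use AB in auto)
    finally show ?thesis .
  qed
  ultimately have "AE x in lebesgue. ?G x = 0" by (rule AE_eq_0_if_interval_integrals)
  then show "AE x in lebesgue. x \<in> {A<..<B} \<longrightarrow> F x = 0"
    by eventually_elim (auto simp: indicator_def)
qed

lemma real_antiderivative:
  fixes g :: "real \<Rightarrow> real"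
  assumes "continuous_on UNIV g"
  obtains G where "\<And>x. (G has_field_derivative g x) (at x)" "\<And>a b. a \<le> b \<Longrightarrow> G b - G a = integral {a..b} g" "G c = 0"
proof -
  let ?g = "\<lambda>x. complex_of_real (g x)"
  have gc: "continuous_on UNIV ?g" using assms by (intro continuous_intros)
  have "?g absolutely_integrable_on {a..b}" for a b
    by (intro absolutely_integrable_continuous_real continuous_on_subset[OF gc]) simp
  then obtain F where F: "prim F ?g" "F c = 0" using prim_exists by blast
  have "((\<lambda>x. Re (F x)) has_vector_derivative Re (?g x)) (at x)" for x
    using bounded_linear.has_vector_derivative[OF bounded_linear_Re prim_deriv[OF F(1) gc]] .
  then have "((\<lambda>x. Re (F x)) has_field_derivative g x) (at x)" for x
    by (simp add: has_real_derivative_iff_has_vector_derivative)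
  moreover have "Re (F b) - Re (F a) = integral {a..b} g" if "a \<le> b" for a b
  proof -
    have "integral {a..b} (\<lambda>x. Re (?g x)) = Re (integral {a..b} ?g)"
      using integral_linear[OF primD(3)[OF F(1) that] bounded_linear_Re] by (simp only: o_def)
    then show ?thesis using primD(2)[OF F(1) that] by simp
  qed
  ultimately show thesis using that[of "\<lambda>x. Re (F x)"] F(2) by simp
qed

text \<open>A bump whose integral vanishes is the derivative of a test function. Subtracting from
  any bump the multiple of a fixed one with the same integral reduces the claim to
  \<open>fundamental_lemma\<close> for F minus a constant.\<close>

lemma du_Bois_Reymond:
  assumes \<Omega>: "open \<Omega>" "is_interval \<Omega>" and F: "loc_integrable \<Omega> F"
    and 0: "\<And>\<phi>. test_fun \<Omega> \<phi> \<Longrightarrow> (LINT x|lebesgue_on \<Omega>. complex_of_real (deriv \<phi> x) * F x) = 0"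
  shows "\<exists>c. AE x in lebesgue_on \<Omega>. F x = c"
proof (cases "\<Omega> = {}")
  case True
  then show ?thesis by (auto simp: AE_lebesgue_on_iff)
next
  case False
  have \<Omega>m: "\<Omega> \<in> sets lebesgue" using \<Omega> by simp
  from False obtain x0 where "x0 \<in> \<Omega>" by blast
  then obtain e where e: "e > 0" "cball x0 e \<subseteq> \<Omega>" using \<Omega>(1) open_contains_cball by blast
  define a0 b0 where "a0 = x0 - e" and "b0 = x0 + e"
  have ab0: "a0 < b0" "{a0..b0} \<subseteq> \<Omega>" using e by (auto simp: a0_def b0_def cball_eq_atLeastAtMost)
  \<comment> \<open>The fixed bump of positive integral on an interval inside \<Omega>; it
    determines the constant \<open>c\<close>.\<close>
  define \<psi>0 where "\<psi>0 = (\<lambda>x. expmol 1 1 (x - a0) * expmol 1 1 (b0 - x))"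
  have \<psi>0: "\<psi>0 \<in> bump_family 1 a0 b0" unfolding \<psi>0_def by (rule bump_family.base)
  have s0: "smooth \<psi>0" using bump_family_smooth[OF \<psi>0] by simp
  define I where "I \<psi> = (LINT x|lebesgue. \<psi> x)" for \<psi> :: "real \<Rightarrow> real"
  have int: "integrable lebesgue \<psi> \<and> I \<psi> = integral {A..B} \<psi>"
    if "continuous_on UNIV \<psi>" "\<And>x. x \<notin> {A..B} \<Longrightarrow> \<psi> x = 0" for \<psi> A B
  proof -
    have ai: "\<psi> absolutely_integrable_on {A..B}"
      by (intro absolutely_integrable_continuous_real continuous_on_subset[OF that(1)]) simp
    moreover have "(\<lambda>x. indicat_real {A..B} x *\<^sub>R \<psi> x) = \<psi>" using that(2) by (intro ext) (auto simp: indicator_def)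
    ultimately show ?thesis
      using set_lebesgue_integral_eq_integral(2)[OF ai] unfolding I_def set_integrable_def set_lebesgue_integral_def by simp
  qed
  have I0: "I \<psi>0 > 0"
  proof -
    have nn: "0 \<le> \<psi>0 x" for x using expmol_le_1[of 1] by (simp add: \<psi>0_def)
    have *: "integrable lebesgue \<psi>0" "I \<psi>0 = integral {a0..b0} \<psi>0"
      using int[of \<psi>0 a0 b0, OF smooth_continuous[OF s0]] bump_family_zero[OF \<psi>0]
      by (metis greaterThanLessThan_subseteq_atLeastAtMost_iff order_refl subsetD)+
    have "I \<psi>0 \<noteq> 0"
    proof
      assume "I \<psi>0 = 0"
      then have "AE x in lebesgue. \<psi>0 x = 0"
        using integral_nonneg_eq_0_iff_AE[OF *(1)] nn by (simp add: I_def)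
      then have "AE x in lebesgue. x \<notin> {a0<..<b0}" by eventually_elim (auto simp: \<psi>0_def expmol_def)
      then obtain N where N: "negligible N" "\<And>x. x \<notin> N \<Longrightarrow> x \<notin> {a0<..<b0}" using AE_negligibleE by blast
      then have "{a0<..<b0} \<subseteq> N" by blast
      then have "negligible {a0<..<b0}" using N(1) negligible_subset by blast
      then show False using ab0(1) open_not_negligible[of "{a0<..<b0}"] by auto
    qed
    moreover have "I \<psi>0 \<ge> 0" unfolding I_def using nn by simp
    ultimately show ?thesis by simp
  qed
  have test_int: "integrable (lebesgue_on \<Omega>) (\<lambda>x. complex_of_real (\<psi> x) * f x)"
    if "\<psi> \<in> bump_family s a b" "{a..b} \<subseteq> \<Omega>" "s > 0" "loc_integrable \<Omega> f" for \<psi> s a b f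
    by (rule test_mult_integrable[OF that(4) \<Omega>m compact_Icc that(2) smooth_continuous[OF bump_family_smooth[OF that(1,3)]]])
       (use bump_family_zero[OF that(1)] in auto)
  define J where "J \<psi> = (LINT x|lebesgue_on \<Omega>. complex_of_real (\<psi> x) * F x)" for \<psi>
  define c where "c = J \<psi>0 / I \<psi>0"
  have main: "J \<psi> = I \<psi> * c" if \<psi>: "\<psi> \<in> bump_family s a b" "{a..b} \<subseteq> \<Omega>" "s > 0" for \<psi> s a b
  proof -
    have sm: "smooth \<psi>" using bump_family_smooth[OF \<psi>(1,3)] .
    define r where "r = - (I \<psi> / I \<psi>0)"
    define \<xi> where "\<xi> x = \<psi> x + r * \<psi>0 x" for x
    have sc: "smooth \<xi>" unfolding \<xi>_def by (rule smooth_lincomb[OF sm s0])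
    \<comment> \<open>The hull of both supports, which lies in \<Omega> because \<Omega> is an
      interval. For a \<ge> b the bump on (a, b) is zero and the end points a, b may lie outside
      \<Omega>, hence the case distinction.\<close>
    define A B where "A = (if a < b then min a a0 else a0)" and "B = (if a < b then max b b0 else b0)"
    have AB: "A < B" "{A..B} \<subseteq> \<Omega>"
    proof -
      show "A < B" using ab0 by (auto simp: A_def B_def)
      have "a0 \<in> \<Omega>" "b0 \<in> \<Omega>" "a < b \<Longrightarrow> a \<in> \<Omega>" "a < b \<Longrightarrow> b \<in> \<Omega>" using \<psi>(2) ab0 by auto
      then have "A \<in> \<Omega>" "B \<in> \<Omega>" unfolding A_def B_def min_def max_def by presburger+
      then show "{A..B} \<subseteq> \<Omega>" using mem_is_interval_1_I[OF \<Omega>(2)] by (meson atLeastAtMost_iff subsetI)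
    qed
    have "{a<..<b} \<subseteq> {A<..<B}" "{a0<..<b0} \<subseteq> {A<..<B}" by (auto simp: A_def B_def)
    then have z: "\<psi> x = 0" "\<psi>0 x = 0" if "x \<notin> {A<..<B}" for x
      using bump_family_zero[OF \<psi>(1), of x] bump_family_zero[OF \<psi>0, of x] that by blast+
    have z': "\<psi> x = 0" "\<psi>0 x = 0" if "x \<notin> {A..B}" for x
      using z[of x] that by (meson atLeastAtMost_iff greaterThanLessThan_iff less_imp_le)+
    have "I \<psi> = integral {A..B} \<psi>" "I \<psi>0 = integral {A..B} \<psi>0" and int2: "integrable lebesgue \<psi>" "integrable lebesgue \<psi>0"
      using int[OF smooth_continuous[OF sm] z'(1)] int[OF smooth_continuous[OF s0] z'(2)] by blast+
    moreover have "integral {A..B} \<xi> = integral {A..B} \<psi> + r * integral {A..B} \<psi>0"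
      unfolding \<xi>_def
      using continuous_imp_integrable_real smooth_continuous[OF sm] smooth_continuous[OF s0]
      by (subst integral_add) (auto intro!: integrable_continuous_real continuous_intros)
    ultimately have \<xi>0: "integral {A..B} \<xi> = 0" using I0 by (simp add: r_def)
    obtain \<Phi> where \<Phi>: "\<And>x. (\<Phi> has_field_derivative \<xi> x) (at x)"
        "\<And>a b. a \<le> b \<Longrightarrow> \<Phi> b - \<Phi> a = integral {a..b} \<xi>" "\<Phi> A = 0"
      using real_antiderivative[OF smooth_continuous[OF sc]] by metis
    have "\<Phi> x = 0" if "x \<notin> {A..B}" for x
    proof (cases "x < A")
      case True
      have "integral {x..A} \<xi> = integral {x..A} (\<lambda>_. 0)"
        by (rule integral_cong) (use z AB in \<open>auto simp: \<xi>_def\<close>)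
      then show ?thesis using \<Phi>(2)[of x A] \<Phi>(3) True by simp
    next
      case False
      have "integral {B..x} \<xi> = integral {B..x} (\<lambda>_. 0)"
        by (rule integral_cong) (use z AB in \<open>auto simp: \<xi>_def\<close>)
      then show ?thesis using \<Phi>(2)[of B x] \<Phi>(2)[of A B] \<Phi>(3) \<xi>0 False that AB by simp
    qed
    then have tf: "test_fun \<Omega> \<Phi>" using smooth_antideriv[OF sc \<Phi>(1)] AB(2) by (intro test_funI[where a=A and b=B]) auto
    have "deriv \<Phi> = \<xi>" using \<Phi>(1) by (auto intro!: DERIV_imp_deriv)
    then have "0 = (LINT x|lebesgue_on \<Omega>. complex_of_real (\<xi> x) * F x)" using 0[OF tf] by simp
    also have "\<dots> = (LINT x|lebesgue_on \<Omega>. complex_of_real (\<psi> x) * F x + complex_of_real r * (complex_of_real (\<psi>0 x) * F x))"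
      by (simp add: \<xi>_def algebra_simps)
    also have "\<dots> = J \<psi> + complex_of_real r * J \<psi>0"
      unfolding J_def using test_int[OF \<psi> F] test_int[OF \<psi>0 ab0(2) _ F]
      by (subst Bochner_Integration.integral_add) auto
    finally show ?thesis using I0 by (simp add: c_def r_def field_simps)
  qed
  have "AE x in lebesgue_on \<Omega>. F x - c = 0"
  proof (rule fundamental_lemma[OF \<Omega>(1)])
    have lc: "loc_integrable \<Omega> (\<lambda>x. c)" by (intro loc_integrable_continuous \<Omega>m continuous_intros)
    show "loc_integrable \<Omega> (\<lambda>x. F x - c)"
      using F lc unfolding loc_integrable_def by (auto intro: set_integral_diff)
    fix s a b \<psi> assume \<psi>: "s > 0" "{a..b} \<subseteq> \<Omega>" "\<psi> \<in> bump_family s a b"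
    have z: "\<psi> x = 0" if "x \<notin> {a..b}" for x using bump_family_zero[OF \<psi>(3), of x] that by auto
    have ii: "integrable lebesgue \<psi>"
      using int[of \<psi> a b] z smooth_continuous[OF bump_family_smooth[OF \<psi>(3,1)]] by auto
    have "(LINT x|lebesgue_on \<Omega>. complex_of_real (\<psi> x) * (F x - c)) =
       (LINT x|lebesgue_on \<Omega>. complex_of_real (\<psi> x) * F x - complex_of_real (\<psi> x) * c)"
      by (simp add: algebra_simps)
    also have "\<dots> = J \<psi> - (LINT x|lebesgue_on \<Omega>. complex_of_real (\<psi> x) * c)"
      unfolding J_def using test_int[OF \<psi>(3,2,1) F] test_int[OF \<psi>(3,2,1) lc]
      by (rule Bochner_Integration.integral_diff)
    also have "(LINT x|lebesgue_on \<Omega>. complex_of_real (\<psi> x) * c) = I \<psi> * c"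
    proof -
      have "(LINT x|lebesgue_on \<Omega>. complex_of_real (\<psi> x) * c) = (LINT x|lebesgue. complex_of_real (\<psi> x) * c)"
        unfolding integral_lebesgue_on_eq[OF \<Omega>m]
      proof (intro Bochner_Integration.integral_cong refl)
        fix x
        have "\<psi> x = 0" if "x \<notin> \<Omega>" using z that \<psi>(2) by blast
        then show "(if x \<in> \<Omega> then complex_of_real (\<psi> x) * c else 0) = complex_of_real (\<psi> x) * c" by simp
      qed
      then show ?thesis by (simp add: I_def integral_complex_of_real)
    qed
    also have "J \<psi> - I \<psi> * c = 0" using main[OF \<psi>(3,2,1)] by simp
    finally show "(LINT x|lebesgue_on \<Omega>. complex_of_real (\<psi> x) * (F x - c)) = 0" .
  qed
  then show ?thesis by (auto intro!: exI[of _ c])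
qed

section \<open>Weak derivatives and absolutely continuous representatives\<close>

lemma test_fun_mult_integrable:
  assumes "test_fun \<Omega> \<phi>" "loc_integrable \<Omega> f" "\<Omega> \<in> sets lebesgue"
  shows "integrable (lebesgue_on \<Omega>) (\<lambda>x. complex_of_real (\<phi> x) * f x)"
proof -
  define K where "K = closure {x. \<phi> x \<noteq> 0}"
  have K: "compact K" "K \<subseteq> \<Omega>" and sm: "smooth \<phi>" using assms(1) by (auto simp: test_fun_iff K_def)
  have "\<phi> x = 0" if "x \<notin> K" for x
    using that closure_subset[of "{x. \<phi> x \<noteq> 0}"] unfolding K_def by auto
  then show ?thesis by (rule test_mult_integrable[OF assms(2,3) K smooth_continuous[OF sm]])
qed

lemma test_integral_lincomb:
  assumes "test_fun \<Omega> \<phi>" "loc_integrable \<Omega> f" "loc_integrable \<Omega> g" "\<Omega> \<in> sets lebesgue"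
  shows "(LINT x|lebesgue_on \<Omega>. complex_of_real (\<phi> x) * (f x + c * g x)) =
    (LINT x|lebesgue_on \<Omega>. complex_of_real (\<phi> x) * f x) + c * (LINT x|lebesgue_on \<Omega>. complex_of_real (\<phi> x) * g x)"
proof -
  have "(LINT x|lebesgue_on \<Omega>. complex_of_real (\<phi> x) * (f x + c * g x)) =
     (LINT x|lebesgue_on \<Omega>. complex_of_real (\<phi> x) * f x + c * (complex_of_real (\<phi> x) * g x))"
    by (simp add: algebra_simps)
  also have "\<dots> = (LINT x|lebesgue_on \<Omega>. complex_of_real (\<phi> x) * f x) + (LINT x|lebesgue_on \<Omega>. c * (complex_of_real (\<phi> x) * g x))"
    by (intro Bochner_Integration.integral_add integrable_mult_right test_fun_mult_integrable assms)
  finally show ?thesis by simp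
qed

lemma loc_integrable_lincomb:
  assumes "loc_integrable \<Omega> f" "loc_integrable \<Omega> g"
  shows "loc_integrable \<Omega> (\<lambda>x. f x + c * g x)"
  using assms unfolding loc_integrable_def by (auto intro!: set_integral_add)

lemma weak_deriv_lincomb:
  assumes \<Omega>: "\<Omega> \<in> sets lebesgue" and f: "weak_deriv \<Omega> j f f'" and g: "weak_deriv \<Omega> j g g'"
  shows "weak_deriv \<Omega> j (\<lambda>x. f x + c * g x) (\<lambda>x. f' x + c * g' x)"
  unfolding weak_deriv_def
proof (intro conjI allI impI)
  have l: "loc_integrable \<Omega> f" "loc_integrable \<Omega> f'" "loc_integrable \<Omega> g" "loc_integrable \<Omega> g'"
    using f g by (auto simp: weak_deriv_def)
  then show "loc_integrable \<Omega> (\<lambda>x. f x + c * g x)" "loc_integrable \<Omega> (\<lambda>x. f' x + c * g' x)"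
    by (intro loc_integrable_lincomb; simp)+
  fix \<phi> assume \<phi>: "test_fun \<Omega> \<phi>"
  have tj: "test_fun \<Omega> ((deriv ^^ j) \<phi>)"
    by (induction j) (use \<phi> test_fun_deriv(1) in auto)
  show "(LINT x|lebesgue_on \<Omega>. complex_of_real ((deriv ^^ j) \<phi> x) * (f x + c * g x)) =
      (-1) ^ j * (LINT x|lebesgue_on \<Omega>. complex_of_real (\<phi> x) * (f' x + c * g' x))"
    unfolding test_integral_lincomb[OF tj l(1,3) \<Omega>] test_integral_lincomb[OF \<phi> l(2,4) \<Omega>]
    using f g \<phi> by (simp add: weak_deriv_def algebra_simps)
qed

lemma sobolev_lincomb:
  assumes \<Omega>: "\<Omega> \<in> sets lebesgue" and f: "f \<in> sobolev k \<Omega>" and g: "g \<in> sobolev k \<Omega>"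
  shows "(\<lambda>x. f x + c * g x) \<in> sobolev k \<Omega>"
  unfolding sobolev_def
proof (intro CollectI conjI allI impI)
  show "(\<lambda>x. f x + c * g x) \<in> carrier (L2 (lebesgue_on \<Omega>))"
    using f g by (intro L2_add L2_scale) (auto simp: sobolev_def)
  fix j assume "j \<le> k"
  then obtain f' g' where "f' \<in> carrier (L2 (lebesgue_on \<Omega>))" "weak_deriv \<Omega> j f f'"
     "g' \<in> carrier (L2 (lebesgue_on \<Omega>))" "weak_deriv \<Omega> j g g'"
    using f g unfolding sobolev_def by blast
  then show "\<exists>h\<in>carrier (L2 (lebesgue_on \<Omega>)). weak_deriv \<Omega> j (\<lambda>x. f x + c * g x) h"
    by (intro bexI[of _ "\<lambda>x. f' x + c * g' x"] weak_deriv_lincomb \<Omega> L2_add L2_scale)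
qed

lemma weak_deriv_zero: "weak_deriv \<Omega> j (\<lambda>x. 0) (\<lambda>x. 0)"
  by (simp add: weak_deriv_def loc_integrable_def set_integrable_def)

lemma sobolev_zero: "(\<lambda>x. 0) \<in> sobolev k \<Omega>"
  unfolding sobolev_def by (auto intro!: bexI[of _ "\<lambda>x. 0"] weak_deriv_zero)

lemma sobolev_scale: "\<Omega> \<in> sets lebesgue \<Longrightarrow> g \<in> sobolev k \<Omega> \<Longrightarrow> (\<lambda>x. c * g x) \<in> sobolev k \<Omega>"
  using sobolev_lincomb[OF _ sobolev_zero, of \<Omega> g k c] by simp

lemma weak_deriv_scale: "\<Omega> \<in> sets lebesgue \<Longrightarrow> weak_deriv \<Omega> j g g' \<Longrightarrow> weak_deriv \<Omega> j (\<lambda>x. c * g x) (\<lambda>x. c * g' x)"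
  using weak_deriv_lincomb[OF _ weak_deriv_zero, of \<Omega> j g g' c] by simp

lemma weak_deriv_unique:
  assumes \<Omega>: "open \<Omega>" and "weak_deriv \<Omega> j f g" "weak_deriv \<Omega> j f h"
  shows "AE x in lebesgue_on \<Omega>. g x = h x"
proof -
  have \<Omega>m: "\<Omega> \<in> sets lebesgue" using \<Omega> by simp
  have l: "loc_integrable \<Omega> g" "loc_integrable \<Omega> h" using assms by (auto simp: weak_deriv_def)
  have "AE x in lebesgue_on \<Omega>. g x + (-1) * h x = 0"
  proof (rule fundamental_lemma[OF \<Omega> loc_integrable_lincomb[OF l]])
    fix s a b \<phi> assume "s > 0" "{a..b} \<subseteq> \<Omega>" "\<phi> \<in> bump_family s a b"
    then have \<phi>: "test_fun \<Omega> \<phi>" using bump_family_test_fun by blast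
    have "(LINT x|lebesgue_on \<Omega>. complex_of_real ((deriv ^^ j) \<phi> x) * f x) = (-1) ^ j * (LINT x|lebesgue_on \<Omega>. complex_of_real (\<phi> x) * k x)"
      if "weak_deriv \<Omega> j f k" for k
      using that \<phi> unfolding weak_deriv_def by blast
    from this[OF assms(2)] this[OF assms(3)] show "(LINT x|lebesgue_on \<Omega>. complex_of_real (\<phi> x) * (g x + (-1) * h x)) = 0"
      unfolding test_integral_lincomb[OF \<phi> l \<Omega>m] by simp
  qed
  then show ?thesis by eventually_elim simp
qed

text \<open>Replaces weak derivatives by \<open>prim\<close>: two applications of du Bois-Reymond
  identify first the weak derivative and then the function itself, up to constants, with
  antiderivatives. These are defined on the whole line because \<open>h\<close> is extended by 0,
  but belong to L^2 only on \<Omega>.\<close>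

lemma sobolev2_prim:
  assumes \<Omega>: "open \<Omega>" "is_interval \<Omega>" and f: "f \<in> sobolev 2 \<Omega>" and h: "weak_deriv \<Omega> 2 f h"
  obtains F p where "prim F p" "prim p (\<lambda>x. if x \<in> \<Omega> then h x else 0)"
    "AE x in lebesgue_on \<Omega>. f x = F x" "p \<in> carrier (L2 (lebesgue_on \<Omega>))" "h \<in> carrier (L2 (lebesgue_on \<Omega>))"
    "F \<in> carrier (L2 (lebesgue_on \<Omega>))"
proof -
  have \<Omega>m: "\<Omega> \<in> sets lebesgue" using \<Omega> by simp
  let ?L = "carrier (L2 (lebesgue_on \<Omega>))"
  have "(1::nat) \<le> 2" by simp
  then obtain g1 g2 where g: "g1 \<in> ?L" "weak_deriv \<Omega> 1 f g1" "g2 \<in> ?L" "weak_deriv \<Omega> 2 f g2"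
    using f unfolding sobolev_def by blast
  have hg: "AE x in lebesgue_on \<Omega>. h x = g2 x" by (rule weak_deriv_unique[OF \<Omega>(1) h g(4)])
  have hL: "h \<in> ?L" by (rule L2_cong_AE[OF \<Omega>m g(3) hg])
  let ?h = "\<lambda>x. if x \<in> \<Omega> then h x else 0"
  obtain P where P: "prim P ?h" using prim_exists[OF L2_absolutely_integrable[OF \<Omega>m hL], of 0 0] by blast
  have lP: "loc_integrable \<Omega> P" using prim_loc_integrable[OF P \<Omega>m] by simp
  have lg: "loc_integrable \<Omega> g1" and lf: "loc_integrable \<Omega> f" using g(2) by (auto simp: weak_deriv_def)
  \<comment> \<open>Both the second weak derivative of \<open>f\<close> and the derivative of
    \<open>P\<close> are \<open>h\<close> on \<Omega>, so g1 - P annihilates all derivatives of test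
    functions.\<close>
  have "\<exists>c. AE x in lebesgue_on \<Omega>. g1 x + (-1) * P x = c"
  proof (rule du_Bois_Reymond[OF \<Omega> loc_integrable_lincomb[OF lg lP]])
    fix \<phi> assume \<phi>: "test_fun \<Omega> \<phi>"
    have "(LINT x|lebesgue_on \<Omega>. complex_of_real ((deriv ^^ 1) (deriv \<phi>) x) * f x) = (-1) ^ 1 * (LINT x|lebesgue_on \<Omega>. complex_of_real (deriv \<phi> x) * g1 x)"
      using g(2) test_fun_deriv(1)[OF \<phi>] unfolding weak_deriv_def by blast
    moreover have "(LINT x|lebesgue_on \<Omega>. complex_of_real ((deriv ^^ 2) \<phi> x) * f x) = (-1) ^ 2 * (LINT x|lebesgue_on \<Omega>. complex_of_real (\<phi> x) * h x)"
      using h \<phi> unfolding weak_deriv_def by blast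
    moreover have "(LINT x|lebesgue_on \<Omega>. complex_of_real (deriv \<phi> x) * P x) = - (LINT x|lebesgue_on \<Omega>. complex_of_real (\<phi> x) * ?h x)"
      by (rule prim_ibp_test[OF P \<phi> \<Omega>m])
    moreover have "(LINT x|lebesgue_on \<Omega>. complex_of_real (\<phi> x) * ?h x) = (LINT x|lebesgue_on \<Omega>. complex_of_real (\<phi> x) * h x)"
      by (intro Bochner_Integration.integral_cong refl) (auto simp: space_restrict_space)
    ultimately show "(LINT x|lebesgue_on \<Omega>. complex_of_real (deriv \<phi> x) * (g1 x + (-1) * P x)) = 0"
      unfolding test_integral_lincomb[OF test_fun_deriv(1)[OF \<phi>] lg lP \<Omega>m]
      by (simp add: numeral_2_eq_2) (metis add.right_inverse)
  qed
  then obtain c1 where c1: "AE x in lebesgue_on \<Omega>. g1 x + (-1) * P x = c1" by blast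
  define p where "p x = P x + c1" for x
  have p: "prim p ?h" using prim_add[OF P prim_const[of c1]] by (simp add: p_def[abs_def])
  have gp: "AE x in lebesgue_on \<Omega>. p x = g1 x" using c1 by eventually_elim (auto simp: p_def)
  have pL: "p \<in> ?L" by (rule L2_cong_AE[OF \<Omega>m g(1) gp])
  have "p absolutely_integrable_on {a..b}" for a b
    by (intro absolutely_integrable_continuous_real prim_continuous[OF p])
  then obtain F0 where F0: "prim F0 p" using prim_exists[of p 0 0] by blast
  have lF: "loc_integrable \<Omega> F0" using prim_loc_integrable[OF F0 \<Omega>m] by simp
  have "\<exists>c. AE x in lebesgue_on \<Omega>. f x + (-1) * F0 x = c"
  proof (rule du_Bois_Reymond[OF \<Omega> loc_integrable_lincomb[OF lf lF]])
    fix \<phi> assume \<phi>: "test_fun \<Omega> \<phi>"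
    have "(LINT x|lebesgue_on \<Omega>. complex_of_real ((deriv ^^ 1) \<phi> x) * f x) = (-1) ^ 1 * (LINT x|lebesgue_on \<Omega>. complex_of_real (\<phi> x) * g1 x)"
      using g(2) \<phi> unfolding weak_deriv_def by blast
    moreover have "(LINT x|lebesgue_on \<Omega>. complex_of_real (deriv \<phi> x) * F0 x) = - (LINT x|lebesgue_on \<Omega>. complex_of_real (\<phi> x) * p x)"
      by (rule prim_ibp_test[OF F0 \<phi> \<Omega>m])
    moreover have "(LINT x|lebesgue_on \<Omega>. complex_of_real (\<phi> x) * p x) = (LINT x|lebesgue_on \<Omega>. complex_of_real (\<phi> x) * g1 x)"
      by (intro integral_cong_AE_lebesgue_on \<Omega>m) (use gp in eventually_elim, simp)
    ultimately show "(LINT x|lebesgue_on \<Omega>. complex_of_real (deriv \<phi> x) * (f x + (-1) * F0 x)) = 0"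
      unfolding test_integral_lincomb[OF test_fun_deriv(1)[OF \<phi>] lf lF \<Omega>m] by simp
  qed
  then obtain c where c: "AE x in lebesgue_on \<Omega>. f x + (-1) * F0 x = c" by blast
  define F where "F x = F0 x + c" for x
  have F: "prim F p" using prim_add[OF F0 prim_const[of c]] by (simp add: F_def[abs_def])
  have fF: "AE x in lebesgue_on \<Omega>. f x = F x" using c by eventually_elim (auto simp: F_def)
  have "f \<in> ?L" using f by (simp add: sobolev_def)
  then have "F \<in> ?L" by (rule L2_cong_AE[OF \<Omega>m]) (use fF in eventually_elim, simp)
  then show thesis using that F p fF pL hL by blast
qed

lemma sobolev2I:
  assumes \<Omega>: "\<Omega> \<in> sets lebesgue" and "prim F p" "prim p h"
    and L: "F \<in> carrier (L2 (lebesgue_on \<Omega>))" "p \<in> carrier (L2 (lebesgue_on \<Omega>))" "h \<in> carrier (L2 (lebesgue_on \<Omega>))"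
  shows "F \<in> sobolev 2 \<Omega>" "weak_deriv \<Omega> 2 F h"
proof -
  show h: "weak_deriv \<Omega> 2 F h" by (rule prim_weak_deriv2[OF assms(2,3) \<Omega>])
  have "\<exists>g\<in>carrier (L2 (lebesgue_on \<Omega>)). weak_deriv \<Omega> j F g" if "j \<le> 2" for j
  proof -
    consider "j = 0" | "j = 1" | "j = 2" using \<open>j \<le> 2\<close> by linarith
    then show ?thesis
    proof cases
      case 1 then show ?thesis using L weak_deriv_0[OF prim_loc_integrable(1)[OF assms(2) \<Omega>]] by blast
    next
      case 2 then show ?thesis using L prim_weak_deriv[OF assms(2) \<Omega>] by blast
    next
      case 3 then show ?thesis using L h by blast
    qed
  qed
  then show "F \<in> sobolev 2 \<Omega>" using L(1) by (simp add: sobolev_def)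
qed

text \<open>Links the continuous function in \<open>vanishes_at_ends\<close> with the absolutely
  continuous representative: they agree up to the end points, so the latter satisfies the Dirichlet
  conditions.\<close>

lemma continuous_AE_eq:
  fixes F G :: "real \<Rightarrow> complex"
  assumes ab: "a < b" and c: "continuous_on {a..b} F" "continuous_on {a..b} G"
    and ae: "AE x in lebesgue_on {a<..<b}. F x = G x" and x: "x \<in> {a..b}"
  shows "F x = G x"
proof -
  let ?D = "\<lambda>x. F x - G x"
  have cD: "continuous_on {a..b} ?D" by (intro continuous_intros c)
  have "open ({a<..<b} \<inter> ?D -` (- {0}))"
    by (intro continuous_open_preimage continuous_on_subset[OF cD]) auto
  moreover have "negligible ({a<..<b} \<inter> ?D -` (- {0}))"
  proof -
    obtain N where N: "negligible N" "\<And>x. x \<notin> N \<Longrightarrow> x \<in> {a<..<b} \<longrightarrow> F x = G x"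
      using AE_negligibleE ae by (subst (asm) AE_lebesgue_on_iff) auto
    have "{a<..<b} \<inter> ?D -` (- {0}) \<subseteq> N" using N(2) by fastforce
    then show ?thesis using N(1) negligible_subset by blast
  qed
  ultimately have "{a<..<b} \<inter> ?D -` (- {0}) = {}" using open_not_negligible by blast
  then have z: "?D y = 0" if "y \<in> {a<..<b}" for y using that by blast
  have "?D x = 0"
    by (rule continuous_constant_on_closure[of "{a<..<b}" ?D]) (use ab cD x z in \<open>auto simp: closure_greaterThanLessThan\<close>)
  then show ?thesis by simp
qed

subsection \<open>Cut-off functions and the quadratic form\<close>

text \<open>The outer square makes the first derivative vanish at the ends too, so that cutting off
  and extending by 0 leads from W^{2,2} of the interval to W^{2,2} of the line. A polynomial keeps
  all derivatives explicit; they are of order 1/m and 1/m^2 on [-m, m].\<close>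

definition cutoff :: "real \<Rightarrow> real \<Rightarrow> real" where "cutoff m x = (1 - (x / m)\<^sup>2)\<^sup>2"
definition cutoff1 :: "real \<Rightarrow> real \<Rightarrow> real" where "cutoff1 m x = - (4 * x / m\<^sup>2) * (1 - (x / m)\<^sup>2)"
definition cutoff2 :: "real \<Rightarrow> real \<Rightarrow> real" where "cutoff2 m x = (12 * (x / m)\<^sup>2 - 4) / m\<^sup>2"

lemma cutoff_deriv:
  assumes "m > 0"
  shows "(cutoff m has_field_derivative cutoff1 m x) (at x)"
    and "(cutoff1 m has_field_derivative cutoff2 m x) (at x)"
  using assms unfolding cutoff_def[abs_def] cutoff1_def[abs_def] cutoff2_def
  by (auto intro!: derivative_eq_intros simp: power2_eq_square field_simps)

lemma cutoff_continuous:
  "continuous_on S (cutoff m)" "continuous_on S (cutoff1 m)" "continuous_on S (cutoff2 m)"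
  unfolding cutoff_def cutoff1_def cutoff2_def divide_inverse by (intro continuous_intros)+

lemma prim_cutoff:
  assumes "m > 0"
  shows "prim (\<lambda>x. complex_of_real (cutoff m x)) (\<lambda>x. complex_of_real (cutoff1 m x))"
    and "prim (\<lambda>x. complex_of_real (cutoff1 m x)) (\<lambda>x. complex_of_real (cutoff2 m x))"
  using cutoff_deriv[OF assms]
  by (auto intro!: prim_of_deriv has_vector_derivative_of_real continuous_intros cutoff_continuous
      simp: has_real_derivative_iff_has_vector_derivative)

lemma cutoff_bounds:
  assumes "m > 0" "x \<in> {-m..m}"
  shows "0 \<le> cutoff m x" "cutoff m x \<le> 1" "\<bar>cutoff1 m x\<bar> \<le> 4 / m" "\<bar>cutoff2 m x\<bar> \<le> 8 / m\<^sup>2"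
proof -
  define y where "y = (x / m)\<^sup>2"
  have x: "\<bar>x / m\<bar> \<le> 1" using assms by (auto simp: abs_le_iff field_simps)
  then have y: "0 \<le> y" "y \<le> 1" by (auto simp: y_def abs_square_le_1)
  show "0 \<le> cutoff m x" by (simp add: cutoff_def)
  show "cutoff m x \<le> 1" unfolding cutoff_def y_def[symmetric] using y by (simp add: power_le_one)
  have "cutoff1 m x = - (4 / m) * ((x / m) * (1 - y))" using assms by (simp add: cutoff1_def y_def power2_eq_square)
  then have "\<bar>cutoff1 m x\<bar> = 4 / m * \<bar>(x / m) * (1 - y)\<bar>" using assms(1) by (simp add: abs_mult)
  moreover have "\<bar>(x / m) * (1 - y)\<bar> \<le> 1 * 1" unfolding abs_mult by (intro mult_mono) (use x y in auto)
  ultimately show "\<bar>cutoff1 m x\<bar> \<le> 4 / m"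
    using mult_left_mono[of "\<bar>(x / m) * (1 - y)\<bar>" 1 "4 / m"] assms(1) by simp
  have "\<bar>12 * y - 4\<bar> \<le> 8" using y by (simp add: abs_le_iff)
  then show "\<bar>cutoff2 m x\<bar> \<le> 8 / m\<^sup>2" using assms by (simp add: cutoff2_def y_def divide_right_mono)
qed

lemma cutoff_ends: "m > 0 \<Longrightarrow> cutoff m m = 0" "m > 0 \<Longrightarrow> cutoff m (-m) = 0"
    "m > 0 \<Longrightarrow> cutoff1 m m = 0" "m > 0 \<Longrightarrow> cutoff1 m (-m) = 0"
  by (simp_all add: cutoff_def cutoff1_def)

text \<open>On the inner half the cut-off is at least (3/4)^2, and 4 (3/4)^4 = 81/64.\<close>

lemma cutoff_lower:
  assumes "m > 0" "\<bar>x\<bar> \<le> m / 2" shows "1 \<le> 4 * (cutoff m x)\<^sup>2"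
proof -
  have "\<bar>x / m\<bar> \<le> 1/2" using assms by (auto simp: abs_le_iff field_simps)
  then have "(x / m)\<^sup>2 \<le> (1/2)\<^sup>2" by (metis abs_ge_zero power2_abs power_mono)
  then have "3/4 \<le> 1 - (x / m)\<^sup>2" by (simp add: power2_eq_square)
  then have "(3/4)\<^sup>2 \<le> cutoff m x" unfolding cutoff_def by (intro power_mono) auto
  then have "((3/4)\<^sup>2)\<^sup>2 \<le> (cutoff m x)\<^sup>2" by (intro power_mono) auto
  then show ?thesis by (simp add: power2_eq_square)
qed

lemma cutoff_tendsto: "(\<lambda>n. cutoff (real n) x) \<longlonglongrightarrow> 1"
proof -
  have "(\<lambda>n. x / real n) \<longlonglongrightarrow> 0" by (rule lim_const_over_n)
  then have "(\<lambda>n. (1 - (x / real n)\<^sup>2)\<^sup>2) \<longlonglongrightarrow> (1 - 0\<^sup>2)\<^sup>2" by (intro tendsto_intros)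
  then show ?thesis by (simp add: cutoff_def)
qed

lemma quadratic_form_interval:
  assumes "prim F p" "prim p (\<lambda>x. if x \<in> {a<..<b} then h x else 0)" "F a = 0" "F b = 0" "a \<le> b"
    and L: "F \<in> carrier (L2 (lebesgue_on {a<..<b}))" "p \<in> carrier (L2 (lebesgue_on {a<..<b}))" "h \<in> carrier (L2 (lebesgue_on {a<..<b}))"
  shows "(LINT x|lebesgue_on {a<..<b}. - h x * cnj (F x)) = complex_of_real ((hnorm (L2 (lebesgue_on {a<..<b})) p)\<^sup>2)"
proof -
  let ?M = "lebesgue_on {a<..<b}" and ?h = "\<lambda>x. if x \<in> {a<..<b} then h x else 0"
  have P: "prim (\<lambda>x. p x * cnj (F x)) (\<lambda>x. ?h x * cnj (F x) + p x * cnj (p x))"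
    by (rule prim_mult[OF assms(2) prim_cnj[OF assms(1)]])
  have i: "integrable ?M (\<lambda>x. h x * cnj (F x))" "integrable ?M (\<lambda>x. p x * cnj (p x))"
    by (rule L2_mult_integrable[OF L(3) L2_cnj[OF L(1)]], rule L2_mult_integrable[OF L(2) L2_cnj[OF L(2)]])
  then have ii: "integrable ?M (\<lambda>x. ?h x * cnj (F x) + p x * cnj (p x))"
    by (subst Bochner_Integration.integrable_cong[where g="\<lambda>x. h x * cnj (F x) + p x * cnj (p x)"]) (auto simp: space_restrict_space)
  have "(LINT x|?M. h x * cnj (F x)) + (LINT x|?M. p x * cnj (p x)) = (LINT x|?M. ?h x * cnj (F x) + p x * cnj (p x))"
    unfolding Bochner_Integration.integral_add[OF i, symmetric]
    by (intro Bochner_Integration.integral_cong) (auto simp: space_restrict_space)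
  also have "\<dots> = integral {a<..<b} (\<lambda>x. ?h x * cnj (F x) + p x * cnj (p x))"
    by (rule lebesgue_integral_eq_integral[OF ii]) simp
  also have "\<dots> = integral {a..b} (\<lambda>x. ?h x * cnj (F x) + p x * cnj (p x))"
    by (simp only: integral_open_interval_real)
  also have "\<dots> = 0" using primD(2)[OF P assms(5)] assms(3,4) by simp
  finally have "(LINT x|?M. - h x * cnj (F x)) = (LINT x|?M. p x * cnj (p x))"
    by (simp add: neg_eq_iff_add_eq_0)
  also have "\<dots> = complex_of_real ((hnorm (L2 ?M) p)\<^sup>2)"
    using inn_L2_self[of ?M p] by (simp add: L2_simps hnorm_L2_sq)
  finally show ?thesis .
qed

text \<open>No decay at infinity is at hand, so the boundary terms are removed by the cut-off. Its
  derivative is at most 4/m, and the extra term vanishes in the limit by dominated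
  convergence.\<close>

lemma quadratic_form_line:
  assumes F: "prim F p" and p: "prim p h"
    and L: "F \<in> carrier (L2 lebesgue)" "p \<in> carrier (L2 lebesgue)" "h \<in> carrier (L2 lebesgue)"
  shows "(LINT x|lebesgue. - h x * cnj (F x)) = complex_of_real ((hnorm (L2 lebesgue) p)\<^sup>2)"
proof -
  let ?k = "\<lambda>x. h x * cnj (F x) + p x * cnj (p x)"
  \<comment> \<open>\<open>Suc n\<close> keeps the radius at least 1: it is positive, and 4/m is
    bounded by 4.\<close>
  define G where "G n x = (if x \<in> {- real (Suc n)..real (Suc n)} then ?k x * complex_of_real (cutoff (real (Suc n)) x) + p x * cnj (F x) * complex_of_real (cutoff1 (real (Suc n)) x) else 0)" for n x
  have i: "integrable lebesgue (\<lambda>x. h x * cnj (F x))" "integrable lebesgue (\<lambda>x. p x * cnj (p x))"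
     "integrable lebesgue (\<lambda>x. p x * cnj (F x))"
    by (rule L2_mult_integrable[OF L(3) L2_cnj[OF L(1)]], rule L2_mult_integrable[OF L(2) L2_cnj[OF L(2)]],
        rule L2_mult_integrable[OF L(2) L2_cnj[OF L(1)]])
  have ik: "integrable lebesgue ?k" by (rule Bochner_Integration.integrable_add[OF i(1,2)])
  have G0: "(LINT x|lebesgue. G n x) = 0" and Gm: "G n \<in> borel_measurable lebesgue" for n
  proof -
    let ?m = "real (Suc n)"
    let ?g = "\<lambda>x. ?k x * complex_of_real (cutoff ?m x) + p x * cnj (F x) * complex_of_real (cutoff1 ?m x)"
    have P: "prim (\<lambda>x. p x * cnj (F x) * complex_of_real (cutoff ?m x)) ?g"
      by (intro prim_mult prim_cnj F p prim_cutoff) simp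
    have ai: "?g absolutely_integrable_on {- ?m..?m}" by (rule primD(1)[OF P]) simp
    have e: "G n = (\<lambda>x. indicat_real {- ?m..?m} x *\<^sub>R ?g x)" by (auto simp: G_def)
    have "(LINT x|lebesgue. G n x) = integral {- ?m..?m} ?g"
      unfolding e using set_lebesgue_integral_eq_integral(2)[OF ai] by (simp only: set_lebesgue_integral_def)
    also have "\<dots> = 0" using primD(2)[OF P, of "- ?m" ?m] cutoff_ends[of ?m] by simp
    finally show "(LINT x|lebesgue. G n x) = 0" .
    show "G n \<in> borel_measurable lebesgue" using ai unfolding e set_integrable_def by (rule borel_measurable_integrable)
  qed
  have "(\<lambda>n. LINT x|lebesgue. G n x) \<longlonglongrightarrow> (LINT x|lebesgue. ?k x)"
  proof (rule integral_dominated_convergence[where w="\<lambda>x. norm (?k x) + 4 * norm (p x * cnj (F x))"])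
    show "integrable lebesgue (\<lambda>x. norm (?k x) + 4 * norm (p x * cnj (F x)))"
      by (intro Bochner_Integration.integrable_add integrable_mult_right integrable_norm ik i(3))
    have bd: "norm (G n x) \<le> norm (?k x) + 4 * norm (p x * cnj (F x))" for n x
    proof (cases "x \<in> {- real (Suc n)..real (Suc n)}")
      case True
      note b = cutoff_bounds[OF _ True]
      have "4 / real (Suc n) \<le> 4" by (simp add: field_simps)
      then have c: "\<bar>cutoff (real (Suc n)) x\<bar> \<le> 1" "\<bar>cutoff1 (real (Suc n)) x\<bar> \<le> 4" using b by auto
      have "norm (G n x) \<le> norm (?k x * complex_of_real (cutoff (real (Suc n)) x)) + norm (p x * cnj (F x) * complex_of_real (cutoff1 (real (Suc n)) x))"
        unfolding G_def using True by (simp only: if_True norm_triangle_ineq)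
      also have "\<dots> = norm (?k x) * \<bar>cutoff (real (Suc n)) x\<bar> + norm (p x * cnj (F x)) * \<bar>cutoff1 (real (Suc n)) x\<bar>"
        by (simp only: norm_mult norm_of_real real_norm_def)
      also have "\<dots> \<le> norm (?k x) * 1 + norm (p x * cnj (F x)) * 4"
        by (intro add_mono mult_left_mono c) auto
      finally show ?thesis by simp
    next
      case False
      then have "G n x = 0" unfolding G_def by (simp only: if_False)
      then show ?thesis by simp
    qed
    then show "AE x in lebesgue. norm (G n x) \<le> norm (?k x) + 4 * norm (p x * cnj (F x))" for n by blast
    have "(\<lambda>n. G n x) \<longlonglongrightarrow> ?k x" for x
    proof -
      obtain N :: nat where N: "\<bar>x\<bar> < real N" using reals_Archimedean2 by blast
      have "(\<lambda>n. cutoff1 (real (Suc n)) x) \<longlonglongrightarrow> 0"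
      proof (rule Lim_null_comparison)
        show "eventually (\<lambda>n. norm (cutoff1 (real (Suc n)) x) \<le> 4 / real (Suc n)) sequentially"
        proof (rule eventually_sequentiallyI[of N])
          fix n assume "n \<ge> N"
          then have "x \<in> {- real (Suc n)..real (Suc n)}" using N by auto
          then show "norm (cutoff1 (real (Suc n)) x) \<le> 4 / real (Suc n)" using cutoff_bounds(3)[of "real (Suc n)" x] by simp
        qed
        show "(\<lambda>n. 4 / real (Suc n)) \<longlonglongrightarrow> 0" using LIMSEQ_Suc[OF lim_const_over_n[of 4]] .
      qed
      then have "(\<lambda>n. ?k x * complex_of_real (cutoff (real (Suc n)) x) + p x * cnj (F x) * complex_of_real (cutoff1 (real (Suc n)) x))
         \<longlonglongrightarrow> ?k x * complex_of_real 1 + p x * cnj (F x) * complex_of_real 0"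
        by (intro tendsto_intros LIMSEQ_Suc[OF cutoff_tendsto])
      then have "(\<lambda>n. ?k x * complex_of_real (cutoff (real (Suc n)) x) + p x * cnj (F x) * complex_of_real (cutoff1 (real (Suc n)) x)) \<longlonglongrightarrow> ?k x"
        by simp
      then show ?thesis
      proof (rule Lim_transform_eventually)
        show "eventually (\<lambda>n. ?k x * complex_of_real (cutoff (real (Suc n)) x) + p x * cnj (F x) * complex_of_real (cutoff1 (real (Suc n)) x) = G n x) sequentially"
        proof (rule eventually_sequentiallyI[of N])
          fix n assume "n \<ge> N"
          then have "x \<in> {- real (Suc n)..real (Suc n)}" using N by auto
          then show "?k x * complex_of_real (cutoff (real (Suc n)) x) + p x * cnj (F x) * complex_of_real (cutoff1 (real (Suc n)) x) = G n x"
            unfolding G_def by (simp only: if_True)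
        qed
      qed
    qed
    then show "AE x in lebesgue. (\<lambda>n. G n x) \<longlonglongrightarrow> ?k x" by blast
  qed (use ik Gm in auto)
  then have "(LINT x|lebesgue. ?k x) = 0" unfolding G0 by (simp only: LIMSEQ_const_iff)
  then have "(LINT x|lebesgue. h x * cnj (F x)) + (LINT x|lebesgue. p x * cnj (p x)) = 0"
    unfolding Bochner_Integration.integral_add[OF i(1,2)] .
  then have "(LINT x|lebesgue. - h x * cnj (F x)) = (LINT x|lebesgue. p x * cnj (p x))"
    by (simp add: neg_eq_iff_add_eq_0)
  also have "\<dots> = complex_of_real ((hnorm (L2 lebesgue) p)\<^sup>2)"
    using inn_L2_self[of lebesgue p] by (simp add: L2_simps hnorm_L2_sq)
  finally show ?thesis .
qed

subsection \<open>Essential range\<close>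

lemma essran_iff:
  assumes "f \<in> borel_measurable lebesgue"
  shows "z \<in> essran f \<longleftrightarrow> (\<forall>e>0. \<not> (AE x in lebesgue. e \<le> dist (f x) z))"
proof -
  have "emeasure lebesgue {x. dist (f x) z < e} > 0 \<longleftrightarrow> \<not> (AE x in lebesgue. e \<le> dist (f x) z)" for e
  proof -
    have "{x \<in> space lebesgue. dist (f x) z < e} \<in> sets lebesgue" using assms by measurable
    then have "(AE x in lebesgue. e \<le> dist (f x) z) \<longleftrightarrow> emeasure lebesgue {x. dist (f x) z < e} = 0"
      by (intro AE_iff_measurable) (auto simp: not_le)
    then show ?thesis by (simp add: zero_less_iff_neq_zero)
  qed
  then show ?thesis by (simp add: essran_def)
qed

text \<open>The complement of the essential range is a union of balls with null preimages; by
  Lindelof countably many of them suffice.\<close>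

lemma AE_in_essran:
  assumes f: "f \<in> borel_measurable lebesgue"
  shows "AE x in lebesgue. f x \<in> essran f"
proof -
  let ?F = "{ball z e | z e. AE x in lebesgue. f x \<notin> ball z e}"
  obtain F' where F': "F' \<subseteq> ?F" "countable F'" "\<Union> F' = \<Union> ?F"
    by (rule Lindelof[of ?F]) auto
  have "AE x in lebesgue. \<forall>B\<in>F'. f x \<notin> B"
    using F' by (subst AE_ball_countable) auto
  then show ?thesis
  proof eventually_elim
    case (elim x)
    then have "f x \<notin> \<Union> F'" by blast
    then have "f x \<notin> \<Union> ?F" unfolding F'(3) .
    moreover have "f x \<in> \<Union> ?F" if x: "f x \<notin> essran f"
    proof -
      obtain e where e: "e > 0" "AE y in lebesgue. e \<le> dist (f y) (f x)"
        using x unfolding essran_iff[OF f] by blast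
      have "AE y in lebesgue. f y \<notin> ball (f x) e" using e(2) by eventually_elim (simp add: dist_commute)
      then have "ball (f x) e \<in> ?F" by blast
      then show ?thesis using e(1) centre_in_ball by blast
    qed
    ultimately show ?case by blast
  qed
qed

subsection \<open>The operator matrix\<close>

locale matrix_model =
  fixes Q V U W :: "real \<Rightarrow> complex" and \<theta> b :: real
  assumes Q: "Q \<in> Linf_loc" and V: "V \<in> Linf_loc" and U: "U \<in> Linf_loc" and W: "W \<in> Linf"
    and \<theta>: "0 \<le> \<theta>" "\<theta> < pi / 2"
    and sector: "essran Q \<subseteq> {z. \<bar>Arg z\<bar> \<le> \<theta>}"
    and growth: "\<forall>R. \<exists>r. AE x in lebesgue. \<bar>x\<bar> \<ge> r \<longrightarrow> norm (Q x) \<ge> R"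
    and b: "0 \<le> b" and Vb: "AE x in lebesgue. (norm (V x))\<^sup>2 \<le> b * norm (Q x)"
begin

lemma meas: "Q \<in> borel_measurable lebesgue" "V \<in> borel_measurable lebesgue"
  "U \<in> borel_measurable lebesgue" "W \<in> borel_measurable lebesgue"
  using Q V U W by (auto simp: Linf_loc_def Linf_def)

lemma meas_on: "Q \<in> borel_measurable (lebesgue_on \<Omega>)" "V \<in> borel_measurable (lebesgue_on \<Omega>)"
  "U \<in> borel_measurable (lebesgue_on \<Omega>)" "W \<in> borel_measurable (lebesgue_on \<Omega>)"
  using meas by (auto intro: measurable_restrict_space1)

lemma cos_pos: "cos \<theta> > 0" and cos_le: "cos \<theta> \<le> 1"
  using \<theta> by (auto intro: cos_gt_zero_pi)

text \<open>Re Q = |Q| cos (Arg Q), and cos decreases on [0, \<pi>]. As \<theta> < \<pi>/2, this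
  turns bounds on the real part of the form into bounds on |Q|.\<close>

lemma Re_Q: "AE x in lebesgue. cos \<theta> * cmod (Q x) \<le> Re (Q x)"
  using AE_in_essran[OF meas(1)]
proof eventually_elim
  case (elim x)
  then have a: "\<bar>Arg (Q x)\<bar> \<le> \<theta>" using sector by auto
  have "Re (Q x) = cmod (Q x) * cos (Arg (Q x))" by (metis rcis_cmod_Arg Re_rcis)
  moreover have "cos \<theta> \<le> cos \<bar>Arg (Q x)\<bar>" using a \<theta> by (intro cos_monotone_0_pi_le) auto
  then have "cos \<theta> * cmod (Q x) \<le> cos (Arg (Q x)) * cmod (Q x)"
    by (intro mult_right_mono) (simp_all add: cos_abs_real)
  ultimately show ?case by (simp add: mult.commute)
qed

lemma W_bound: obtains w where "w \<ge> 0" "AE x in lebesgue. cmod (W x) \<le> w"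
proof -
  obtain C where C: "AE x in lebesgue. cmod (W x) \<le> C" using W by (auto simp: Linf_def)
  then have "AE x in lebesgue. cmod (W x) \<le> max C 0" by eventually_elim simp
  then show thesis using that[of "max C 0"] by simp
qed

lemma AE_on: "AE x in lebesgue. P x \<Longrightarrow> AE x in lebesgue_on \<Omega>. P x" if "\<Omega> \<in> sets lebesgue"
  unfolding AE_lebesgue_on_iff[OF that] by (auto elim: eventually_mono)

lemma local_bound:
  obtains C where "C \<ge> 1" "AE x in lebesgue. x \<in> {c..d} \<longrightarrow> cmod (Q x) \<le> C \<and> cmod (V x) \<le> C \<and> cmod (U x) \<le> C \<and> cmod (W x) \<le> C"
proof -
  have loc: "\<exists>C. AE x in lebesgue. x \<in> {c..d} \<longrightarrow> cmod (k x) \<le> C" if "k \<in> Linf_loc" for k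
    using that compact_Icc unfolding Linf_loc_def by blast
  obtain C1 where C1: "AE x in lebesgue. x \<in> {c..d} \<longrightarrow> cmod (Q x) \<le> C1" using loc[OF Q] by blast
  obtain C2 where C2: "AE x in lebesgue. x \<in> {c..d} \<longrightarrow> cmod (V x) \<le> C2" using loc[OF V] by blast
  obtain C3 where C3: "AE x in lebesgue. x \<in> {c..d} \<longrightarrow> cmod (U x) \<le> C3" using loc[OF U] by blast
  obtain w where w: "w \<ge> 0" "AE x in lebesgue. cmod (W x) \<le> w" using W_bound .
  define C where "C = 1 + \<bar>C1\<bar> + \<bar>C2\<bar> + \<bar>C3\<bar> + w"
  have "AE x in lebesgue. x \<in> {c..d} \<longrightarrow> cmod (Q x) \<le> C \<and> cmod (V x) \<le> C \<and> cmod (U x) \<le> C \<and> cmod (W x) \<le> C"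
    using C1 C2 C3 w(2) by eventually_elim (use w(1) in \<open>auto simp: C_def\<close>)
  moreover have "C \<ge> 1" using w(1) by (simp add: C_def)
  ultimately show thesis using that by blast
qed

abbreviation "Mop \<Omega> D1 D2 \<equiv> matrix_op \<Omega> D1 D2 Q W V U"

lemma shift_matrix_iff:
  assumes \<Omega>: "\<Omega> \<in> sets lebesgue"
    and D: "D1 \<subseteq> carrier (L2 (lebesgue_on \<Omega>))" "D2 \<subseteq> carrier (L2 (lebesgue_on \<Omega>))"
  shows "((f, g), (u, v)) \<in> op_shift (Hsp \<Omega>) (Mop \<Omega> D1 D2) \<zeta> \<longleftrightarrow>
     f \<in> D1 \<and> g \<in> D2 \<and> u \<in> carrier (L2 (lebesgue_on \<Omega>)) \<and> v \<in> carrier (L2 (lebesgue_on \<Omega>)) \<and>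
     (\<exists>h. weak_deriv \<Omega> 2 f h \<and> (AE x in lebesgue_on \<Omega>. u x = - h x + (Q x - \<zeta>) * f x + W x * g x)) \<and>
     (AE x in lebesgue_on \<Omega>. v x = V x * f x + (U x - \<zeta>) * g x)" (is "?l \<longleftrightarrow> ?r")
proof
  assume ?l
  then obtain u' v' where uv: "((f, g), (u', v')) \<in> Mop \<Omega> D1 D2" "u = (\<lambda>x. u' x + (- \<zeta>) * f x)" "v = (\<lambda>x. v' x + (- \<zeta>) * g x)"
    by (auto simp: op_shift_def op_diff_def hilbert_sum_simps L2_simps)
  then obtain h where h: "f \<in> D1" "g \<in> D2" "u' \<in> carrier (L2 (lebesgue_on \<Omega>))" "v' \<in> carrier (L2 (lebesgue_on \<Omega>))"
    "weak_deriv \<Omega> 2 f h" "AE x in lebesgue_on \<Omega>. u' x = - h x + Q x * f x + W x * g x"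
    "AE x in lebesgue_on \<Omega>. v' x = V x * f x + U x * g x"
    by (auto simp: matrix_op_def hilbert_sum_simps)
  have "u \<in> carrier (L2 (lebesgue_on \<Omega>))" "v \<in> carrier (L2 (lebesgue_on \<Omega>))"
    unfolding uv(2,3) using h D by (auto intro!: L2_add L2_scale)
  moreover have "AE x in lebesgue_on \<Omega>. u x = - h x + (Q x - \<zeta>) * f x + W x * g x"
    using h(6) by eventually_elim (simp add: uv algebra_simps)
  moreover have "AE x in lebesgue_on \<Omega>. v x = V x * f x + (U x - \<zeta>) * g x"
    using h(7) by eventually_elim (simp add: uv algebra_simps)
  ultimately show ?r using h by blast
next
  assume r: ?r
  then obtain h where h: "weak_deriv \<Omega> 2 f h" "AE x in lebesgue_on \<Omega>. u x = - h x + (Q x - \<zeta>) * f x + W x * g x" by blast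
  let ?u = "\<lambda>x. u x + \<zeta> * f x" and ?v = "\<lambda>x. v x + \<zeta> * g x"
  have fg: "f \<in> carrier (L2 (lebesgue_on \<Omega>))" "g \<in> carrier (L2 (lebesgue_on \<Omega>))" using r D by auto
  have "?u \<in> carrier (L2 (lebesgue_on \<Omega>))" "?v \<in> carrier (L2 (lebesgue_on \<Omega>))"
    using r fg by (auto intro!: L2_add L2_scale)
  moreover have "AE x in lebesgue_on \<Omega>. ?u x = - h x + Q x * f x + W x * g x"
    using h(2) by eventually_elim (simp add: algebra_simps)
  moreover have "AE x in lebesgue_on \<Omega>. v x = V x * f x + (U x - \<zeta>) * g x" using r by blast
  then have "AE x in lebesgue_on \<Omega>. ?v x = V x * f x + U x * g x"
    by eventually_elim (simp add: algebra_simps)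
  ultimately have "((f, g), (?u, ?v)) \<in> Mop \<Omega> D1 D2"
    using r h(1) by (auto simp: matrix_op_def hilbert_sum_simps)
  moreover have "((f, g), (f, g)) \<in> Id_on (carrier (Hsp \<Omega>))" using fg by (intro Id_onI) (simp add: hilbert_sum_simps)
  moreover have "(u, v) = add (Hsp \<Omega>) (?u, ?v) (hilbert.scale (Hsp \<Omega>) (- \<zeta>) (f, g))"
    by (simp add: hilbert_sum_simps L2_simps)
  ultimately show ?l unfolding op_shift_def op_diff_def by blast
qed

lemma graph_matrix:
  assumes \<Omega>: "\<Omega> \<in> sets lebesgue"
    and D: "D1 \<subseteq> carrier (L2 (lebesgue_on \<Omega>))" "D2 \<subseteq> carrier (L2 (lebesgue_on \<Omega>))"
    and lin: "\<And>f g c. f \<in> D1 \<Longrightarrow> g \<in> D1 \<Longrightarrow> (\<lambda>x. f x + c * g x) \<in> D1" "\<And>f c. f \<in> D1 \<Longrightarrow> (\<lambda>x. c * f x) \<in> D1"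
      "\<And>f g c. f \<in> D2 \<Longrightarrow> g \<in> D2 \<Longrightarrow> (\<lambda>x. f x + c * g x) \<in> D2" "\<And>f c. f \<in> D2 \<Longrightarrow> (\<lambda>x. c * f x) \<in> D2"
  shows "graph_op (Hsp \<Omega>) (Mop \<Omega> D1 D2)"
proof -
  interpret H: semihilbert "Hsp \<Omega>" by (rule semihilbert_Hsp)
  let ?L = "carrier (L2 (lebesgue_on \<Omega>))"
  have iff: "((f, g), (u, v)) \<in> Mop \<Omega> D1 D2 \<longleftrightarrow> f \<in> D1 \<and> g \<in> D2 \<and> u \<in> ?L \<and> v \<in> ?L \<and>
     (\<exists>h. weak_deriv \<Omega> 2 f h \<and> (AE x in lebesgue_on \<Omega>. u x = - h x + Q x * f x + W x * g x)) \<and>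
     (AE x in lebesgue_on \<Omega>. v x = V x * f x + U x * g x)" for f g u v
    by (auto simp: matrix_op_def hilbert_sum_simps)
  show ?thesis
  proof
    fix x y x' y' c
    show "x \<in> carrier (Hsp \<Omega>) \<and> y \<in> carrier (Hsp \<Omega>)" if "(x, y) \<in> Mop \<Omega> D1 D2"
      using that D by (cases x; cases y) (auto simp: iff hilbert_sum_simps)
    show "(hilbert.scale (Hsp \<Omega>) c x, hilbert.scale (Hsp \<Omega>) c y) \<in> Mop \<Omega> D1 D2" if xy: "(x, y) \<in> Mop \<Omega> D1 D2"
    proof -
      obtain f g u v where x: "x = (f, g)" "y = (u, v)" by (cases x; cases y) auto
      obtain h where h: "f \<in> D1" "g \<in> D2" "u \<in> ?L" "v \<in> ?L" "weak_deriv \<Omega> 2 f h"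
        "AE x in lebesgue_on \<Omega>. u x = - h x + Q x * f x + W x * g x"
        "AE x in lebesgue_on \<Omega>. v x = V x * f x + U x * g x"
        using xy unfolding x iff by blast
      have "AE x in lebesgue_on \<Omega>. c * u x = - (c * h x) + Q x * (c * f x) + W x * (c * g x)"
        using h(6)
      proof eventually_elim
        case (elim x)
        show ?case unfolding elim by (simp add: algebra_simps)
      qed
      moreover have "AE x in lebesgue_on \<Omega>. c * v x = V x * (c * f x) + U x * (c * g x)"
        using h(7)
      proof eventually_elim
        case (elim x)
        show ?case unfolding elim by (simp add: algebra_simps)
      qed
      ultimately have "((\<lambda>x. c * f x, \<lambda>x. c * g x), (\<lambda>x. c * u x, \<lambda>x. c * v x)) \<in> Mop \<Omega> D1 D2"
        unfolding iff using h weak_deriv_scale[OF \<Omega> h(5), of c] by (auto intro!: lin L2_scale)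
      then show ?thesis by (simp add: x hilbert_sum_simps L2_simps)
    qed
    show "(add (Hsp \<Omega>) x (hilbert.scale (Hsp \<Omega>) c x'), add (Hsp \<Omega>) y (hilbert.scale (Hsp \<Omega>) c y')) \<in> Mop \<Omega> D1 D2"
      if xy: "(x, y) \<in> Mop \<Omega> D1 D2" "(x', y') \<in> Mop \<Omega> D1 D2"
    proof -
      obtain f g u v where x: "x = (f, g)" "y = (u, v)" by (cases x; cases y) auto
      obtain f' g' u' v' where x': "x' = (f', g')" "y' = (u', v')" by (cases x'; cases y') auto
      obtain h where h: "f \<in> D1" "g \<in> D2" "u \<in> ?L" "v \<in> ?L" "weak_deriv \<Omega> 2 f h"
        "AE x in lebesgue_on \<Omega>. u x = - h x + Q x * f x + W x * g x"
        "AE x in lebesgue_on \<Omega>. v x = V x * f x + U x * g x"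
        using xy(1) unfolding x iff by blast
      obtain h' where h': "f' \<in> D1" "g' \<in> D2" "u' \<in> ?L" "v' \<in> ?L" "weak_deriv \<Omega> 2 f' h'"
        "AE x in lebesgue_on \<Omega>. u' x = - h' x + Q x * f' x + W x * g' x"
        "AE x in lebesgue_on \<Omega>. v' x = V x * f' x + U x * g' x"
        using xy(2) unfolding x' iff by blast
      have "AE x in lebesgue_on \<Omega>. u x + c * u' x = - (h x + c * h' x) + Q x * (f x + c * f' x) + W x * (g x + c * g' x)"
        using h(6) h'(6)
      proof eventually_elim
        case (elim x)
        show ?case unfolding elim by (simp add: algebra_simps)
      qed
      moreover have "AE x in lebesgue_on \<Omega>. v x + c * v' x = V x * (f x + c * f' x) + U x * (g x + c * g' x)"
        using h(7) h'(7)
      proof eventually_elim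
        case (elim x)
        show ?case unfolding elim by (simp add: algebra_simps)
      qed
      ultimately have "((\<lambda>x. f x + c * f' x, \<lambda>x. g x + c * g' x), (\<lambda>x. u x + c * u' x, \<lambda>x. v x + c * v' x)) \<in> Mop \<Omega> D1 D2"
        unfolding iff using h h' weak_deriv_lincomb[OF \<Omega> h(5) h'(5), of c] by (auto intro!: lin L2_scale L2_add)
      then show ?thesis by (simp add: x x' hilbert_sum_simps L2_simps)
    qed
    show "(x, y') \<in> Mop \<Omega> D1 D2"
      if xy: "(x, y) \<in> Mop \<Omega> D1 D2" and y': "y' \<in> carrier (Hsp \<Omega>)"
        and n: "hnorm (Hsp \<Omega>) (add (Hsp \<Omega>) y' (hilbert.scale (Hsp \<Omega>) (-1) y)) = 0"
    proof -
      obtain f g u v where x: "x = (f, g)" "y = (u, v)" by (cases x; cases y) auto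
      obtain u' v' where x': "y' = (u', v')" by (cases y') auto
      obtain h where h: "f \<in> D1" "g \<in> D2" "u \<in> ?L" "v \<in> ?L" "weak_deriv \<Omega> 2 f h"
        "AE x in lebesgue_on \<Omega>. u x = - h x + Q x * f x + W x * g x"
        "AE x in lebesgue_on \<Omega>. v x = V x * f x + U x * g x"
        using xy unfolding x iff by blast
      have c': "u' \<in> ?L" "v' \<in> ?L" using y' by (auto simp: x' hilbert_sum_simps)
      have d: "(\<lambda>x. u' x - u x) \<in> ?L" "(\<lambda>x. v' x - v x) \<in> ?L" using c' h by (auto intro: L2_diff)
      have "hnorm (Hsp \<Omega>) (\<lambda>x. u' x - u x, \<lambda>x. v' x - v x) = 0"
        using n by (simp add: x x' hilbert_sum_simps L2_simps)
      then have "hnorm (L2 (lebesgue_on \<Omega>)) (\<lambda>x. u' x - u x) \<le> 0" "hnorm (L2 (lebesgue_on \<Omega>)) (\<lambda>x. v' x - v x) \<le> 0"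
        using hnorm_Hsp_ge[OF d] by simp_all
      then have "hnorm (L2 (lebesgue_on \<Omega>)) (\<lambda>x. u' x - u x) = 0" "hnorm (L2 (lebesgue_on \<Omega>)) (\<lambda>x. v' x - v x) = 0"
        by (simp_all add: antisym)
      then have ae: "AE x in lebesgue_on \<Omega>. u' x - u x = 0" "AE x in lebesgue_on \<Omega>. v' x - v x = 0"
        using hnorm_L2_eq_0 d by blast+
      have "AE x in lebesgue_on \<Omega>. u' x = - h x + Q x * f x + W x * g x"
        using h(6) ae(1) by eventually_elim simp
      moreover have "AE x in lebesgue_on \<Omega>. v' x = V x * f x + U x * g x"
        using h(7) ae(2) by eventually_elim simp
      ultimately show ?thesis unfolding x x' iff using h c' by blast
    qed
  qed
qed

subsection \<open>Domains\<close>

abbreviation "LR \<equiv> L2 (lebesgue :: real measure)"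

lemma domA_sub: "domA Q \<subseteq> carrier (L2 (lebesgue_on UNIV))" and domU_sub: "domU U \<subseteq> carrier (L2 (lebesgue_on UNIV))"
  by (auto simp: domA_def domU_def sobolev_def)

lemma T_graph: "graph_op (Hsp UNIV) (op_T Q W V U)"
  unfolding op_T_def
proof (rule graph_matrix[OF _ domA_sub domU_sub])
  have Us: "UNIV \<in> sets (lebesgue :: real measure)" by simp
  fix f g c
  show "(\<lambda>x. f x + c * g x) \<in> domA Q" if fg: "f \<in> domA Q" "g \<in> domA Q"
  proof -
    have "(\<lambda>x. Q x * f x + c * (Q x * g x)) \<in> carrier (L2 (lebesgue_on UNIV))"
      using fg by (intro L2_add L2_scale) (auto simp: domA_def)
    then show ?thesis using fg sobolev_lincomb[OF Us, of f 2 g c] by (simp add: domA_def algebra_simps)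
  qed
  show "(\<lambda>x. c * f x) \<in> domA Q" if f: "f \<in> domA Q"
  proof -
    have "(\<lambda>x. c * (Q x * f x)) \<in> carrier (L2 (lebesgue_on UNIV))" using f by (intro L2_scale) (auto simp: domA_def)
    then show ?thesis using f sobolev_scale[OF Us, of f 2 c] by (simp add: domA_def algebra_simps)
  qed
  show "(\<lambda>x. f x + c * g x) \<in> domU U" if fg: "f \<in> domU U" "g \<in> domU U"
  proof -
    have "(\<lambda>x. U x * f x + c * (U x * g x)) \<in> carrier (L2 (lebesgue_on UNIV))"
      using fg by (intro L2_add L2_scale) (auto simp: domU_def)
    then show ?thesis using fg by (auto simp: domU_def algebra_simps intro: L2_add L2_scale)
  qed
  show "(\<lambda>x. c * f x) \<in> domU U" if f: "f \<in> domU U"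
  proof -
    have "(\<lambda>x. c * (U x * f x)) \<in> carrier (L2 (lebesgue_on UNIV))" using f by (intro L2_scale) (auto simp: domU_def)
    then show ?thesis using f by (auto simp: domU_def algebra_simps intro: L2_scale)
  qed
qed simp

abbreviation "domN n \<equiv> {f \<in> sobolev 2 (interval n). vanishes_at_ends (- real n) (real n) f}"

lemma domN_sub: "domN n \<subseteq> carrier (L2 (lebesgue_on (interval n)))"
  by (auto simp: sobolev_def)

lemma interval_sets [simp]: "interval n \<in> sets lebesgue" "open (interval n)" "is_interval (interval n)"
  by (auto simp: interval_def is_interval_1)

lemma Tn_graph: "graph_op (Hsp (interval n)) (op_Tn Q W V U n)"
  unfolding op_Tn_def
proof (rule graph_matrix[OF _ domN_sub order_refl])
  fix f g c
  show "(\<lambda>x. f x + c * g x) \<in> domN n" if fg: "f \<in> domN n" "g \<in> domN n"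
  proof -
    obtain F where F: "continuous_on {- real n..real n} F" "AE x in lebesgue_on {- real n<..<real n}. f x = F x" "F (- real n) = 0" "F (real n) = 0"
      using fg(1) by (auto simp: vanishes_at_ends_def)
    obtain G where G: "continuous_on {- real n..real n} G" "AE x in lebesgue_on {- real n<..<real n}. g x = G x" "G (- real n) = 0" "G (real n) = 0"
      using fg(2) by (auto simp: vanishes_at_ends_def)
    have "AE x in lebesgue_on {- real n<..<real n}. f x + c * g x = F x + c * G x"
      using F(2) G(2) by eventually_elim simp
    then have "vanishes_at_ends (- real n) (real n) (\<lambda>x. f x + c * g x)"
      unfolding vanishes_at_ends_def using F G
      by (intro exI[of _ "\<lambda>x. F x + c * G x"]) (auto intro!: continuous_intros)
    then show ?thesis using fg sobolev_lincomb[of "interval n" f 2 g c] by simp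
  qed
  show "(\<lambda>x. c * f x) \<in> domN n" if f: "f \<in> domN n"
  proof -
    obtain F where F: "continuous_on {- real n..real n} F" "AE x in lebesgue_on {- real n<..<real n}. f x = F x" "F (- real n) = 0" "F (real n) = 0"
      using f by (auto simp: vanishes_at_ends_def)
    have "AE x in lebesgue_on {- real n<..<real n}. c * f x = c * F x"
      using F(2) by eventually_elim simp
    then have "vanishes_at_ends (- real n) (real n) (\<lambda>x. c * f x)"
      unfolding vanishes_at_ends_def using F
      by (intro exI[of _ "\<lambda>x. c * F x"]) (auto intro!: continuous_intros)
    then show ?thesis using f sobolev_scale[of "interval n" f 2 c] by simp
  qed
qed (auto intro: L2_add L2_scale)

end

subsection \<open>Localized singular sequences\<close>

lemma two_linear_equations:
  fixes v1 v2 v3 w1 w2 w3 :: complex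
  obtains c1 c2 c3 where "(c1, c2, c3) \<noteq> (0, 0, 0)" "c1 * v1 + c2 * v2 + c3 * v3 = 0" "c1 * w1 + c2 * w2 + c3 * w3 = 0"
proof -
  have one: "\<exists>s t. (s, t) \<noteq> (0, 0) \<and> s * x + t * y = 0" for x y :: complex
  proof (cases "x = 0 \<and> y = 0")
    case True
    then show ?thesis by (intro exI[of _ 1] exI[of _ 0]) simp
  next
    case False
    then show ?thesis by (intro exI[of _ y] exI[of _ "- x"]) auto
  qed
  show thesis
  proof (cases "v1 = 0")
    case False
    \<comment> \<open>Solving the first equation for the first unknown, multiplied by
      \<open>v1\<close> to avoid a division, leaves one equation for two parameters.\<close>
    obtain s t where st: "(s, t) \<noteq> (0, 0)" "s * (v1 * w2 - v2 * w1) + t * (v1 * w3 - v3 * w1) = 0" using one by blast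
    show thesis
      by (rule that[of "- (s * v2 + t * v3)" "s * v1" "t * v1"]) (use st False in \<open>auto simp: algebra_simps\<close>)
  next
    case True
    obtain s' t' where st': "(s', t') \<noteq> (0, 0)" "s' * v2 + t' * v3 = 0" using one by blast
    obtain s t where st: "(s, t) \<noteq> (0, 0)" "s * w1 + t * (s' * w2 + t' * w3) = 0" using one by blast
    have "t * s' * v2 + t * t' * v3 = t * (s' * v2 + t' * v3)" by (simp add: algebra_simps)
    then show thesis
      using st' st True by (intro that[of s "t * s'" "t * t'"]) (auto simp: algebra_simps)
  qed
qed

lemma L2_bounded_on_interval:
  fixes f :: "real \<Rightarrow> complex"
  assumes f: "f \<in> borel_measurable lebesgue" and bd: "AE x in lebesgue. x \<in> {c..d} \<longrightarrow> cmod (f x) \<le> K"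
    and z: "\<And>x. x \<notin> {c..d} \<Longrightarrow> f x = 0" and "c \<le> d" "d - c \<le> 1" "0 \<le> K"
  shows "f \<in> carrier (L2 lebesgue)" "hnorm (L2 lebesgue) f \<le> K"
proof -
  let ?i = "\<lambda>x. complex_of_real (indicat_real {c..d} x)"
  have sq: "(\<lambda>x. (cmod (?i x))\<^sup>2) = indicat_real {c..d}" by (auto simp: indicator_def)
  have ii: "integrable lebesgue (indicat_real {c..d})" by (rule integrable_real_indicator) (auto simp: emeasure_lborel_Icc_eq)
  have i: "?i \<in> carrier (L2 lebesgue)"
    unfolding carrier_L2 sq using ii by (auto intro!: borel_measurable_of_real borel_measurable_integrable)
  have le: "AE x in lebesgue. cmod (f x) \<le> K * cmod (?i x)"
    using bd
  proof eventually_elim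
    case (elim x)
    then show ?case using z[of x] by (cases "x \<in> {c..d}") auto
  qed
  show "f \<in> carrier (L2 lebesgue)" by (rule L2_dominated[OF i f le])
  have "hnorm (L2 lebesgue) f \<le> K * hnorm (L2 lebesgue) ?i" by (rule hnorm_L2_mono[OF i f le assms(6)])
  also have "hnorm (L2 lebesgue) ?i \<le> 1"
    unfolding hnorm_L2 sq using assms(4,5) by simp
  finally show "hnorm (L2 lebesgue) f \<le> K" using assms(6) by (simp add: mult_left_mono)
qed

lemma L2_restrict_support:
  fixes f :: "real \<Rightarrow> complex"
  assumes "\<Omega> \<in> sets lebesgue" "\<And>x. x \<notin> \<Omega> \<Longrightarrow> f x = 0"
  shows "f \<in> carrier (L2 (lebesgue_on \<Omega>)) \<longleftrightarrow> f \<in> carrier (L2 lebesgue)"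
    and "hnorm (L2 (lebesgue_on \<Omega>)) f = hnorm (L2 lebesgue) f"
proof -
  have e: "(\<lambda>x. if x \<in> \<Omega> then f x else 0) = f" "(\<lambda>x. if x \<in> \<Omega> then (cmod (f x))\<^sup>2 else 0) = (\<lambda>x. (cmod (f x))\<^sup>2)"
    using assms(2) by (auto simp: fun_eq_iff)
  show "f \<in> carrier (L2 (lebesgue_on \<Omega>)) \<longleftrightarrow> f \<in> carrier (L2 lebesgue)"
    unfolding carrier_L2 measurable_lebesgue_on_iff[OF assms(1)] integrable_lebesgue_on_iff[OF assms(1)] e ..
  show "hnorm (L2 (lebesgue_on \<Omega>)) f = hnorm (L2 lebesgue) f"
    unfolding hnorm_L2 integral_lebesgue_on_eq[OF assms(1)] e ..
qed

lemma prim_eq_const: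
  assumes "prim F f" "x \<le> y" "\<And>t. t \<in> {x<..<y} \<Longrightarrow> f t = 0"
  shows "F x = F y"
proof -
  have "integral {x..y} f = integral {x..y} (\<lambda>t. 0)"
    by (rule integral_spike[of "{x, y}"]) (use assms(3) in auto)
  then show ?thesis using primD(2)[OF assms(1,2)] by simp
qed

lemma prim_norm_bound:
  assumes F: "prim F f" and "c \<le> x" "x \<le> d" and "F c = 0"
    and g: "g absolutely_integrable_on {c..d}" "AE t in lebesgue. t \<in> {c..d} \<longrightarrow> cmod (f t) \<le> g t"
  shows "cmod (F x) \<le> integral {c..d} (g :: real \<Rightarrow> real)"
proof -
  obtain N where N: "negligible N" "\<And>t. t \<notin> N \<Longrightarrow> t \<in> {c..d} \<longrightarrow> cmod (f t) \<le> g t" using AE_negligibleE[OF g(2)] by blast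
  \<comment> \<open>The bound holds only almost everywhere; on the exceptional null set it is
    replaced by |f|, without changing the integral.\<close>
  let ?g = "\<lambda>t. if t \<in> N then cmod (f t) else g t"
  have fi: "f absolutely_integrable_on {c..d}" using primD(1)[OF F, of c d] assms by simp
  have gi: "g integrable_on {c..d}" using g(1) by (rule set_lebesgue_integral_eq_integral(1))
  have g'i: "?g integrable_on {c..d}" by (rule integrable_spike[OF gi N(1)]) simp
  have le: "cmod (f t) \<le> ?g t" if "t \<in> {c..d}" for t using N(2)[of t] that by auto
  have sub: "?g integrable_on {c..x}" using g'i by (rule integrable_on_subinterval) (use assms in auto)
  have "cmod (F x) = cmod (integral {c..x} f)" using primD(2)[OF F assms(2)] assms(4) by simp
  also have "\<dots> \<le> integral {c..x} ?g"
    by (rule integral_norm_bound_integral[OF primD(3)[OF F assms(2)] sub]) (use le assms in auto)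
  also have "\<dots> \<le> integral {c..d} ?g"
    by (rule integral_subset_le[OF _ sub g'i]) (use assms(3) order_trans[OF norm_ge_zero le] in auto)
  also have "\<dots> = integral {c..d} g" by (rule integral_spike[OF N(1)]) simp
  finally show ?thesis .
qed

context matrix_model
begin

text \<open>Here \<open>g\<close> is the indicator of a set on which \<open>U\<close> is close to \<open>\<lambda>\<close> times a quadratic polynomial, whose three
  coefficients leave room for the two linear conditions under which \<open>F'' = W g\<close> has a compactly supported solution.\<close>

lemma local_solution:
  assumes \<Omega>: "open \<Omega>" and lam: "\<And>e. e > 0 \<Longrightarrow> \<not> (AE x in lebesgue_on \<Omega>. e \<le> cmod (U x - lam))"
    and e: "e > 0"
  obtains F p g c d where "prim F p" "prim p (\<lambda>x. W x * g x)" "{c..d} \<subseteq> \<Omega>" "c \<le> d" "d - c \<le> e" "d - c \<le> 1"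
    "\<And>x. x \<notin> {c..d} \<Longrightarrow> F x = 0 \<and> p x = 0 \<and> g x = 0"
    "g \<in> carrier LR" "hnorm LR g = 1"
    "hnorm LR (\<lambda>x. (Q x - lam) * F x) \<le> e" "hnorm LR (\<lambda>x. V x * F x + (U x - lam) * g x) \<le> e"
proof -
  have \<Omega>m: "\<Omega> \<in> sets lebesgue" using \<Omega> by simp
  \<comment> \<open>One half of \<open>e\<close> is spent on V F, the other on (U - lam) g.\<close>
  define e' where "e' = e / 2"
  have e': "e' > 0" using e by (simp add: e'_def)
  obtain k0 k1 where k: "{k0..k1} \<subseteq> \<Omega>" "\<not> (AE x in lebesgue. x \<in> {k0<..<k1} \<longrightarrow> e' \<le> cmod (U x - lam))"
    using AE_on_open_if_compact[OF \<Omega>, of "\<lambda>x. e' \<le> cmod (U x - lam)"] lam[OF e'] by blast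
  obtain C0 where C0: "C0 \<ge> 1" "AE x in lebesgue. x \<in> {k0..k1} \<longrightarrow> cmod (Q x) \<le> C0 \<and> cmod (V x) \<le> C0 \<and> cmod (U x) \<le> C0 \<and> cmod (W x) \<le> C0"
    using local_bound .
  define C where "C = C0 + cmod lam"
  have C1: "C \<ge> 1" using C0(1) norm_ge_zero[of lam] unfolding C_def by linarith
  have C: "AE x in lebesgue. x \<in> {k0..k1} \<longrightarrow> cmod (Q x - lam) \<le> C \<and> cmod (V x) \<le> C \<and> cmod (W x) \<le> C \<and> cmod (U x) \<le> C"
    using C0(2)
  proof eventually_elim
    case (elim x)
    then show ?case using norm_triangle_ineq4[of "Q x" lam] norm_ge_zero[of lam] unfolding C_def by (smt (verit))
  qed
  \<comment> \<open>On an interval of length at most \<delta> the bound C on p gives |F| \<le> C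
    \<delta>, so that (Q - lam) F and V F are at most C^2 \<delta> \<le> e'.\<close>
  define \<delta> where "\<delta> = min 1 (min e (e' / C\<^sup>2))"
  have \<delta>: "\<delta> > 0" "\<delta> \<le> 1" "\<delta> \<le> e" "C\<^sup>2 * \<delta> \<le> e'"
  proof -
    have "C\<^sup>2 > 0" using C1 by simp
    then show "\<delta> > 0" "\<delta> \<le> 1" "\<delta> \<le> e" using e e' by (auto simp: \<delta>_def)
    have "\<delta> \<le> e' / C\<^sup>2" by (simp add: \<delta>_def)
    then show "C\<^sup>2 * \<delta> \<le> e'" using \<open>C\<^sup>2 > 0\<close> by (simp add: field_simps)
  qed
  \<comment> \<open>A countable grid of mesh \<delta>: on some cell \<open>U\<close> comes close to
    \<open>lam\<close> on a nonnull set.\<close>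
  obtain j :: int where j: "\<not> (AE x in lebesgue. x \<in> {k0<..<k1} \<inter> {real_of_int j * \<delta>..(real_of_int j + 1) * \<delta>} \<longrightarrow> e' \<le> cmod (U x - lam))"
  proof (rule ccontr)
    assume "\<not> thesis"
    then have "AE x in lebesgue. \<forall>j::int. x \<in> {k0<..<k1} \<inter> {real_of_int j * \<delta>..(real_of_int j + 1) * \<delta>} \<longrightarrow> e' \<le> cmod (U x - lam)"
      using that by (subst AE_all_countable) blast
    then have "AE x in lebesgue. x \<in> {k0<..<k1} \<longrightarrow> e' \<le> cmod (U x - lam)"
    proof eventually_elim
      case (elim x)
      have f: "real_of_int \<lfloor>x / \<delta>\<rfloor> \<le> x / \<delta>" "x / \<delta> \<le> real_of_int \<lfloor>x / \<delta>\<rfloor> + 1" by linarith+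
      have x: "x / \<delta> * \<delta> = x" using \<delta>(1) by simp
      have "x \<in> {real_of_int \<lfloor>x / \<delta>\<rfloor> * \<delta>..(real_of_int \<lfloor>x / \<delta>\<rfloor> + 1) * \<delta>}"
        using mult_right_mono[OF f(1), of \<delta>] mult_right_mono[OF f(2), of \<delta>] \<delta>(1) unfolding x by simp
      then show ?case using elim by blast
    qed
    then show False using k(2) by blast
  qed
  define c d where "c = max k0 (real_of_int j * \<delta>)" and "d = min k1 ((real_of_int j + 1) * \<delta>)"
  have cd_sub: "{c..d} \<subseteq> {k0..k1}" by (auto simp: c_def d_def)
  have sub_cd: "{k0<..<k1} \<inter> {real_of_int j * \<delta>..(real_of_int j + 1) * \<delta>} \<subseteq> {c..d}" by (auto simp: c_def d_def)
  have cd: "c \<le> d"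
  proof (rule ccontr)
    assume "\<not> c \<le> d"
    then have "{k0<..<k1} \<inter> {real_of_int j * \<delta>..(real_of_int j + 1) * \<delta>} = {}" using sub_cd by auto
    then show False using j by simp
  qed
  have "d - c \<le> (real_of_int j + 1) * \<delta> - real_of_int j * \<delta>" unfolding c_def d_def by linarith
  then have dc: "d - c \<le> \<delta>" by (simp add: algebra_simps)
  define E where "E = {x \<in> {c..d}. cmod (U x - lam) < e'}"
  have Em: "E \<in> sets lebesgue"
  proof -
    have "{x \<in> space lebesgue. cmod (U x - lam) < e'} \<in> sets lebesgue" using meas(3) by measurable
    then have "{c..d} \<inter> {x \<in> space lebesgue. cmod (U x - lam) < e'} \<in> sets lebesgue" by (intro sets.Int) auto
    moreover have "{c..d} \<inter> {x \<in> space lebesgue. cmod (U x - lam) < e'} = E" by (auto simp: E_def)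
    ultimately show ?thesis by simp
  qed
  have E_nonnull: "\<not> (AE x in lebesgue. x \<notin> E)"
  proof
    assume "AE x in lebesgue. x \<notin> E"
    then have "AE x in lebesgue. x \<in> {k0<..<k1} \<inter> {real_of_int j * \<delta>..(real_of_int j + 1) * \<delta>} \<longrightarrow> e' \<le> cmod (U x - lam)"
      by eventually_elim (use sub_cd in \<open>auto simp: E_def\<close>)
    then show False using j by blast
  qed
  \<comment> \<open>Moments of W over E. With p and F starting from 0 at c, the conditions p d = 0
    and F d = 0 say that W g and x W g have integral 0; for a polynomial of degree at most 2 this
    involves the orders 0 to 3.\<close>
  define m where "m k = integral {c..d} (\<lambda>x. W x * (indicator E x * complex_of_real x ^ k))" for k :: nat
  let ?Q = "\<lambda>P x. indicator E x * poly P (complex_of_real x)"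
  have Qm: "?Q P \<in> borel_measurable lebesgue" for P
    using Em by (intro borel_measurable_times borel_measurable_indicator continuous_measurable_lebesgue continuous_intros)
  have Qz: "?Q P x = 0" if "x \<notin> {c..d}" for P x using that by (auto simp: E_def)
  have Qb: "\<exists>K\<ge>0. \<forall>x. cmod (?Q P x) \<le> K" for P
  proof -
    have "compact ((\<lambda>x. poly P (complex_of_real x)) ` {c..d})"
      by (intro compact_continuous_image continuous_intros) auto
    then obtain K where "\<And>x. x \<in> {c..d} \<Longrightarrow> cmod (poly P (complex_of_real x)) \<le> K"
      using compact_imp_bounded bounded_iff by (metis imageI)
    then have "cmod (?Q P x) \<le> max K 0" for x
      by (cases "x \<in> E") (auto simp: E_def intro: max.coboundedI1)
    then show ?thesis by (intro exI[of _ "max K 0"]) auto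
  qed
  have QL: "?Q P \<in> carrier LR" for P
  proof -
    obtain K where "K \<ge> 0" "\<And>x. cmod (?Q P x) \<le> K" using Qb by blast
    then show ?thesis using Qz dc \<delta>(2) cd by (intro L2_bounded_on_interval(1)[OF Qm, where c=c and d=d and K=K]) auto
  qed
  have WL: "(\<lambda>x. W x * g x) \<in> carrier LR" if g: "g \<in> carrier LR" for g
  proof -
    obtain w where "AE x in lebesgue. cmod (W x) \<le> w" using W_bound by blast
    then have "AE x in lebesgue. cmod (W x * g x) \<le> w * cmod (g x)"
      by eventually_elim (auto simp: norm_mult mult_right_mono)
    then show ?thesis
      by (rule L2_dominated[OF g borel_measurable_times[OF meas(4) L2_measurable[OF g]]])
  qed
  have ai: "f absolutely_integrable_on {x..y}" if "f \<in> carrier LR" for f x y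
    using L2_absolutely_integrable[of UNIV f x y] that by (simp add: lebesgue_on_UNIV_eq)
  obtain c1 c2 c3 where cc: "(c1, c2, c3) \<noteq> (0, 0, 0)" "c1 * m 0 + c2 * m 1 + c3 * m 2 = 0" "c1 * m 1 + c2 * m 2 + c3 * m 3 = 0"
    by (rule two_linear_equations)
  define P where "P = [:c1, c2, c3:]"
  have P0: "P \<noteq> 0" using cc(1) by (auto simp: P_def)
  have mono: "(\<lambda>x. indicator E x * complex_of_real x ^ k) \<in> carrier LR" for k
    using QL[of "monom 1 k"] by (simp add: poly_monom)
  have mi: "(\<lambda>x. W x * (indicator E x * complex_of_real x ^ k)) integrable_on {c..d}" for k
    by (intro set_lebesgue_integral_eq_integral(1) ai WL mono)
  have int3: "integral {c..d} (\<lambda>x. a * (W x * (indicator E x * complex_of_real x ^ k)) + a' * (W x * (indicator E x * complex_of_real x ^ l)) + a'' * (W x * (indicator E x * complex_of_real x ^ n)))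
      = a * m k + a' * m l + a'' * m n" for a a' a'' k l n
    unfolding m_def
    by (subst integral_add, intro integrable_add integrable_on_mult_right mi, intro integrable_on_mult_right mi,
        subst integral_add, intro integrable_on_mult_right mi, intro integrable_on_mult_right mi) simp
  have I0: "integral {c..d} (\<lambda>x. W x * ?Q P x) = 0"
  proof -
    have "(\<lambda>x. W x * ?Q P x) = (\<lambda>x. c1 * (W x * (indicator E x * complex_of_real x ^ 0)) + c2 * (W x * (indicator E x * complex_of_real x ^ 1)) + c3 * (W x * (indicator E x * complex_of_real x ^ 2)))"
      by (simp add: P_def algebra_simps power2_eq_square)
    then show ?thesis using cc(2) int3[of c1 0 c2 1 c3 2] by simp
  qed
  have I1: "integral {c..d} (\<lambda>x. complex_of_real x * (W x * ?Q P x)) = 0"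
  proof -
    have "(\<lambda>x. complex_of_real x * (W x * ?Q P x)) = (\<lambda>x. c1 * (W x * (indicator E x * complex_of_real x ^ 1)) + c2 * (W x * (indicator E x * complex_of_real x ^ 2)) + c3 * (W x * (indicator E x * complex_of_real x ^ 3)))"
      by (simp add: P_def algebra_simps power2_eq_square power3_eq_cube)
    then show ?thesis using cc(3) int3[of c1 1 c2 2 c3 3] by simp
  qed
  define nn where "nn = hnorm LR (?Q P)"
  \<comment> \<open>A nonzero polynomial has only finitely many zeros, and \<open>E\<close> is not a
    null set.\<close>
  have nn: "nn > 0"
  proof -
    have "nn \<noteq> 0"
    proof
      assume "nn = 0"
      then have z: "AE x in lebesgue. ?Q P x = 0" using hnorm_L2_eq_0[OF QL] by (simp add: nn_def)
      have "finite {z. poly P z = 0}" using P0 by (rule poly_roots_finite)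
      then have "finite ((\<lambda>x::real. complex_of_real x) -` {z. poly P z = 0})" by (rule finite_vimageI) (simp add: inj_def)
      then have "negligible ((\<lambda>x::real. complex_of_real x) -` {z. poly P z = 0})" by (rule negligible_finite)
      then have "AE x in lebesgue. poly P (complex_of_real x) \<noteq> 0"
        unfolding eventually_ae_filter_negligible by (auto simp: vimage_def)
      with z have "AE x in lebesgue. x \<notin> E" by eventually_elim (auto simp: indicator_def split: if_splits)
      then show False using E_nonnull by blast
    qed
    then show ?thesis by (simp add: nn_def less_le)
  qed
  define g where "g x = complex_of_real (1 / nn) * ?Q P x" for x
  have gL: "g \<in> carrier LR" unfolding g_def by (intro L2_scale QL)
  have gz: "g x = 0" if "x \<notin> E" for x using that by (simp add: g_def)
  have gz': "g x = 0" if "x \<notin> {c..d}" for x using that Qz by (simp add: g_def)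
  have gn: "hnorm LR g = 1"
    using semihilbert.hnorm_scale[OF semihilbert_L2 QL[of P], of "complex_of_real (1 / nn)"] nn
    by (simp add: g_def[abs_def] L2_simps nn_def[symmetric] norm_divide)
  have WgL: "(\<lambda>x. W x * g x) \<in> carrier LR" by (rule WL[OF gL])
  obtain p where p: "prim p (\<lambda>x. W x * g x)" "p c = 0" using prim_exists[OF ai[OF WgL], of c 0] by blast
  have "p absolutely_integrable_on {a..b}" for a b
    by (intro absolutely_integrable_continuous_real prim_continuous[OF p(1)])
  then obtain F where F: "prim F p" "F c = 0" using prim_exists[of p c 0] by blast
  have pd: "p d = 0"
  proof -
    have "integral {c..d} (\<lambda>x. W x * g x) = integral {c..d} (\<lambda>x. complex_of_real (1 / nn) * (W x * ?Q P x))"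
      by (rule integral_cong) (simp add: g_def)
    also have "\<dots> = 0" by (simp only: integral_mult_right I0 mult_zero_right)
    finally show ?thesis using primD(2)[OF p(1) cd] p(2) by simp
  qed
  \<comment> \<open>Integrating x p by parts expresses F d, the integral of p, as minus the first
    moment of W g, since p vanishes at both ends.\<close>
  have Fd: "F d = 0"
  proof -
    have px: "prim (\<lambda>x. complex_of_real x) (\<lambda>x. 1)"
      by (rule prim_of_deriv) (auto intro!: derivative_eq_intros)
    have pr: "prim (\<lambda>x. complex_of_real x * p x) (\<lambda>x. 1 * p x + complex_of_real x * (W x * g x))"
      by (rule prim_mult[OF px p(1)])
    have pi: "p integrable_on {c..d}" by (rule integrable_continuous_real[OF prim_continuous[OF p(1)]])
    have "integral {c..d} (\<lambda>x. complex_of_real x * (W x * g x)) = integral {c..d} (\<lambda>x. complex_of_real (1 / nn) * (complex_of_real x * (W x * ?Q P x)))"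
      by (rule integral_cong) (simp add: g_def)
    also have "\<dots> = 0" by (simp only: integral_mult_right I1 mult_zero_right)
    finally have z: "integral {c..d} (\<lambda>x. complex_of_real x * (W x * g x)) = 0" .
    have "(\<lambda>x. complex_of_real x * (W x * g x)) integrable_on {c..d}"
      using integrable_diff[OF primD(3)[OF pr cd] pi] by simp
    then have "integral {c..d} (\<lambda>x. p x + complex_of_real x * (W x * g x)) = integral {c..d} p"
      using integral_add[OF pi, of "\<lambda>x. complex_of_real x * (W x * g x)"] z by simp
    moreover have "integral {c..d} (\<lambda>x. p x + complex_of_real x * (W x * g x)) = 0"
      using primD(2)[OF pr cd] p(2) pd by simp
    ultimately show ?thesis using primD(2)[OF F(1) cd] F(2) by simp
  qed
  have pz: "p x = 0" if "x \<notin> {c..d}" for x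
  proof (cases "x < c")
    case True
    then show ?thesis using prim_eq_const[OF p(1), of x c] gz' p(2) by simp
  next
    case False
    then have "d < x" using that by simp
    then show ?thesis using prim_eq_const[OF p(1), of d x] gz' pd by simp
  qed
  have Fz: "F x = 0" if "x \<notin> {c..d}" for x
  proof (cases "x < c")
    case True
    then show ?thesis using prim_eq_const[OF F(1), of x c] pz F(2) by simp
  next
    case False
    then have "d < x" using that by simp
    then show ?thesis using prim_eq_const[OF F(1), of d x] pz Fd by simp
  qed
  have pb: "cmod (p x) \<le> C" if "x \<in> {c..d}" for x
  proof -
    \<comment> \<open>From |g| \<le> (1 + |g|^2) / 2, the norm of g being 1 and the length at most
      1, the integral of |W g| is at most C.\<close>
    let ?g = "\<lambda>t. C * ((1 + (cmod (g t))\<^sup>2) / 2)"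
    have gi: "integrable lebesgue (\<lambda>t. (cmod (g t))\<^sup>2)" by (rule L2_integrable[OF gL])
    then have gs: "(\<lambda>t. (cmod (g t))\<^sup>2) absolutely_integrable_on {c..d}"
      unfolding set_integrable_def by (intro integrable_mult_indicator) auto
    have ga: "?g absolutely_integrable_on {c..d}"
      by (intro set_integrable_mult_right set_integrable_divide set_integral_add gs) simp
    have "AE t in lebesgue. t \<in> {c..d} \<longrightarrow> cmod (W t * g t) \<le> ?g t"
      using C
    proof eventually_elim
      case (elim t)
      show ?case
      proof
        assume "t \<in> {c..d}"
        then have w: "cmod (W t) \<le> C" using elim cd_sub by auto
        have "cmod (g t) \<le> (1 + (cmod (g t))\<^sup>2) / 2" using sum_squares_bound[of 1 "cmod (g t)"] by simp
        then have "cmod (W t) * cmod (g t) \<le> C * ((1 + (cmod (g t))\<^sup>2) / 2)"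
          using w C1 by (intro mult_mono) auto
        then show "cmod (W t * g t) \<le> ?g t" by (simp add: norm_mult)
      qed
    qed
    then have "cmod (p x) \<le> integral {c..d} ?g"
      by (intro prim_norm_bound[OF p(1) _ _ p(2) ga]) (use that in auto)
    also have "\<dots> = C * ((integral {c..d} (\<lambda>t. 1) + integral {c..d} (\<lambda>t. (cmod (g t))\<^sup>2)) / 2)"
      using integral_add[OF integrable_const_ivl set_lebesgue_integral_eq_integral(1)[OF gs], of 1] by simp
    also have "\<dots> \<le> C * ((1 + 1) / 2)"
    proof -
      have "integral {c..d} (\<lambda>t. (cmod (g t))\<^sup>2) = (LINT t|lebesgue. indicat_real {c..d} t *\<^sub>R (cmod (g t))\<^sup>2)"
        using set_lebesgue_integral_eq_integral(2)[OF gs] by (simp add: set_lebesgue_integral_def)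
      also have "\<dots> = (LINT t|lebesgue. (cmod (g t))\<^sup>2)"
        by (intro Bochner_Integration.integral_cong refl) (use gz' in \<open>auto simp: indicator_def\<close>)
      also have "\<dots> = 1" using gn hnorm_L2_sq[of lebesgue g] by simp
      finally show ?thesis using dc \<delta>(2) cd C1 by simp
    qed
    finally show ?thesis by simp
  qed
  have Fb: "cmod (F x) \<le> C * \<delta>" if "x \<in> {c..d}" for x
  proof -
    have "cmod (F x) \<le> integral {c..d} (\<lambda>t. C)"
      by (intro prim_norm_bound[OF F(1) _ _ F(2)]) (use that pb in auto)
    also have "\<dots> = C * (d - c)" using cd by simp
    also have "\<dots> \<le> C * \<delta>" using dc C1 by (intro mult_left_mono) auto
    finally show ?thesis .
  qed
  have Fm: "F \<in> borel_measurable lebesgue"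
    by (intro continuous_measurable_lebesgue prim_continuous[OF F(1)])
  have bd: "AE x in lebesgue. x \<in> {c..d} \<longrightarrow> cmod (k x * F x) \<le> e'" if "AE x in lebesgue. x \<in> {c..d} \<longrightarrow> cmod (k x) \<le> C" for k
    using that
  proof eventually_elim
    case (elim x)
    show ?case
    proof
      assume x: "x \<in> {c..d}"
      then have "cmod (k x) * cmod (F x) \<le> C * (C * \<delta>)" using elim Fb[OF x] C1 by (intro mult_mono) auto
      also have "\<dots> \<le> e'" using \<delta>(4) by (simp add: power2_eq_square)
      finally show "cmod (k x * F x) \<le> e'" by (simp add: norm_mult)
    qed
  qed
  have QC: "AE x in lebesgue. x \<in> {c..d} \<longrightarrow> cmod (Q x - lam) \<le> C" and VC: "AE x in lebesgue. x \<in> {c..d} \<longrightarrow> cmod (V x) \<le> C"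
    using C cd_sub by (auto elim!: eventually_mono)
  have mQ: "(\<lambda>x. (Q x - lam) * F x) \<in> borel_measurable lebesgue" "(\<lambda>x. V x * F x) \<in> borel_measurable lebesgue"
    using meas Fm by measurable
  have dc1: "d - c \<le> 1" using dc \<delta> by simp
  have e'0: "0 \<le> e'" using e' by simp
  have QF: "hnorm LR (\<lambda>x. (Q x - lam) * F x) \<le> e'"
    by (rule L2_bounded_on_interval(2)[OF mQ(1) bd[OF QC] _ cd dc1 e'0]) (simp add: Fz)
  have VF: "hnorm LR (\<lambda>x. V x * F x) \<le> e'" "(\<lambda>x. V x * F x) \<in> carrier LR"
    using L2_bounded_on_interval[OF mQ(2) bd[OF VC] _ cd dc1 e'0] by (simp_all add: Fz)
  have mU: "(\<lambda>x. (U x - lam) * g x) \<in> borel_measurable lebesgue" using meas(3) L2_measurable[OF gL] by measurable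
  have Ug': "cmod ((U x - lam) * g x) \<le> e' * cmod (g x)" for x
    by (cases "x \<in> E") (auto simp: gz norm_mult E_def intro!: mult_right_mono)
  then have Ug: "AE x in lebesgue. cmod ((U x - lam) * g x) \<le> e' * cmod (g x)" by blast
  have UgL: "(\<lambda>x. (U x - lam) * g x) \<in> carrier LR" by (rule L2_dominated[OF gL mU Ug])
  have "hnorm LR (\<lambda>x. V x * F x + (U x - lam) * g x) \<le> hnorm LR (\<lambda>x. V x * F x) + hnorm LR (\<lambda>x. (U x - lam) * g x)"
    by (rule L2_triangle[OF VF(2) UgL])
  also have "\<dots> \<le> e' + e' * 1"
    using VF(1) hnorm_L2_mono[OF gL mU Ug e'0] gn by simp
  finally have VU: "hnorm LR (\<lambda>x. V x * F x + (U x - lam) * g x) \<le> e" by (simp add: e'_def)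
  have "e' \<le> e" using e by (simp add: e'_def)
  show thesis
  proof (rule that[OF F(1) p(1) _ cd _ dc1 _ gL gn _ VU])
    show "{c..d} \<subseteq> \<Omega>" using cd_sub k(1) by blast
    show "d - c \<le> e" using dc \<delta> by simp
    show "F x = 0 \<and> p x = 0 \<and> g x = 0" if "x \<notin> {c..d}" for x using Fz pz gz' that by simp
    show "hnorm LR (\<lambda>x. (Q x - lam) * F x) \<le> e" using QF \<open>e' \<le> e\<close> by simp
  qed
qed

end

text \<open>Truncation at height n: the excess of h over n has small integral for some n, and the
  truncated part contributes at most n times the length of the interval.\<close>

lemma absolute_continuity_integral:
  fixes h :: "real \<Rightarrow> real"
  assumes h: "integrable lebesgue h" "\<And>x. 0 \<le> h x" and e: "e > 0"
  shows "\<exists>\<delta>>0. \<forall>c d. c \<le> d \<longrightarrow> d - c \<le> \<delta> \<longrightarrow> (LINT x|lebesgue. indicat_real {c..d} x * h x) \<le> e"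
proof -
  have "(\<lambda>n::nat. LINT x|lebesgue. max (h x - real n) 0) \<longlonglongrightarrow> (LINT x|(lebesgue :: real measure). 0)"
  proof (rule integral_dominated_convergence[where w=h])
    have "(\<lambda>n::nat. max (h x - real n) 0) \<longlonglongrightarrow> 0" for x
    proof (rule tendsto_eventually)
      obtain N :: nat where "h x \<le> real N" using real_arch_simple by blast
      then have "max (h x - real n) 0 = 0" if "n \<ge> N" for n using that by simp
      then show "eventually (\<lambda>n::nat. max (h x - real n) 0 = 0) sequentially" by (rule eventually_sequentiallyI)
    qed
    then show "AE x in lebesgue. (\<lambda>n::nat. max (h x - real n) 0) \<longlonglongrightarrow> 0" by simp
    show "(\<lambda>x. max (h x - real n) 0) \<in> borel_measurable lebesgue" for n :: nat using h(1) by measurable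
    have "norm (max (h x - real n) 0) \<le> h x" for x and n :: nat using h(2)[of x] by simp
    then show "AE x in lebesgue. norm (max (h x - real n) 0) \<le> h x" for n :: nat by blast
  qed (use h in auto)
  then have "eventually (\<lambda>n::nat. (LINT x|lebesgue. max (h x - real n) 0) < e / 2) sequentially"
    by (rule order_tendstoD(2)) (use e in simp)
  then obtain n :: nat where n: "(LINT x|lebesgue. max (h x - real n) 0) < e / 2"
    using eventually_happens'[OF sequentially_bot] by blast
  have im: "integrable lebesgue (\<lambda>x. max (h x - real n) 0)"
    by (rule Bochner_Integration.integrable_bound[OF h(1)]) (use h in \<open>auto intro!: borel_measurable_max\<close>)
  show ?thesis
  proof (intro exI conjI allI impI)
    show "0 < e / (2 * (real n + 1))" using e by simp
    fix c d assume cd: "c \<le> d" "d - c \<le> e / (2 * (real n + 1))"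
    have ii: "integrable lebesgue (indicat_real {c..d})" by (rule integrable_real_indicator) (auto simp: emeasure_lborel_Icc_eq)
    have ih: "integrable lebesgue (\<lambda>x. indicat_real {c..d} x * h x)"
      using integrable_mult_indicator[OF _ h(1), of "{c..d}"] by simp
    have "(LINT x|lebesgue. indicat_real {c..d} x * h x) \<le> (LINT x|lebesgue. real n * indicat_real {c..d} x + max (h x - real n) 0)"
      by (intro integral_mono ih Bochner_Integration.integrable_add integrable_mult_right ii im) (use h in \<open>auto simp: indicator_def\<close>)
    also have "\<dots> = real n * (d - c) + (LINT x|lebesgue. max (h x - real n) 0)"
      using ii im cd by (subst Bochner_Integration.integral_add) auto
    also have "\<dots> \<le> real n * (e / (2 * (real n + 1))) + e / 2"
      using cd n by (intro add_mono mult_left_mono) auto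
    also have "\<dots> \<le> e" using e by (simp add: field_simps)
    finally show "(LINT x|lebesgue. indicat_real {c..d} x * h x) \<le> e" .
  qed
qed

text \<open>Only the part of \<open>y\<close> on the interval enters. Hence bounded sequences with
  supports of shrinking length tend weakly to 0, whether or not their supports overlap.\<close>

lemma L2_tail_Cauchy_Schwarz:
  assumes x: "x \<in> carrier (L2 lebesgue)" "\<And>t. t \<notin> {c..d::real} \<Longrightarrow> x t = 0" and y: "y \<in> carrier (L2 lebesgue)"
  shows "cmod (LINT t|lebesgue. x t * cnj (y t)) \<le> hnorm (L2 lebesgue) x * sqrt (LINT t|lebesgue. indicat_real {c..d} t * (cmod (y t))\<^sup>2)"
proof -
  let ?y = "\<lambda>t. indicator {c..d} t * y t"
  have "(indicator {c..d} :: real \<Rightarrow> complex) \<in> borel_measurable lebesgue"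
    by (intro borel_measurable_indicator) auto
  then have m: "?y \<in> borel_measurable lebesgue" by (rule borel_measurable_times[OF _ L2_measurable[OF y]])
  have yL: "?y \<in> carrier (L2 lebesgue)"
    by (rule L2_dominated[OF y m, where C=1]) (auto simp: indicator_def)
  have "(LINT t|lebesgue. x t * cnj (y t)) = (LINT t|lebesgue. x t * cnj (?y t))"
    by (intro Bochner_Integration.integral_cong refl) (use x(2) in \<open>auto simp: indicator_def\<close>)
  moreover have "(cmod (?y t))\<^sup>2 = indicat_real {c..d} t * (cmod (y t))\<^sup>2" for t by (simp add: indicator_def)
  then have "hnorm (L2 lebesgue) ?y = sqrt (LINT t|lebesgue. indicat_real {c..d} t * (cmod (y t))\<^sup>2)"
    unfolding hnorm_L2 by (simp only: )
  ultimately show ?thesis using L2_Cauchy_Schwarz[OF x(1) yL] by metis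
qed

context matrix_model
begin

lemma T_shift_iff:
  "((f, g), (u, v)) \<in> op_shift (Hsp UNIV) (op_T Q W V U) \<zeta> \<longleftrightarrow>
     f \<in> domA Q \<and> g \<in> domU U \<and> u \<in> carrier LR \<and> v \<in> carrier LR \<and>
     (\<exists>h. weak_deriv UNIV 2 f h \<and> (AE x in lebesgue. u x = - h x + (Q x - \<zeta>) * f x + W x * g x)) \<and>
     (AE x in lebesgue. v x = V x * f x + (U x - \<zeta>) * g x)"
  unfolding op_T_def using shift_matrix_iff[OF _ domA_sub domU_sub, of f g u v \<zeta>]
  by (simp add: lebesgue_on_UNIV_eq AE_lebesgue_on_iff)

lemma Tn_shift_iff:
  "((f, g), (u, v)) \<in> op_shift (Hsp (interval n)) (op_Tn Q W V U n) \<zeta> \<longleftrightarrow>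
     f \<in> domN n \<and> g \<in> carrier (L2 (lebesgue_on (interval n))) \<and>
     u \<in> carrier (L2 (lebesgue_on (interval n))) \<and> v \<in> carrier (L2 (lebesgue_on (interval n))) \<and>
     (\<exists>h. weak_deriv (interval n) 2 f h \<and> (AE x in lebesgue_on (interval n). u x = - h x + (Q x - \<zeta>) * f x + W x * g x)) \<and>
     (AE x in lebesgue_on (interval n). v x = V x * f x + (U x - \<zeta>) * g x)"
  unfolding op_Tn_def using shift_matrix_iff[OF _ domN_sub order_refl, of n f g u v \<zeta>] by simp

lemma domA_iff: "f \<in> domA Q \<longleftrightarrow> f \<in> sobolev 2 UNIV \<and> (\<lambda>x. Q x * f x) \<in> carrier LR"
  and domU_iff: "f \<in> domU U \<longleftrightarrow> f \<in> carrier LR \<and> (\<lambda>x. U x * f x) \<in> carrier LR"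
  by (simp_all add: domA_def domU_def lebesgue_on_UNIV_eq)

text \<open>The domains enter only through \<open>D1\<close> and \<open>D2\<close>, which say that
  compactly supported solutions belong to them; so one construction serves the line and all
  intervals. As F'' = W g, the first row reduces to (Q - lam) F.\<close>

lemma local_approximate_eigenvector:
  assumes \<Omega>: "open \<Omega>" and lam: "\<And>e. e > 0 \<Longrightarrow> \<not> (AE x in lebesgue_on \<Omega>. e \<le> cmod (U x - lam))" and e: "e > 0"
    and D1: "\<And>F p h c d. prim F p \<Longrightarrow> prim p h \<Longrightarrow> F \<in> carrier (L2 (lebesgue_on \<Omega>)) \<Longrightarrow> p \<in> carrier (L2 (lebesgue_on \<Omega>)) \<Longrightarrow>
      h \<in> carrier (L2 (lebesgue_on \<Omega>)) \<Longrightarrow> {c..d} \<subseteq> \<Omega> \<Longrightarrow> (\<And>x. x \<notin> {c..d} \<Longrightarrow> F x = 0) \<Longrightarrow> F \<in> D1"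
    and D2: "\<And>g c d. g \<in> carrier (L2 (lebesgue_on \<Omega>)) \<Longrightarrow> {c..d} \<subseteq> \<Omega> \<Longrightarrow> (\<And>x. x \<notin> {c..d} \<Longrightarrow> g x = 0) \<Longrightarrow> g \<in> D2"
    and sub: "D1 \<subseteq> carrier (L2 (lebesgue_on \<Omega>))" "D2 \<subseteq> carrier (L2 (lebesgue_on \<Omega>))"
    and gr: "graph_op (Hsp \<Omega>) (Mop \<Omega> D1 D2)"
  obtains f g u v c d where "((f, g), (u, v)) \<in> op_shift (Hsp \<Omega>) (Mop \<Omega> D1 D2) lam"
    "hnorm (Hsp \<Omega>) (f, g) = 1" "hnorm (Hsp \<Omega>) (u, v) \<le> e" "c \<le> d" "d - c \<le> e" "{c..d} \<subseteq> \<Omega>"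
    "\<And>x. x \<notin> {c..d} \<Longrightarrow> f x = 0 \<and> g x = 0"
proof -
  have \<Omega>m: "\<Omega> \<in> sets lebesgue" using \<Omega> by simp
  interpret G: graph_op "Hsp \<Omega>" "Mop \<Omega> D1 D2" by fact
  define e' where "e' = e / 2"
  have e': "e' > 0" "e' \<le> e" "2 * e' = e" using e by (auto simp: e'_def)
  obtain F p g c d where s: "prim F p" "prim p (\<lambda>x. W x * g x)" "{c..d} \<subseteq> \<Omega>" "c \<le> d" "d - c \<le> e'" "d - c \<le> 1"
    "\<And>x. x \<notin> {c..d} \<Longrightarrow> F x = 0 \<and> p x = 0 \<and> g x = 0"
    "g \<in> carrier LR" "hnorm LR g = 1"
    "hnorm LR (\<lambda>x. (Q x - lam) * F x) \<le> e'" "hnorm LR (\<lambda>x. V x * F x + (U x - lam) * g x) \<le> e'"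
    by (rule local_solution[OF \<Omega> lam e'(1)]) blast+
  let ?u = "\<lambda>x. (Q x - lam) * F x" and ?v = "\<lambda>x. V x * F x + (U x - lam) * g x"
  obtain C where C: "C \<ge> 1" "AE x in lebesgue. x \<in> {c..d} \<longrightarrow> cmod (Q x) \<le> C \<and> cmod (V x) \<le> C \<and> cmod (U x) \<le> C \<and> cmod (W x) \<le> C"
    using local_bound .
  have zero: "\<And>x. x \<notin> {c..d} \<Longrightarrow> F x = 0" "\<And>x. x \<notin> {c..d} \<Longrightarrow> p x = 0" "\<And>x. x \<notin> {c..d} \<Longrightarrow> g x = 0"
    using s(7) by blast+
  have cont: "k \<in> carrier LR" if k: "continuous_on UNIV k" "\<And>x. x \<notin> {c..d} \<Longrightarrow> k x = 0" for k
  proof -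
    have "compact (k ` {c..d})" by (intro compact_continuous_image continuous_on_subset[OF k(1)]) auto
    then obtain K where K: "\<And>x. x \<in> {c..d} \<Longrightarrow> cmod (k x) \<le> K"
      using compact_imp_bounded bounded_iff by (metis imageI)
    have "0 \<le> K" using K[of c] s(4) norm_ge_zero[of "k c"] by (meson atLeastAtMost_iff order_refl order_trans)
    then show ?thesis
      by (intro L2_bounded_on_interval(1)[OF continuous_measurable_lebesgue[OF k(1)] _ k(2) s(4,6)]) (use K in auto)
  qed
  have FL: "F \<in> carrier LR" by (rule cont[OF prim_continuous[OF s(1)] zero(1)])
  have pL: "p \<in> carrier LR" by (rule cont[OF prim_continuous[OF s(2)] zero(2)])
  have loc_mult: "(\<lambda>x. k x * y x) \<in> carrier LR"
    if "k \<in> borel_measurable lebesgue" "AE x in lebesgue. x \<in> {c..d} \<longrightarrow> cmod (k x) \<le> C" "y \<in> carrier LR" "\<And>x. x \<notin> {c..d} \<Longrightarrow> y x = 0" for k y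
  proof (rule L2_dominated[OF that(3)])
    show "(\<lambda>x. k x * y x) \<in> borel_measurable lebesgue" by (rule borel_measurable_times[OF that(1) L2_measurable[OF that(3)]])
    show "AE x in lebesgue. cmod (k x * y x) \<le> C * cmod (y x)"
      using that(2)
    proof eventually_elim
      case (elim x)
      then show ?case using that(4)[of x] by (cases "x \<in> {c..d}") (auto simp: norm_mult mult_right_mono)
    qed
  qed
  have CQ: "AE x in lebesgue. x \<in> {c..d} \<longrightarrow> cmod (Q x) \<le> C" "AE x in lebesgue. x \<in> {c..d} \<longrightarrow> cmod (V x) \<le> C"
     "AE x in lebesgue. x \<in> {c..d} \<longrightarrow> cmod (U x) \<le> C" "AE x in lebesgue. x \<in> {c..d} \<longrightarrow> cmod (W x) \<le> C"
    using C(2) by (auto elim: eventually_mono)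
  have uL: "?u \<in> carrier LR"
    using L2_diff[OF loc_mult[OF meas(1) CQ(1) FL zero(1)] L2_scale[OF FL, of lam]] by (simp add: algebra_simps)
  have vL: "?v \<in> carrier LR"
    using L2_add[OF loc_mult[OF meas(2) CQ(2) FL zero(1)] L2_diff[OF loc_mult[OF meas(3) CQ(3) s(8) zero(3)] L2_scale[OF s(8), of lam]]]
    by (simp add: algebra_simps)
  have WgL: "(\<lambda>x. W x * g x) \<in> carrier LR" by (rule loc_mult[OF meas(4) CQ(4) s(8) zero(3)])
  have res: "k \<in> carrier (L2 (lebesgue_on \<Omega>))" "hnorm (L2 (lebesgue_on \<Omega>)) k = hnorm LR k"
    if "k \<in> carrier LR" "\<And>x. x \<notin> {c..d} \<Longrightarrow> k x = 0" for k
  proof -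
    have "k x = 0" if "x \<notin> \<Omega>" for x using that s(3) \<open>\<And>x. x \<notin> {c..d} \<Longrightarrow> k x = 0\<close> by blast
    then show "k \<in> carrier (L2 (lebesgue_on \<Omega>))" "hnorm (L2 (lebesgue_on \<Omega>)) k = hnorm LR k"
      using L2_restrict_support[OF \<Omega>m, of k] \<open>k \<in> carrier LR\<close> by auto
  qed
  have FO: "F \<in> carrier (L2 (lebesgue_on \<Omega>))" by (rule res(1)[OF FL zero(1)])
  have pO: "p \<in> carrier (L2 (lebesgue_on \<Omega>))" by (rule res(1)[OF pL zero(2)])
  have gO: "g \<in> carrier (L2 (lebesgue_on \<Omega>))" by (rule res(1)[OF s(8) zero(3)])
  have WgO: "(\<lambda>x. W x * g x) \<in> carrier (L2 (lebesgue_on \<Omega>))" by (rule res(1)[OF WgL]) (simp add: zero)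
  have uO: "?u \<in> carrier (L2 (lebesgue_on \<Omega>))" "hnorm (L2 (lebesgue_on \<Omega>)) ?u = hnorm LR ?u"
    by (rule res[OF uL], simp add: zero)+
  have vO: "?v \<in> carrier (L2 (lebesgue_on \<Omega>))" "hnorm (L2 (lebesgue_on \<Omega>)) ?v = hnorm LR ?v"
    by (rule res[OF vL], simp add: zero)+
  have wd: "weak_deriv \<Omega> 2 F (\<lambda>x. W x * g x)" by (rule prim_weak_deriv2[OF s(1,2) \<Omega>m])
  have mem: "((F, g), (?u, ?v)) \<in> op_shift (Hsp \<Omega>) (Mop \<Omega> D1 D2) lam"
    unfolding shift_matrix_iff[OF \<Omega>m sub]
  proof (intro conjI exI)
    show "F \<in> D1" by (rule D1[OF s(1,2) FO pO WgO s(3) zero(1)])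
    show "g \<in> D2" by (rule D2[OF gO s(3) zero(3)])
  qed (use uO vO wd in auto)
  \<comment> \<open>The second component alone has norm 1, so N \<ge> 1 and normalising does not
    enlarge the image.\<close>
  define N where "N = hnorm (Hsp \<Omega>) (F, g)"
  have gn: "hnorm (L2 (lebesgue_on \<Omega>)) g = 1" using res(2)[OF s(8) zero(3)] s(9) by simp
  have N1: "N \<ge> 1" using hnorm_Hsp_ge(2)[OF FO gO] gn by (simp add: N_def)
  have uvn: "hnorm (Hsp \<Omega>) (?u, ?v) \<le> e"
  proof (rule power2_le_imp_le)
    have "(hnorm (Hsp \<Omega>) (?u, ?v))\<^sup>2 = (hnorm LR ?u)\<^sup>2 + (hnorm LR ?v)\<^sup>2"
      unfolding hnorm_Hsp_sq[OF uO(1) vO(1)] uO(2) vO(2) ..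
    also have "\<dots> \<le> e'\<^sup>2 + e'\<^sup>2" by (intro add_mono power_mono s hnorm_L2_nonneg)
    also have "\<dots> \<le> (2 * e')\<^sup>2" by (simp add: power2_eq_square)
    finally show "(hnorm (Hsp \<Omega>) (?u, ?v))\<^sup>2 \<le> e\<^sup>2" using e'(3) by simp
  qed (use e in simp)
  let ?c = "complex_of_real (1 / N)"
  have sc: "(hilbert.scale (Hsp \<Omega>) ?c (F, g), hilbert.scale (Hsp \<Omega>) ?c (?u, ?v)) \<in> op_shift (Hsp \<Omega>) (Mop \<Omega> D1 D2) lam"
    by (rule G.shift_scale[OF mem])
  have cl: "(F, g) \<in> carrier (Hsp \<Omega>)" "(?u, ?v) \<in> carrier (Hsp \<Omega>)" using G.shift_closed[OF mem] by auto
  show thesis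
  proof (rule that[of "\<lambda>x. ?c * F x" "\<lambda>x. ?c * g x" "\<lambda>x. ?c * ?u x" "\<lambda>x. ?c * ?v x" c d])
    show "((\<lambda>x. ?c * F x, \<lambda>x. ?c * g x), (\<lambda>x. ?c * ?u x, \<lambda>x. ?c * ?v x)) \<in> op_shift (Hsp \<Omega>) (Mop \<Omega> D1 D2) lam"
      using sc by (simp add: hilbert_sum_simps L2_simps)
    have "hnorm (Hsp \<Omega>) (hilbert.scale (Hsp \<Omega>) ?c (F, g)) = 1"
      unfolding G.hnorm_scale[OF cl(1)] N_def[symmetric] using N1 by (simp add: norm_divide)
    then show "hnorm (Hsp \<Omega>) (\<lambda>x. ?c * F x, \<lambda>x. ?c * g x) = 1"
      by (simp add: hilbert_sum_simps L2_simps)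
    have "hnorm (Hsp \<Omega>) (hilbert.scale (Hsp \<Omega>) ?c (?u, ?v)) = 1 / N * hnorm (Hsp \<Omega>) (?u, ?v)"
      unfolding G.hnorm_scale[OF cl(2)] using N1 by (simp add: norm_divide)
    also have "\<dots> \<le> 1 * e" using N1 uvn by (intro mult_mono) auto
    finally show "hnorm (Hsp \<Omega>) (\<lambda>x. ?c * ?u x, \<lambda>x. ?c * ?v x) \<le> e"
      by (simp add: hilbert_sum_simps L2_simps)
  qed (use s e' zero in auto)
qed

text \<open>The approximate eigenvectors are taken on intervals of length at most 1/(n+1). Absolute
  continuity of the integral of |y|^2 then gives weak convergence to 0 in each component.\<close>

lemma essran_subset_ess_spectrum: "essran U \<subseteq> ess_spectrum (Hsp UNIV) (op_T Q W V U)"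
proof
  fix lam assume "lam \<in> essran U"
  then have lam: "\<not> (AE x in lebesgue_on UNIV. e \<le> cmod (U x - lam))" if "e > 0" for e
    using that unfolding essran_iff[OF meas(3)] lebesgue_on_UNIV_eq dist_norm by blast
  have ex: "\<exists>f g u v c d. ((f, g), (u, v)) \<in> op_shift (Hsp UNIV) (op_T Q W V U) lam \<and> hnorm (Hsp UNIV) (f, g) = 1 \<and>
     hnorm (Hsp UNIV) (u, v) \<le> 1 / real (Suc n) \<and> c \<le> d \<and> d - c \<le> 1 / real (Suc n) \<and> (\<forall>x. x \<notin> {c..d} \<longrightarrow> f x = 0 \<and> g x = 0)" for n
  proof -
    have D1: "F \<in> domA Q" if "prim F p" "prim p h" "F \<in> carrier (L2 (lebesgue_on UNIV))" "p \<in> carrier (L2 (lebesgue_on UNIV))"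
      "h \<in> carrier (L2 (lebesgue_on UNIV))" "\<And>x. x \<notin> {c..d} \<Longrightarrow> F x = 0" for F p h c d
    proof -
      obtain C where C: "C \<ge> 1" "AE x in lebesgue. x \<in> {c..d} \<longrightarrow> cmod (Q x) \<le> C \<and> cmod (V x) \<le> C \<and> cmod (U x) \<le> C \<and> cmod (W x) \<le> C"
        using local_bound .
      have FL: "F \<in> carrier LR" using that(3) by (simp add: lebesgue_on_UNIV_eq)
      have "AE x in lebesgue. cmod (Q x * F x) \<le> C * cmod (F x)"
        using C(2)
      proof eventually_elim
        case (elim x)
        then show ?case using that(6)[of x] by (cases "x \<in> {c..d}") (auto simp: norm_mult mult_right_mono)
      qed
      then have "(\<lambda>x. Q x * F x) \<in> carrier LR"
        by (rule L2_dominated[OF FL borel_measurable_times[OF meas(1) L2_measurable[OF FL]]])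
      then show ?thesis unfolding domA_iff using sobolev2I(1)[OF _ that(1-5)] by simp
    qed
    have D2: "g \<in> domU U" if "g \<in> carrier (L2 (lebesgue_on UNIV))" "\<And>x. x \<notin> {c..d} \<Longrightarrow> g x = 0" for g c d
    proof -
      obtain C where C: "C \<ge> 1" "AE x in lebesgue. x \<in> {c..d} \<longrightarrow> cmod (Q x) \<le> C \<and> cmod (V x) \<le> C \<and> cmod (U x) \<le> C \<and> cmod (W x) \<le> C"
        using local_bound .
      have gL: "g \<in> carrier LR" using that(1) by (simp add: lebesgue_on_UNIV_eq)
      have "AE x in lebesgue. cmod (U x * g x) \<le> C * cmod (g x)"
        using C(2)
      proof eventually_elim
        case (elim x)
        then show ?case using that(2)[of x] by (cases "x \<in> {c..d}") (auto simp: norm_mult mult_right_mono)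
      qed
      then have "(\<lambda>x. U x * g x) \<in> carrier LR"
        by (rule L2_dominated[OF gL borel_measurable_times[OF meas(3) L2_measurable[OF gL]]])
      then show ?thesis unfolding domU_iff using gL by simp
    qed
    have e: "1 / real (Suc n) > 0" by simp
    obtain f g u v c d where "((f, g), (u, v)) \<in> op_shift (Hsp UNIV) (Mop UNIV (domA Q) (domU U)) lam"
        "hnorm (Hsp UNIV) (f, g) = 1" "hnorm (Hsp UNIV) (u, v) \<le> 1 / real (Suc n)" "c \<le> d" "d - c \<le> 1 / real (Suc n)"
        "\<And>x. x \<notin> {c..d} \<Longrightarrow> f x = 0 \<and> g x = 0"
      by (rule local_approximate_eigenvector[OF open_UNIV lam e D1 D2 domA_sub domU_sub T_graph[unfolded op_T_def]]) blast+
    then show ?thesis unfolding op_T_def by blast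
  qed
  obtain f g u v c d where s: "\<And>n. ((f n, g n), (u n, v n)) \<in> op_shift (Hsp UNIV) (op_T Q W V U) lam"
     "\<And>n. hnorm (Hsp UNIV) (f n, g n) = 1"
     "\<And>n. hnorm (Hsp UNIV) (u n, v n) \<le> 1 / real (Suc n)" "\<And>n. c n \<le> d n" "\<And>n. d n - c n \<le> 1 / real (Suc n)"
     "\<And>n x. x \<notin> {c n..d n} \<Longrightarrow> f n x = 0 \<and> g n x = 0"
    using ex by metis
  have L: "f n \<in> carrier LR" "g n \<in> carrier LR" for n
    using s(1)[of n] unfolding T_shift_iff domA_iff domU_iff by (auto simp: sobolev_def lebesgue_on_UNIV_eq)
  have n1: "hnorm LR (f n) \<le> 1" "hnorm LR (g n) \<le> 1" for n
    using hnorm_Hsp_ge[of "f n" UNIV "g n"] L[of n] s(2)[of n] by (simp_all add: lebesgue_on_UNIV_eq)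
  have w0: "(\<lambda>n. LINT t|lebesgue. k n t * cnj (y t)) \<longlonglongrightarrow> 0"
    if k: "\<And>n. k n \<in> carrier LR" "\<And>n. hnorm LR (k n) \<le> 1" "\<And>n t. t \<notin> {c n..d n} \<Longrightarrow> k n t = 0" and y: "y \<in> carrier LR" for k y
  proof (rule LIMSEQ_I)
    fix r :: real assume r: "r > 0"
    have "(r / 2)\<^sup>2 > 0" using r by simp
    then obtain \<delta> where \<delta>: "\<delta> > 0" "\<And>c d. c \<le> d \<Longrightarrow> d - c \<le> \<delta> \<Longrightarrow> (LINT t|lebesgue. indicat_real {c..d} t * (cmod (y t))\<^sup>2) \<le> (r / 2)\<^sup>2"
      using absolute_continuity_integral[OF L2_integrable[OF y]] by (metis zero_le_power2)
    obtain N :: nat where N: "N > 0" "1 / real N < \<delta>" using \<delta>(1) by (metis nat_approx_posE zero_less_Suc of_nat_Suc)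
    show "\<exists>N. \<forall>n\<ge>N. norm ((LINT t|lebesgue. k n t * cnj (y t)) - 0) < r"
    proof (intro exI allI impI)
      fix n assume n: "n \<ge> N"
      have "1 / real (Suc n) \<le> 1 / real N" using N n by (intro divide_left_mono) auto
      then have "d n - c n \<le> \<delta>" using s(5)[of n] N(2) by simp
      then have "sqrt (LINT t|lebesgue. indicat_real {c n..d n} t * (cmod (y t))\<^sup>2) \<le> sqrt ((r / 2)\<^sup>2)"
        using \<delta>(2)[OF s(4)] by (intro real_sqrt_le_mono)
      then have sq: "sqrt (LINT t|lebesgue. indicat_real {c n..d n} t * (cmod (y t))\<^sup>2) \<le> r / 2" using r by simp
      have "cmod (LINT t|lebesgue. k n t * cnj (y t)) \<le> hnorm LR (k n) * sqrt (LINT t|lebesgue. indicat_real {c n..d n} t * (cmod (y t))\<^sup>2)"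
        by (rule L2_tail_Cauchy_Schwarz[OF k(1) k(3) y])
      also have "\<dots> \<le> 1 * (r / 2)" by (intro mult_mono k(2) sq) (auto intro!: integral_nonneg_AE)
      finally show "norm ((LINT t|lebesgue. k n t * cnj (y t)) - 0) < r" using r by simp
    qed
  qed
  have "weakly_null (Hsp UNIV) (\<lambda>n. (f n, g n))"
    unfolding weakly_null_def
  proof
    fix y assume "y \<in> carrier (Hsp UNIV)"
    then obtain y1 y2 where y: "y = (y1, y2)" "y1 \<in> carrier LR" "y2 \<in> carrier LR"
      by (cases y) (auto simp: hilbert_sum_simps lebesgue_on_UNIV_eq)
    have "(\<lambda>n. (LINT t|lebesgue. f n t * cnj (y1 t)) + (LINT t|lebesgue. g n t * cnj (y2 t))) \<longlonglongrightarrow> 0 + 0"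
      by (intro tendsto_add w0 L n1 y) (use s(6) in auto)
    then show "(\<lambda>n. inn (Hsp UNIV) (f n, g n) y) \<longlonglongrightarrow> 0"
      by (simp add: y(1) hilbert_sum_simps L2_simps lebesgue_on_UNIV_eq)
  qed
  moreover have "(\<lambda>n. hnorm (Hsp UNIV) (u n, v n)) \<longlonglongrightarrow> 0"
  proof (rule tendsto_sandwich[OF always_eventually always_eventually, where f="\<lambda>_. 0"])
    show "(\<lambda>n. 1 / real (Suc n)) \<longlonglongrightarrow> 0" using LIMSEQ_Suc[OF lim_const_over_n[of 1]] .
  qed (use s(3) in auto)
  ultimately show "lam \<in> ess_spectrum (Hsp UNIV) (op_T Q W V U)"
    unfolding ess_spectrum_def using s(1,2)
    by (intro CollectI exI[of _ "\<lambda>n. (f n, g n)"] exI[of _ "\<lambda>n. (u n, v n)"]) simp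
qed

text \<open>\<open>U\<close> is essentially bounded on the interval. If each point had a disc around
  it that \<open>U\<close> avoids almost everywhere, finitely many such discs would cover the closed
  disc containing the values of \<open>U\<close>. So some \<open>lam\<close> is an essential value
  there, and approximate eigenvectors at \<open>lam\<close> exclude a bounded inverse.\<close>

lemma Tn_spectrum_nonempty:
  assumes n: "n \<ge> 1"
  shows "spectrum (Hsp (interval n)) (op_Tn Q W V U n) \<noteq> {}"
proof -
  let ?I = "interval n"
  obtain C where C: "C \<ge> 1" "AE x in lebesgue. x \<in> {- real n..real n} \<longrightarrow> cmod (Q x) \<le> C \<and> cmod (V x) \<le> C \<and> cmod (U x) \<le> C \<and> cmod (W x) \<le> C"
    using local_bound .
  have "\<exists>lam. \<forall>e>0. \<not> (AE x in lebesgue_on ?I. e \<le> cmod (U x - lam))"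
  proof (rule ccontr)
    assume "\<not> ?thesis"
    then obtain r where r: "\<And>z. r z > 0" "\<And>z. AE x in lebesgue_on ?I. r z \<le> cmod (U x - z)" by metis
    have "cball 0 C \<subseteq> (\<Union>z\<in>cball 0 C. ball z (r z))" using r(1) by auto
    then obtain Z where Z: "finite Z" "cball 0 C \<subseteq> (\<Union>z\<in>Z. ball z (r z))"
      using compactE_image[OF compact_cball, of "cball 0 C" "\<lambda>z. ball z (r z)" 0 C] by (metis open_ball)
    have "AE x in lebesgue_on ?I. \<forall>z\<in>Z. r z \<le> cmod (U x - z)"
      using Z(1) r(2) by (simp add: AE_finite_all)
    moreover have "AE x in lebesgue_on ?I. cmod (U x) \<le> C"
      using C(2) unfolding AE_lebesgue_on_iff[OF interval_sets(1)] by (auto simp: interval_def elim: eventually_mono)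
    ultimately have "AE x in lebesgue_on ?I. False"
    proof eventually_elim
      case (elim x)
      then have "U x \<in> cball 0 C" by simp
      then obtain z where "z \<in> Z" "U x \<in> ball z (r z)" using Z(2) by blast
      then show ?case using elim(1) by (force simp: dist_norm norm_minus_commute)
    qed
    then have "AE x in lebesgue. x \<notin> ?I" unfolding AE_lebesgue_on_iff[OF interval_sets(1)] by simp
    then obtain N where N: "negligible N" "\<And>x. x \<notin> N \<Longrightarrow> x \<notin> ?I" using AE_negligibleE by blast
    then have "negligible ?I" using negligible_subset by blast
    moreover have "0 \<in> ?I" using n by (simp add: interval_def)
    ultimately show False using open_not_negligible[of ?I] by auto
  qed
  then obtain lam where lam: "\<And>e. e > 0 \<Longrightarrow> \<not> (AE x in lebesgue_on ?I. e \<le> cmod (U x - lam))" by blast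
  have D1: "F \<in> domN n" if "prim F p" "prim p h" "F \<in> carrier (L2 (lebesgue_on ?I))" "p \<in> carrier (L2 (lebesgue_on ?I))"
      "h \<in> carrier (L2 (lebesgue_on ?I))" "{c..d} \<subseteq> ?I" "\<And>x. x \<notin> {c..d} \<Longrightarrow> F x = 0" for F p h c d
  proof -
    have "real n \<notin> ?I" "- real n \<notin> ?I" by (auto simp: interval_def)
    then have "F (real n) = 0" "F (- real n) = 0" using that(6,7) by blast+
    then have "vanishes_at_ends (- real n) (real n) F"
      unfolding vanishes_at_ends_def using prim_continuous[OF that(1)] by (intro exI[of _ F]) auto
    then show ?thesis using sobolev2I(1)[OF interval_sets(1) that(1-5)] by simp
  qed
  have D2: "g \<in> carrier (L2 (lebesgue_on ?I))"
    if "g \<in> carrier (L2 (lebesgue_on ?I))" "{c..d} \<subseteq> ?I" "\<And>x. x \<notin> {c..d} \<Longrightarrow> g x = 0" for g c d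
    by (rule that(1))
  have "lam \<notin> resolvent_set (Hsp ?I) (op_Tn Q W V U n)"
  proof
    assume "lam \<in> resolvent_set (Hsp ?I) (op_Tn Q W V U n)"
    then have "\<exists>K. \<forall>(x, y)\<in>op_shift (Hsp ?I) (op_Tn Q W V U n) lam. hnorm (Hsp ?I) x \<le> K * hnorm (Hsp ?I) y"
      unfolding resolvent_set_def by simp
    then obtain K where K: "\<forall>(x, y)\<in>op_shift (Hsp ?I) (op_Tn Q W V U n) lam. hnorm (Hsp ?I) x \<le> K * hnorm (Hsp ?I) y" ..
    define e where "e = 1 / (2 * (\<bar>K\<bar> + 1))"
    have e: "e > 0" by (simp add: e_def)
    obtain f g u v where s: "((f, g), (u, v)) \<in> op_shift (Hsp ?I) (Mop ?I (domN n) (carrier (L2 (lebesgue_on ?I)))) lam"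
        "hnorm (Hsp ?I) (f, g) = 1" "hnorm (Hsp ?I) (u, v) \<le> e"
      by (rule local_approximate_eigenvector[OF interval_sets(2) lam e D1 D2 domN_sub order_refl Tn_graph[unfolded op_Tn_def]]) blast+
    have "1 \<le> K * hnorm (Hsp ?I) (u, v)" using bspec[OF K s(1)[folded op_Tn_def]] s(2) by simp
    also have "\<dots> \<le> \<bar>K\<bar> * e" using s(3) by (intro mult_mono) auto
    also have "\<dots> < 1" by (simp add: e_def field_simps)
    finally show False by simp
  qed
  then show ?thesis by (auto simp: spectrum_def)
qed

end

section \<open>Pointwise bounds, the form of \<open>Q\<close> and compactness\<close>

lemma indicator_L2:
  fixes x t :: real
  assumes "x \<le> t"
  shows "(indicator {x..t} :: real \<Rightarrow> complex) \<in> carrier (L2 lebesgue)" "hnorm (L2 lebesgue) (indicator {x..t}) = sqrt (t - x)"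
proof -
  have sq: "(\<lambda>s. (cmod (indicator {x..t} s))\<^sup>2) = indicat_real {x..t}" by (auto simp: indicator_def)
  have ii: "integrable lebesgue (indicat_real {x..t})" by (rule integrable_real_indicator) (auto simp: emeasure_lborel_Icc_eq)
  show "(indicator {x..t} :: real \<Rightarrow> complex) \<in> carrier (L2 lebesgue)"
    unfolding carrier_L2 sq using ii by (auto intro!: borel_measurable_indicator)
  show "hnorm (L2 lebesgue) (indicator {x..t}) = sqrt (t - x)"
    unfolding hnorm_L2 sq using assms by simp
qed

lemma integral_interval_L2:
  fixes f :: "real \<Rightarrow> complex"
  assumes f: "f \<in> carrier (L2 lebesgue)" and "x \<le> t"
  shows "integral {x..t} f = (LINT s|lebesgue. f s * cnj (indicator {x..t} s))"
    and "cmod (integral {x..t} f) \<le> hnorm (L2 lebesgue) f * sqrt (t - x)"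
proof -
  have "f absolutely_integrable_on {x..t}"
    using L2_absolutely_integrable[of UNIV f x t] f by (simp add: lebesgue_on_UNIV_eq)
  then have "integral {x..t} f = (LINT s|lebesgue. indicat_real {x..t} s *\<^sub>R f s)"
    using set_lebesgue_integral_eq_integral(2) by (metis set_lebesgue_integral_def)
  also have "\<dots> = (LINT s|lebesgue. f s * cnj (indicator {x..t} s))"
    by (intro Bochner_Integration.integral_cong) (auto simp: indicator_def)
  finally show *: "integral {x..t} f = (LINT s|lebesgue. f s * cnj (indicator {x..t} s))" .
  show "cmod (integral {x..t} f) \<le> hnorm (L2 lebesgue) f * sqrt (t - x)"
    unfolding * using L2_Cauchy_Schwarz[OF f indicator_L2(1)[OF assms(2)]] indicator_L2(2)[OF assms(2)] by simp
qed

text \<open>The value at x is compared with the mean over [x, x + \<delta>], from which it differs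
  by at most sqrt \<delta> times the norm of p. The mean is an inner product with an indicator, so
  weak convergence together with bounded p yields pointwise convergence.\<close>

lemma prim_average:
  assumes F: "prim F p" and L: "p \<in> carrier (L2 lebesgue)" and \<delta>: "0 < \<delta>"
  shows "cmod (F x) \<le> cmod (integral {x..x + \<delta>} F) / \<delta> + sqrt \<delta> * hnorm (L2 lebesgue) p"
proof -
  have Fi: "F integrable_on {x..x + \<delta>}" by (rule integrable_continuous_real[OF prim_continuous[OF F]])
  have "cmod (integral {x..x + \<delta>} (\<lambda>t. F x - F t)) \<le> integral {x..x + \<delta>} (\<lambda>t. sqrt \<delta> * hnorm (L2 lebesgue) p)"
  proof (rule integral_norm_bound_integral)
    show "(\<lambda>t. F x - F t) integrable_on {x..x + \<delta>}" using Fi by (intro integrable_diff) auto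
    fix t assume t: "t \<in> {x..x + \<delta>}"
    then have "cmod (F t - F x) \<le> hnorm (L2 lebesgue) p * sqrt (t - x)"
      using primD(2)[OF F, of x t] integral_interval_L2(2)[OF L, of x t] by simp
    also have "\<dots> \<le> hnorm (L2 lebesgue) p * sqrt \<delta>" using t by (intro mult_left_mono) auto
    finally show "cmod (F x - F t) \<le> sqrt \<delta> * hnorm (L2 lebesgue) p"
      by (simp add: norm_minus_commute mult.commute)
  qed auto
  also have "\<dots> = \<delta> * (sqrt \<delta> * hnorm (L2 lebesgue) p)" using \<delta> by simp
  finally have 1: "cmod (integral {x..x + \<delta>} (\<lambda>t. F x - F t)) \<le> \<delta> * (sqrt \<delta> * hnorm (L2 lebesgue) p)" .
  have "integral {x..x + \<delta>} (\<lambda>t. F x - F t) = complex_of_real \<delta> * F x - integral {x..x + \<delta>} F"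
    using Fi \<delta> by (subst integral_diff) (auto simp: scaleR_conv_of_real)
  then have "complex_of_real \<delta> * F x = integral {x..x + \<delta>} F + integral {x..x + \<delta>} (\<lambda>t. F x - F t)" by simp
  then have "\<delta> * cmod (F x) \<le> cmod (integral {x..x + \<delta>} F) + \<delta> * (sqrt \<delta> * hnorm (L2 lebesgue) p)"
    (is "_ \<le> ?B")
  proof -
    assume *: "complex_of_real \<delta> * F x = integral {x..x + \<delta>} F + integral {x..x + \<delta>} (\<lambda>t. F x - F t)"
    have "\<delta> * cmod (F x) = cmod (complex_of_real \<delta> * F x)" using \<delta> by (simp add: norm_mult)
    also have "\<dots> \<le> ?B" unfolding * by (rule order_trans[OF norm_triangle_ineq add_left_mono[OF 1]])
    finally show ?thesis .
  qed
  then show ?thesis using \<delta> by (simp add: field_simps)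
qed

context matrix_model
begin

definition qform :: "real set \<Rightarrow> (real \<Rightarrow> complex) \<Rightarrow> real" where
  "qform \<Omega> f = (LINT x|lebesgue_on \<Omega>. Re (Q x) * (cmod (f x))\<^sup>2)"

lemma Qf_integrable:
  assumes "f \<in> carrier (L2 (lebesgue_on \<Omega>))" "(\<lambda>x. Q x * f x) \<in> carrier (L2 (lebesgue_on \<Omega>))"
  shows "integrable (lebesgue_on \<Omega>) (\<lambda>x. Q x * f x * cnj (f x))"
    "integrable (lebesgue_on \<Omega>) (\<lambda>x. Re (Q x) * (cmod (f x))\<^sup>2)"
    "Re (LINT x|lebesgue_on \<Omega>. Q x * f x * cnj (f x)) = qform \<Omega> f"
proof -
  show i: "integrable (lebesgue_on \<Omega>) (\<lambda>x. Q x * f x * cnj (f x))" by (rule L2_mult_integrable[OF assms(2) L2_cnj[OF assms(1)]])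
  have e: "Re (Q x * f x * cnj (f x)) = Re (Q x) * (cmod (f x))\<^sup>2" for x
    by (simp add: mult.assoc complex_norm_square[symmetric] del: complex_mult_cnj)
  show "integrable (lebesgue_on \<Omega>) (\<lambda>x. Re (Q x) * (cmod (f x))\<^sup>2)" using integrable_Re[OF i] unfolding e .
  show "Re (LINT x|lebesgue_on \<Omega>. Q x * f x * cnj (f x)) = qform \<Omega> f"
    unfolding qform_def integral_Re[OF i, symmetric] e ..
qed

text \<open>|V|^2 \<le> b |Q| \<le> (b / cos \<theta>) Re Q almost everywhere: the sector condition
  makes \<open>V\<close> bounded relative to the form of \<open>Q\<close>, with the same constant on
  the line and on every interval.\<close>

lemma qform_bounds:
  assumes \<Omega>: "\<Omega> \<in> sets lebesgue" and f: "f \<in> carrier (L2 (lebesgue_on \<Omega>))" "(\<lambda>x. Q x * f x) \<in> carrier (L2 (lebesgue_on \<Omega>))"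
  shows "0 \<le> qform \<Omega> f"
    and "(\<lambda>x. V x * f x) \<in> carrier (L2 (lebesgue_on \<Omega>))"
    and "(hnorm (L2 (lebesgue_on \<Omega>)) (\<lambda>x. V x * f x))\<^sup>2 \<le> b / cos \<theta> * qform \<Omega> f"
proof -
  note i = Qf_integrable(2)[OF f]
  have rq: "AE x in lebesgue_on \<Omega>. cos \<theta> * cmod (Q x) \<le> Re (Q x)" by (rule AE_on[OF \<Omega> Re_Q])
  show "0 \<le> qform \<Omega> f" unfolding qform_def
  proof (rule integral_nonneg_AE)
    show "AE x in lebesgue_on \<Omega>. 0 \<le> Re (Q x) * (cmod (f x))\<^sup>2"
      using rq
    proof eventually_elim
      case (elim x)
      have "0 \<le> cos \<theta> * cmod (Q x)" using cos_pos by simp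
      then show ?case using elim by simp
    qed
  qed
  have le: "AE x in lebesgue_on \<Omega>. (cmod (V x * f x))\<^sup>2 \<le> b / cos \<theta> * (Re (Q x) * (cmod (f x))\<^sup>2)"
    using rq AE_on[OF \<Omega> Vb]
  proof eventually_elim
    case (elim x)
    have "cmod (Q x) \<le> Re (Q x) / cos \<theta>" using elim(1) cos_pos by (simp add: field_simps)
    then have "b * cmod (Q x) \<le> b * (Re (Q x) / cos \<theta>)" using b by (rule mult_left_mono)
    then have "(cmod (V x))\<^sup>2 \<le> b / cos \<theta> * Re (Q x)" using elim(2) by simp
    then have "(cmod (V x))\<^sup>2 * (cmod (f x))\<^sup>2 \<le> b / cos \<theta> * Re (Q x) * (cmod (f x))\<^sup>2" by (intro mult_right_mono) auto
    then show ?case by (simp add: norm_mult power_mult_distrib mult.assoc)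
  qed
  have m: "(\<lambda>x. V x * f x) \<in> borel_measurable (lebesgue_on \<Omega>)" by (rule borel_measurable_times[OF meas_on(2) L2_measurable[OF f(1)]])
  have ir: "integrable (lebesgue_on \<Omega>) (\<lambda>x. b / cos \<theta> * (Re (Q x) * (cmod (f x))\<^sup>2))" by (rule integrable_mult_right[OF i])
  have iv: "integrable (lebesgue_on \<Omega>) (\<lambda>x. (cmod (V x * f x))\<^sup>2)"
  proof (rule Bochner_Integration.integrable_bound[OF ir])
    show "(\<lambda>x. (cmod (V x * f x))\<^sup>2) \<in> borel_measurable (lebesgue_on \<Omega>)" using m by measurable
    show "AE x in lebesgue_on \<Omega>. norm ((cmod (V x * f x))\<^sup>2) \<le> norm (b / cos \<theta> * (Re (Q x) * (cmod (f x))\<^sup>2))"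
      using le
    proof eventually_elim
      case (elim x)
      have "norm ((cmod (V x * f x))\<^sup>2) = (cmod (V x * f x))\<^sup>2" by simp
      then show ?case using elim abs_ge_self[of "b / cos \<theta> * (Re (Q x) * (cmod (f x))\<^sup>2)"] unfolding real_norm_def by linarith
    qed
  qed
  show "(\<lambda>x. V x * f x) \<in> carrier (L2 (lebesgue_on \<Omega>))" unfolding carrier_L2 using m iv by blast
  show "(hnorm (L2 (lebesgue_on \<Omega>)) (\<lambda>x. V x * f x))\<^sup>2 \<le> b / cos \<theta> * qform \<Omega> f"
    unfolding hnorm_L2_sq qform_def Bochner_Integration.integral_mult_right[OF i, symmetric]
    by (rule integral_mono_AE[OF iv ir le])
qed

lemma form_identity_line:
  assumes f: "f \<in> domA Q" and h: "weak_deriv UNIV 2 f h"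
  obtains F p where "prim F p" "prim p h" "AE x in lebesgue. f x = F x" "f \<in> carrier LR" "F \<in> carrier LR" "p \<in> carrier LR" "h \<in> carrier LR"
    "(\<lambda>x. Q x * f x) \<in> carrier LR"
    "Re (LINT x|lebesgue. (- h x + Q x * f x) * cnj (f x)) = (hnorm LR p)\<^sup>2 + qform UNIV f"
proof -
  have fs: "f \<in> sobolev 2 UNIV" and Qf: "(\<lambda>x. Q x * f x) \<in> carrier LR" using f by (auto simp: domA_iff)
  have fL: "f \<in> carrier LR" using fs by (simp add: sobolev_def lebesgue_on_UNIV_eq)
  have iv: "is_interval (UNIV :: real set)" by (simp add: is_interval_1)
  obtain F p where F: "prim F p" "prim p h" "AE x in lebesgue. f x = F x" "p \<in> carrier LR" "h \<in> carrier LR" "F \<in> carrier LR"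
    by (rule sobolev2_prim[OF open_UNIV iv fs h]) (simp add: lebesgue_on_UNIV_eq AE_lebesgue_on_iff)
  have i1: "integrable lebesgue (\<lambda>x. - h x * cnj (f x))" by (rule L2_mult_integrable[OF L2_uminus[OF F(5)] L2_cnj[OF fL]])
  have i2: "integrable lebesgue (\<lambda>x. Q x * f x * cnj (f x))" by (rule L2_mult_integrable[OF Qf L2_cnj[OF fL]])
  have "(LINT x|lebesgue. (- h x + Q x * f x) * cnj (f x)) = (LINT x|lebesgue. - h x * cnj (f x)) + (LINT x|lebesgue. Q x * f x * cnj (f x))"
    unfolding Bochner_Integration.integral_add[OF i1 i2, symmetric] by (simp add: algebra_simps)
  also have "(LINT x|lebesgue. - h x * cnj (f x)) = (LINT x|lebesgue. - h x * cnj (F x))"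
  proof (rule integral_cong_AE)
    show "(\<lambda>x. - h x * cnj (F x)) \<in> borel_measurable lebesgue"
      by (rule borel_measurable_integrable[OF L2_mult_integrable[OF L2_uminus[OF F(5)] L2_cnj[OF F(6)]]])
    show "AE x in lebesgue. - h x * cnj (f x) = - h x * cnj (F x)" using F(3) by eventually_elim simp
  qed (rule borel_measurable_integrable[OF i1])
  also have "\<dots> = complex_of_real ((hnorm LR p)\<^sup>2)" by (rule quadratic_form_line[OF F(1,2,6,4,5)])
  finally have "Re (LINT x|lebesgue. (- h x + Q x * f x) * cnj (f x)) = (hnorm LR p)\<^sup>2 + Re (LINT x|lebesgue. Q x * f x * cnj (f x))"
    by simp
  moreover have "Re (LINT x|lebesgue. Q x * f x * cnj (f x)) = qform UNIV f"
    using Qf_integrable(3)[of f UNIV] fL Qf by (simp add: lebesgue_on_UNIV_eq)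
  ultimately show thesis using that F fL Qf by simp
qed

text \<open>For |x| \<ge> r one has 1 \<le> Re Q / (R cos \<theta>), so the form controls the tail.
  The majorant \<open>k\<close> inside is left open: on the line it is the localized |F|^2, on an
  interval four times the square of the function after cutting off.\<close>

lemma tail_estimate:
  assumes \<Omega>: "\<Omega> \<in> sets lebesgue" and f: "f \<in> carrier (L2 (lebesgue_on \<Omega>))" "(\<lambda>x. Q x * f x) \<in> carrier (L2 (lebesgue_on \<Omega>))"
    and R: "R > 0" "AE x in lebesgue. \<bar>x\<bar> \<ge> r \<longrightarrow> R \<le> cmod (Q x)"
    and k: "integrable (lebesgue_on \<Omega>) k" "\<And>x. 0 \<le> k x" "AE x in lebesgue_on \<Omega>. \<bar>x\<bar> < r \<longrightarrow> (cmod (f x))\<^sup>2 \<le> k x"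
  shows "(hnorm (L2 (lebesgue_on \<Omega>)) f)\<^sup>2 \<le> (LINT x|lebesgue_on \<Omega>. k x) + qform \<Omega> f / (R * cos \<theta>)"
proof -
  note i = Qf_integrable(2)[OF f]
  have c: "R * cos \<theta> > 0" using R(1) cos_pos by simp
  have "(LINT x|lebesgue_on \<Omega>. (cmod (f x))\<^sup>2) \<le> (LINT x|lebesgue_on \<Omega>. k x + Re (Q x) * (cmod (f x))\<^sup>2 / (R * cos \<theta>))"
  proof (rule integral_mono_AE[OF L2_integrable[OF f(1)]])
    show "integrable (lebesgue_on \<Omega>) (\<lambda>x. k x + Re (Q x) * (cmod (f x))\<^sup>2 / (R * cos \<theta>))"
      by (intro Bochner_Integration.integrable_add k(1) integrable_divide i)
    show "AE x in lebesgue_on \<Omega>. (cmod (f x))\<^sup>2 \<le> k x + Re (Q x) * (cmod (f x))\<^sup>2 / (R * cos \<theta>)"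
      using AE_on[OF \<Omega> Re_Q] AE_on[OF \<Omega> R(2)] k(3)
    proof eventually_elim
      case (elim x)
      have "0 \<le> cos \<theta> * cmod (Q x)" using cos_pos by simp
      then have nn: "0 \<le> Re (Q x) * (cmod (f x))\<^sup>2 / (R * cos \<theta>)" using elim(1) c by (intro divide_nonneg_pos mult_nonneg_nonneg) auto
      show ?case
      proof (cases "\<bar>x\<bar> < r")
        case True
        then show ?thesis using elim(3) nn by simp
      next
        case False
        then have "R * cos \<theta> \<le> cmod (Q x) * cos \<theta>" using elim(2) cos_pos by (intro mult_right_mono) auto
        then have "R * cos \<theta> \<le> Re (Q x)" using elim(1) by (simp add: mult.commute)
        then have "R * cos \<theta> * (cmod (f x))\<^sup>2 \<le> Re (Q x) * (cmod (f x))\<^sup>2" by (intro mult_right_mono) auto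
        then have "(cmod (f x))\<^sup>2 \<le> Re (Q x) * (cmod (f x))\<^sup>2 / (R * cos \<theta>)" using c by (simp add: field_simps)
        then show ?thesis using k(2)[of x] by linarith
      qed
    qed
  qed
  also have "\<dots> = (LINT x|lebesgue_on \<Omega>. k x) + qform \<Omega> f / (R * cos \<theta>)"
    unfolding qform_def using k(1) i by (subst Bochner_Integration.integral_add) auto
  finally show ?thesis by (simp add: hnorm_L2_sq)
qed

text \<open>A substitute for the compact embedding of the form domain. Averages give pointwise
  convergence and a uniform bound, dominated convergence gives convergence in L^2 on bounded
  intervals, and the growth of |Q| makes the tails uniformly small.\<close>

lemma compactness:
  assumes F: "\<And>n. prim (F n) (p n)" "\<And>n. AE x in lebesgue. f n x = F n x"
    and L: "\<And>n. f n \<in> carrier LR" "\<And>n. p n \<in> carrier LR" "\<And>n. (\<lambda>x. Q x * f n x) \<in> carrier LR" "\<And>n. F n \<in> carrier LR"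
    and bd: "\<And>n. hnorm LR (f n) \<le> 1" "\<And>n. hnorm LR (p n) \<le> C" "\<And>n. qform UNIV (f n) \<le> C"
    and weak: "\<And>y. y \<in> carrier LR \<Longrightarrow> (\<lambda>n. LINT t|lebesgue. f n t * cnj (y t)) \<longlonglongrightarrow> 0"
  shows "(\<lambda>n. hnorm LR (f n)) \<longlonglongrightarrow> 0"
proof -
  have C: "0 \<le> C" using bd(2)[of 0] order_trans[OF hnorm_L2_nonneg] by blast
  have Fn: "hnorm LR (F n) = hnorm LR (f n)" for n
    by (rule hnorm_L2_cong_AE) (use L F(2)[of n] in \<open>auto intro: L2_measurable elim: eventually_mono\<close>)
  have avg: "cmod (F n x) \<le> cmod (integral {x..x + \<delta>} (F n)) / \<delta> + sqrt \<delta> * C" if "0 < \<delta>" for n x \<delta>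
    by (rule order_trans[OF prim_average[OF F(1) L(2) that] add_left_mono[OF mult_left_mono[OF bd(2)]]])
       (use that in simp)
  have Fb: "cmod (F n x) \<le> 1 + C" for n x
  proof -
    have "cmod (integral {x..x + 1} (F n)) \<le> 1" using integral_interval_L2(2)[OF L(4), of x "x + 1" n] bd(1)[of n] Fn[of n] by simp
    then show ?thesis using avg[of 1 n x] by simp
  qed
  have F0: "(\<lambda>n. F n x) \<longlonglongrightarrow> 0" for x
  proof (rule LIMSEQ_I)
    fix r :: real assume r: "r > 0"
    \<comment> \<open>Chosen so that sqrt \<delta> C < r/2; the shift by 1 allows C = 0.\<close>
    define \<delta> where "\<delta> = (r / (2 * (C + 1)))\<^sup>2"
    have \<delta>: "\<delta> > 0" using r C by (simp add: \<delta>_def)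
    have sq: "sqrt \<delta> = r / (2 * (C + 1))" using r C by (simp add: \<delta>_def)
    have s: "sqrt \<delta> * C < r / 2" unfolding sq using r C by (simp add: field_simps)
    have xd: "x \<le> x + \<delta>" using \<delta> by simp
    have "(\<lambda>n. LINT t|lebesgue. f n t * cnj (indicator {x..x + \<delta>} t)) \<longlonglongrightarrow> 0" by (rule weak[OF indicator_L2(1)[OF xd]])
    moreover have "(LINT t|lebesgue. f n t * cnj (indicator {x..x + \<delta>} t)) = integral {x..x + \<delta>} (F n)" for n
    proof -
      have "(LINT t|lebesgue. f n t * cnj (indicator {x..x + \<delta>} t)) = (LINT t|lebesgue. F n t * cnj (indicator {x..x + \<delta>} t))"
      proof (rule integral_cong_AE)
        show "(\<lambda>t. f n t * cnj (indicator {x..x + \<delta>} t)) \<in> borel_measurable lebesgue"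
          by (rule borel_measurable_integrable[OF L2_mult_integrable[OF L(1) L2_cnj[OF indicator_L2(1)[OF xd]]]])
        show "(\<lambda>t. F n t * cnj (indicator {x..x + \<delta>} t)) \<in> borel_measurable lebesgue"
          by (rule borel_measurable_integrable[OF L2_mult_integrable[OF L(4) L2_cnj[OF indicator_L2(1)[OF xd]]]])
        show "AE t in lebesgue. f n t * cnj (indicator {x..x + \<delta>} t) = F n t * cnj (indicator {x..x + \<delta>} t)"
          using F(2)[of n] by eventually_elim simp
      qed
      then show ?thesis using integral_interval_L2(1)[OF L(4) xd] by simp
    qed
    ultimately have "(\<lambda>n. cmod (integral {x..x + \<delta>} (F n))) \<longlonglongrightarrow> 0" by (simp add: tendsto_norm_zero)
    moreover have "\<delta> * (r / 2) > 0" using \<delta> r by simp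
    ultimately have "eventually (\<lambda>n. cmod (integral {x..x + \<delta>} (F n)) < \<delta> * (r / 2)) sequentially"
      by (rule order_tendstoD(2))
    then have "eventually (\<lambda>n. norm (F n x - 0) < r) sequentially"
    proof eventually_elim
      case (elim n)
      then have "cmod (integral {x..x + \<delta>} (F n)) / \<delta> < r / 2" using \<delta> by (simp add: field_simps)
      then have "cmod (F n x) < r" using avg[OF \<delta>, of n x] s by linarith
      then show ?case by simp
    qed
    then show "\<exists>N. \<forall>n\<ge>N. norm (F n x - 0) < r" by (simp add: eventually_sequentially)
  qed
  have loc: "(\<lambda>n. LINT x|lebesgue. indicat_real {-r..r} x * (cmod (F n x))\<^sup>2) \<longlonglongrightarrow> 0" for r :: real
  proof -
    have "(\<lambda>n. LINT x|lebesgue. indicat_real {-r..r} x * (cmod (F n x))\<^sup>2) \<longlonglongrightarrow> (LINT x|(lebesgue :: real measure). 0)"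
    proof (rule integral_dominated_convergence[where w="\<lambda>x. (1 + C)\<^sup>2 * indicat_real {-r..r} x"])
      show "integrable lebesgue (\<lambda>x. (1 + C)\<^sup>2 * indicat_real {-r..r} x)"
        by (intro integrable_mult_right integrable_real_indicator) (auto simp: emeasure_lborel_Icc_eq)
      show "(\<lambda>x. indicat_real {-r..r} x * (cmod (F n x))\<^sup>2) \<in> borel_measurable lebesgue" for n
        using L2_measurable[OF L(4)[of n]] by (intro borel_measurable_times borel_measurable_indicator borel_measurable_power borel_measurable_norm) auto
      have "(\<lambda>n. indicat_real {-r..r} x * (cmod (F n x))\<^sup>2) \<longlonglongrightarrow> indicat_real {-r..r} x * (cmod 0)\<^sup>2" for x
        by (intro tendsto_intros F0)
      then show "AE x in lebesgue. (\<lambda>n. indicat_real {-r..r} x * (cmod (F n x))\<^sup>2) \<longlonglongrightarrow> 0" by simp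
      have "(cmod (F n x))\<^sup>2 \<le> (1 + C)\<^sup>2" for n x by (intro power_mono Fb) simp
      then show "AE x in lebesgue. norm (indicat_real {-r..r} x * (cmod (F n x))\<^sup>2) \<le> (1 + C)\<^sup>2 * indicat_real {-r..r} x" for n
        by (auto simp: indicator_def)
    qed auto
    then show ?thesis by simp
  qed
  have "(\<lambda>n. (hnorm LR (f n))\<^sup>2) \<longlonglongrightarrow> 0"
  proof (rule LIMSEQ_I)
    fix e :: real assume e: "e > 0"
    \<comment> \<open>Chosen so that the tail C / (R cos \<theta>) is below e/2.\<close>
    define R where "R = 2 * (C + 1) / (e * cos \<theta>)"
    have R: "R > 0" using e C cos_pos by (simp add: R_def)
    obtain r where r: "AE x in lebesgue. \<bar>x\<bar> \<ge> r \<longrightarrow> R \<le> cmod (Q x)" using growth by blast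
    have "C / (R * cos \<theta>) = e * C / (2 * (C + 1))" using cos_pos C e by (simp add: R_def)
    also have "\<dots> < e / 2" using e C by (simp add: field_simps)
    finally have Cr: "C / (R * cos \<theta>) < e / 2" .
    have est: "(hnorm LR (f n))\<^sup>2 \<le> (LINT x|lebesgue. indicat_real {-r..r} x * (cmod (F n x))\<^sup>2) + C / (R * cos \<theta>)" for n
    proof -
      have "integrable lebesgue (\<lambda>x. indicat_real {-r..r} x *\<^sub>R (cmod (F n x))\<^sup>2)"
        by (intro integrable_mult_indicator L2_integrable[OF L(4)]) auto
      then have k: "integrable lebesgue (\<lambda>x. indicat_real {-r..r} x * (cmod (F n x))\<^sup>2)" by simp
      have "AE x in lebesgue. \<bar>x\<bar> < r \<longrightarrow> (cmod (f n x))\<^sup>2 \<le> indicat_real {-r..r} x * (cmod (F n x))\<^sup>2"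
        using F(2)[of n] by eventually_elim (auto simp: indicator_def)
      then have "(hnorm LR (f n))\<^sup>2 \<le> (LINT x|lebesgue. indicat_real {-r..r} x * (cmod (F n x))\<^sup>2) + qform UNIV (f n) / (R * cos \<theta>)"
        using tail_estimate[of UNIV "f n", OF _ _ _ R r, of "\<lambda>x. indicat_real {-r..r} x * (cmod (F n x))\<^sup>2"] L(1,3) k
        by (simp add: lebesgue_on_UNIV_eq AE_lebesgue_on_iff)
      also have "qform UNIV (f n) / (R * cos \<theta>) \<le> C / (R * cos \<theta>)" using bd(3)[of n] R cos_pos by (intro divide_right_mono) auto
      finally show ?thesis by simp
    qed
    have "e / 2 > 0" using e by simp
    then have "eventually (\<lambda>n. (LINT x|lebesgue. indicat_real {-r..r} x * (cmod (F n x))\<^sup>2) < e / 2) sequentially"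
      by (rule order_tendstoD(2)[OF loc])
    then have "eventually (\<lambda>n. norm ((hnorm LR (f n))\<^sup>2 - 0) < e) sequentially"
    proof eventually_elim
      case (elim n)
      then have "(hnorm LR (f n))\<^sup>2 < e" using est[of n] Cr by linarith
      then show ?case by simp
    qed
    then show "\<exists>N. \<forall>n\<ge>N. norm ((hnorm LR (f n))\<^sup>2 - 0) < e" by (simp add: eventually_sequentially)
  qed
  from tendsto_real_sqrt[OF this] show ?thesis by simp
qed


subsection \<open>The essential spectrum\<close>

lemma resolvent_lower_bound:
  assumes "\<zeta> \<notin> essran U"
  obtains e where "e > 0" "AE x in lebesgue. e \<le> cmod (U x - \<zeta>)"
  using assms unfolding essran_iff[OF meas(3)] dist_norm by blast

abbreviation "Rs \<zeta> f \<equiv> (\<lambda>x. inverse (U x - \<zeta>) * f x)"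

lemma resolvent_L2:
  assumes \<Omega>: "\<Omega> \<in> sets lebesgue" and e: "e > 0" "AE x in lebesgue_on \<Omega>. e \<le> cmod (U x - \<zeta>)" and f: "f \<in> carrier (L2 (lebesgue_on \<Omega>))"
  shows "Rs \<zeta> f \<in> carrier (L2 (lebesgue_on \<Omega>))" "hnorm (L2 (lebesgue_on \<Omega>)) (Rs \<zeta> f) \<le> 1 / e * hnorm (L2 (lebesgue_on \<Omega>)) f"
proof -
  have m: "Rs \<zeta> f \<in> borel_measurable (lebesgue_on \<Omega>)"
    by (rule borel_measurable_times[OF borel_measurable_inverse[OF borel_measurable_diff[OF meas_on(3) borel_measurable_const]] L2_measurable[OF f]])
  have le: "AE x in lebesgue_on \<Omega>. cmod (Rs \<zeta> f x) \<le> 1 / e * cmod (f x)"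
    using e(2)
  proof eventually_elim
    case (elim x)
    then have "inverse (cmod (U x - \<zeta>)) \<le> inverse e" using e(1) by (intro le_imp_inverse_le) auto
    then have "inverse (cmod (U x - \<zeta>)) * cmod (f x) \<le> inverse e * cmod (f x)" by (intro mult_right_mono) auto
    then show ?case by (simp add: norm_mult norm_inverse inverse_eq_divide norm_divide)
  qed
  show "Rs \<zeta> f \<in> carrier (L2 (lebesgue_on \<Omega>))" by (rule L2_dominated[OF f m le])
  show "hnorm (L2 (lebesgue_on \<Omega>)) (Rs \<zeta> f) \<le> 1 / e * hnorm (L2 (lebesgue_on \<Omega>)) f"
    by (rule hnorm_L2_mono[OF f m le]) (use e in simp)
qed

lemma mult_op_UNIV:
  "mult_op (lebesgue_on UNIV) k = {(f, g). f \<in> carrier LR \<and> g \<in> carrier LR \<and> (AE x in lebesgue. g x = k x * f x)}"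
  by (simp add: mult_op_def lebesgue_on_UNIV_eq AE_lebesgue_on_iff)

text \<open>\<open>op_norm\<close> is a real supremum and means something only once the set is
  bounded, which the gap between \<open>U\<close> and \<zeta> provides. Positivity, tested on an
  indicator, keeps the division in the definition of \<epsilon> away from the default value
  0.\<close>

lemma resolvent_norm_facts:
  assumes z: "\<zeta> \<notin> essran U"
  shows "resolvent_norm U \<zeta> > 0"
    and "f \<in> carrier LR \<Longrightarrow> Rs \<zeta> f \<in> carrier LR"
    and "f \<in> carrier LR \<Longrightarrow> hnorm LR (Rs \<zeta> f) \<le> resolvent_norm U \<zeta> * hnorm LR f"
proof -
  obtain e where e: "e > 0" "AE x in lebesgue. e \<le> cmod (U x - \<zeta>)" using resolvent_lower_bound[OF z] .
  have e': "AE x in lebesgue_on UNIV. e \<le> cmod (U x - \<zeta>)" using e(2) by (simp add: AE_lebesgue_on_iff)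
  have RL: "Rs \<zeta> f \<in> carrier LR" "hnorm LR (Rs \<zeta> f) \<le> 1 / e * hnorm LR f" if "f \<in> carrier LR" for f
    using resolvent_L2[of UNIV e \<zeta> f] e(1) e' that by (simp_all add: lebesgue_on_UNIV_eq)
  let ?S = "{hnorm LR y |x y. (x, y) \<in> mult_op (lebesgue_on UNIV) (\<lambda>x. inverse (U x - \<zeta>)) \<and> hnorm LR x \<le> 1}"
  have rn: "resolvent_norm U \<zeta> = Sup ?S" by (simp add: resolvent_norm_def op_norm_def lebesgue_on_UNIV_eq)
  have bdd: "bdd_above ?S"
  proof (rule bdd_aboveI[where M="1 / e"])
    fix s assume "s \<in> ?S"
    then obtain x y where xy: "s = hnorm LR y" "x \<in> carrier LR" "y \<in> carrier LR" "AE t in lebesgue. y t = Rs \<zeta> x t" "hnorm LR x \<le> 1"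
      unfolding mult_op_UNIV by auto
    have "hnorm LR y = hnorm LR (Rs \<zeta> x)"
      by (rule hnorm_L2_cong_AE[OF L2_measurable[OF xy(3)] L2_measurable[OF RL(1)[OF xy(2)]] xy(4)])
    also have "\<dots> \<le> 1 / e * 1" using RL(2)[OF xy(2)] xy(5) e(1) by (meson mult_left_mono order_trans divide_nonneg_pos zero_le_one)
    finally show "s \<le> 1 / e" using xy(1) by simp
  qed
  have mem: "hnorm LR (Rs \<zeta> f) \<le> resolvent_norm U \<zeta>" if "f \<in> carrier LR" "hnorm LR f \<le> 1" for f
    unfolding rn by (rule cSup_upper[OF _ bdd]) (use that RL(1) mult_op_UNIV in auto)
  show "f \<in> carrier LR \<Longrightarrow> Rs \<zeta> f \<in> carrier LR" by (rule RL(1))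
  show "hnorm LR (Rs \<zeta> f) \<le> resolvent_norm U \<zeta> * hnorm LR f" if f: "f \<in> carrier LR"
  proof (cases "hnorm LR f = 0")
    case True
    then show ?thesis using RL(2)[OF f] by simp
  next
    case False
    let ?c = "complex_of_real (1 / hnorm LR f)"
    have p: "hnorm LR f > 0" using False by (simp add: less_le)
    have cs: "hnorm LR (\<lambda>x. ?c * g x) = 1 / hnorm LR f * hnorm LR g" if "g \<in> carrier LR" for g
      using semihilbert.hnorm_scale[OF semihilbert_L2 that, of ?c] p by (simp add: L2_simps norm_divide)
    have "hnorm LR (Rs \<zeta> (\<lambda>x. ?c * f x)) \<le> resolvent_norm U \<zeta>"
      by (rule mem[OF L2_scale[OF f]]) (use cs[OF f] p in simp)
    moreover have "Rs \<zeta> (\<lambda>x. ?c * f x) = (\<lambda>x. ?c * Rs \<zeta> f x)" by (simp add: mult_ac)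
    ultimately have "1 / hnorm LR f * hnorm LR (Rs \<zeta> f) \<le> resolvent_norm U \<zeta>" using cs[OF RL(1)[OF f]] by simp
    then show ?thesis using p by (simp add: field_simps)
  qed
  have i: "(indicator {0..1} :: real \<Rightarrow> complex) \<in> carrier LR" "hnorm LR (indicator {0..1}) \<le> 1"
    using indicator_L2[of 0 1] by simp_all
  have "hnorm LR (Rs \<zeta> (indicator {0..1})) \<noteq> 0"
  proof
    assume "hnorm LR (Rs \<zeta> (indicator {0..1})) = 0"
    then have "AE x in lebesgue. Rs \<zeta> (indicator {0..1}) x = 0" using hnorm_L2_eq_0[OF RL(1)[OF i(1)]] by simp
    with e(2) have "AE x in lebesgue. x \<notin> {0..1::real}" by eventually_elim (use e(1) in \<open>auto simp: indicator_def split: if_splits\<close>)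
    then obtain N where N: "negligible N" "\<And>x. x \<notin> N \<Longrightarrow> x \<notin> {0..1::real}" using AE_negligibleE by blast
    then have "negligible {0..1::real}" using negligible_subset by blast
    then have "negligible {0<..<1::real}" by (rule negligible_subset) auto
    then show False using open_not_negligible[of "{0<..<1::real}"] by simp
  qed
  then have "hnorm LR (Rs \<zeta> (indicator {0..1})) > 0" by (simp add: less_le)
  then show "resolvent_norm U \<zeta> > 0" using mem[OF i] by linarith
qed

abbreviation "T \<equiv> op_T Q W V U"

lemma op_B_iff:
  "((f, g), (u, v)) \<in> op_B b0 U \<zeta> \<longleftrightarrow> f \<in> carrier LR \<and> u \<in> carrier LR \<and> g \<in> carrier LR \<and> v \<in> carrier LR \<and>
     (AE x in lebesgue. u x = f x) \<and> (AE x in lebesgue. v x = complex_of_real (1 / (b0 * (resolvent_norm U \<zeta>)\<^sup>2)) * inverse (U x - \<zeta>) * g x)"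
  unfolding op_B_def Let_def diag_op_def mult_op_UNIV by auto

lemma T_iff:
  "((f, g), (u, v)) \<in> T \<longleftrightarrow> f \<in> domA Q \<and> g \<in> domU U \<and> u \<in> carrier LR \<and> v \<in> carrier LR \<and>
     (\<exists>h. weak_deriv UNIV 2 f h \<and> (AE x in lebesgue. u x = - h x + Q x * f x + W x * g x)) \<and>
     (AE x in lebesgue. v x = V x * f x + U x * g x)"
  by (auto simp: op_T_def matrix_op_def hilbert_sum_simps lebesgue_on_UNIV_eq AE_lebesgue_on_iff)

lemma hnorm_UNIV_sq: "f \<in> carrier LR \<Longrightarrow> g \<in> carrier LR \<Longrightarrow> (hnorm (Hsp UNIV) (f, g))\<^sup>2 = (hnorm LR f)\<^sup>2 + (hnorm LR g)\<^sup>2"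
  using hnorm_Hsp_sq[of f UNIV g] by (simp add: lebesgue_on_UNIV_eq)

lemma hnorm_UNIV_ge: "f \<in> carrier LR \<Longrightarrow> g \<in> carrier LR \<Longrightarrow> hnorm LR f \<le> hnorm (Hsp UNIV) (f, g)"
   "f \<in> carrier LR \<Longrightarrow> g \<in> carrier LR \<Longrightarrow> hnorm LR g \<le> hnorm (Hsp UNIV) (f, g)"
  using hnorm_Hsp_ge[of f UNIV g] by (simp_all add: lebesgue_on_UNIV_eq)

text \<open>B T - lam B acts as B (T - lam) and B is bounded, so a singular sequence of T - lam
  makes the images, and with them the inner products with the sequence, tend to 0.\<close>

lemma ess_spectrum_subset_pencil:
  assumes z: "\<zeta> \<notin> essran U"
  shows "ess_spectrum (Hsp UNIV) T \<subseteq> ess_num_range_pencil (Hsp UNIV) (T O op_B b0 U \<zeta>) (op_B b0 U \<zeta>)"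
proof
  fix lam assume "lam \<in> ess_spectrum (Hsp UNIV) T"
  then obtain x y where xy: "\<And>n. (x n, y n) \<in> op_shift (Hsp UNIV) T lam" "\<And>n. hnorm (Hsp UNIV) (x n) = 1"
    "weakly_null (Hsp UNIV) x" "(\<lambda>n. hnorm (Hsp UNIV) (y n)) \<longlonglongrightarrow> 0"
    unfolding ess_spectrum_def by blast
  define c where "c = complex_of_real (1 / (b0 * (resolvent_norm U \<zeta>)\<^sup>2))"
  let ?rn = "resolvent_norm U \<zeta>"
  define Y where "Y n = (fst (y n), \<lambda>t. c * inverse (U t - \<zeta>) * snd (y n) t)" for n
  interpret G: graph_op "Hsp UNIV" T by (rule T_graph)
  have L: "fst (y n) \<in> carrier LR" "snd (y n) \<in> carrier LR" "fst (x n) \<in> carrier LR" "snd (x n) \<in> carrier LR" for n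
    using G.shift_closed[OF xy(1)[of n]] by (auto simp: hilbert_sum_simps lebesgue_on_UNIV_eq mem_Times_iff)
  have R2: "(\<lambda>t. c * inverse (U t - \<zeta>) * k t) \<in> carrier LR" if "k \<in> carrier LR" for k
    using L2_scale[OF resolvent_norm_facts(2)[OF z that], of c] by (simp add: mult.assoc)
  have YL: "snd (Y n) \<in> carrier LR" for n unfolding Y_def using R2[OF L(2)] by simp
  have mem: "(x n, Y n) \<in> op_diff (Hsp UNIV) (T O op_B b0 U \<zeta>) lam (op_B b0 U \<zeta>)" for n
  proof -
    obtain w where w: "(x n, w) \<in> T" "y n = add (Hsp UNIV) w (hilbert.scale (Hsp UNIV) (- lam) (x n))"
      using xy(1)[of n] unfolding G.shift_iff by blast
    obtain f g u v where p: "x n = (f, g)" "w = (u, v)" by (metis surj_pair)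
    have uv: "u \<in> carrier LR" "v \<in> carrier LR" using w(1) unfolding p T_iff by auto
    have fg: "f \<in> carrier LR" "g \<in> carrier LR" using L(3,4)[of n] p by auto
    let ?w = "(u, \<lambda>t. c * inverse (U t - \<zeta>) * v t)" and ?z = "(f, \<lambda>t. c * inverse (U t - \<zeta>) * g t)"
    have "(w, ?w) \<in> op_B b0 U \<zeta>" unfolding p op_B_iff c_def[symmetric] using uv R2[OF uv(2)] by simp
    then have 1: "(x n, ?w) \<in> T O op_B b0 U \<zeta>" using w(1) by blast
    have 2: "(x n, ?z) \<in> op_B b0 U \<zeta>" unfolding p op_B_iff c_def[symmetric] using fg R2[OF fg(2)] by simp
    have "Y n = add (Hsp UNIV) ?w (hilbert.scale (Hsp UNIV) (- lam) ?z)"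
      unfolding Y_def w(2) p by (simp add: hilbert_sum_simps L2_simps algebra_simps)
    then show ?thesis unfolding op_diff_def using 1 2 by blast
  qed
  \<comment> \<open>A common bound for the two diagonal entries of B, the identity and the scaled
    resolvent.\<close>
  define K where "K = max 1 (cmod c * ?rn)"
  have bound: "cmod (inn (Hsp UNIV) (Y n) (x n)) \<le> 2 * K * hnorm (Hsp UNIV) (y n)" for n
  proof -
    have "inn (Hsp UNIV) (Y n) (x n) = (LINT t|lebesgue. fst (y n) t * cnj (fst (x n) t)) + (LINT t|lebesgue. snd (Y n) t * cnj (snd (x n) t))"
      by (simp add: hilbert_sum_simps L2_simps lebesgue_on_UNIV_eq Y_def)
    also have "cmod \<dots> \<le> hnorm LR (fst (y n)) * hnorm LR (fst (x n)) + hnorm LR (snd (Y n)) * hnorm LR (snd (x n))"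
      by (intro norm_triangle_mono L2_Cauchy_Schwarz L YL)
    also have "\<dots> \<le> (K * hnorm (Hsp UNIV) (y n)) * 1 + (K * hnorm (Hsp UNIV) (y n)) * 1"
    proof (intro add_mono mult_mono)
      show "hnorm LR (fst (x n)) \<le> 1" "hnorm LR (snd (x n)) \<le> 1"
        using hnorm_UNIV_ge[OF L(3,4), of n n] xy(2)[of n] by simp_all
      have yn: "hnorm LR (fst (y n)) \<le> hnorm (Hsp UNIV) (y n)" "hnorm LR (snd (y n)) \<le> hnorm (Hsp UNIV) (y n)"
        using hnorm_UNIV_ge[OF L(1,2), of n n] by simp_all
      have "1 * hnorm (Hsp UNIV) (y n) \<le> K * hnorm (Hsp UNIV) (y n)" by (intro mult_right_mono) (auto simp: K_def)
      then show "hnorm LR (fst (y n)) \<le> K * hnorm (Hsp UNIV) (y n)" using yn(1) by simp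
      have "hnorm LR (snd (Y n)) = cmod c * hnorm LR (Rs \<zeta> (snd (y n)))"
        using semihilbert.hnorm_scale[OF semihilbert_L2 resolvent_norm_facts(2)[OF z L(2)], of c n]
        by (simp add: Y_def L2_simps mult.assoc)
      also have "\<dots> \<le> cmod c * (?rn * hnorm LR (snd (y n)))"
        by (intro mult_left_mono resolvent_norm_facts(3)[OF z L(2)]) simp
      also have "\<dots> \<le> K * hnorm (Hsp UNIV) (y n)"
        unfolding mult.assoc[symmetric] by (intro mult_mono yn) (auto simp: K_def)
      finally show "hnorm LR (snd (Y n)) \<le> K * hnorm (Hsp UNIV) (y n)" .
    qed (auto simp: K_def intro!: mult_nonneg_nonneg)
    finally show ?thesis by simp
  qed
  have "(\<lambda>n. inn (Hsp UNIV) (Y n) (x n)) \<longlonglongrightarrow> 0"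
  proof (rule Lim_null_comparison[OF always_eventually])
    show "\<forall>n. norm (inn (Hsp UNIV) (Y n) (x n)) \<le> 2 * K * hnorm (Hsp UNIV) (y n)" using bound by blast
    show "(\<lambda>n. 2 * K * hnorm (Hsp UNIV) (y n)) \<longlonglongrightarrow> 0" using tendsto_mult_left[OF xy(4), of "2 * K"] by simp
  qed
  then show "lam \<in> ess_num_range_pencil (Hsp UNIV) (T O op_B b0 U \<zeta>) (op_B b0 U \<zeta>)"
    unfolding ess_num_range_pencil_def ess_num_range_def using mem xy(2,3) by blast
qed

lemma weakly_null_components:
  assumes "weakly_null (Hsp UNIV) (\<lambda>n. (f n, g n))" "y \<in> carrier LR"
  shows "(\<lambda>n. LINT t|lebesgue. f n t * cnj (y t)) \<longlonglongrightarrow> 0"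
proof -
  have "(y, \<lambda>t. 0) \<in> carrier (Hsp UNIV)" using assms(2) by (simp add: hilbert_sum_simps lebesgue_on_UNIV_eq)
  then have "(\<lambda>n. inn (Hsp UNIV) (f n, g n) (y, \<lambda>t. 0)) \<longlonglongrightarrow> 0" using assms(1) unfolding weakly_null_def by blast
  then show ?thesis by (simp add: hilbert_sum_simps L2_simps lebesgue_on_UNIV_eq)
qed

text \<open>The choice of \<open>\<epsilon>\<close> makes the off-diagonal term at most half of the two diagonal ones.\<close>

lemma pencil_coercive:
  assumes z: "\<zeta> \<notin> essran U" and ab: "a0 > 0" "b0 > 0"
    and rel: "\<And>f h. f \<in> domA Q \<Longrightarrow> weak_deriv UNIV 2 f h \<Longrightarrow>
      (hnorm LR (\<lambda>x. V x * f x))\<^sup>2 \<le> a0 * (hnorm LR f)\<^sup>2 + b0 * Re (LINT x|lebesgue. (- h x + Q x * f x) * cnj (f x))"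
    and w: "w \<ge> 0" "AE x in lebesgue. cmod (W x) \<le> w"
    and mem: "((f, g), y) \<in> op_diff (Hsp UNIV) (T O op_B b0 U \<zeta>) \<zeta> (op_B b0 U \<zeta>)"
  obtains F p where "prim F p" "AE x in lebesgue. f x = F x" "f \<in> carrier LR" "g \<in> carrier LR" "F \<in> carrier LR" "p \<in> carrier LR"
    "(\<lambda>x. Q x * f x) \<in> carrier LR"
    "((hnorm LR p)\<^sup>2 + qform UNIV f) / 2 + 1 / (b0 * (resolvent_norm U \<zeta>)\<^sup>2) / 2 * (hnorm LR g)\<^sup>2
      \<le> Re (inn (Hsp UNIV) y (f, g)) + hnorm LR f * (w * hnorm LR g + (cmod \<zeta> + a0 / (2 * b0)) * hnorm LR f)"
proof -
  define rn where "rn = resolvent_norm U \<zeta>"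
  define ep where "ep = 1 / (b0 * rn\<^sup>2)"
  have rn: "rn > 0" using resolvent_norm_facts(1)[OF z] by (simp add: rn_def)
  have ep: "ep > 0" using ab rn by (simp add: ep_def)
  obtain Y Z where YZ: "((f, g), Y) \<in> T O op_B b0 U \<zeta>" "((f, g), Z) \<in> op_B b0 U \<zeta>" "y = add (Hsp UNIV) Y (hilbert.scale (Hsp UNIV) (- \<zeta>) Z)"
    using mem unfolding op_diff_def by blast
  obtain u v where uv: "((f, g), (u, v)) \<in> T" "((u, v), Y) \<in> op_B b0 U \<zeta>" using YZ(1) by auto
  obtain Y1 Y2 where Yp: "Y = (Y1, Y2)" by (cases Y)
  obtain Z1 Z2 where Zp: "Z = (Z1, Z2)" by (cases Z)
  have fd: "f \<in> domA Q" and gd: "g \<in> domU U" and uvL: "u \<in> carrier LR" "v \<in> carrier LR"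
    and vae: "AE x in lebesgue. v x = V x * f x + U x * g x" using uv(1) unfolding T_iff by auto
  obtain h where h: "weak_deriv UNIV 2 f h" "AE x in lebesgue. u x = - h x + Q x * f x + W x * g x" using uv(1) unfolding T_iff by auto
  obtain F p where F: "prim F p" "AE x in lebesgue. f x = F x" "f \<in> carrier LR" "F \<in> carrier LR" "p \<in> carrier LR" "h \<in> carrier LR"
    "(\<lambda>x. Q x * f x) \<in> carrier LR"
    "Re (LINT x|lebesgue. (- h x + Q x * f x) * cnj (f x)) = (hnorm LR p)\<^sup>2 + qform UNIV f"
    by (rule form_identity_line[OF fd h(1)])
  have gL: "g \<in> carrier LR" using gd by (simp add: domU_iff)
  let ?A = "(hnorm LR p)\<^sup>2 + qform UNIV f"
  have YA: "Y1 \<in> carrier LR" "Y2 \<in> carrier LR" "AE x in lebesgue. Y1 x = u x"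
    "AE x in lebesgue. Y2 x = complex_of_real ep * inverse (U x - \<zeta>) * v x"
    using uv(2) unfolding Yp op_B_iff ep_def rn_def by auto
  have ZA: "Z1 \<in> carrier LR" "Z2 \<in> carrier LR" "AE x in lebesgue. Z1 x = f x"
    "AE x in lebesgue. Z2 x = complex_of_real ep * inverse (U x - \<zeta>) * g x"
    using YZ(2) unfolding Zp op_B_iff ep_def rn_def by auto
  obtain e where e: "e > 0" "AE x in lebesgue. e \<le> cmod (U x - \<zeta>)" using resolvent_lower_bound[OF z] .
  have Qf: "(\<lambda>x. - h x + Q x * f x) \<in> carrier LR" by (rule L2_add[OF L2_uminus[OF F(6)] F(7)])
  have Wm: "(\<lambda>x. W x * g x) \<in> borel_measurable lebesgue" by (rule borel_measurable_times[OF meas(4) L2_measurable[OF gL]])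
  have Wle: "AE x in lebesgue. cmod (W x * g x) \<le> w * cmod (g x)" using w(2) by eventually_elim (auto simp: norm_mult mult_right_mono)
  have WL: "(\<lambda>x. W x * g x) \<in> carrier LR" by (rule L2_dominated[OF gL Wm Wle])
  have Wn: "hnorm LR (\<lambda>x. W x * g x) \<le> w * hnorm LR g" by (rule hnorm_L2_mono[OF gL Wm Wle w(1)])
  have Vf: "(\<lambda>x. V x * f x) \<in> carrier LR"
    using qform_bounds(2)[of UNIV f] F(3,7) by (simp add: lebesgue_on_UNIV_eq)
  have RV: "Rs \<zeta> (\<lambda>x. V x * f x) \<in> carrier LR" by (rule resolvent_norm_facts(2)[OF z Vf])
  have RVn: "hnorm LR (Rs \<zeta> (\<lambda>x. V x * f x)) \<le> rn * hnorm LR (\<lambda>x. V x * f x)"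
    unfolding rn_def by (rule resolvent_norm_facts(3)[OF z Vf])
  have y1: "AE x in lebesgue. Y1 x + - \<zeta> * Z1 x = (- h x + Q x * f x) + (W x * g x - \<zeta> * f x)"
    using YA(3) ZA(3) h(2) by eventually_elim (simp add: algebra_simps)
  \<comment> \<open>At its own parameter the pencil has the diagonal entry \<epsilon> (U -
    \<zeta>)^(-1) (U - \<zeta>) = \<epsilon> in the second row; this is the source of the coercive
    term in g.\<close>
  have y2: "AE x in lebesgue. Y2 x + - \<zeta> * Z2 x = complex_of_real ep * Rs \<zeta> (\<lambda>x. V x * f x) x + complex_of_real ep * g x"
    using YA(4) ZA(4) vae e(2)
  proof eventually_elim
    case (elim x)
    then have nz: "U x - \<zeta> \<noteq> 0" using e(1) by auto
    have "Y2 x + - \<zeta> * Z2 x = complex_of_real ep * (inverse (U x - \<zeta>) * (V x * f x) + inverse (U x - \<zeta>) * (U x - \<zeta>) * g x)"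
      unfolding elim by (simp add: algebra_simps)
    also have "inverse (U x - \<zeta>) * (U x - \<zeta>) = 1" using nz by simp
    finally show ?case by (simp add: algebra_simps)
  qed
  have WfL: "(\<lambda>x. W x * g x - \<zeta> * f x) \<in> carrier LR" by (rule L2_diff[OF WL L2_scale[OF F(3)]])
  have i1: "(LINT x|lebesgue. (Y1 x + - \<zeta> * Z1 x) * cnj (f x)) =
      (LINT x|lebesgue. (- h x + Q x * f x) * cnj (f x)) + (LINT x|lebesgue. (W x * g x - \<zeta> * f x) * cnj (f x))"
  proof -
    note j = L2_mult_integrable[OF Qf L2_cnj[OF F(3)]] L2_mult_integrable[OF WfL L2_cnj[OF F(3)]]
    have "(LINT x|lebesgue. (Y1 x + - \<zeta> * Z1 x) * cnj (f x)) = (LINT x|lebesgue. (- h x + Q x * f x) * cnj (f x) + (W x * g x - \<zeta> * f x) * cnj (f x))"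
    proof (rule integral_cong_AE)
      show "(\<lambda>x. (Y1 x + - \<zeta> * Z1 x) * cnj (f x)) \<in> borel_measurable lebesgue"
        by (rule borel_measurable_integrable[OF L2_mult_integrable[OF L2_add[OF YA(1) L2_scale[OF ZA(1)]] L2_cnj[OF F(3)]]])
      show "AE x in lebesgue. (Y1 x + - \<zeta> * Z1 x) * cnj (f x) = (- h x + Q x * f x) * cnj (f x) + (W x * g x - \<zeta> * f x) * cnj (f x)"
        using y1
      proof eventually_elim
        case (elim x)
        show ?case unfolding elim by (rule distrib_right)
      qed
    qed (rule borel_measurable_integrable[OF Bochner_Integration.integrable_add[OF j]])
    then show ?thesis unfolding Bochner_Integration.integral_add[OF j] .
  qed
  have i2: "(LINT x|lebesgue. (Y2 x + - \<zeta> * Z2 x) * cnj (g x)) =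
      complex_of_real ep * (LINT x|lebesgue. Rs \<zeta> (\<lambda>x. V x * f x) x * cnj (g x)) + complex_of_real (ep * (hnorm LR g)\<^sup>2)"
  proof -
    note j = L2_mult_integrable[OF RV L2_cnj[OF gL]] L2_mult_integrable[OF gL L2_cnj[OF gL]]
    note j' = integrable_mult_right[OF j(1), of "complex_of_real ep"] integrable_mult_right[OF j(2), of "complex_of_real ep"]
    have "(LINT x|lebesgue. (Y2 x + - \<zeta> * Z2 x) * cnj (g x)) =
        (LINT x|lebesgue. complex_of_real ep * (Rs \<zeta> (\<lambda>x. V x * f x) x * cnj (g x)) + complex_of_real ep * (g x * cnj (g x)))"
    proof (rule integral_cong_AE)
      show "(\<lambda>x. (Y2 x + - \<zeta> * Z2 x) * cnj (g x)) \<in> borel_measurable lebesgue"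
        by (rule borel_measurable_integrable[OF L2_mult_integrable[OF L2_add[OF YA(2) L2_scale[OF ZA(2)]] L2_cnj[OF gL]]])
      show "AE x in lebesgue. (Y2 x + - \<zeta> * Z2 x) * cnj (g x) =
         complex_of_real ep * (Rs \<zeta> (\<lambda>x. V x * f x) x * cnj (g x)) + complex_of_real ep * (g x * cnj (g x))"
        using y2
      proof eventually_elim
        case (elim x)
        show ?case unfolding elim by (simp add: distrib_right mult.assoc)
      qed
    qed (rule borel_measurable_integrable[OF Bochner_Integration.integrable_add[OF j']])
    also have "\<dots> = complex_of_real ep * (LINT x|lebesgue. Rs \<zeta> (\<lambda>x. V x * f x) x * cnj (g x)) + complex_of_real ep * (LINT x|lebesgue. g x * cnj (g x))"
      unfolding Bochner_Integration.integral_add[OF j'] Bochner_Integration.integral_mult_right[OF j(1)] Bochner_Integration.integral_mult_right[OF j(2)] ..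
    also have "(LINT x|lebesgue. g x * cnj (g x)) = complex_of_real ((hnorm LR g)\<^sup>2)"
      using inn_L2_self[of lebesgue g] by (simp add: L2_simps hnorm_L2_sq)
    finally show ?thesis by simp
  qed
  define I1 where "I1 = (LINT x|lebesgue. (W x * g x - \<zeta> * f x) * cnj (f x))"
  define I2 where "I2 = (LINT x|lebesgue. Rs \<zeta> (\<lambda>x. V x * f x) x * cnj (g x))"
  have inn: "Re (inn (Hsp UNIV) y (f, g)) = ?A + Re I1 + (ep * Re I2 + ep * (hnorm LR g)\<^sup>2)"
  proof -
    have "inn (Hsp UNIV) y (f, g) = (LINT x|lebesgue. (Y1 x + - \<zeta> * Z1 x) * cnj (f x)) + (LINT x|lebesgue. (Y2 x + - \<zeta> * Z2 x) * cnj (g x))"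
      unfolding YZ(3) Yp Zp by (simp add: hilbert_sum_simps L2_simps lebesgue_on_UNIV_eq)
    then show ?thesis unfolding i1 i2 I1_def[symmetric] I2_def[symmetric] using F(8) by simp
  qed
  have I1b: "- Re I1 \<le> (w * hnorm LR g + cmod \<zeta> * hnorm LR f) * hnorm LR f"
  proof -
    have "- Re I1 \<le> cmod I1" using abs_Re_le_cmod[of I1] by linarith
    also have "\<dots> \<le> hnorm LR (\<lambda>x. W x * g x - \<zeta> * f x) * hnorm LR f" unfolding I1_def by (rule L2_Cauchy_Schwarz[OF WfL F(3)])
    also have "hnorm LR (\<lambda>x. W x * g x - \<zeta> * f x) \<le> w * hnorm LR g + cmod \<zeta> * hnorm LR f"
      using semihilbert.triangle[OF semihilbert_L2 WL F(3), of "- \<zeta>"] Wn by (simp add: L2_simps)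
    finally show ?thesis by (simp add: mult_right_mono)
  qed
  have I2b: "- (ep * Re I2) \<le> ep / 2 * (hnorm LR g)\<^sup>2 + a0 / (2 * b0) * (hnorm LR f)\<^sup>2 + ?A / 2"
  proof -
    have "- Re I2 \<le> cmod I2" using abs_Re_le_cmod[of I2] by linarith
    also have "\<dots> \<le> hnorm LR (Rs \<zeta> (\<lambda>x. V x * f x)) * hnorm LR g" unfolding I2_def by (rule L2_Cauchy_Schwarz[OF RV gL])
    also have "\<dots> \<le> (rn * hnorm LR (\<lambda>x. V x * f x)) * hnorm LR g" by (intro mult_right_mono RVn) simp
    also have "\<dots> \<le> ((rn * hnorm LR (\<lambda>x. V x * f x))\<^sup>2 + (hnorm LR g)\<^sup>2) / 2"
      using sum_squares_bound[of "rn * hnorm LR (\<lambda>x. V x * f x)" "hnorm LR g"] by simp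
    finally have "ep * (- Re I2) \<le> ep * (((rn * hnorm LR (\<lambda>x. V x * f x))\<^sup>2 + (hnorm LR g)\<^sup>2) / 2)"
      using ep by (intro mult_left_mono) auto
    \<comment> \<open>Here ep * rn^2 = 1 / b0, the reason for the choice of \<epsilon>: the relative
      bound on V then turns the first summand into half of the form plus a multiple of the squared
      norm of f.\<close>
    also have "\<dots> = (hnorm LR (\<lambda>x. V x * f x))\<^sup>2 / (2 * b0) + ep / 2 * (hnorm LR g)\<^sup>2"
      using rn ab by (simp add: ep_def power_mult_distrib field_simps)
    also have "(hnorm LR (\<lambda>x. V x * f x))\<^sup>2 / (2 * b0) \<le> (a0 * (hnorm LR f)\<^sup>2 + b0 * ?A) / (2 * b0)"
      using rel[OF fd h(1)] ab unfolding F(8) by (intro divide_right_mono) auto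
    also have "\<dots> = a0 / (2 * b0) * (hnorm LR f)\<^sup>2 + ?A / 2" using ab by (simp add: field_simps)
    finally show ?thesis by simp
  qed
  have "?A / 2 + ep / 2 * (hnorm LR g)\<^sup>2 \<le> Re (inn (Hsp UNIV) y (f, g)) + (w * hnorm LR g + cmod \<zeta> * hnorm LR f) * hnorm LR f + a0 / (2 * b0) * (hnorm LR f)\<^sup>2"
  proof -
    have arith: "r = A + i + (e + G) \<Longrightarrow> - i \<le> X \<Longrightarrow> - e \<le> G / 2 + Y + A / 2 \<Longrightarrow> A / 2 + G / 2 \<le> r + X + Y"
      for r A i e G X Y :: real by linarith
    show ?thesis using arith[OF inn I1b, of "a0 / (2 * b0) * (hnorm LR f)\<^sup>2"] I2b by simp
  qed
  also have "\<dots> = Re (inn (Hsp UNIV) y (f, g)) + hnorm LR f * (w * hnorm LR g + (cmod \<zeta> + a0 / (2 * b0)) * hnorm LR f)"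
    by (simp add: algebra_simps power2_eq_square)
  finally show thesis using that[OF F(1,2,3) gL F(4,5,7)] unfolding ep_def rn_def by simp
qed

text \<open>It is enough to test \<zeta> against the pencil with the parameter \<zeta> itself: a
  point of the intersection outside the essential range would belong to its own pencil. Coercivity
  bounds the energy, compactness sends the first component to 0, and the coercive term then sends
  the second one to 0, against the normalisation.\<close>

lemma pencil_subset_essran:
  assumes z: "\<zeta> \<notin> essran U" and ab: "a0 > 0" "b0 > 0"
    and rel: "\<And>f h. f \<in> domA Q \<Longrightarrow> weak_deriv UNIV 2 f h \<Longrightarrow>
      (hnorm LR (\<lambda>x. V x * f x))\<^sup>2 \<le> a0 * (hnorm LR f)\<^sup>2 + b0 * Re (LINT x|lebesgue. (- h x + Q x * f x) * cnj (f x))"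
  shows "\<zeta> \<notin> ess_num_range_pencil (Hsp UNIV) (T O op_B b0 U \<zeta>) (op_B b0 U \<zeta>)"
proof
  assume "\<zeta> \<in> ess_num_range_pencil (Hsp UNIV) (T O op_B b0 U \<zeta>) (op_B b0 U \<zeta>)"
  then obtain x y where xy: "\<And>n. (x n, y n) \<in> op_diff (Hsp UNIV) (T O op_B b0 U \<zeta>) \<zeta> (op_B b0 U \<zeta>)"
    "\<And>n. hnorm (Hsp UNIV) (x n) = 1" "weakly_null (Hsp UNIV) x" "(\<lambda>n. inn (Hsp UNIV) (y n) (x n)) \<longlonglongrightarrow> 0"
    unfolding ess_num_range_pencil_def ess_num_range_def by blast
  define f g where "f n = fst (x n)" and "g n = snd (x n)" for n
  have x: "x n = (f n, g n)" for n by (simp add: f_def g_def)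
  obtain w where w: "w \<ge> 0" "AE x in lebesgue. cmod (W x) \<le> w" using W_bound .
  define ep where "ep = 1 / (b0 * (resolvent_norm U \<zeta>)\<^sup>2)"
  have ep: "ep > 0" using resolvent_norm_facts(1)[OF z] ab by (simp add: ep_def)
  define t where "t n = Re (inn (Hsp UNIV) (y n) (f n, g n))" for n
  define m where "m = cmod \<zeta> + a0 / (2 * b0)"
  have m: "m \<ge> 0" using ab by (simp add: m_def)
  define R where "R n F p \<longleftrightarrow> prim F p \<and> (AE x in lebesgue. f n x = F x) \<and> f n \<in> carrier LR \<and> g n \<in> carrier LR \<and> F \<in> carrier LR \<and> p \<in> carrier LR \<and>
    (\<lambda>x. Q x * f n x) \<in> carrier LR \<and>
    ((hnorm LR p)\<^sup>2 + qform UNIV (f n)) / 2 + ep / 2 * (hnorm LR (g n))\<^sup>2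
      \<le> t n + hnorm LR (f n) * (w * hnorm LR (g n) + m * hnorm LR (f n))" for n F p
  have ex: "\<exists>F p. R n F p" for n
  proof (rule pencil_coercive[OF z ab rel w xy(1)[of n, unfolded x]])
    fix F p assume a: "prim F p" "AE x in lebesgue. f n x = F x" "f n \<in> carrier LR" "g n \<in> carrier LR"
      "F \<in> carrier LR" "p \<in> carrier LR" "(\<lambda>x. Q x * f n x) \<in> carrier LR"
      "((hnorm LR p)\<^sup>2 + qform UNIV (f n)) / 2 + 1 / (b0 * (resolvent_norm U \<zeta>)\<^sup>2) / 2 * (hnorm LR (g n))\<^sup>2
      \<le> Re (inn (Hsp UNIV) (y n) (f n, g n)) + hnorm LR (f n) * (w * hnorm LR (g n) + (cmod \<zeta> + a0 / (2 * b0)) * hnorm LR (f n))"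
    show ?thesis unfolding R_def t_def ep_def m_def
      by (intro exI conjI) (rule a)+
  qed
  obtain F where "\<forall>n. \<exists>p. R n (F n) p" using choice[of "\<lambda>n F. \<exists>p. R n F p"] ex by auto
  then obtain p where R: "\<forall>n. R n (F n) (p n)" using choice[of "\<lambda>n p. R n (F n) p"] by auto
  have s: "prim (F n) (p n)" "AE x in lebesgue. f n x = F n x" "f n \<in> carrier LR"
    "g n \<in> carrier LR" "F n \<in> carrier LR" "p n \<in> carrier LR" "(\<lambda>x. Q x * f n x) \<in> carrier LR"
    "((hnorm LR (p n))\<^sup>2 + qform UNIV (f n)) / 2 + ep / 2 * (hnorm LR (g n))\<^sup>2
      \<le> t n + hnorm LR (f n) * (w * hnorm LR (g n) + m * hnorm LR (f n))" for n
    using R[rule_format, of n] unfolding R_def by - (elim conjE, assumption)+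
  have n1: "(hnorm LR (f n))\<^sup>2 + (hnorm LR (g n))\<^sup>2 = 1" for n
    using hnorm_UNIV_sq[OF s(3,4), of n n] xy(2)[of n] unfolding x by simp
  have le1: "hnorm LR (f n) \<le> 1" "hnorm LR (g n) \<le> 1" for n
    using hnorm_UNIV_ge[OF s(3,4), of n n] xy(2)[of n] unfolding x by simp_all
  have t0: "t \<longlonglongrightarrow> 0" using tendsto_Re[OF xy(4)] unfolding t_def[abs_def] x by simp
  then obtain B where B: "\<And>n. \<bar>t n\<bar> \<le> B" using convergent_imp_Bseq[OF convergentI[OF t0]] unfolding Bseq_def by auto
  have q0: "0 \<le> qform UNIV (f n)" for n
    using qform_bounds(1)[of UNIV "f n"] s(3,7) by (simp add: lebesgue_on_UNIV_eq)
  have prod: "hnorm LR (f n) * (w * hnorm LR (g n) + m * hnorm LR (f n)) \<le> hnorm LR (f n) * (w + m)" for n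
  proof (intro mult_left_mono)
    have "w * hnorm LR (g n) \<le> w * 1" "m * hnorm LR (f n) \<le> m * 1" using w(1) m by (intro mult_left_mono le1; simp)+
    then show "w * hnorm LR (g n) + m * hnorm LR (f n) \<le> w + m" by simp
  qed simp
  \<comment> \<open>The maximum with 1 gives C \<le> C^2, so one constant bounds the form and, after
    taking roots, the norm of p.\<close>
  define C where "C = max 1 (2 * (B + (w + m)))"
  have C1: "C \<ge> 1" by (simp add: C_def)
  have E: "(hnorm LR (p n))\<^sup>2 + qform UNIV (f n) \<le> C" for n
  proof -
    have "hnorm LR (f n) * (w + m) \<le> 1 * (w + m)" using le1 w(1) m by (intro mult_right_mono) auto
    moreover have "0 \<le> ep / 2 * (hnorm LR (g n))\<^sup>2" using ep by simp
    ultimately have "((hnorm LR (p n))\<^sup>2 + qform UNIV (f n)) / 2 \<le> B + (w + m)"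
    proof -
      have arith: "h \<le> 1 * k \<Longrightarrow> 0 \<le> G \<Longrightarrow> A + G \<le> tn + H \<Longrightarrow> H \<le> h \<Longrightarrow> \<bar>tn\<bar> \<le> B \<Longrightarrow> A \<le> B + k"
        for h k G A H tn B :: real by linarith
      show "hnorm LR (f n) * (w + m) \<le> 1 * (w + m) \<Longrightarrow> 0 \<le> ep / 2 * (hnorm LR (g n))\<^sup>2 \<Longrightarrow>
        ((hnorm LR (p n))\<^sup>2 + qform UNIV (f n)) / 2 \<le> B + (w + m)"
        by (rule arith[OF _ _ s(8) prod B])
    qed
    then show ?thesis by (simp add: C_def)
  qed
  have weak: "weakly_null (Hsp UNIV) (\<lambda>n. (f n, g n))" using xy(3) by (simp add: f_def g_def)
  have f0: "(\<lambda>n. hnorm LR (f n)) \<longlonglongrightarrow> 0"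
  proof (rule compactness[OF s(1,2,3,6,7,5) le1(1), where C = C])
    fix n
    have "(hnorm LR (p n))\<^sup>2 \<le> C" using E[of n] q0[of n] by linarith
    also have "1 * C \<le> C * C" using C1 by (intro mult_right_mono) linarith+
    then have "C \<le> C\<^sup>2" by (simp add: power2_eq_square)
    finally have "(hnorm LR (p n))\<^sup>2 \<le> C\<^sup>2" .
    then show "hnorm LR (p n) \<le> C" by (rule power2_le_imp_le) (use C1 in linarith)
    show "qform UNIV (f n) \<le> C" using E[of n] zero_le_power2[of "hnorm LR (p n)"] by linarith
  next
    fix y assume "y \<in> carrier LR"
    then show "(\<lambda>n. LINT t|lebesgue. f n t * cnj (y t)) \<longlonglongrightarrow> 0"
      by (rule weakly_null_components[OF weak])
  qed
  have "(\<lambda>n. (hnorm LR (f n))\<^sup>2 + 2 / ep * (t n + hnorm LR (f n) * (w + m))) \<longlonglongrightarrow> 0\<^sup>2 + 2 / ep * (0 + 0 * (w + m))"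
    by (intro tendsto_intros f0 t0)
  then have lim: "(\<lambda>n. (hnorm LR (f n))\<^sup>2 + 2 / ep * (t n + hnorm LR (f n) * (w + m))) \<longlonglongrightarrow> 0" by simp
  have "1 \<le> (hnorm LR (f n))\<^sup>2 + 2 / ep * (t n + hnorm LR (f n) * (w + m))" for n
  proof -
    have "ep / 2 * (hnorm LR (g n))\<^sup>2 \<le> t n + hnorm LR (f n) * (w + m)"
    proof -
      have "0 \<le> ((hnorm LR (p n))\<^sup>2 + qform UNIV (f n)) / 2" using q0[of n] by simp
      then show ?thesis using add_increasing[OF _ order_refl] order_trans[OF s(8)[of n] add_left_mono[OF prod[of n]]] by (meson order_trans)
    qed
    then have "2 / ep * (ep / 2 * (hnorm LR (g n))\<^sup>2) \<le> 2 / ep * (t n + hnorm LR (f n) * (w + m))"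
      using ep by (intro mult_left_mono) auto
    then have "(hnorm LR (g n))\<^sup>2 \<le> 2 / ep * (t n + hnorm LR (f n) * (w + m))" using ep by simp
    then show ?thesis using n1[of n] by linarith
  qed
  then have "1 \<le> (0::real)" using LIMSEQ_le_const[OF lim] by blast
  then show False by simp
qed

lemma part_i:
  assumes ab: "a0 > 0" "b0 > 0"
    and rel: "\<forall>f h. f \<in> domA Q \<and> weak_deriv UNIV 2 f h \<longrightarrow>
           (hnorm (L2 (lebesgue_on UNIV)) (\<lambda>x. V x * f x))\<^sup>2
             \<le> a0 * (hnorm (L2 (lebesgue_on UNIV)) f)\<^sup>2
               + b0 * Re (inn (L2 (lebesgue_on UNIV)) (\<lambda>x. - h x + Q x * f x) f)"
  shows "ess_spectrum (Hsp UNIV) T = (\<Inter>\<zeta>\<in>- essran U. ess_num_range_pencil (Hsp UNIV) (T O op_B b0 U \<zeta>) (op_B b0 U \<zeta>))"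
    and "(\<Inter>\<zeta>\<in>- essran U. ess_num_range_pencil (Hsp UNIV) (T O op_B b0 U \<zeta>) (op_B b0 U \<zeta>)) = essran U"
proof -
  let ?I = "\<Inter>\<zeta>\<in>- essran U. ess_num_range_pencil (Hsp UNIV) (T O op_B b0 U \<zeta>) (op_B b0 U \<zeta>)"
  have rel': "(hnorm LR (\<lambda>x. V x * f x))\<^sup>2 \<le> a0 * (hnorm LR f)\<^sup>2 + b0 * Re (LINT x|lebesgue. (- h x + Q x * f x) * cnj (f x))"
    if "f \<in> domA Q" "weak_deriv UNIV 2 f h" for f h
  proof -
    have "(hnorm (L2 (lebesgue_on UNIV)) (\<lambda>x. V x * f x))\<^sup>2
             \<le> a0 * (hnorm (L2 (lebesgue_on UNIV)) f)\<^sup>2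
               + b0 * Re (inn (L2 (lebesgue_on UNIV)) (\<lambda>x. - h x + Q x * f x) f)"
      using rel that by blast
    then show ?thesis unfolding lebesgue_on_UNIV_eq L2_simps .
  qed
  have 1: "essran U \<subseteq> ess_spectrum (Hsp UNIV) T" by (rule essran_subset_ess_spectrum)
  have 2: "ess_spectrum (Hsp UNIV) T \<subseteq> ?I" using ess_spectrum_subset_pencil by blast
  have 3: "?I \<subseteq> essran U" using pencil_subset_essran[OF _ ab rel'] by blast
  show "ess_spectrum (Hsp UNIV) T = ?I" "?I = essran U" using 1 2 3 by blast+
qed

end

subsection \<open>The initial value problem\<close>

text \<open>Picard iteration for the integral equation, the form suited to a merely measurable q. In
  the supremum norm weighted by exp (k (x - a)) each of the two integrations gains a factor 1/k and
  q costs K; with k^2 = 2 K the increments halve at each step.\<close>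

lemma linear_ivp:
  fixes q f0 :: "real \<Rightarrow> complex"
  assumes qm: "q \<in> borel_measurable lebesgue" and qb: "\<And>t. cmod (q t) \<le> K" and K: "K > 0" and ab: "a \<le> b"
    and f0: "continuous_on {a..b} f0"
  shows "\<exists>f. continuous_on {a..b} f \<and> (\<forall>x\<in>{a..b}. f x = f0 x + integral {a..x} (\<lambda>s. integral {a..s} (\<lambda>t. q t * f t)))"
proof -
  define J where "J u x = integral {a..x} (\<lambda>s. integral {a..s} (\<lambda>t. q t * u t))" for u :: "real \<Rightarrow> complex" and x
  define k where "k = sqrt (2 * K)"
  have k: "k > 0" "k * k = 2 * K" using K by (simp_all add: k_def)
  have qu: "(\<lambda>t. q t * u t) integrable_on {a..s}" if "continuous_on {a..b} u" "s \<le> b" for u s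
  proof -
    have c: "continuous_on {a..s} u" using that by (auto intro: continuous_on_subset)
    have "(\<lambda>t. q t * u t) absolutely_integrable_on {a..s}"
    proof (rule absolutely_integrable_bounded_measurable_product[OF bilinear_conv_bounded_bilinear[THEN iffD2, OF bounded_bilinear_mult]])
      show "q \<in> borel_measurable (lebesgue_on {a..s})" using qm by (rule measurable_restrict_space1)
      show "bounded (q ` {a..s})" using qb by (auto simp: bounded_iff)
      show "u absolutely_integrable_on {a..s}" by (rule absolutely_integrable_continuous_real[OF c])
    qed simp
    then show ?thesis by (rule set_lebesgue_integral_eq_integral(1))
  qed
  have cI: "continuous_on {a..b} (\<lambda>s. integral {a..s} (\<lambda>t. q t * u t))" if "continuous_on {a..b} u" for u
    by (rule indefinite_integral_continuous_1[OF qu[OF that order_refl]])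
  have cJ: "continuous_on {a..b} (J u)" if "continuous_on {a..b} u" for u
    unfolding J_def by (rule indefinite_integral_continuous_1[OF integrable_continuous_real[OF cI[OF that]]])
  have ei: "((\<lambda>t. M * exp (k * (t - a))) has_integral M * (exp (k * (s - a)) - 1) / k) {a..s}" if "a \<le> s" for M s
  proof -
    have "((\<lambda>t. M * exp (k * (t - a))) has_integral M * exp (k * (s - a)) / k - M * exp (k * (a - a)) / k) {a..s}"
      using that k(1) by (intro fundamental_theorem_of_calculus)
        (auto intro!: derivative_eq_intros simp: has_real_derivative_iff_has_vector_derivative[symmetric])
    then show ?thesis by (simp add: right_diff_distrib diff_divide_distrib)
  qed
  have step: "cmod (integral {a..s} v) \<le> M / k * exp (k * (s - a))"
    if "v integrable_on {a..s}" "a \<le> s" "0 \<le> M" "\<And>t. t \<in> {a..s} \<Longrightarrow> cmod (v t) \<le> M * exp (k * (t - a))" for v s M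
  proof -
    have "cmod (integral {a..s} v) \<le> integral {a..s} (\<lambda>t. M * exp (k * (t - a)))"
      by (rule integral_norm_bound_integral[OF that(1) has_integral_integrable[OF ei[OF that(2)]] that(4)])
    also have "\<dots> = M * (exp (k * (s - a)) - 1) / k" using ei[OF that(2)] by (rule integral_unique)
    also have "\<dots> \<le> M * exp (k * (s - a)) / k" using that(3) k(1) by (intro divide_right_mono mult_left_mono) auto
    finally show ?thesis by simp
  qed
  have Jb: "cmod (J u x) \<le> M / 2 * exp (k * (x - a))"
    if u: "continuous_on {a..b} u" "\<And>t. t \<in> {a..b} \<Longrightarrow> cmod (u t) \<le> M * exp (k * (t - a))" and x: "x \<in> {a..b}" and M: "0 \<le> M" for u M x
  proof -
    have 1: "cmod (integral {a..s} (\<lambda>t. q t * u t)) \<le> K * M / k * exp (k * (s - a))" if s: "s \<in> {a..x}" for s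
    proof (rule step)
      show "(\<lambda>t. q t * u t) integrable_on {a..s}" using qu[OF u(1)] s x by simp
      fix t assume t: "t \<in> {a..s}"
      have "cmod (q t) * cmod (u t) \<le> K * (M * exp (k * (t - a)))" using qb u(2)[of t] t s x K by (intro mult_mono) auto
      then show "cmod (q t * u t) \<le> K * M * exp (k * (t - a))" by (simp add: norm_mult mult.assoc)
    qed (use s K M in auto)
    have "cmod (J u x) \<le> K * M / k / k * exp (k * (x - a))"
      unfolding J_def
    proof (rule step)
      show "(\<lambda>s. integral {a..s} (\<lambda>t. q t * u t)) integrable_on {a..x}"
        by (rule integrable_continuous_real[OF continuous_on_subset[OF cI[OF u(1)]]]) (use x in auto)
    qed (use 1 x K M k in auto)
    also have "K * M / k / k = M / 2" using k K by (simp add: field_simps)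
    finally show ?thesis .
  qed
  have Jd: "J u x - J v x = J (\<lambda>t. u t - v t) x" if "continuous_on {a..b} u" "continuous_on {a..b} v" "x \<in> {a..b}" for u v x
  proof -
    have "J (\<lambda>t. u t - v t) x = integral {a..x} (\<lambda>s. integral {a..s} (\<lambda>t. q t * u t) - integral {a..s} (\<lambda>t. q t * v t))"
      unfolding J_def
    proof (rule integral_cong)
      fix s assume "s \<in> {a..x}"
      then have sb: "s \<le> b" using that(3) by simp
      show "integral {a..s} (\<lambda>t. q t * (u t - v t)) = integral {a..s} (\<lambda>t. q t * u t) - integral {a..s} (\<lambda>t. q t * v t)"
        unfolding right_diff_distrib by (rule integral_diff[OF qu[OF that(1) sb] qu[OF that(2) sb]])
    qed
    also have "\<dots> = J u x - J v x"
      unfolding J_def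
      by (rule integral_diff; rule integrable_continuous_real, rule continuous_on_subset[OF cI]) (use that in auto)
    finally show ?thesis by simp
  qed
  define v where "v = rec_nat f0 (\<lambda>_ u x. f0 x + J u x)"
  have v0: "v 0 = f0" and vs: "v (Suc n) = (\<lambda>x. f0 x + J (v n) x)" for n by (simp_all add: v_def)
  have cv: "continuous_on {a..b} (v n)" for n
    by (induction n) (auto simp: v0 vs intro!: continuous_intros f0 cJ)
  obtain M0 where M0: "\<And>x. x \<in> {a..b} \<Longrightarrow> cmod (f0 x) \<le> M0"
    using compact_imp_bounded[OF compact_continuous_image[OF f0 compact_Icc]] unfolding bounded_iff by (metis imageI)
  have M: "0 \<le> M0" using M0[of a] ab by (meson atLeastAtMost_iff norm_ge_zero order_refl order_trans)
  have e1: "1 \<le> exp (k * (x - a))" if "x \<in> {a..b}" for x using that k by simp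
  have f0b: "cmod (f0 x) \<le> M0 * exp (k * (x - a))" if "x \<in> {a..b}" for x
    using M0[OF that] mult_left_mono[OF e1[OF that] M] by simp
  have d: "cmod (v (Suc n) x - v n x) \<le> M0 / 2 ^ (Suc n) * exp (k * (x - a))" if "x \<in> {a..b}" for n x
    using that
  proof (induction n arbitrary: x)
    case 0
    then show ?case using Jb[OF f0 f0b 0 M] by (simp add: v0 vs)
  next
    case (Suc n)
    have "v (Suc (Suc n)) x - v (Suc n) x = J (v (Suc n)) x - J (v n) x" by (simp only: vs[of "Suc n"] vs[of n] add_diff_cancel_left)
    also have "\<dots> = J (\<lambda>t. v (Suc n) t - v n t) x" by (rule Jd[OF cv cv Suc.prems])
    also have "cmod \<dots> \<le> M0 / 2 ^ Suc n / 2 * exp (k * (x - a))"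
      by (rule Jb[OF continuous_on_diff[OF cv cv] Suc.IH Suc.prems]) (use M in auto)
    finally show ?case by (simp add: mult.commute)
  qed
  define E where "E = M0 * exp (k * (b - a))"
  have d': "cmod (v (Suc n) x - v n x) \<le> E * (1/2) ^ n" if "x \<in> {a..b}" for n x
  proof -
    have "M0 / 2 ^ (Suc n) * exp (k * (x - a)) \<le> M0 / 2 ^ n * exp (k * (b - a))"
      using M that k by (intro mult_mono divide_left_mono) auto
    then show ?thesis using d[OF that, of n] by (simp add: E_def power_one_over)
  qed
  have "uniform_limit {a..b} (\<lambda>n x. \<Sum>i<n. v (Suc i) x - v i x) (\<lambda>x. \<Sum>i. v (Suc i) x - v i x) sequentially"
    by (rule Weierstrass_m_test[where M="\<lambda>n. E * (1/2) ^ n"]) (auto intro: d' summable_mult)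
  then have ul0: "uniform_limit {a..b} (\<lambda>n x. v n x - v 0 x) (\<lambda>x. \<Sum>i. v (Suc i) x - v i x) sequentially"
    by (simp only: sum_lessThan_telescope[of "\<lambda>i. v i x" for x])
  define f where "f x = v 0 x + (\<Sum>i. v (Suc i) x - v i x)" for x
  have "uniform_limit {a..b} (\<lambda>n x. v 0 x + (v n x - v 0 x)) f sequentially"
    unfolding f_def by (rule uniform_limit_add[OF uniform_limit_const ul0])
  then have ul: "uniform_limit {a..b} v f sequentially" by simp
  have cf: "continuous_on {a..b} f"
    by (rule uniform_limit_theorem[OF _ ul]) (auto simp: cv)
  have "f x = f0 x + J f x" if x: "x \<in> {a..b}" for x
  proof (rule LIMSEQ_unique)
    show "(\<lambda>n. v (Suc n) x) \<longlonglongrightarrow> f x" by (rule LIMSEQ_Suc[OF tendsto_uniform_limitI[OF ul x]])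
    have "(\<lambda>n. J (v n) x - J f x) \<longlonglongrightarrow> 0"
    proof (rule LIMSEQ_I)
      fix e :: real assume e: "e > 0"
      define e' where "e' = e / exp (k * (x - a))"
      have e': "e' > 0" using e by (simp add: e'_def)
      then obtain N where N: "\<And>n t. n \<ge> N \<Longrightarrow> t \<in> {a..b} \<Longrightarrow> dist (v n t) (f t) < e'"
        using ul unfolding uniform_limit_iff eventually_sequentially by blast
      show "\<exists>N. \<forall>n\<ge>N. norm (J (v n) x - J f x - 0) < e"
      proof (intro exI allI impI)
        fix n assume n: "n \<ge> N"
        have "cmod (J (\<lambda>t. v n t - f t) x) \<le> e' / 2 * exp (k * (x - a))"
        proof (rule Jb[OF continuous_on_diff[OF cv cf] _ x])
          fix t assume t: "t \<in> {a..b}"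
          have "cmod (v n t - f t) \<le> e'" using N[OF n t] by (simp add: dist_norm)
          also have "\<dots> \<le> e' * exp (k * (t - a))" using e1[OF t] e' by simp
          finally show "cmod (v n t - f t) \<le> e' * exp (k * (t - a))" .
        qed (use e' in simp)
        also have "\<dots> < e" using e by (simp add: e'_def)
        finally show "norm (J (v n) x - J f x - 0) < e" by (simp add: Jd[OF cv cf x])
      qed
    qed
    then have "(\<lambda>n. f0 x + (J (v n) x - J f x) + J f x) \<longlonglongrightarrow> f0 x + 0 + J f x" by (intro tendsto_intros)
    then show "(\<lambda>n. v (Suc n) x) \<longlonglongrightarrow> f0 x + J f x" by (simp add: vs)
  qed
  then show ?thesis using cf unfolding J_def by blast
qed

text \<open>Yields F'' = q F - k on [a, b] with F = 0 and F' = \<alpha> at a. The right-hand side is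
  set to 0 outside [a, b], so that both functions are absolutely continuous on the whole
  line.\<close>

lemma second_order_ivp:
  assumes qm: "q \<in> borel_measurable lebesgue" and qb: "\<And>t. cmod (q t) \<le> K" and ab: "a \<le> b"
    and k: "\<And>c d. k absolutely_integrable_on {c..d}"
  obtains F p where "prim F p" "prim p (\<lambda>t. if t \<in> {a..b} then q t * F t - k t else 0)" "F a = 0" "p a = \<alpha>"
proof -
  obtain P where P: "prim P k" "P a = 0" using prim_exists[OF k] by blast
  have cP: "continuous_on S P" for S by (rule prim_continuous[OF P(1)])
  \<comment> \<open>\<open>f0\<close> carries the initial slope and the inhomogeneity: f0'' = -k,
    with f0 = 0 and f0' = \<alpha> at a.\<close>
  define f0 where "f0 x = integral {a..x} (\<lambda>s. \<alpha> - P s)" for x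
  have c0: "continuous_on {a..b} f0"
    unfolding f0_def by (intro indefinite_integral_continuous_1 integrable_continuous_real continuous_intros cP)
  have K: "max K 1 > 0" and qb': "\<And>t. cmod (q t) \<le> max K 1" using qb by (auto intro: max.coboundedI1)
  obtain f where f: "continuous_on {a..b} f"
    "\<And>x. x \<in> {a..b} \<Longrightarrow> f x = f0 x + integral {a..x} (\<lambda>s. integral {a..s} (\<lambda>t. q t * f t))"
    using linear_ivp[OF qm qb' K ab c0] by blast
  have qf: "(\<lambda>t. q t * f t) absolutely_integrable_on {a..b}"
  proof (rule absolutely_integrable_bounded_measurable_product[OF bilinear_conv_bounded_bilinear[THEN iffD2, OF bounded_bilinear_mult]])
    show "q \<in> borel_measurable (lebesgue_on {a..b})" using qm by (rule measurable_restrict_space1)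
    show "bounded (q ` {a..b})" using qb by (auto simp: bounded_iff)
    show "f absolutely_integrable_on {a..b}" by (rule absolutely_integrable_continuous_real[OF f(1)])
  qed simp
  let ?h = "\<lambda>t. if t \<in> {a..b} then q t * f t - k t else 0"
  have hi: "?h absolutely_integrable_on {c..d}" for c d
  proof -
    have "(\<lambda>t. q t * f t - k t) absolutely_integrable_on {a..b}" by (intro set_integral_diff qf k)
    then have "integrable lebesgue (\<lambda>t. indicat_real {a..b} t *\<^sub>R (q t * f t - k t))" by (simp add: set_integrable_def)
    then have "integrable lebesgue (\<lambda>t. indicat_real {c..d} t *\<^sub>R (indicat_real {a..b} t *\<^sub>R (q t * f t - k t)))"
      by (rule integrable_mult_indicator[rotated]) simp
    moreover have "indicat_real {c..d} t *\<^sub>R (indicat_real {a..b} t *\<^sub>R (q t * f t - k t)) = indicat_real {c..d} t *\<^sub>R ?h t" for t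
      by (simp add: indicator_def)
    ultimately show ?thesis by (simp only: set_integrable_def)
  qed
  obtain p where p: "prim p ?h" "p a = \<alpha>" using prim_exists[OF hi] by blast
  have "p absolutely_integrable_on {c..d}" for c d
    by (intro absolutely_integrable_continuous_real prim_continuous[OF p(1)])
  then obtain F where F: "prim F p" "F a = 0" using prim_exists[of p a 0] by blast
  have ps: "p s = \<alpha> - P s + integral {a..s} (\<lambda>t. q t * f t)" if s: "s \<in> {a..b}" for s
  proof -
    have qs: "(\<lambda>t. q t * f t) integrable_on {a..s}"
      by (rule integrable_on_subinterval[OF set_lebesgue_integral_eq_integral(1)[OF qf]]) (use s in auto)
    have ks: "k integrable_on {a..s}" by (rule set_lebesgue_integral_eq_integral(1)[OF k])
    have "p s - p a = integral {a..s} ?h" using primD(2)[OF p(1), of a s] s by simp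
    also have "\<dots> = integral {a..s} (\<lambda>t. q t * f t - k t)" by (rule integral_cong) (use s in auto)
    also have "\<dots> = integral {a..s} (\<lambda>t. q t * f t) - integral {a..s} k" by (rule integral_diff[OF qs ks])
    also have "integral {a..s} k = P s" using primD(2)[OF P(1), of a s] s P(2) by simp
    finally show ?thesis using p(2) by (simp add: algebra_simps)
  qed
  have Ff: "F x = f x" if x: "x \<in> {a..b}" for x
  proof -
    have "F x = integral {a..x} p" using primD(2)[OF F(1), of a x] x F(2) by simp
    also have "\<dots> = integral {a..x} (\<lambda>s. (\<alpha> - P s) + integral {a..s} (\<lambda>t. q t * f t))"
      by (rule integral_cong) (use ps x in auto)
    also have "\<dots> = f0 x + integral {a..x} (\<lambda>s. integral {a..s} (\<lambda>t. q t * f t))"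
      unfolding f0_def
    proof (rule integral_add)
      show "(\<lambda>s. \<alpha> - P s) integrable_on {a..x}" by (intro integrable_continuous_real continuous_intros cP)
      have "continuous_on {a..b} (\<lambda>s. integral {a..s} (\<lambda>t. q t * f t))"
        by (rule indefinite_integral_continuous_1[OF set_lebesgue_integral_eq_integral(1)[OF qf]])
      then show "(\<lambda>s. integral {a..s} (\<lambda>t. q t * f t)) integrable_on {a..x}"
        by (intro integrable_continuous_real) (rule continuous_on_subset, use x in auto)
    qed
    also have "\<dots> = f x" using f(2)[OF x] by simp
    finally show ?thesis .
  qed
  have "(\<lambda>t. if t \<in> {a..b} then q t * F t - k t else 0) = ?h" using Ff by (auto simp: fun_eq_iff)
  then show thesis using that F p by simp
qed

context matrix_model
begin

lemma interval_eq: "interval n = {- real n<..<real n}"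
  by (simp add: interval_def)

lemma L2_interval_continuous:
  assumes "continuous_on UNIV k" shows "k \<in> carrier (L2 (lebesgue_on (interval n)))"
proof -
  have "compact (k ` {- real n..real n})" by (intro compact_continuous_image continuous_on_subset[OF assms]) auto
  then obtain K where K: "\<And>x. x \<in> {- real n..real n} \<Longrightarrow> cmod (k x) \<le> K"
    using compact_imp_bounded bounded_iff by (metis imageI)
  have i: "integrable lebesgue (\<lambda>x. K\<^sup>2 * indicat_real {- real n<..<real n} x)"
    using lmeasurable_box[of "- real n" "real n"]
    by (intro integrable_mult_right integrable_real_indicator) (auto simp: fmeasurable_def)
  have m: "k \<in> borel_measurable lebesgue" by (rule continuous_measurable_lebesgue[OF assms])
  have "integrable lebesgue (\<lambda>x. indicat_real {- real n<..<real n} x * (cmod (k x))\<^sup>2)"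
  proof (rule Bochner_Integration.integrable_bound[OF i])
    show "(\<lambda>x. indicat_real {- real n<..<real n} x * (cmod (k x))\<^sup>2) \<in> borel_measurable lebesgue"
      using m by (intro borel_measurable_times borel_measurable_indicator borel_measurable_power borel_measurable_norm) auto
    have "norm (indicat_real {- real n<..<real n} x * (cmod (k x))\<^sup>2) \<le> norm (K\<^sup>2 * indicat_real {- real n<..<real n} x)" for x
    proof (cases "x \<in> {- real n<..<real n}")
      case True
      then have "(cmod (k x))\<^sup>2 \<le> K\<^sup>2" using K[of x] by (intro power_mono) auto
      then show ?thesis using True by simp
    qed simp
    then show "AE x in lebesgue. norm (indicat_real {- real n<..<real n} x * (cmod (k x))\<^sup>2) \<le> norm (K\<^sup>2 * indicat_real {- real n<..<real n} x)"
      by blast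
  qed
  moreover have "(\<lambda>x. indicat_real {- real n<..<real n} x * (cmod (k x))\<^sup>2) = (\<lambda>x. if x \<in> interval n then (cmod (k x))\<^sup>2 else 0)"
    by (auto simp: indicator_def interval_def)
  ultimately have "integrable (lebesgue_on (interval n)) (\<lambda>x. (cmod (k x))\<^sup>2)"
    unfolding integrable_lebesgue_on_iff[OF interval_sets(1)] by simp
  then show ?thesis unfolding carrier_L2 using m by (auto intro: measurable_restrict_space1)
qed

lemma interval_bounded_mult:
  assumes k: "k \<in> borel_measurable (lebesgue_on (interval n))" "AE x in lebesgue_on (interval n). cmod (k x) \<le> C"
    and f: "f \<in> carrier (L2 (lebesgue_on (interval n)))"
  shows "(\<lambda>x. k x * f x) \<in> carrier (L2 (lebesgue_on (interval n)))"
proof (rule L2_dominated[OF f borel_measurable_times[OF k(1) L2_measurable[OF f]]])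
  show "AE x in lebesgue_on (interval n). cmod (k x * f x) \<le> C * cmod (f x)"
    using k(2) by eventually_elim (auto simp: norm_mult mult_right_mono)
qed

lemma interval_bounds:
  obtains C where "C \<ge> 1" "AE x in lebesgue_on (interval n). cmod (Q x) \<le> C" "AE x in lebesgue_on (interval n). cmod (V x) \<le> C"
    "AE x in lebesgue_on (interval n). cmod (U x) \<le> C" "AE x in lebesgue_on (interval n). cmod (W x) \<le> C"
proof -
  obtain C where C: "C \<ge> 1" "AE x in lebesgue. x \<in> {- real n..real n} \<longrightarrow> cmod (Q x) \<le> C \<and> cmod (V x) \<le> C \<and> cmod (U x) \<le> C \<and> cmod (W x) \<le> C"
    using local_bound .
  show thesis
    by (rule that[OF C(1)]; unfold AE_lebesgue_on_iff[OF interval_sets(1)]; use C(2) in eventually_elim; auto simp: interval_def)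
qed

text \<open>The first component of \<open>(T\<^sub>n - \<mu>)(f, g) = (u, v)\<close> solves a scalar Sturm--Liouville problem once
  \<open>g = (U - \<mu>)\<^sup>-\<^sup>1 (v - V f)\<close> has been eliminated.\<close>

lemma Tn_surjective:
  assumes n: "n \<ge> 1" and e: "e > 0" "AE x in lebesgue_on (interval n). e \<le> cmod (U x - \<mu>)"
    and lb: "\<And>x y. (x, y) \<in> op_shift (Hsp (interval n)) (op_Tn Q W V U n) \<mu> \<Longrightarrow> hnorm (Hsp (interval n)) x \<le> C * hnorm (Hsp (interval n)) y"
    and y: "y \<in> carrier (Hsp (interval n))"
  shows "\<exists>x. (x, y) \<in> op_shift (Hsp (interval n)) (op_Tn Q W V U n) \<mu>"
proof -
  let ?I = "interval n" and ?a = "- real n" and ?b = "real n"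
  let ?L = "carrier (L2 (lebesgue_on ?I))"
  have ab: "?a \<le> ?b" "?a < ?b" using n by auto
  obtain B where B: "B \<ge> 1" "AE x in lebesgue_on ?I. cmod (Q x) \<le> B" "AE x in lebesgue_on ?I. cmod (V x) \<le> B"
    "AE x in lebesgue_on ?I. cmod (U x) \<le> B" "AE x in lebesgue_on ?I. cmod (W x) \<le> B" using interval_bounds .
  \<comment> \<open>The potential of the Schur complement: inserting g = (U - \<mu>)^(-1) (v - V f)
    into the first row leaves -f'' + s f.\<close>
  define s where "s t = Q t - \<mu> - W t * inverse (U t - \<mu>) * V t" for t
  define K where "K = B + cmod \<mu> + B * (1 / e) * B"
  \<comment> \<open>\<open>linear_ivp\<close> requires a bound at every point; \<open>q\<close>
    differs from \<open>s\<close> on the interval only in a null set.\<close>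
  define q where "q t = (if cmod (s t) \<le> K then s t else 0)" for t
  have K0: "K \<ge> 0" using B(1) e(1) by (simp add: K_def)
  have sm: "s \<in> borel_measurable lebesgue" unfolding s_def[abs_def] using meas by measurable
  have qm: "q \<in> borel_measurable lebesgue" unfolding q_def[abs_def] using sm by measurable
  have qb: "cmod (q t) \<le> K" for t using K0 by (simp add: q_def)
  have qs: "AE t in lebesgue_on ?I. q t = s t"
    using B(2,3,5) e(2)
  proof eventually_elim
    case (elim t)
    have "cmod (inverse (U t - \<mu>)) \<le> 1 / e" 
      using le_imp_inverse_le[OF elim(4) e(1)] by (simp add: norm_inverse inverse_eq_divide norm_divide)
    then have "cmod (W t * inverse (U t - \<mu>) * V t) \<le> B * (1 / e) * B"
      unfolding norm_mult using elim B(1) e(1) by (intro mult_mono) auto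
    moreover have "cmod (s t) \<le> cmod (Q t) + cmod \<mu> + cmod (W t * inverse (U t - \<mu>) * V t)"
      unfolding s_def by (meson add_right_mono norm_triangle_ineq4 order_trans)
    ultimately have "cmod (s t) \<le> K" using elim(1) unfolding K_def by linarith
    then show ?case by (simp add: q_def)
  qed
  have solve: "((F, Rs \<mu> (\<lambda>t. v t - V t * F t)), (u, v)) \<in> op_shift (Hsp ?I) (op_Tn Q W V U n) \<mu>"
    if F: "prim F p" "prim p (\<lambda>t. if t \<in> {?a..?b} then q t * F t - k t else 0)" "F ?a = 0" "F ?b = 0"
      and k: "\<And>t. t \<in> ?I \<Longrightarrow> k t = u t - W t * Rs \<mu> v t" and uv: "u \<in> ?L" "v \<in> ?L" for F p k u v
  proof -
    have cF: "continuous_on UNIV F" and cp: "continuous_on UNIV p" using prim_continuous F by auto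
    have FL: "F \<in> ?L" and pL: "p \<in> ?L" using L2_interval_continuous cF cp by auto
    have VF: "(\<lambda>t. V t * F t) \<in> ?L" by (rule interval_bounded_mult[OF meas_on(2) B(3) FL])
    have gL: "Rs \<mu> (\<lambda>t. v t - V t * F t) \<in> ?L" by (rule resolvent_L2(1)[OF interval_sets(1) e L2_diff[OF uv(2) VF]])
    have RvL: "Rs \<mu> v \<in> ?L" by (rule resolvent_L2(1)[OF interval_sets(1) e uv(2)])
    have WRv: "(\<lambda>t. W t * Rs \<mu> v t) \<in> ?L" by (rule interval_bounded_mult[OF meas_on(4) B(5) RvL])
    let ?h = "\<lambda>t. if t \<in> {?a..?b} then q t * F t - k t else 0"
    have qF: "(\<lambda>t. q t * F t) \<in> ?L"
      by (rule interval_bounded_mult[OF measurable_restrict_space1[OF qm] _ FL]) (use qb in blast)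
    have hae: "AE t in lebesgue_on ?I. ?h t = q t * F t - (u t - W t * Rs \<mu> v t)"
      unfolding AE_lebesgue_on_iff[OF interval_sets(1)] by (rule AE_I2) (use k in \<open>auto simp: interval_def\<close>)
    have hL: "?h \<in> ?L" by (rule L2_cong_AE[OF interval_sets(1) L2_diff[OF qF L2_diff[OF uv(1) WRv]] hae])
    have FD: "F \<in> domN n"
      using sobolev2I(1)[OF interval_sets(1) F(1,2) FL pL hL] F(3,4) cF
      by (auto simp: vanishes_at_ends_def intro!: exI[of _ F] intro: continuous_on_subset)
    have wd: "weak_deriv ?I 2 F ?h" by (rule prim_weak_deriv2[OF F(1,2) interval_sets(1)])
    have "AE t in lebesgue_on ?I. u t = - ?h t + (Q t - \<mu>) * F t + W t * Rs \<mu> (\<lambda>t. v t - V t * F t) t"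
      using hae qs
    proof eventually_elim
      case (elim t)
      have "- ?h t = (u t - W t * Rs \<mu> v t) - s t * F t" unfolding elim(1) unfolding elim(2) by simp
      then show ?case unfolding s_def by (simp add: algebra_simps)
    qed
    moreover have "AE t in lebesgue_on ?I. v t = V t * F t + (U t - \<mu>) * Rs \<mu> (\<lambda>t. v t - V t * F t) t"
      using e(2)
    proof eventually_elim
      case (elim t)
      then have "U t - \<mu> \<noteq> 0" using e(1) by auto
      then have "(U t - \<mu>) * inverse (U t - \<mu>) = 1" by (rule right_inverse)
      then have "(U t - \<mu>) * (inverse (U t - \<mu>) * (v t - V t * F t)) = v t - V t * F t"
        by (metis mult.assoc mult_1_left)
      then show ?case by (simp only:) simp
    qed
    ultimately show ?thesis unfolding Tn_shift_iff using FD gL uv wd by blast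
  qed
  obtain F1 p1 where F1: "prim F1 p1" "prim p1 (\<lambda>t. if t \<in> {?a..?b} then q t * F1 t - 0 else 0)" "F1 ?a = 0" "p1 ?a = 1"
    by (rule second_order_ivp[OF qm qb ab(1), of "\<lambda>t. 0" 1]) auto
  \<comment> \<open>The solution that starts with value 0 and slope 1 cannot vanish at the other
    end: it would give a vector with image 0, so by \<open>lb\<close> it would vanish, and with it
    the initial slope.\<close>
  have b1: "F1 ?b \<noteq> 0"
  proof
    assume b0: "F1 ?b = 0"
    have FL: "F1 \<in> ?L" by (rule L2_interval_continuous[OF prim_continuous[OF F1(1)]])
    have VF: "(\<lambda>t. V t * F1 t) \<in> ?L" by (rule interval_bounded_mult[OF meas_on(2) B(3) FL])
    have gL: "Rs \<mu> (\<lambda>t. 0 - V t * F1 t) \<in> ?L" by (rule resolvent_L2(1)[OF interval_sets(1) e L2_diff[OF L2_zero VF]])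
    have "((F1, Rs \<mu> (\<lambda>t. 0 - V t * F1 t)), (\<lambda>t. 0, \<lambda>t. 0)) \<in> op_shift (Hsp ?I) (op_Tn Q W V U n) \<mu>"
      by (rule solve[OF F1(1,2,3) b0]) auto
    then have "hnorm (Hsp ?I) (F1, Rs \<mu> (\<lambda>t. 0 - V t * F1 t)) \<le> C * hnorm (Hsp ?I) (\<lambda>t. 0, \<lambda>t. 0)" by (rule lb)
    also have "hnorm (Hsp ?I) (\<lambda>t. 0, \<lambda>t. 0) = 0" by (simp add: hnorm_def hilbert_sum_simps L2_simps)
    finally have "hnorm (L2 (lebesgue_on ?I)) F1 \<le> 0" using hnorm_Hsp_ge(1)[OF FL gL] by simp
    then have "hnorm (L2 (lebesgue_on ?I)) F1 = 0" by (simp add: antisym)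
    then have "AE t in lebesgue_on ?I. F1 t = 0" using hnorm_L2_eq_0[OF FL] by blast
    then have ae: "AE t in lebesgue_on {?a<..<?b}. F1 t = 0" unfolding interval_eq .
    have z: "F1 t = 0" if "t \<in> {?a..?b}" for t
      by (rule continuous_AE_eq[OF ab(2) prim_continuous[OF F1(1)] continuous_on_const ae that])
    have "p1 t = 0" if t: "t \<in> ?I" for t
    proof -
      have "(F1 has_vector_derivative p1 t) (at t)" by (rule prim_deriv[OF F1(1) prim_continuous[OF F1(2)]])
      moreover have "(F1 has_vector_derivative 0) (at t)"
        by (rule has_vector_derivative_transform_within_open[of "\<lambda>_. 0" 0 t ?I]) (use t z in \<open>auto simp: interval_def\<close>)
      ultimately show ?thesis by (rule vector_derivative_unique_at)
    qed
    then have "AE t in lebesgue_on ?I. p1 t = 0" unfolding AE_lebesgue_on_iff[OF interval_sets(1)] by (intro AE_I2) auto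
    then have ae': "AE t in lebesgue_on {?a<..<?b}. p1 t = 0" unfolding interval_eq .
    have "p1 ?a = 0"
      by (rule continuous_AE_eq[OF ab(2) prim_continuous[OF F1(2)] continuous_on_const ae']) (use ab in simp)
    then show False using F1(4) by simp
  qed
  obtain u v where y': "y = (u, v)" "u \<in> ?L" "v \<in> ?L" using y by (cases y) (auto simp: hilbert_sum_simps)
  have RvL: "Rs \<mu> v \<in> ?L" by (rule resolvent_L2(1)[OF interval_sets(1) e y'(3)])
  have WRv: "(\<lambda>t. W t * Rs \<mu> v t) \<in> ?L" by (rule interval_bounded_mult[OF meas_on(4) B(5) RvL])
  define k where "k = (\<lambda>t. if t \<in> ?I then u t - W t * Rs \<mu> v t else 0)"
  have ki: "k absolutely_integrable_on {c..d}" for c d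
    unfolding k_def by (rule L2_absolutely_integrable[OF interval_sets(1) L2_diff[OF y'(2) WRv]])
  obtain F2 p2 where F2: "prim F2 p2" "prim p2 (\<lambda>t. if t \<in> {?a..?b} then q t * F2 t - k t else 0)" "F2 ?a = 0" "p2 ?a = 0"
    by (rule second_order_ivp[OF qm qb ab(1) ki, of 0]) auto
  \<comment> \<open>Shooting: the multiple of the homogeneous solution that corrects the value at
    the right end.\<close>
  define c where "c = - F2 ?b / F1 ?b"
  define F where "F t = F2 t + c * F1 t" for t
  have "prim F (\<lambda>t. p2 t + c * p1 t)" unfolding F_def by (intro prim_add prim_cmult F1 F2)
  moreover have "prim (\<lambda>t. p2 t + c * p1 t) (\<lambda>t. if t \<in> {?a..?b} then q t * F t - k t else 0)"
  proof -
    have "(\<lambda>t. if t \<in> {?a..?b} then q t * F t - k t else 0) =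
      (\<lambda>t. (if t \<in> {?a..?b} then q t * F2 t - k t else 0) + c * (if t \<in> {?a..?b} then q t * F1 t - 0 else 0))"
      by (auto simp: F_def algebra_simps fun_eq_iff)
    then show ?thesis using prim_add[OF F2(2) prim_cmult[OF F1(2), of c]] by simp
  qed
  moreover have "F ?a = 0" "F ?b = 0" using F1(3) F2(3) b1 by (auto simp: F_def c_def)
  ultimately have "((F, Rs \<mu> (\<lambda>t. v t - V t * F t)), (u, v)) \<in> op_shift (Hsp ?I) (op_Tn Q W V U n) \<mu>"
    by (rule solve) (use y' in \<open>auto simp: k_def\<close>)
  then show ?thesis using y'(1) by blast
qed

end

subsection \<open>Cutting off between the line and the intervals\<close>

lemma L2_zero_extension:
  fixes k :: "real \<Rightarrow> complex"
  assumes \<Omega>: "\<Omega> \<in> sets lebesgue" and k: "k \<in> carrier (L2 (lebesgue_on \<Omega>))"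
  shows "(\<lambda>x. if x \<in> \<Omega> then k x else 0) \<in> carrier (L2 lebesgue)"
    and "hnorm (L2 lebesgue) (\<lambda>x. if x \<in> \<Omega> then k x else 0) = hnorm (L2 (lebesgue_on \<Omega>)) k"
proof -
  let ?k = "\<lambda>x. if x \<in> \<Omega> then k x else 0"
  have ae: "AE x in lebesgue_on \<Omega>. ?k x = k x" unfolding AE_lebesgue_on_iff[OF \<Omega>] by (rule AE_I2) simp
  have m: "?k \<in> carrier (L2 (lebesgue_on \<Omega>))" by (rule L2_cong_AE[OF \<Omega> k ae])
  have z: "x \<notin> \<Omega> \<Longrightarrow> ?k x = 0" for x by simp
  show "?k \<in> carrier (L2 lebesgue)" by (rule L2_restrict_support(1)[OF \<Omega> z, THEN iffD1, OF _ m])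
  have "hnorm (L2 lebesgue) ?k = hnorm (L2 (lebesgue_on \<Omega>)) ?k" by (rule L2_restrict_support(2)[OF \<Omega> z, symmetric])
  also have "\<dots> = hnorm (L2 (lebesgue_on \<Omega>)) k" by (rule hnorm_L2_cong_AE[OF L2_measurable[OF m] L2_measurable[OF k] ae])
  finally show "hnorm (L2 lebesgue) ?k = hnorm (L2 (lebesgue_on \<Omega>)) k" .
qed

lemma L2_restrict:
  fixes k :: "real \<Rightarrow> complex"
  assumes \<Omega>: "\<Omega> \<in> sets lebesgue" and k: "k \<in> carrier (L2 lebesgue)"
  shows "k \<in> carrier (L2 (lebesgue_on \<Omega>))" and "hnorm (L2 (lebesgue_on \<Omega>)) k \<le> hnorm (L2 lebesgue) k"
proof -
  let ?k = "\<lambda>x. if x \<in> \<Omega> then k x else 0"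
  have km: "?k \<in> borel_measurable lebesgue"
    by (rule measurable_lebesgue_on_iff[OF \<Omega>, THEN iffD1]) (rule measurable_restrict_space1[OF L2_measurable[OF k]])
  have le: "AE x in lebesgue. cmod (?k x) \<le> 1 * cmod (k x)" by (rule AE_I2) simp
  have kL: "?k \<in> carrier (L2 lebesgue)" by (rule L2_dominated[OF k km le])
  have z: "x \<notin> \<Omega> \<Longrightarrow> ?k x = 0" for x by simp
  have m: "?k \<in> carrier (L2 (lebesgue_on \<Omega>))" by (rule L2_restrict_support(1)[OF \<Omega> z, THEN iffD2, OF _ kL])
  have ae: "AE x in lebesgue_on \<Omega>. k x = ?k x" unfolding AE_lebesgue_on_iff[OF \<Omega>] by (rule AE_I2) simp
  show k': "k \<in> carrier (L2 (lebesgue_on \<Omega>))" by (rule L2_cong_AE[OF \<Omega> m ae])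
  have "hnorm (L2 (lebesgue_on \<Omega>)) k = hnorm (L2 lebesgue) ?k" by (rule L2_zero_extension(2)[OF \<Omega> k', symmetric])
  also have "\<dots> \<le> 1 * hnorm (L2 lebesgue) k" by (rule hnorm_L2_mono[OF k km le]) simp
  finally show "hnorm (L2 (lebesgue_on \<Omega>)) k \<le> hnorm (L2 lebesgue) k" by simp
qed

lemma hnorm_Hsp_le:
  assumes "f \<in> carrier (L2 (lebesgue_on \<Omega>))" "g \<in> carrier (L2 (lebesgue_on \<Omega>))"
  shows "hnorm (Hsp \<Omega>) (f, g) \<le> hnorm (L2 (lebesgue_on \<Omega>)) f + hnorm (L2 (lebesgue_on \<Omega>)) g"
  by (rule power2_le_imp_le) (simp_all add: hnorm_Hsp_sq[OF assms] power2_sum)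

lemma L2_triangle_diff:
  assumes "f \<in> carrier (L2 M)" "g \<in> carrier (L2 M)"
  shows "hnorm (L2 M) (\<lambda>x. f x - g x) \<le> hnorm (L2 M) f + hnorm (L2 M) g"
  using semihilbert.triangle[OF semihilbert_L2 assms, of "-1"] by (simp add: L2_simps)

lemma hnorm_L2_scale: "f \<in> carrier (L2 M) \<Longrightarrow> hnorm (L2 M) (\<lambda>x. c * f x) = cmod c * hnorm (L2 M) f"
  using semihilbert.hnorm_scale[OF semihilbert_L2, of f M c] by (simp add: L2_simps)

abbreviation "LI n \<equiv> L2 (lebesgue_on (interval n))"

lemma cutoff_mult:
  assumes n: "n \<ge> 1" and k: "k \<in> carrier (LI n)"
  shows "(\<lambda>x. complex_of_real (cutoff (real n) x) * k x) \<in> carrier (LI n)"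
    and "(\<lambda>x. complex_of_real (cutoff1 (real n) x) * k x) \<in> carrier (LI n)"
    and "(\<lambda>x. complex_of_real (cutoff2 (real n) x) * k x) \<in> carrier (LI n)"
    and "hnorm (LI n) (\<lambda>x. complex_of_real (cutoff (real n) x) * k x) \<le> hnorm (LI n) k"
    and "hnorm (LI n) (\<lambda>x. complex_of_real (cutoff1 (real n) x) * k x) \<le> 4 / real n * hnorm (LI n) k"
    and "hnorm (LI n) (\<lambda>x. complex_of_real (cutoff2 (real n) x) * k x) \<le> 8 / (real n)\<^sup>2 * hnorm (LI n) k"
proof -
  have n0: "real n > 0" using n by simp
  have I: "interval n \<in> sets lebesgue" by (simp add: interval_def)
  have *: "(\<lambda>x. complex_of_real (c x) * k x) \<in> carrier (LI n) \<and> hnorm (LI n) (\<lambda>x. complex_of_real (c x) * k x) \<le> C * hnorm (LI n) k"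
    if c: "continuous_on UNIV c" "\<And>x. x \<in> {- real n..real n} \<Longrightarrow> \<bar>c x\<bar> \<le> C" and C: "0 \<le> C" for c C
  proof -
    have "(\<lambda>x. complex_of_real (c x)) \<in> borel_measurable lebesgue"
      by (rule continuous_measurable_lebesgue) (intro continuous_intros c(1))
    then have m: "(\<lambda>x. complex_of_real (c x) * k x) \<in> borel_measurable (lebesgue_on (interval n))"
      by (intro borel_measurable_times measurable_restrict_space1 L2_measurable[OF k])
    have "AE x in lebesgue. x \<in> interval n \<longrightarrow> cmod (complex_of_real (c x) * k x) \<le> C * cmod (k x)"
      using c(2) by (intro AE_I2) (auto simp: interval_def norm_mult intro!: mult_right_mono)
    then have le: "AE x in lebesgue_on (interval n). cmod (complex_of_real (c x) * k x) \<le> C * cmod (k x)"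
      unfolding AE_lebesgue_on_iff[OF I] .
    show ?thesis using L2_dominated[OF k m le] hnorm_L2_mono[OF k m le C] ..
  qed
  have c0: "\<And>x. x \<in> {- real n..real n} \<Longrightarrow> \<bar>cutoff (real n) x\<bar> \<le> 1" using cutoff_bounds(1,2)[OF n0] by (simp add: abs_of_nonneg)
  note 0 = *[OF cutoff_continuous(1) c0] and 1 = *[OF cutoff_continuous(2) cutoff_bounds(3)[OF n0]]
    and 2 = *[OF cutoff_continuous(3) cutoff_bounds(4)[OF n0]]
  show "(\<lambda>x. complex_of_real (cutoff (real n) x) * k x) \<in> carrier (LI n)"
    "(\<lambda>x. complex_of_real (cutoff1 (real n) x) * k x) \<in> carrier (LI n)"
    "(\<lambda>x. complex_of_real (cutoff2 (real n) x) * k x) \<in> carrier (LI n)"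
    "hnorm (LI n) (\<lambda>x. complex_of_real (cutoff (real n) x) * k x) \<le> hnorm (LI n) k"
    "hnorm (LI n) (\<lambda>x. complex_of_real (cutoff1 (real n) x) * k x) \<le> 4 / real n * hnorm (LI n) k"
    "hnorm (LI n) (\<lambda>x. complex_of_real (cutoff2 (real n) x) * k x) \<le> 8 / (real n)\<^sup>2 * hnorm (LI n) k"
    using 0 1 2 n0 by simp_all
qed

lemma prim_cutoff_mult:
  assumes m: "m > 0" and F: "prim F p" and p: "prim p h"
  shows "prim (\<lambda>x. complex_of_real (cutoff m x) * F x) (\<lambda>x. complex_of_real (cutoff1 m x) * F x + complex_of_real (cutoff m x) * p x)"
    and "prim (\<lambda>x. complex_of_real (cutoff1 m x) * F x + complex_of_real (cutoff m x) * p x)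
      (\<lambda>x. complex_of_real (cutoff2 m x) * F x + 2 * (complex_of_real (cutoff1 m x) * p x) + complex_of_real (cutoff m x) * h x)"
proof -
  show "prim (\<lambda>x. complex_of_real (cutoff m x) * F x) (\<lambda>x. complex_of_real (cutoff1 m x) * F x + complex_of_real (cutoff m x) * p x)"
    by (rule prim_mult[OF prim_cutoff(1)[OF m] F])
  have "prim (\<lambda>x. complex_of_real (cutoff1 m x) * F x + complex_of_real (cutoff m x) * p x)
      (\<lambda>x. (complex_of_real (cutoff2 m x) * F x + complex_of_real (cutoff1 m x) * p x) +
        (complex_of_real (cutoff1 m x) * p x + complex_of_real (cutoff m x) * h x))"
    by (intro prim_add prim_mult prim_cutoff m F p)
  then show "prim (\<lambda>x. complex_of_real (cutoff1 m x) * F x + complex_of_real (cutoff m x) * p x)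
      (\<lambda>x. complex_of_real (cutoff2 m x) * F x + 2 * (complex_of_real (cutoff1 m x) * p x) + complex_of_real (cutoff m x) * h x)"
    by (simp only: mult_2 add.assoc)
qed

context matrix_model
begin

abbreviation "Tn \<equiv> op_Tn Q W V U"

text \<open>The first row is paired with \<open>f\<close>; the Dirichlet conditions remove the
  boundary terms. It matters that the right-hand side carries a factor
  \<open>hnorm (LI n) f\<close>: smallness of the first component will make its form, and hence V f,
  small.\<close>

lemma Tn_energy:
  assumes n: "n \<ge> 1" and w: "w \<ge> 0" "AE x in lebesgue. cmod (W x) \<le> w"
    and mem: "((f, g), (u, v)) \<in> op_shift (Hsp (interval n)) (Tn n) \<mu>"
  obtains F p h where "prim F p" "prim p (\<lambda>x. if x \<in> interval n then h x else 0)"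
    "AE x in lebesgue_on (interval n). f x = F x"
    "F \<in> carrier (LI n)" "p \<in> carrier (LI n)" "h \<in> carrier (LI n)"
    "f \<in> carrier (LI n)" "g \<in> carrier (LI n)" "u \<in> carrier (LI n)" "v \<in> carrier (LI n)" "(\<lambda>x. Q x * f x) \<in> carrier (LI n)"
    "AE x in lebesgue_on (interval n). u x = - h x + (Q x - \<mu>) * f x + W x * g x"
    "AE x in lebesgue_on (interval n). v x = V x * f x + (U x - \<mu>) * g x"
    "(hnorm (LI n) p)\<^sup>2 + qform (interval n) f \<le> hnorm (LI n) f * (hnorm (LI n) u + cmod \<mu> * hnorm (LI n) f + w * hnorm (LI n) g)"
proof -
  let ?I = "interval n"
  have ab: "- real n < real n" "- real n \<le> real n" using n by auto
  have gL: "g \<in> carrier (LI n)" and uL: "u \<in> carrier (LI n)" and vL: "v \<in> carrier (LI n)"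
    and f: "f \<in> sobolev 2 ?I" and bc: "vanishes_at_ends (- real n) (real n) f"
    and vae: "AE x in lebesgue_on ?I. v x = V x * f x + (U x - \<mu>) * g x"
    using mem unfolding Tn_shift_iff by auto
  obtain h where h: "weak_deriv ?I 2 f h" "AE x in lebesgue_on ?I. u x = - h x + (Q x - \<mu>) * f x + W x * g x"
    using mem unfolding Tn_shift_iff by auto
  have fL: "f \<in> carrier (LI n)" using f by (simp add: sobolev_def)
  obtain F p where F: "prim F p" "prim p (\<lambda>x. if x \<in> ?I then h x else 0)"
    "AE x in lebesgue_on ?I. f x = F x" "p \<in> carrier (LI n)" "h \<in> carrier (LI n)" "F \<in> carrier (LI n)"
    by (rule sobolev2_prim[OF interval_sets(2,3) f h(1)])
  obtain G where G: "continuous_on {- real n..real n} G" "AE x in lebesgue_on {- real n<..<real n}. f x = G x"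
    "G (- real n) = 0" "G (real n) = 0" using bc unfolding vanishes_at_ends_def by blast
  have "AE x in lebesgue_on {- real n<..<real n}. F x = G x"
    using F(3)[unfolded interval_eq] G(2) by eventually_elim simp
  then have FG: "F x = G x" if "x \<in> {- real n..real n}" for x
    using continuous_AE_eq[OF ab(1) prim_continuous[OF F(1)] G(1)] that by blast
  have F0: "F (- real n) = 0" "F (real n) = 0" using FG G(3,4) ab by auto
  obtain B where B: "B \<ge> 1" "AE x in lebesgue_on ?I. cmod (Q x) \<le> B" using interval_bounds[of n] by metis
  have QL: "(\<lambda>x. Q x * f x) \<in> carrier (LI n)" by (rule interval_bounded_mult[OF meas_on(1) B(2) fL])
  have Wm: "(\<lambda>x. W x * g x) \<in> borel_measurable (lebesgue_on ?I)"
    by (rule borel_measurable_times[OF meas_on(4) L2_measurable[OF gL]])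
  have Wle: "AE x in lebesgue_on ?I. cmod (W x * g x) \<le> w * cmod (g x)"
    using AE_on[OF interval_sets(1) w(2)] by eventually_elim (auto simp: norm_mult mult_right_mono)
  have WL: "(\<lambda>x. W x * g x) \<in> carrier (LI n)" by (rule L2_dominated[OF gL Wm Wle])
  have Wn: "hnorm (LI n) (\<lambda>x. W x * g x) \<le> w * hnorm (LI n) g" by (rule hnorm_L2_mono[OF gL Wm Wle w(1)])
  let ?r = "\<lambda>x. (u x + \<mu> * f x) - W x * g x"
  have umL: "(\<lambda>x. u x + \<mu> * f x) \<in> carrier (LI n)" by (rule L2_add[OF uL L2_scale[OF fL]])
  have rL: "?r \<in> carrier (LI n)" by (rule L2_diff[OF umL WL])
  have rn: "hnorm (LI n) ?r \<le> hnorm (LI n) u + cmod \<mu> * hnorm (LI n) f + w * hnorm (LI n) g"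
    using L2_triangle_diff[OF umL WL] L2_triangle[OF uL L2_scale[OF fL], of \<mu>] Wn
    unfolding hnorm_L2_scale[OF fL] by linarith
  note j = L2_mult_integrable[OF L2_uminus[OF F(5)] L2_cnj[OF fL]] L2_mult_integrable[OF QL L2_cnj[OF fL]]
  have "(LINT x|lebesgue_on ?I. ?r x * cnj (f x)) = (LINT x|lebesgue_on ?I. - h x * cnj (f x) + Q x * f x * cnj (f x))"
  proof (rule integral_cong_AE_lebesgue_on[OF interval_sets(1)])
    show "AE x in lebesgue_on ?I. ?r x * cnj (f x) = - h x * cnj (f x) + Q x * f x * cnj (f x)"
      using h(2)
    proof eventually_elim
      case (elim x)
      show ?case unfolding elim by (simp add: algebra_simps)
    qed
  qed
  also have "\<dots> = (LINT x|lebesgue_on ?I. - h x * cnj (f x)) + (LINT x|lebesgue_on ?I. Q x * f x * cnj (f x))"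
    by (rule Bochner_Integration.integral_add[OF j])
  also have "(LINT x|lebesgue_on ?I. - h x * cnj (f x)) = (LINT x|lebesgue_on ?I. - h x * cnj (F x))"
    by (rule integral_cong_AE_lebesgue_on[OF interval_sets(1)]) (use F(3) in eventually_elim, simp)
  also have "\<dots> = complex_of_real ((hnorm (LI n) p)\<^sup>2)"
    unfolding interval_eq
    by (rule quadratic_form_interval[OF F(1) F(2)[unfolded interval_eq] F0 ab(2) F(6,4,5)[unfolded interval_eq]])
  finally have "(hnorm (LI n) p)\<^sup>2 + qform ?I f = Re (LINT x|lebesgue_on ?I. ?r x * cnj (f x))"
    using Qf_integrable(3)[OF fL QL] by simp
  also have "\<dots> \<le> cmod (LINT x|lebesgue_on ?I. ?r x * cnj (f x))" by (rule complex_Re_le_cmod)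
  also have "\<dots> \<le> hnorm (LI n) ?r * hnorm (LI n) f" by (rule L2_Cauchy_Schwarz[OF rL fL])
  also have "\<dots> \<le> (hnorm (LI n) u + cmod \<mu> * hnorm (LI n) f + w * hnorm (LI n) g) * hnorm (LI n) f"
    by (rule mult_right_mono[OF rn]) simp
  finally show thesis
    using that[OF F(1-3,6,4,5) fL gL uL vL QL h(2) vae] by (simp add: mult.commute)
qed

text \<open>The commutator of the cutoff with the second derivative costs only \<open>8/n\<close> and \<open>8/n\<^sup>2\<close>.\<close>

lemma Tn_to_T:
  assumes n: "n \<ge> 1" and F: "prim F p" "prim p (\<lambda>x. if x \<in> interval n then h x else 0)"
    "AE x in lebesgue_on (interval n). f x = F x"
    "F \<in> carrier (LI n)" "p \<in> carrier (LI n)" "h \<in> carrier (LI n)"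
    "f \<in> carrier (LI n)" "g \<in> carrier (LI n)" "u \<in> carrier (LI n)" "v \<in> carrier (LI n)" "(\<lambda>x. Q x * f x) \<in> carrier (LI n)"
    and uv: "AE x in lebesgue_on (interval n). u x = - h x + (Q x - \<mu>) * f x + W x * g x"
    "AE x in lebesgue_on (interval n). v x = V x * f x + (U x - \<mu>) * g x"
    and lb: "\<And>x y. (x, y) \<in> op_shift (Hsp UNIV) T lam \<Longrightarrow> hnorm (Hsp UNIV) x \<le> C * hnorm (Hsp UNIV) y" and C: "C \<ge> 0"
  shows "hnorm (LI n) (\<lambda>x. complex_of_real (cutoff (real n) x) * f x) \<le>
    C * (hnorm (LI n) u + hnorm (LI n) v + cmod (\<mu> - lam) * (hnorm (LI n) f + hnorm (LI n) g)
       + 8 / real n * hnorm (LI n) p + 8 / (real n)\<^sup>2 * hnorm (LI n) f)"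
proof -
  let ?I = "interval n"
  have n0: "real n > 0" "- real n \<le> real n" using n by auto
  define \<eta> where "\<eta> x = complex_of_real (cutoff (real n) x)" for x
  define \<eta>1 where "\<eta>1 x = complex_of_real (cutoff1 (real n) x)" for x
  define \<eta>2 where "\<eta>2 x = complex_of_real (cutoff2 (real n) x)" for x
  note cm = cutoff_mult[OF n, folded \<eta>_def \<eta>1_def \<eta>2_def]
  define e where "e k x = (if x \<in> ?I then k x else 0)" for k :: "real \<Rightarrow> complex" and x
  have eL: "e k \<in> carrier LR" "hnorm LR (e k) = hnorm (LI n) k" if "k \<in> carrier (LI n)" for k
    using L2_zero_extension[OF interval_sets(1) that] by (simp_all add: e_def[abs_def])
  note pm = prim_cutoff_mult[OF n0(1) F(1,2), folded \<eta>_def \<eta>1_def \<eta>2_def]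
  let ?h = "\<lambda>x. if x \<in> ?I then h x else 0"
  define fc pc hc where "fc x = \<eta> x * F x" and "pc x = \<eta>1 x * F x + \<eta> x * p x"
    and "hc x = \<eta>2 x * F x + 2 * (\<eta>1 x * p x) + \<eta> x * ?h x" for x
  have hae: "AE x in lebesgue_on ?I. ?h x = h x" unfolding AE_lebesgue_on_iff[OF interval_sets(1)] by (rule AE_I2) simp
  have hL: "?h \<in> carrier (LI n)" by (rule L2_cong_AE[OF interval_sets(1) F(6) hae])
  have cL: "fc \<in> carrier (LI n)" "pc \<in> carrier (LI n)" "hc \<in> carrier (LI n)"
    unfolding fc_def[abs_def] pc_def[abs_def] hc_def[abs_def] using cm(1-3) F(4,5) hL by (auto intro!: L2_add L2_scale)
  have p1: "prim (e fc) (e pc)" and p2: "prim (e pc) (e hc)"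
    unfolding e_def interval_eq
    by (rule prim_zero_extension[OF _ _ _ n0(2)];
      use pm cutoff_ends[OF n0(1)] in \<open>simp add: fc_def[abs_def] pc_def[abs_def] hc_def[abs_def] \<eta>_def \<eta>1_def\<close>)+
  obtain B where B: "B \<ge> 1" "AE x in lebesgue_on ?I. cmod (Q x) \<le> B" "AE x in lebesgue_on ?I. cmod (U x) \<le> B"
    using interval_bounds[of n] by metis
  define gc where "gc x = \<eta> x * g x" for x
  have gcL: "gc \<in> carrier (LI n)" unfolding gc_def[abs_def] by (rule cm(1)[OF F(8)])
  have Qc: "(\<lambda>x. Q x * fc x) \<in> carrier (LI n)" by (rule interval_bounded_mult[OF meas_on(1) B(2) cL(1)])
  have Uc: "(\<lambda>x. U x * gc x) \<in> carrier (LI n)" by (rule interval_bounded_mult[OF meas_on(3) B(3) gcL])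
  \<comment> \<open>The first row after cutting off: the image is cut off, the spectral parameter is
    changed from \<mu> to \<open>lam\<close>, and the last bracket is the commutator of the cut-off
    with the second derivative.\<close>
  define uc where "uc x = \<eta> x * u x + (\<mu> - lam) * (\<eta> x * f x) - (2 * (\<eta>1 x * p x) + \<eta>2 x * F x)" for x
  define vc where "vc x = \<eta> x * v x + (\<mu> - lam) * (\<eta> x * g x)" for x
  note u1 = L2_add[OF cm(1)[OF F(9)] L2_scale[OF cm(1)[OF F(7)], of "\<mu> - lam"]]
    and u2 = L2_add[OF L2_scale[OF cm(2)[OF F(5)], of 2] cm(3)[OF F(4)]]
  have ucL: "uc \<in> carrier (LI n)" unfolding uc_def[abs_def] by (rule L2_diff[OF u1 u2])
  have vcL: "vc \<in> carrier (LI n)" unfolding vc_def[abs_def] by (rule L2_add[OF cm(1)[OF F(10)] L2_scale[OF cm(1)[OF F(8)]]])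
  have mem: "((e fc, e gc), (e uc, e vc)) \<in> op_shift (Hsp UNIV) T lam"
    unfolding T_shift_iff
  proof (intro conjI exI)
    have Qe: "(\<lambda>x. Q x * e fc x) = e (\<lambda>x. Q x * fc x)" and Ue: "(\<lambda>x. U x * e gc x) = e (\<lambda>x. U x * gc x)"
      by (auto simp: e_def fun_eq_iff)
    have "e fc \<in> sobolev 2 UNIV"
      by (rule sobolev2I(1)[OF _ p1 p2]) (auto simp: lebesgue_on_UNIV_eq eL(1) cL)
    then show "e fc \<in> domA Q" unfolding domA_iff Qe using eL(1)[OF Qc] ..
    show "e gc \<in> domU U" unfolding domU_iff Ue using eL(1)[OF gcL] eL(1)[OF Uc] ..
    show "e uc \<in> carrier LR" "e vc \<in> carrier LR" using eL(1) ucL vcL by auto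
    show "weak_deriv UNIV 2 (e fc) (e hc)" by (rule prim_weak_deriv2[OF p1 p2]) simp
    show "AE x in lebesgue. e uc x = - e hc x + (Q x - lam) * e fc x + W x * e gc x"
      using uv(1)[unfolded AE_lebesgue_on_iff[OF interval_sets(1)]] F(3)[unfolded AE_lebesgue_on_iff[OF interval_sets(1)]]
    proof eventually_elim
      case (elim x)
      show ?case
      proof (cases "x \<in> ?I")
        case True
        then have eq: "u x = - h x + (Q x - \<mu>) * F x + W x * g x" "f x = F x" using elim by auto
        show ?thesis unfolding e_def uc_def hc_def fc_def gc_def eq using True by (simp add: algebra_simps)
      qed (simp add: e_def)
    qed
    show "AE x in lebesgue. e vc x = V x * e fc x + (U x - lam) * e gc x"
      using uv(2)[unfolded AE_lebesgue_on_iff[OF interval_sets(1)]] F(3)[unfolded AE_lebesgue_on_iff[OF interval_sets(1)]]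
    proof eventually_elim
      case (elim x)
      show ?case
      proof (cases "x \<in> ?I")
        case True
        then have eq: "v x = V x * F x + (U x - \<mu>) * g x" "f x = F x" using elim by auto
        show ?thesis unfolding e_def vc_def fc_def gc_def eq using True by (simp add: algebra_simps)
      qed (simp add: e_def)
    qed
  qed
  let ?N = "hnorm (LI n)"
  have Ff: "?N F = ?N f" by (rule hnorm_L2_cong_AE[OF L2_measurable[OF F(4)] L2_measurable[OF F(7)]]) (use F(3) in eventually_elim, simp)
  have un: "?N uc \<le> ?N u + cmod (\<mu> - lam) * ?N f + (2 * (4 / real n * ?N p) + 8 / (real n)\<^sup>2 * ?N f)"
  proof -
    have "?N uc \<le> ?N (\<lambda>x. \<eta> x * u x + (\<mu> - lam) * (\<eta> x * f x)) + ?N (\<lambda>x. 2 * (\<eta>1 x * p x) + \<eta>2 x * F x)"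
      unfolding uc_def[abs_def] by (rule L2_triangle_diff[OF u1 u2])
    also have "\<dots> \<le> (?N (\<lambda>x. \<eta> x * u x) + ?N (\<lambda>x. (\<mu> - lam) * (\<eta> x * f x))) + (?N (\<lambda>x. 2 * (\<eta>1 x * p x)) + ?N (\<lambda>x. \<eta>2 x * F x))"
      by (intro add_mono L2_triangle cm(1,3) L2_scale cm(2) F)
    also have "\<dots> \<le> (?N u + cmod (\<mu> - lam) * ?N f) + (2 * (4 / real n * ?N p) + 8 / (real n)\<^sup>2 * ?N f)"
      unfolding hnorm_L2_scale[OF cm(1)[OF F(7)]] hnorm_L2_scale[OF cm(2)[OF F(5)]]
      using cm(6)[OF F(4)] cm(5)[OF F(5)] unfolding Ff
      by (intro add_mono cm(4) F mult_left_mono) auto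
    finally show ?thesis .
  qed
  have vn: "?N vc \<le> ?N v + cmod (\<mu> - lam) * ?N g"
  proof -
    have "?N vc \<le> ?N (\<lambda>x. \<eta> x * v x) + ?N (\<lambda>x. (\<mu> - lam) * (\<eta> x * g x))"
      unfolding vc_def[abs_def] by (intro L2_triangle cm(1) L2_scale F)
    also have "\<dots> \<le> ?N v + cmod (\<mu> - lam) * ?N g"
      unfolding hnorm_L2_scale[OF cm(1)[OF F(8)]] by (intro add_mono cm(4) F mult_left_mono) auto
    finally show ?thesis .
  qed
  have "?N (\<lambda>x. \<eta> x * f x) = ?N fc"
    unfolding fc_def[abs_def]
    by (rule hnorm_L2_cong_AE[OF L2_measurable[OF cm(1)[OF F(7)]] L2_measurable[OF cm(1)[OF F(4)]]]) (use F(3) in eventually_elim, simp)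
  also have "\<dots> = hnorm LR (e fc)" by (rule eL(2)[OF cL(1), symmetric])
  also have "\<dots> \<le> hnorm (Hsp UNIV) (e fc, e gc)" by (rule hnorm_UNIV_ge[OF eL(1)[OF cL(1)] eL(1)[OF gcL]])
  also have "\<dots> \<le> C * hnorm (Hsp UNIV) (e uc, e vc)" by (rule lb[OF mem])
  also have "\<dots> \<le> C * (?N uc + ?N vc)"
    using hnorm_Hsp_le[of "e uc" UNIV "e vc"] eL[OF ucL] eL[OF vcL] C
    by (intro mult_left_mono) (auto simp: lebesgue_on_UNIV_eq)
  also have "\<dots> \<le> C * (?N u + ?N v + cmod (\<mu> - lam) * (?N f + ?N g) + 8 / real n * ?N p + 8 / (real n)\<^sup>2 * ?N f)"
  proof (rule mult_left_mono[OF _ C])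
    have "2 * (4 / real n * ?N p) = 8 / real n * ?N p" by simp
    then show "?N uc + ?N vc \<le> ?N u + ?N v + cmod (\<mu> - lam) * (?N f + ?N g) + 8 / real n * ?N p + 8 / (real n)\<^sup>2 * ?N f"
      using un vn unfolding distrib_left by linarith
  qed
  finally show ?thesis unfolding \<eta>_def .
qed

text \<open>The multiplication entries commute with the cut-off, so only the second derivative
  produces an error. Its size c / n depends on the vector through the norms of p and F; it vanishes
  as n grows with the vector fixed. The continuous representative \<open>F\<close> is used so that
  the boundary values are visible.\<close>

lemma T_to_Tn:
  assumes mem: "((f, g), (u, v)) \<in> op_shift (Hsp UNIV) T \<zeta>"
  obtains F c where "F \<in> carrier LR" "AE x in lebesgue. f x = F x" "f \<in> carrier LR" "g \<in> carrier LR" "u \<in> carrier LR" "v \<in> carrier LR" "c \<ge> 0"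
    "\<And>n. n \<ge> 1 \<Longrightarrow> \<exists>y. ((\<lambda>x. complex_of_real (cutoff (real n) x) * F x, \<lambda>x. complex_of_real (cutoff (real n) x) * g x), y) \<in>
        op_shift (Hsp (interval n)) (Tn n) \<zeta> \<and> hnorm (Hsp (interval n)) y \<le> hnorm LR u + hnorm LR v + c / real n"
proof -
  have fd: "f \<in> domA Q" and gd: "g \<in> domU U" and uL: "u \<in> carrier LR" and vL: "v \<in> carrier LR"
    and vae: "AE x in lebesgue. v x = V x * f x + (U x - \<zeta>) * g x" using mem unfolding T_shift_iff by auto
  obtain h where h: "weak_deriv UNIV 2 f h" "AE x in lebesgue. u x = - h x + (Q x - \<zeta>) * f x + W x * g x"
    using mem unfolding T_shift_iff by auto
  obtain F p where F: "prim F p" "prim p h" "AE x in lebesgue. f x = F x" "f \<in> carrier LR" "F \<in> carrier LR" "p \<in> carrier LR" "h \<in> carrier LR"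
    by (rule form_identity_line[OF fd h(1)])
  have gL: "g \<in> carrier LR" using gd by (simp add: domU_iff)
  define c where "c = 8 * hnorm LR p + 8 * hnorm LR F"
  have c: "c \<ge> 0" by (simp add: c_def)
  show thesis
  proof (rule that[OF F(5,3,4) gL uL vL c])
    fix n :: nat assume n: "n \<ge> 1"
    let ?I = "interval n"
    have n0: "real n > 0" "- real n < real n" using n by auto
    define \<eta> where "\<eta> x = complex_of_real (cutoff (real n) x)" for x
    define \<eta>1 where "\<eta>1 x = complex_of_real (cutoff1 (real n) x)" for x
    define \<eta>2 where "\<eta>2 x = complex_of_real (cutoff2 (real n) x)" for x
    note cm = cutoff_mult[OF n, folded \<eta>_def \<eta>1_def \<eta>2_def]
    note pm = prim_cutoff_mult[OF n0(1) F(1,2), folded \<eta>_def \<eta>1_def \<eta>2_def]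
    note r = L2_restrict[OF interval_sets(1)[of n]]
    note L = r(1)[OF F(5)] r(1)[OF F(6)] r(1)[OF F(7)]
    have cL: "(\<lambda>x. \<eta> x * F x) \<in> carrier (LI n)" "(\<lambda>x. \<eta>1 x * F x + \<eta> x * p x) \<in> carrier (LI n)"
      "(\<lambda>x. \<eta>2 x * F x + 2 * (\<eta>1 x * p x) + \<eta> x * h x) \<in> carrier (LI n)"
      using cm(1-3) L by (auto intro!: L2_add L2_scale)
    define uc where "uc x = \<eta> x * u x - (2 * (\<eta>1 x * p x) + \<eta>2 x * F x)" for x
    define vc where "vc x = \<eta> x * v x" for x
    note u2 = L2_add[OF L2_scale[OF cm(2)[OF L(2)], of 2] cm(3)[OF L(1)]]
    have ucL: "uc \<in> carrier (LI n)" unfolding uc_def[abs_def] by (rule L2_diff[OF cm(1)[OF r(1)[OF uL]] u2])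
    have vcL: "vc \<in> carrier (LI n)" unfolding vc_def[abs_def] by (rule cm(1)[OF r(1)[OF vL]])
    have "((\<lambda>x. \<eta> x * F x, \<lambda>x. \<eta> x * g x), (uc, vc)) \<in> op_shift (Hsp ?I) (Tn n) \<zeta>"
      unfolding Tn_shift_iff
    proof (intro conjI exI CollectI)
      show "(\<lambda>x. \<eta> x * F x) \<in> sobolev 2 ?I" by (rule sobolev2I(1)[OF interval_sets(1) pm cL])
      show "weak_deriv ?I 2 (\<lambda>x. \<eta> x * F x) (\<lambda>x. \<eta>2 x * F x + 2 * (\<eta>1 x * p x) + \<eta> x * h x)"
        by (rule sobolev2I(2)[OF interval_sets(1) pm cL])
      show "vanishes_at_ends (- real n) (real n) (\<lambda>x. \<eta> x * F x)"
        unfolding vanishes_at_ends_def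
      proof (intro exI conjI)
        show "continuous_on {- real n..real n} (\<lambda>x. \<eta> x * F x)" by (rule prim_continuous[OF pm(1)])
        show "\<eta> (- real n) * F (- real n) = 0" "\<eta> (real n) * F (real n) = 0"
          using cutoff_ends[OF n0(1)] by (simp_all add: \<eta>_def)
      qed simp
      show "(\<lambda>x. \<eta> x * g x) \<in> carrier (LI n)" by (rule cm(1)[OF r(1)[OF gL]])
      show "uc \<in> carrier (LI n)" "vc \<in> carrier (LI n)" by fact+
      show "AE x in lebesgue_on ?I. uc x = - (\<eta>2 x * F x + 2 * (\<eta>1 x * p x) + \<eta> x * h x) + (Q x - \<zeta>) * (\<eta> x * F x) + W x * (\<eta> x * g x)"
        using AE_on[OF interval_sets(1) h(2)] AE_on[OF interval_sets(1) F(3)]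
      proof eventually_elim
        case (elim x)
        show ?case unfolding uc_def elim by (simp add: algebra_simps)
      qed
      show "AE x in lebesgue_on ?I. vc x = V x * (\<eta> x * F x) + (U x - \<zeta>) * (\<eta> x * g x)"
        using AE_on[OF interval_sets(1) vae] AE_on[OF interval_sets(1) F(3)]
      proof eventually_elim
        case (elim x)
        show ?case unfolding vc_def elim by (simp add: algebra_simps)
      qed
    qed
    moreover have "hnorm (Hsp ?I) (uc, vc) \<le> hnorm LR u + hnorm LR v + c / real n"
    proof -
      let ?N = "hnorm (LI n)"
      have "hnorm (Hsp ?I) (uc, vc) \<le> ?N uc + ?N vc" by (rule hnorm_Hsp_le[OF ucL vcL])
      also have "?N uc \<le> ?N (\<lambda>x. \<eta> x * u x) + ?N (\<lambda>x. 2 * (\<eta>1 x * p x) + \<eta>2 x * F x)"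
        unfolding uc_def[abs_def] by (rule L2_triangle_diff[OF cm(1)[OF r(1)[OF uL]] u2])
      also have "?N (\<lambda>x. 2 * (\<eta>1 x * p x) + \<eta>2 x * F x) \<le> ?N (\<lambda>x. 2 * (\<eta>1 x * p x)) + ?N (\<lambda>x. \<eta>2 x * F x)"
        by (intro L2_triangle cm(3) L2_scale cm(2) L)
      also have "?N (\<lambda>x. 2 * (\<eta>1 x * p x)) = 2 * ?N (\<lambda>x. \<eta>1 x * p x)" by (simp add: hnorm_L2_scale[OF cm(2)[OF L(2)]])
      also have "?N (\<lambda>x. \<eta>1 x * p x) \<le> 4 / real n * hnorm LR p"
        using order_trans[OF cm(5)[OF L(2)] mult_left_mono[OF r(2)[OF F(6)]]] by simp
      also have "?N (\<lambda>x. \<eta>2 x * F x) \<le> 8 / real n * hnorm LR F"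
      proof -
        have "?N (\<lambda>x. \<eta>2 x * F x) \<le> 8 / (real n)\<^sup>2 * hnorm LR F"
          using order_trans[OF cm(6)[OF L(1)] mult_left_mono[OF r(2)[OF F(5)]]] by simp
        also have "\<dots> \<le> 8 / real n * hnorm LR F"
          using n by (intro mult_right_mono divide_left_mono) (auto simp: power2_eq_square)
        finally show ?thesis .
      qed
      also have "?N (\<lambda>x. \<eta> x * u x) \<le> hnorm LR u" by (rule order_trans[OF cm(4)[OF r(1)[OF uL]] r(2)[OF uL]])
      also have "?N vc \<le> hnorm LR v" unfolding vc_def[abs_def] by (rule order_trans[OF cm(4)[OF r(1)[OF vL]] r(2)[OF vL]])
      finally show ?thesis by (simp add: c_def add_divide_distrib algebra_simps)
    qed
    ultimately show "\<exists>y. ((\<lambda>x. complex_of_real (cutoff (real n) x) * F x, \<lambda>x. complex_of_real (cutoff (real n) x) * g x), y) \<in>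
        op_shift (Hsp ?I) (Tn n) \<zeta> \<and> hnorm (Hsp ?I) y \<le> hnorm LR u + hnorm LR v + c / real n"
      unfolding \<eta>_def by blast
  qed
qed

lemma cutoff_norm_tendsto:
  assumes k: "k \<in> carrier LR"
  shows "(\<lambda>n. hnorm (LI n) (\<lambda>x. complex_of_real (cutoff (real n) x) * k x)) \<longlonglongrightarrow> hnorm LR k"
proof -
  \<comment> \<open>The polynomial cut-off is bounded by 1 only on the interval itself; setting the
    integrand to 0 outside makes |k|^2 a majorant.\<close>
  let ?d = "\<lambda>n x. if x \<in> interval n then (cutoff (real n) x)\<^sup>2 * (cmod (k x))\<^sup>2 else 0"
  have eq: "hnorm (LI n) (\<lambda>x. complex_of_real (cutoff (real n) x) * k x) = sqrt (LINT x|lebesgue. ?d n x)" for n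
  proof -
    have "(cmod (complex_of_real (cutoff (real n) x) * k x))\<^sup>2 = (cutoff (real n) x)\<^sup>2 * (cmod (k x))\<^sup>2" for x
      by (simp add: norm_mult power_mult_distrib)
    then show ?thesis unfolding hnorm_L2 integral_lebesgue_on_eq[OF interval_sets(1)] by presburger
  qed
  have "(\<lambda>n. LINT x|lebesgue. ?d n x) \<longlonglongrightarrow> (LINT x|lebesgue. (cmod (k x))\<^sup>2)"
  proof (rule integral_dominated_convergence[where w="\<lambda>x. (cmod (k x))\<^sup>2"])
    show "(\<lambda>x. (cmod (k x))\<^sup>2) \<in> borel_measurable lebesgue" using L2_integrable[OF k] by (rule borel_measurable_integrable)
    then have "(\<lambda>x. (cutoff (real n) x)\<^sup>2 * (cmod (k x))\<^sup>2) \<in> borel_measurable lebesgue" for n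
      by (rule borel_measurable_times[OF borel_measurable_power[OF continuous_measurable_lebesgue[OF cutoff_continuous(1)]]])
    then show "?d n \<in> borel_measurable lebesgue" for n
      by (rule measurable_lebesgue_on_iff[OF interval_sets(1), THEN iffD1, OF measurable_restrict_space1])
    show "integrable lebesgue (\<lambda>x. (cmod (k x))\<^sup>2)" by (rule L2_integrable[OF k])
    show "AE x in lebesgue. (\<lambda>n. ?d n x) \<longlonglongrightarrow> (cmod (k x))\<^sup>2"
    proof (rule AE_I2)
      fix x
      have "(\<lambda>n. (cutoff (real n) x)\<^sup>2 * (cmod (k x))\<^sup>2) \<longlonglongrightarrow> 1\<^sup>2 * (cmod (k x))\<^sup>2"
        by (intro tendsto_intros cutoff_tendsto)
      moreover have "\<forall>\<^sub>F n in sequentially. (cutoff (real n) x)\<^sup>2 * (cmod (k x))\<^sup>2 = ?d n x"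
      proof -
        obtain N :: nat where N: "\<bar>x\<bar> < real N" using reals_Archimedean2 by blast
        show ?thesis using eventually_ge_at_top[of N] by eventually_elim (use N in \<open>auto simp: interval_def\<close>)
      qed
      ultimately show "(\<lambda>n. ?d n x) \<longlonglongrightarrow> (cmod (k x))\<^sup>2" using Lim_transform_eventually by fastforce
    qed
    fix n
    show "AE x in lebesgue. norm (?d n x) \<le> (cmod (k x))\<^sup>2"
    proof (rule AE_I2)
      fix x
      have "(cutoff (real n) x)\<^sup>2 \<le> 1" if "x \<in> interval n"
        using cutoff_bounds(1,2)[of "real n" x] that by (auto simp: interval_def power_le_one)
      then show "norm (?d n x) \<le> (cmod (k x))\<^sup>2" by (auto simp: mult_left_le_one_le)
    qed
  qed
  then have "(\<lambda>n. sqrt (LINT x|lebesgue. ?d n x)) \<longlonglongrightarrow> sqrt (LINT x|lebesgue. (cmod (k x))\<^sup>2)" by (rule tendsto_real_sqrt)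
  then show ?thesis unfolding eq unfolding hnorm_L2 .
qed

end

subsection \<open>Convergence of the spectra\<close>

text \<open>The distance to a spectrum need not be attained as far as is known here, so points
  within 1/(n+1) of the infimum are chosen. Nonemptiness provides them also for the small n.\<close>

lemma approximatedI:
  assumes ne: "\<And>n. n \<ge> 1 \<Longrightarrow> \<sigma>n n \<noteq> {}"
    and near: "\<And>e. e > 0 \<Longrightarrow> \<exists>N. \<forall>n\<ge>N. \<exists>z\<in>\<sigma>n n. dist z \<zeta> < e"
  shows "approximated \<sigma>n \<zeta>"
proof -
  have "\<exists>z\<in>\<sigma>n n. dist \<zeta> z < infdist \<zeta> (\<sigma>n n) + 1 / (real n + 1)" if "n \<ge> 1" for n
  proof (rule ccontr)
    assume "\<not> ?thesis"
    then have "infdist \<zeta> (\<sigma>n n) + 1 / (real n + 1) \<le> (INF z\<in>\<sigma>n n. dist \<zeta> z)"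
      by (intro cINF_greatest ne that) (auto simp: not_less)
    then have "infdist \<zeta> (\<sigma>n n) + 1 / (real n + 1) \<le> infdist \<zeta> (\<sigma>n n)"
      unfolding infdist_notempty[OF ne[OF that]] .
    then show False by (simp add: field_simps)
  qed
  then obtain l where l: "\<And>n. n \<ge> 1 \<Longrightarrow> l n \<in> \<sigma>n n"
    "\<And>n. n \<ge> 1 \<Longrightarrow> dist \<zeta> (l n) < infdist \<zeta> (\<sigma>n n) + 1 / (real n + 1)" by metis
  have "l \<longlonglongrightarrow> \<zeta>"
  proof (rule metric_LIMSEQ_I)
    fix e :: real assume e: "e > 0"
    obtain N where N: "\<forall>n\<ge>N. \<exists>z\<in>\<sigma>n n. dist z \<zeta> < e / 2" using near[of "e / 2"] e by auto
    obtain m :: nat where m: "2 / e < real m" using reals_Archimedean2 by blast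
    show "\<exists>N. \<forall>n\<ge>N. dist (l n) \<zeta> < e"
    proof (intro exI allI impI)
      fix n assume n: "n \<ge> max 1 (max N m)"
      then obtain z where z: "z \<in> \<sigma>n n" "dist z \<zeta> < e / 2" using N by auto
      have "infdist \<zeta> (\<sigma>n n) \<le> dist \<zeta> z" by (rule infdist_le[OF z(1)])
      then have a: "infdist \<zeta> (\<sigma>n n) < e / 2" using z(2) by (simp add: dist_commute)
      have "real m \<le> real n" using n by simp
      then have "2 / e < real n + 1" using m by linarith
      then have "1 / (real n + 1) < e / 2" using e by (simp add: field_simps)
      then show "dist (l n) \<zeta> < e" using a l(2)[of n] n by (simp add: dist_commute)
    qed
  qed
  then show ?thesis unfolding approximated_def using l(1) by blast
qed

context matrix_model
begin

lemma resolvent_set_bound: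
  assumes "\<zeta> \<in> resolvent_set (Hsp \<Omega>) S"
  obtains C where "C \<ge> 0" "\<And>x y. (x, y) \<in> op_shift (Hsp \<Omega>) S \<zeta> \<Longrightarrow> hnorm (Hsp \<Omega>) x \<le> C * hnorm (Hsp \<Omega>) y"
proof -
  obtain C where C: "\<forall>(x, y)\<in>op_shift (Hsp \<Omega>) S \<zeta>. hnorm (Hsp \<Omega>) x \<le> C * hnorm (Hsp \<Omega>) y"
    using assms unfolding resolvent_set_def by blast
  show thesis
  proof (rule that[of "max C 0"])
    fix x y assume "(x, y) \<in> op_shift (Hsp \<Omega>) S \<zeta>"
    then have "hnorm (Hsp \<Omega>) x \<le> C * hnorm (Hsp \<Omega>) y" using C by blast
    also have "\<dots> \<le> max C 0 * hnorm (Hsp \<Omega>) y" by (rule mult_right_mono) simp_all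
    finally show "hnorm (Hsp \<Omega>) x \<le> max C 0 * hnorm (Hsp \<Omega>) y" .
  qed simp
qed

text \<open>A lower bound excludes singular sequences, and the essential range of \<open>U\<close>
  consists of points that have them.\<close>

lemma essran_gap:
  assumes lb: "\<And>x y. (x, y) \<in> op_shift (Hsp UNIV) T lam \<Longrightarrow> hnorm (Hsp UNIV) x \<le> C * hnorm (Hsp UNIV) y"
  obtains d where "d > 0" "AE x in lebesgue. d \<le> cmod (U x - lam)"
proof -
  have "lam \<notin> ess_spectrum (Hsp UNIV) T"
  proof
    assume "lam \<in> ess_spectrum (Hsp UNIV) T"
    then obtain x y where xy: "\<And>n. (x n, y n) \<in> op_shift (Hsp UNIV) T lam" "\<And>n. hnorm (Hsp UNIV) (x n) = 1"
      "(\<lambda>n. hnorm (Hsp UNIV) (y n)) \<longlonglongrightarrow> 0" unfolding ess_spectrum_def by blast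
    have "1 \<le> C * hnorm (Hsp UNIV) (y n)" for n using lb[OF xy(1)[of n]] unfolding xy(2) .
    moreover have "(\<lambda>n. C * hnorm (Hsp UNIV) (y n)) \<longlonglongrightarrow> C * 0" by (intro tendsto_intros xy(3))
    ultimately have "1 \<le> C * 0" by (intro LIMSEQ_le_const[of _ "C * 0" 1]) auto
    then show False by simp
  qed
  then have "lam \<notin> essran U" using essran_subset_ess_spectrum by blast
  then obtain d where "d > 0" "AE x in lebesgue. d \<le> dist (U x) lam" unfolding essran_iff[OF meas(3)] by blast
  then show thesis using that by (simp add: dist_norm)
qed

text \<open>If \<open>T - \<lambda>\<close> is bounded below, cutting off shows that the first component of a unit vector on which
  \<open>T\<^sub>n - \<mu>\<close> is small is small on \<open>(-n/2, n/2)\<close>, and the growth of \<open>Q\<close> makes it small outside;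
  the energy then controls \<open>V f\<close>, and the second component is small since \<open>U - \<lambda>\<close> is bounded away from 0.\<close>

lemma Tn_uniform_bound:
  assumes lb: "\<And>x y. (x, y) \<in> op_shift (Hsp UNIV) T lam \<Longrightarrow> hnorm (Hsp UNIV) x \<le> C * hnorm (Hsp UNIV) y" and C: "C \<ge> 0"
  obtains N \<delta> where "\<delta> > 0"
    "\<And>n \<mu> x y. n \<ge> N \<Longrightarrow> cmod (\<mu> - lam) \<le> \<delta> \<Longrightarrow> (x, y) \<in> op_shift (Hsp (interval n)) (Tn n) \<mu> \<Longrightarrow>
      hnorm (Hsp (interval n)) x \<le> 1 / \<delta> * hnorm (Hsp (interval n)) y"
    "\<And>n \<mu>. n \<ge> N \<Longrightarrow> cmod (\<mu> - lam) \<le> \<delta> \<Longrightarrow> \<mu> \<in> resolvent_set (Hsp (interval n)) (Tn n)"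
proof -
  obtain d where d: "d > 0" "AE x in lebesgue. d \<le> cmod (U x - lam)" by (rule essran_gap[OF lb])
  obtain w where w: "w \<ge> 0" "AE x in lebesgue. cmod (W x) \<le> w" using W_bound .
  \<comment> \<open>Bounds the bracket in the energy estimate for unit vectors: |\<mu>| and the norm
    of u each contribute at most \<delta> \<le> 1/2 beyond |lam| + w.\<close>
  define M where "M = 1 + cmod lam + w"
  have M: "M \<ge> 1" using w by (simp add: M_def)
  define \<kappa> where "\<kappa> = b / cos \<theta> * M"
  have \<kappa>: "\<kappa> \<ge> 0" using b cos_pos M by (simp add: \<kappa>_def)
  \<comment> \<open>The target size of the first component: at most 1/4, and so small that the
    squared norm of V f, at most \<kappa> \<tau>, is below (d/8)^2.\<close>
  define \<tau> where "\<tau> = min (1/4) ((d / 8)\<^sup>2 / (\<kappa> + 1))"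
  have "(d / 8)\<^sup>2 / (\<kappa> + 1) > 0" using d(1) \<kappa> by (intro divide_pos_pos) auto
  then have "\<tau> > 0" unfolding \<tau>_def by simp
  moreover have "\<tau> \<le> 1/4" unfolding \<tau>_def by (rule min.cobounded1)
  ultimately have \<tau>: "\<tau> > 0" "\<tau> \<le> 1/4" .
  have \<tau>\<kappa>: "\<kappa> * \<tau> \<le> (d / 8)\<^sup>2"
  proof -
    have "\<kappa> * \<tau> \<le> (\<kappa> + 1) * ((d / 8)\<^sup>2 / (\<kappa> + 1))" using \<kappa> \<tau> by (intro mult_mono) (auto simp: \<tau>_def)
    also have "\<dots> = (d / 8)\<^sup>2" using \<kappa> by simp
    finally show ?thesis .
  qed
  \<comment> \<open>Makes the contribution M / (R cos \<theta>) of the tail equal to \<tau>^2 /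
    2.\<close>
  define R where "R = 2 * M / (\<tau>\<^sup>2 * cos \<theta>)"
  have R: "R > 0" using M \<tau> cos_pos by (simp add: R_def)
  have MR: "M / (R * cos \<theta>) = \<tau>\<^sup>2 / 2" using M \<tau> cos_pos by (simp add: R_def field_simps)
  obtain r where r: "AE x in lebesgue. \<bar>x\<bar> \<ge> r \<longrightarrow> R \<le> cmod (Q x)" using growth by blast
  \<comment> \<open>Collects the terms from cutting off when each small quantity is at most
    \<delta>: the images give 2 \<delta>, the change of parameter another 2 \<delta>, the commutator
    8 \<delta> M + 8 \<delta>.\<close>
  define c1 where "c1 = C * (12 + 8 * M)"
  have c1: "c1 \<ge> 0" using C M by (simp add: c1_def)
  \<comment> \<open>The entries serve, in turn, the energy bound M, the gap d/2 of
    \<open>U - \<mu>\<close> together with the size of v, and the inner part of the first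
    component.\<close>
  define \<delta> where "\<delta> = min (1/2) (min (d / 8) (\<tau> / (4 * (c1 + 1))))"
  have \<delta>: "\<delta> > 0" "\<delta> \<le> 1/2" "\<delta> \<le> d / 8" "\<delta> \<le> \<tau> / (4 * (c1 + 1))" 
  proof -
    show "\<delta> \<le> 1/2" unfolding \<delta>_def by (rule min.cobounded1)
    show "\<delta> \<le> d / 8" unfolding \<delta>_def by (rule min.coboundedI2[OF min.cobounded1])
    show "\<delta> \<le> \<tau> / (4 * (c1 + 1))" unfolding \<delta>_def by (rule min.coboundedI2[OF min.cobounded2])
    have "d / 8 > 0" "\<tau> / (4 * (c1 + 1)) > 0" using d(1) \<tau>(1) c1 by auto
    then show "\<delta> > 0" unfolding \<delta>_def by simp
  qed
  have c1\<delta>: "2 * (c1 * \<delta>) \<le> \<tau> / 2"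
  proof -
    have "c1 * \<delta> \<le> (c1 + 1) * (\<tau> / (4 * (c1 + 1)))" using c1 \<delta> by (intro mult_mono) auto
    also have "\<dots> = \<tau> / 4" using c1 by (simp add: field_simps)
    finally show ?thesis by simp
  qed
  \<comment> \<open>n \<ge> 1/\<delta> makes the commutator of order \<delta>; n \<ge> 2 r puts (-r,
    r) into the half of the interval where the cut-off is bounded below.\<close>
  obtain N :: nat where N: "max 1 (max (1 / \<delta>) (2 * r)) \<le> real N" using real_arch_simple by blast
  have Ud: "AE x in lebesgue_on (interval n). d / 2 \<le> cmod (U x - \<mu>)" if "cmod (\<mu> - lam) \<le> \<delta>" for n \<mu>
    using AE_on[OF interval_sets(1) d(2)]
  proof eventually_elim
    case (elim x)
    have "cmod (U x - lam) \<le> cmod (U x - \<mu>) + cmod (\<mu> - lam)" using norm_triangle_ineq[of "U x - \<mu>" "\<mu> - lam"] by simp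
    then show ?case using elim that \<delta>(3) d(1) by linarith
  qed
  \<comment> \<open>It suffices to refute unit vectors with image of norm at most \<delta>; scaling
    yields the bound with constant 1/\<delta>.\<close>
  have unit: False if n: "n \<ge> N" and \<mu>: "cmod (\<mu> - lam) \<le> \<delta>"
    and mem: "((f, g), (u, v)) \<in> op_shift (Hsp (interval n)) (Tn n) \<mu>"
    and x1: "hnorm (Hsp (interval n)) (f, g) = 1" and y1: "hnorm (Hsp (interval n)) (u, v) \<le> \<delta>" for n \<mu> f g u v
  proof -
    let ?N = "hnorm (LI n)"
    have nN: "real N \<le> real n" using n by simp
    have n1: "n \<ge> 1" "1 \<le> real n" "1 / \<delta> \<le> real n" "2 * r \<le> real n" using N nN by auto
    obtain F p h where F: "prim F p" "prim p (\<lambda>x. if x \<in> interval n then h x else 0)"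
      "AE x in lebesgue_on (interval n). f x = F x"
      "F \<in> carrier (LI n)" "p \<in> carrier (LI n)" "h \<in> carrier (LI n)"
      "f \<in> carrier (LI n)" "g \<in> carrier (LI n)" "u \<in> carrier (LI n)" "v \<in> carrier (LI n)" "(\<lambda>x. Q x * f x) \<in> carrier (LI n)"
      and eq: "AE x in lebesgue_on (interval n). u x = - h x + (Q x - \<mu>) * f x + W x * g x"
      "AE x in lebesgue_on (interval n). v x = V x * f x + (U x - \<mu>) * g x"
      and E: "(?N p)\<^sup>2 + qform (interval n) f \<le> ?N f * (?N u + cmod \<mu> * ?N f + w * ?N g)"
      by (rule Tn_energy[OF n1(1) w mem])
    have le: "?N f \<le> 1" "?N g \<le> 1" "?N u \<le> \<delta>" "?N v \<le> \<delta>"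
      using hnorm_Hsp_ge[OF F(7,8)] hnorm_Hsp_ge[OF F(9,10)] x1 y1 by auto
    have q0: "0 \<le> qform (interval n) f" by (rule qform_bounds(1)[OF interval_sets(1) F(7,11)])
    have E1: "(?N p)\<^sup>2 + qform (interval n) f \<le> ?N f * M"
    proof -
      have "cmod \<mu> \<le> cmod lam + \<delta>" using norm_triangle_sub[of \<mu> lam] \<mu> by linarith
      then have "cmod \<mu> * ?N f \<le> (cmod lam + \<delta>) * 1" using le(1) \<delta>(1) by (intro mult_mono) auto
      moreover have "w * ?N g \<le> w * 1" using le(2) w(1) by (intro mult_left_mono) auto
      ultimately have "?N u + cmod \<mu> * ?N f + w * ?N g \<le> \<delta> + (cmod lam + \<delta>) * 1 + w * 1" using le(3) by (intro add_mono)
      also have "\<dots> \<le> M" using \<delta>(2) unfolding M_def by simp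
      finally have "?N u + cmod \<mu> * ?N f + w * ?N g \<le> M" .
      then have "?N f * (?N u + cmod \<mu> * ?N f + w * ?N g) \<le> ?N f * M" by (intro mult_left_mono) simp_all
      then show ?thesis using E by linarith
    qed
    have fM: "?N f * M \<le> M" using mult_right_mono[OF le(1), of M] M by simp
    have pM: "?N p \<le> M"
    proof (rule power2_le_imp_le)
      have "(?N p)\<^sup>2 \<le> M" using E1 fM q0 by linarith
      also have "M \<le> M * M" using mult_right_mono[OF M, of M] M by simp
      finally show "(?N p)\<^sup>2 \<le> M\<^sup>2" by (simp add: power2_eq_square)
    qed (use M in simp)
    let ?\<eta> = "\<lambda>x. complex_of_real (cutoff (real n) x) * f x"
    have eta_n: "?N ?\<eta> \<le> c1 * \<delta>"
    proof -
      have in': "1 / real n \<le> \<delta>" using n1(2,3) \<delta>(1) by (simp add: field_simps)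
      have "?N ?\<eta> \<le> C * (?N u + ?N v + cmod (\<mu> - lam) * (?N f + ?N g) + 8 / real n * ?N p + 8 / (real n)\<^sup>2 * ?N f)"
        by (rule Tn_to_T[OF n1(1) F eq lb C])
      also have "\<dots> \<le> C * (\<delta> + \<delta> + \<delta> * 2 + (8 * \<delta>) * M + 8 * \<delta>)"
      proof (rule mult_left_mono[OF _ C], intro add_mono)
        show "cmod (\<mu> - lam) * (?N f + ?N g) \<le> \<delta> * 2" using \<mu> le(1,2) \<delta>(1) by (intro mult_mono) auto
        have "8 / real n \<le> 8 * \<delta>" using in' by simp
        then show "8 / real n * ?N p \<le> (8 * \<delta>) * M" using pM \<delta>(1) by (intro mult_mono) auto
        have "8 / (real n)\<^sup>2 \<le> 8 / real n" using n1(2) by (intro divide_left_mono) (auto simp: power2_eq_square)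
        then have "8 / (real n)\<^sup>2 * ?N f \<le> (8 * \<delta>) * 1" using in' le(1) \<delta>(1) by (intro mult_mono) auto
        then show "8 / (real n)\<^sup>2 * ?N f \<le> 8 * \<delta>" by simp
      qed (use le in auto)
      also have "\<dots> = c1 * \<delta>" by (simp add: c1_def algebra_simps)
      finally show ?thesis .
    qed
    have f\<tau>: "?N f \<le> \<tau>"
    proof (rule power2_le_imp_le)
      let ?k = "\<lambda>x. 4 * (cmod (?\<eta> x))\<^sup>2"
      have ki: "integrable (lebesgue_on (interval n)) ?k"
        by (intro integrable_mult_right L2_integrable cutoff_mult(1) n1(1) F(7))
      have "(?N f)\<^sup>2 \<le> (LINT x|lebesgue_on (interval n). ?k x) + qform (interval n) f / (R * cos \<theta>)"
      proof (rule tail_estimate[OF interval_sets(1) F(7,11) R r ki])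
        show "AE x in lebesgue_on (interval n). \<bar>x\<bar> < r \<longrightarrow> (cmod (f x))\<^sup>2 \<le> ?k x"
        proof (rule AE_I2, rule impI)
          fix x assume "\<bar>x\<bar> < r"
          then have "1 \<le> 4 * (cutoff (real n) x)\<^sup>2" using n1(2,4) by (intro cutoff_lower) auto
          then have "1 * (cmod (f x))\<^sup>2 \<le> (4 * (cutoff (real n) x)\<^sup>2) * (cmod (f x))\<^sup>2" by (rule mult_right_mono) simp
          then show "(cmod (f x))\<^sup>2 \<le> ?k x" by (simp add: norm_mult power_mult_distrib)
        qed
      qed simp
      also have "(LINT x|lebesgue_on (interval n). ?k x) = 4 * (?N ?\<eta>)\<^sup>2"
        unfolding hnorm_L2_sq by (rule integral_mult_right_zero)
      also have "4 * (?N ?\<eta>)\<^sup>2 \<le> \<tau>\<^sup>2 / 4"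
      proof -
        have "2 * ?N ?\<eta> \<le> \<tau> / 2" using eta_n c1\<delta> by linarith
        then have "(2 * ?N ?\<eta>)\<^sup>2 \<le> (\<tau> / 2)\<^sup>2" by (rule power_mono) simp
        then show ?thesis by (simp add: power_mult_distrib power_divide)
      qed
      also have "qform (interval n) f / (R * cos \<theta>) \<le> M / (R * cos \<theta>)"
        using E1 fM zero_le_power2[of "?N p"] R cos_pos by (intro divide_right_mono) (linarith, simp)
      finally have "(?N f)\<^sup>2 \<le> \<tau>\<^sup>2 / 4 + \<tau>\<^sup>2 / 2" unfolding MR by simp
      then show "(?N f)\<^sup>2 \<le> \<tau>\<^sup>2" using zero_le_power2[of \<tau>] by linarith
    qed (use \<tau> in simp)
    note VL = qform_bounds(2)[OF interval_sets(1) F(7,11)]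
    have Vd: "?N (\<lambda>x. V x * f x) \<le> d / 8"
    proof (rule power2_le_imp_le)
      have "qform (interval n) f \<le> ?N f * M" using E1 zero_le_power2[of "?N p"] by linarith
      also have "\<dots> \<le> \<tau> * M" using f\<tau> M by (intro mult_right_mono) auto
      finally have "b / cos \<theta> * qform (interval n) f \<le> b / cos \<theta> * (\<tau> * M)" using b cos_pos by (intro mult_left_mono) auto
      also have "\<dots> = \<kappa> * \<tau>" by (simp add: \<kappa>_def)
      finally show "(?N (\<lambda>x. V x * f x))\<^sup>2 \<le> (d / 8)\<^sup>2" using qform_bounds(3)[OF interval_sets(1) F(7,11)] \<tau>\<kappa> by linarith
    qed (use d in simp)
    have "AE x in lebesgue_on (interval n). cmod (g x) \<le> 2 / d * cmod (v x - V x * f x)"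
      using eq(2) Ud[OF \<mu>]
    proof eventually_elim
      case (elim x)
      have "d / 2 * cmod (g x) \<le> cmod (U x - \<mu>) * cmod (g x)" by (rule mult_right_mono[OF elim(2)]) simp
      also have "\<dots> = cmod (v x - V x * f x)" unfolding elim(1) by (simp add: norm_mult)
      finally show ?case using d(1) by (simp add: field_simps)
    qed
    then have "?N g \<le> 2 / d * ?N (\<lambda>x. v x - V x * f x)"
      using d(1) by (intro hnorm_L2_mono[OF L2_diff[OF F(10) VL] L2_measurable[OF F(8)]]) auto
    also have "\<dots> \<le> 2 / d * (d / 8 + d / 8)"
      using L2_triangle_diff[OF F(10) VL] le(4) \<delta>(3) Vd d(1) by (intro mult_left_mono) auto
    also have "\<dots> = 1 / 2" using d(1) by simp
    \<comment> \<open>The norms of the two components are at most 1/4 and 1/2, too small for a unit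
      vector.\<close>
    finally have "?N f + ?N g \<le> 3 / 4" using f\<tau> \<tau>(2) by linarith
    then show False using hnorm_Hsp_le[OF F(7,8)] x1 by linarith
  qed
  have bd: "hnorm (Hsp (interval n)) x \<le> 1 / \<delta> * hnorm (Hsp (interval n)) y"
    if n: "n \<ge> N" and \<mu>: "cmod (\<mu> - lam) \<le> \<delta>" and mem: "(x, y) \<in> op_shift (Hsp (interval n)) (Tn n) \<mu>" for n \<mu> x y
  proof (rule ccontr)
    let ?H = "Hsp (interval n)"
    assume "\<not> ?thesis"
    then have lt: "1 / \<delta> * hnorm ?H y < hnorm ?H x" by simp
    moreover have "0 \<le> 1 / \<delta> * hnorm ?H y" using \<delta>(1) by simp
    ultimately have x0: "hnorm ?H x > 0" by linarith
    have cl: "x \<in> carrier ?H" "y \<in> carrier ?H" using graph_op.shift_closed[OF Tn_graph mem] by auto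
    let ?c = "complex_of_real (1 / hnorm ?H x)"
    have s: "(hilbert.scale ?H ?c x, hilbert.scale ?H ?c y) \<in> op_shift ?H (Tn n) \<mu>" by (rule graph_op.shift_scale[OF Tn_graph mem])
    have c: "cmod ?c = 1 / hnorm ?H x" using x0 by (simp only: norm_of_real) simp
    have sx: "hnorm ?H (hilbert.scale ?H ?c x) = 1"
      unfolding semihilbert.hnorm_scale[OF semihilbert_Hsp cl(1)] c using x0 by simp
    have sy: "hnorm ?H (hilbert.scale ?H ?c y) \<le> \<delta>"
      unfolding semihilbert.hnorm_scale[OF semihilbert_Hsp cl(2)] c using lt x0 \<delta>(1) by (simp add: field_simps)
    obtain f g u v where fg: "hilbert.scale ?H ?c x = (f, g)" "hilbert.scale ?H ?c y = (u, v)" by (metis surj_pair)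
    show False by (rule unit[OF n \<mu> s[unfolded fg] sx[unfolded fg] sy[unfolded fg]])
  qed
  show thesis
  proof (rule that[OF \<delta>(1) bd])
    fix n \<mu> assume n: "n \<ge> N" and \<mu>: "cmod (\<mu> - lam) \<le> \<delta>"
    have n1: "n \<ge> 1" using N n by auto
    have d2: "d / 2 > 0" using d(1) by simp
    show "\<mu> \<in> resolvent_set (Hsp (interval n)) (Tn n)"
      by (rule graph_op.resolvent_setI[OF Tn_graph Tn_surjective[OF n1 d2 Ud[OF \<mu>] bd[OF n \<mu>]] bd[OF n \<mu>]])
  qed
qed

lemma no_pollution: "no_spectral_pollution (spectrum (Hsp UNIV) T) (\<lambda>n. spectrum (Hsp (interval n)) (Tn n))"
  unfolding no_spectral_pollution_def
proof
  assume "\<exists>\<zeta>. \<zeta> \<notin> spectrum (Hsp UNIV) T \<and> (\<exists>I l. infinite I \<and> I \<subseteq> {1..} \<and>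
    (\<forall>n\<in>I. l n \<in> spectrum (Hsp (interval n)) (Tn n)) \<and> (l \<longlongrightarrow> \<zeta>) (inf sequentially (principal I)))"
  then obtain \<zeta> I l where z: "\<zeta> \<in> resolvent_set (Hsp UNIV) T" and I: "infinite I"
    "\<And>n. n \<in> I \<Longrightarrow> l n \<notin> resolvent_set (Hsp (interval n)) (Tn n)" "(l \<longlongrightarrow> \<zeta>) (inf sequentially (principal I))"
    unfolding spectrum_def by blast
  obtain C where C: "C \<ge> 0" "\<And>x y. (x, y) \<in> op_shift (Hsp UNIV) T \<zeta> \<Longrightarrow> hnorm (Hsp UNIV) x \<le> C * hnorm (Hsp UNIV) y"
    using resolvent_set_bound[OF z] by blast
  obtain N \<delta> where N: "\<delta> > 0" "\<And>n \<mu>. n \<ge> N \<Longrightarrow> cmod (\<mu> - \<zeta>) \<le> \<delta> \<Longrightarrow> \<mu> \<in> resolvent_set (Hsp (interval n)) (Tn n)"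
  proof (rule Tn_uniform_bound[OF C(2,1)])
    fix \<delta> N assume "\<delta> > 0" "\<And>n \<mu>. n \<ge> N \<Longrightarrow> cmod (\<mu> - \<zeta>) \<le> \<delta> \<Longrightarrow> \<mu> \<in> resolvent_set (Hsp (interval n)) (Tn n)"
    then show thesis by (rule that)
  qed
  have "\<forall>\<^sub>F n in inf sequentially (principal I). dist (l n) \<zeta> < \<delta>" by (rule tendstoD[OF I(3) N(1)])
  then obtain N' where N': "\<And>n. n \<ge> N' \<Longrightarrow> n \<in> I \<Longrightarrow> dist (l n) \<zeta> < \<delta>"
    unfolding eventually_inf_principal eventually_sequentially by blast
  obtain n where n: "n \<ge> max N N'" "n \<in> I" using I(1) unfolding infinite_nat_iff_unbounded_le by blast
  then have "l n \<in> resolvent_set (Hsp (interval n)) (Tn n)"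
    using N(2)[of n "l n"] N'[of n] by (simp add: dist_norm)
  then show False using I(2)[OF n(2)] by blast
qed

text \<open>At \<zeta> itself no bound for \<open>T\<close> is known in advance, so the detour over
  a circle of regular points is made: there the truncations have uniform bounds for all large n. For
  those n whose spectrum misses the disc the bound extends to the centre, and it then returns to
  \<open>T\<close>.\<close>

lemma eigenvalue_near:
  assumes z: "\<zeta> isolated_in spectrum (Hsp UNIV) T" and e: "e > 0"
  shows "\<exists>N. \<forall>n\<ge>N. \<exists>z\<in>spectrum (Hsp (interval n)) (Tn n). dist z \<zeta> < e"
proof (rule ccontr)
  assume "\<not> ?thesis"
  then have bad: "\<And>N. \<exists>n\<ge>N. \<forall>z. dist z \<zeta> < e \<longrightarrow> z \<in> resolvent_set (Hsp (interval n)) (Tn n)"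
    unfolding spectrum_def by blast
  obtain X where X: "open X" "X \<inter> spectrum (Hsp UNIV) T = {\<zeta>}" using z unfolding isolated_in_def by blast
  have zX: "\<zeta> \<in> X" using X(2) by blast
  obtain e0 where e0: "e0 > 0" "ball \<zeta> e0 \<subseteq> X" using X(1) zX open_contains_ball by blast
  have res: "z \<in> resolvent_set (Hsp UNIV) T" if "z \<noteq> \<zeta>" "dist z \<zeta> < e0" for z
    using that X(2) e0(2) unfolding spectrum_def by (auto simp: dist_commute)
  define r where "r = min e e0 / 2"
  have r: "r > 0" "r < e" "r < e0" using e e0(1) by (auto simp: r_def)
  have "\<exists>N \<delta>. \<delta> > 0 \<and> (\<forall>n \<mu> x y. n \<ge> N \<longrightarrow> cmod (\<mu> - lam) \<le> \<delta> \<longrightarrow> (x, y) \<in> op_shift (Hsp (interval n)) (Tn n) \<mu> \<longrightarrow>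
      hnorm (Hsp (interval n)) x \<le> 1 / \<delta> * hnorm (Hsp (interval n)) y)" if "lam \<in> sphere \<zeta> r" for lam
  proof -
    have l: "lam \<in> resolvent_set (Hsp UNIV) T" using that r by (intro res) (auto simp: dist_commute)
    obtain C where C: "C \<ge> 0" "\<And>x y. (x, y) \<in> op_shift (Hsp UNIV) T lam \<Longrightarrow> hnorm (Hsp UNIV) x \<le> C * hnorm (Hsp UNIV) y"
      using resolvent_set_bound[OF l] by blast
    show ?thesis
    proof (rule Tn_uniform_bound[OF C(2,1)])
      fix \<delta> N assume "\<delta> > 0" and "\<And>n \<mu> x y. n \<ge> N \<Longrightarrow> cmod (\<mu> - lam) \<le> \<delta> \<Longrightarrow> (x, y) \<in> op_shift (Hsp (interval n)) (Tn n) \<mu> \<Longrightarrow>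
        hnorm (Hsp (interval n)) x \<le> 1 / \<delta> * hnorm (Hsp (interval n)) y"
      then show ?thesis by (intro exI[of _ N] exI[of _ \<delta>] conjI allI impI)
    qed
  qed
  then obtain N \<delta> where N: "\<And>lam. lam \<in> sphere \<zeta> r \<Longrightarrow> \<delta> lam > 0"
    "\<And>lam n \<mu> x y. lam \<in> sphere \<zeta> r \<Longrightarrow> n \<ge> N lam \<Longrightarrow> cmod (\<mu> - lam) \<le> \<delta> lam \<Longrightarrow> (x, y) \<in> op_shift (Hsp (interval n)) (Tn n) \<mu> \<Longrightarrow>
      hnorm (Hsp (interval n)) x \<le> 1 / \<delta> lam * hnorm (Hsp (interval n)) y"
    by metis
  have cov: "sphere \<zeta> r \<subseteq> (\<Union>lam\<in>sphere \<zeta> r. ball lam (\<delta> lam))" using N(1) by fastforce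
  obtain A where A: "A \<subseteq> sphere \<zeta> r" "finite A" "sphere \<zeta> r \<subseteq> (\<Union>lam\<in>A. ball lam (\<delta> lam))"
    by (rule compactE_image[OF compact_sphere _ cov]) auto
  \<comment> \<open>Sums serve as common upper bounds over the finite cover of the circle.\<close>
  define N0 where "N0 = (\<Sum>lam\<in>A. N lam)"
  define K where "K = (\<Sum>lam\<in>A. 1 / \<delta> lam)"
  have \<delta>0: "0 \<le> 1 / \<delta> lam" if "lam \<in> A" for lam using N(1)[of lam] A(1) that by (auto intro!: divide_nonneg_nonneg less_imp_le)
  have K: "K \<ge> 0" unfolding K_def by (rule sum_nonneg[OF \<delta>0])
  have circle: "hnorm (Hsp (interval n)) x \<le> K * hnorm (Hsp (interval n)) y"
    if n: "n \<ge> N0" and \<mu>: "cmod (\<mu> - \<zeta>) = r" and mem: "(x, y) \<in> op_shift (Hsp (interval n)) (Tn n) \<mu>" for n \<mu> x y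
  proof -
    have "\<mu> \<in> sphere \<zeta> r" using \<mu> by (simp add: dist_norm norm_minus_commute)
    then obtain lam where lam: "lam \<in> A" "dist lam \<mu> < \<delta> lam" using A(3) by auto
    have lS: "lam \<in> sphere \<zeta> r" using lam(1) A(1) by blast
    have "N lam \<le> N0" unfolding N0_def by (rule member_le_sum[OF lam(1) _ A(2)]) simp
    then have "hnorm (Hsp (interval n)) x \<le> 1 / \<delta> lam * hnorm (Hsp (interval n)) y"
      using lam(2) n by (intro N(2)[OF lS _ _ mem]) (auto simp: dist_norm norm_minus_commute)
    also have "\<dots> \<le> K * hnorm (Hsp (interval n)) y"
      unfolding K_def
      by (intro mult_right_mono member_le_sum[OF lam(1) _ A(2)]) (use \<delta>0 in auto)
    finally show ?thesis .
  qed
  have freq: "\<exists>n\<ge>m. n \<ge> 1 \<and> (\<forall>x y. (x, y) \<in> op_shift (Hsp (interval n)) (Tn n) \<zeta> \<longrightarrow>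
      hnorm (Hsp (interval n)) x \<le> K * hnorm (Hsp (interval n)) y)" for m
  proof -
    obtain n where n: "n \<ge> max (max 1 m) N0" "\<And>z. dist z \<zeta> < e \<Longrightarrow> z \<in> resolvent_set (Hsp (interval n)) (Tn n)"
      using bad[of "max (max 1 m) N0"] by blast
    have n0: "n \<ge> N0" using n(1) by simp
    have "hnorm (Hsp (interval n)) x \<le> K * hnorm (Hsp (interval n)) y" if "(x, y) \<in> op_shift (Hsp (interval n)) (Tn n) \<zeta>" for x y
    proof (rule graph_op.resolvent_bound_center[OF Tn_graph r(1) _ circle[OF n0] that])
      fix z assume "cmod (z - \<zeta>) \<le> r"
      then show "z \<in> resolvent_set (Hsp (interval n)) (Tn n)" using n(2)[of z] r(2) by (simp add: dist_norm)
    qed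
    then show ?thesis using n(1) by (intro exI[of _ n]) auto
  qed
  \<comment> \<open>The factor 2 comes from estimating the sum of the norms of both components of
    the image by twice its norm.\<close>
  have lower: "hnorm (Hsp UNIV) x \<le> 2 * K * hnorm (Hsp UNIV) y" if mem: "(x, y) \<in> op_shift (Hsp UNIV) T \<zeta>" for x y
  proof -
    obtain f g u v where xy: "x = (f, g)" "y = (u, v)" by (metis surj_pair)
    obtain F c where F: "F \<in> carrier LR" "AE x in lebesgue. f x = F x" "f \<in> carrier LR" "g \<in> carrier LR" "u \<in> carrier LR" "v \<in> carrier LR" "c \<ge> 0"
      and Fn: "\<And>n. n \<ge> 1 \<Longrightarrow> \<exists>y. ((\<lambda>x. complex_of_real (cutoff (real n) x) * F x, \<lambda>x. complex_of_real (cutoff (real n) x) * g x), y) \<in>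
        op_shift (Hsp (interval n)) (Tn n) \<zeta> \<and> hnorm (Hsp (interval n)) y \<le> hnorm LR u + hnorm LR v + c / real n"
    proof (rule T_to_Tn[OF mem[unfolded xy]])
      fix F c assume a: "F \<in> carrier LR" "AE x in lebesgue. f x = F x" "f \<in> carrier LR" "g \<in> carrier LR" "u \<in> carrier LR" "v \<in> carrier LR" "c \<ge> 0"
        "\<And>n. n \<ge> 1 \<Longrightarrow> \<exists>y. ((\<lambda>x. complex_of_real (cutoff (real n) x) * F x, \<lambda>x. complex_of_real (cutoff (real n) x) * g x), y) \<in>
        op_shift (Hsp (interval n)) (Tn n) \<zeta> \<and> hnorm (Hsp (interval n)) y \<le> hnorm LR u + hnorm LR v + c / real n"
      show thesis by (rule that[OF a])
    qed
    let ?a = "\<lambda>k n. hnorm (LI n) (\<lambda>x. complex_of_real (cutoff (real n) x) * k x)"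
    let ?s = "hnorm LR u + hnorm LR v"
    \<comment> \<open>The bounds for the truncations hold only for arbitrarily large n. That is
      enough: \<open>D\<close> converges along all n and is nonpositive infinitely often, so its
      limit is nonpositive.\<close>
    define D where "D n = (?a F n)\<^sup>2 + (?a g n)\<^sup>2 - (K * (?s + c * (1 / real n)))\<^sup>2" for n
    have D: "D \<longlonglongrightarrow> (hnorm LR F)\<^sup>2 + (hnorm LR g)\<^sup>2 - (K * (?s + c * 0))\<^sup>2"
      unfolding D_def by (intro tendsto_intros cutoff_norm_tendsto F lim_1_over_n)
    have "\<exists>n\<ge>m. D n \<le> 0" for m
    proof -
      obtain n where n: "n \<ge> m" "n \<ge> 1" and bd: "\<And>x y. (x, y) \<in> op_shift (Hsp (interval n)) (Tn n) \<zeta> \<Longrightarrow>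
        hnorm (Hsp (interval n)) x \<le> K * hnorm (Hsp (interval n)) y" using freq by blast
      obtain y' where y': "((\<lambda>x. complex_of_real (cutoff (real n) x) * F x, \<lambda>x. complex_of_real (cutoff (real n) x) * g x), y') \<in>
        op_shift (Hsp (interval n)) (Tn n) \<zeta>" "hnorm (Hsp (interval n)) y' \<le> ?s + c / real n" using Fn[OF n(2)] by blast
      note L = cutoff_mult(1)[OF n(2) L2_restrict(1)[OF interval_sets(1) F(1)]]
        cutoff_mult(1)[OF n(2) L2_restrict(1)[OF interval_sets(1) F(4)]]
      let ?x = "(\<lambda>x. complex_of_real (cutoff (real n) x) * F x, \<lambda>x. complex_of_real (cutoff (real n) x) * g x)"
      have "hnorm (Hsp (interval n)) ?x \<le> K * (?s + c * (1 / real n))"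
        using order_trans[OF bd[OF y'(1)] mult_left_mono[OF y'(2) K]] by simp
      then have "(hnorm (Hsp (interval n)) ?x)\<^sup>2 \<le> (K * (?s + c * (1 / real n)))\<^sup>2" by (rule power_mono) simp
      then have "D n \<le> 0" unfolding D_def hnorm_Hsp_sq[OF L] by simp
      then show ?thesis using n(1) by blast
    qed
    then have "(hnorm LR F)\<^sup>2 + (hnorm LR g)\<^sup>2 - (K * (?s + c * 0))\<^sup>2 \<le> 0"
      using order_tendstoD(1)[OF D, of 0] unfolding eventually_sequentially by (meson not_le)
    moreover have "hnorm LR F = hnorm LR f"
      by (rule hnorm_L2_cong_AE[OF L2_measurable[OF F(1)] L2_measurable[OF F(3)]]) (use F(2) in eventually_elim, simp)
    ultimately have "(hnorm (Hsp UNIV) x)\<^sup>2 \<le> (K * ?s)\<^sup>2" unfolding xy hnorm_UNIV_sq[OF F(3,4)] by simp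
    then have "hnorm (Hsp UNIV) x \<le> K * ?s" by (rule power2_le_imp_le) (use K in simp)
    also have "\<dots> \<le> K * (hnorm (Hsp UNIV) y + hnorm (Hsp UNIV) y)"
      unfolding xy by (intro mult_left_mono add_mono hnorm_UNIV_ge F K)
    finally show ?thesis by simp
  qed
  \<comment> \<open>A regular point of \<open>T\<close> at distance t from \<zeta>: inside the
    punctured disc free of spectrum, and close enough for \<open>surjective_near\<close> with the
    bound 2 K; the added 1 covers K = 0.\<close>
  define t where "t = min (r / 2) (1 / (8 * K + 1))"
  have t: "t > 0" "t < r" "t \<le> 1 / (8 * K + 1)" using r(1) K by (auto simp: t_def)
  define z1 where "z1 = \<zeta> + complex_of_real t"
  have z1: "cmod (z1 - \<zeta>) = t" using t(1) by (simp add: z1_def)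
  have z1r: "z1 \<in> resolvent_set (Hsp UNIV) T" using t r(3) z1 by (intro res) (auto simp: dist_norm z1_def)
  have tK: "4 * (2 * K) * cmod (z1 - \<zeta>) \<le> 1"
  proof -
    have "8 * K * t \<le> (8 * K + 1) * (1 / (8 * K + 1))" using t K by (intro mult_mono) auto
    then show ?thesis using K z1 by simp
  qed
  have "\<exists>x. (x, y) \<in> op_shift (Hsp UNIV) T \<zeta>" if y: "y \<in> carrier (Hsp UNIV)" for y
  proof (rule graph_op.surjective_near[OF T_graph _ lower _ tK _ y])
    fix u :: "nat \<Rightarrow> fun2"
    assume u: "\<And>k. u k \<in> carrier (Hsp UNIV)"
      and "\<exists>K. \<forall>k. hnorm (Hsp UNIV) (add (Hsp UNIV) (u (Suc k)) (hilbert.scale (Hsp UNIV) (-1) (u k))) \<le> K * (1/2) ^ k"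
    then obtain K where "\<And>k. hnorm (Hsp UNIV) (add (Hsp UNIV) (u (Suc k)) (hilbert.scale (Hsp UNIV) (-1) (u k))) \<le> K * (1/2) ^ k" by blast
    then show "\<exists>v\<in>carrier (Hsp UNIV). (\<lambda>k. hnorm (Hsp UNIV) (add (Hsp UNIV) v (hilbert.scale (Hsp UNIV) (-1) (u k)))) \<longlonglongrightarrow> 0"
      by (rule Hsp_complete[OF u])
  next
    show "0 \<le> 2 * K" using K by simp
    show "\<exists>x. (x, y) \<in> op_shift (Hsp UNIV) T z1" if "y \<in> carrier (Hsp UNIV)" for y
      using z1r that unfolding resolvent_set_def by blast
  qed
  then have "\<zeta> \<in> resolvent_set (Hsp UNIV) T" using graph_op.resolvent_setI[OF T_graph _ lower] by blast
  then show False using z unfolding isolated_in_def spectrum_def by blast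
qed

end
theorem theorem4p17:
  fixes Q V U W :: "real \<Rightarrow> complex" and \<theta> b :: real
  assumes "Q \<in> Linf_loc" and "V \<in> Linf_loc" and "U \<in> Linf_loc" and "W \<in> Linf"
    and "0 \<le> \<theta>" and "\<theta> < pi / 2"
    and "essran Q \<subseteq> {z. \<bar>Arg z\<bar> \<le> \<theta>}"
    and "\<forall>R. \<exists>r. AE x in lebesgue. \<bar>x\<bar> \<ge> r \<longrightarrow> norm (Q x) \<ge> R"
    and "0 \<le> b" and "AE x in lebesgue. (norm (V x))\<^sup>2 \<le> b * norm (Q x)"
  shows
    "(\<forall>a0 b0. a0 > 0 \<and> b0 > 0 \<and>
        (\<forall>f h. f \<in> domA Q \<and> weak_deriv UNIV 2 f h \<longrightarrow>
           (hnorm (L2 (lebesgue_on UNIV)) (\<lambda>x. V x * f x))\<^sup>2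
             \<le> a0 * (hnorm (L2 (lebesgue_on UNIV)) f)\<^sup>2
               + b0 * Re (inn (L2 (lebesgue_on UNIV)) (\<lambda>x. - h x + Q x * f x) f))
      \<longrightarrow> ess_spectrum (Hsp UNIV) (op_T Q W V U)
            = (\<Inter>\<zeta>\<in>- essran U. ess_num_range_pencil (Hsp UNIV) (op_T Q W V U O op_B b0 U \<zeta>) (op_B b0 U \<zeta>))
        \<and> (\<Inter>\<zeta>\<in>- essran U. ess_num_range_pencil (Hsp UNIV) (op_T Q W V U O op_B b0 U \<zeta>) (op_B b0 U \<zeta>))
            = essran U)
     \<and> no_spectral_pollution (spectrum (Hsp UNIV) (op_T Q W V U))
         (\<lambda>n. spectrum (Hsp (interval n)) (op_Tn Q W V U n))
     \<and> (\<forall>\<zeta>\<in>discrete_eigenvalues (Hsp UNIV) (op_T Q W V U).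
          approximated (\<lambda>n. spectrum (Hsp (interval n)) (op_Tn Q W V U n)) \<zeta>)"
proof -
  interpret matrix_model Q V U W \<theta> b
    by (rule matrix_model.intro) (rule assms)+
  show ?thesis
  proof (intro conjI allI impI ballI)
    fix a0 b0 :: real
    assume a: "a0 > 0 \<and> b0 > 0 \<and>
        (\<forall>f h. f \<in> domA Q \<and> weak_deriv UNIV 2 f h \<longrightarrow>
           (hnorm (L2 (lebesgue_on UNIV)) (\<lambda>x. V x * f x))\<^sup>2
             \<le> a0 * (hnorm (L2 (lebesgue_on UNIV)) f)\<^sup>2
               + b0 * Re (inn (L2 (lebesgue_on UNIV)) (\<lambda>x. - h x + Q x * f x) f))"
    note p = part_i[OF a[THEN conjunct1] a[THEN conjunct2, THEN conjunct1] a[THEN conjunct2, THEN conjunct2]]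
    show "ess_spectrum (Hsp UNIV) T = (\<Inter>\<zeta>\<in>- essran U. ess_num_range_pencil (Hsp UNIV) (T O op_B b0 U \<zeta>) (op_B b0 U \<zeta>))"
      by (rule p(1))
    show "(\<Inter>\<zeta>\<in>- essran U. ess_num_range_pencil (Hsp UNIV) (T O op_B b0 U \<zeta>) (op_B b0 U \<zeta>)) = essran U"
      by (rule p(2))
  next
    show "no_spectral_pollution (spectrum (Hsp UNIV) T) (\<lambda>n. spectrum (Hsp (interval n)) (Tn n))" by (rule no_pollution)
  next
    fix \<zeta> assume "\<zeta> \<in> discrete_eigenvalues (Hsp UNIV) T"
    then have z: "\<zeta> isolated_in spectrum (Hsp UNIV) T" unfolding discrete_eigenvalues_def by blast
    show "approximated (\<lambda>n. spectrum (Hsp (interval n)) (Tn n)) \<zeta>"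
      by (rule approximatedI[OF Tn_spectrum_nonempty eigenvalue_near[OF z]])
  qed
qed

end
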